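(* Under the hypotheses of the full time span conditioning theorem (i.e. $N\ge1$, $r>0$, $0<t_1<t_2<1$, $h\in H^1([0,1])$ with $h\le r$ on $[0,1]$ and $h=r$ on $[0,1]\setminus(t_1,t_2)$), $$\mathbb P\big(B_N(t)<h(t)\ \forall t\in[0,1]\ \big|\ B_N(t)<r\ \forall t\in[0,1]\big)=\det\big(\mathbb 1-K_{\tau_1}+T^h_{\tau_1,\tau_2}K_{\tau_2,\tau_1}\big)_{L^2(\mathbb R_-)},$$ where $K_{\tau_1}=K_{\tau_1,\tau_1}$, operator products are compositions of integral operators on $L^2(\mathbb R_-)$, and for $\sigma,\sigma'>0$, $$K_{\sigma,\sigma'}(u,v)=\sum_{n,m=0}^{N-1}\Psi_{\sigma}^n(u)\,(\mathbb 1-K_0)^{-1}(n,m)\,\Phi_{\sigma'}^m(v).$$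
   Context: $B_1\le\dots\le B_N$ are $N$ standard Brownian bridges (diffusion coefficient $1$) from $0$ at time $0$ to $0$ at time $1$ conditioned in Doob's sense not to intersect on $(0,1)$; $B_N$ is the top path. $\mathbb R_-=(-\infty,0]$. Set $\tau_i=\frac14\frac{t_i}{1-t_i}$, $\widetilde h(\tau)=\frac{1+4\tau}{\sqrt2}\big[h\big(\frac{4\tau}{1+4\tau}\big)-r\big]$, and with $\widetilde b$ a Brownian motion with diffusion coefficient $2$, $T^h_{\tau_1,\tau_2}(u,v)=\frac{\mathrm d}{\mathrm dv}\mathbb P_{\widetilde b(\tau_1)=u}\big(\widetilde b(\tau)\le0\ \forall\tau\in[\tau_1,\tau_2],\ \widetilde b(\tau)\le\widetilde h(\tau)\ \forall\tau\in(\tau_1,\tau_2),\ \widetilde b(\tau_2)\le v\big)$. With $f_W(u)=e^{(\sqrt2r-2W)u}$, $g_Z(u)=e^{-(\sqrt2r-2Z)u}$: $\Phi_\tau^n(u)=\frac1{\pi \mathrm i}\int_{\mathrm i\mathbb R}\mathrm dW\,W^n e^{\tau(\sqrt2r-2W)^2-\sqrt2rW}(f_W(u)-f_W(-u))$, $\Psi_\tau^m(u)=\frac1{2\pi \mathrm i}\oint_{\Gamma_0}\mathrm dZ\,Z^{-(m+1)}e^{-\tau(\sqrt2r-2Z)^2+\sqrt2rZ}(g_Z(u)-g_Z(-u))$, $K_0(n,m)=\frac1{2\pi \mathrm i}\oint_{\Gamma_0}\mathrm dZ\,\frac{(\sqrt2r-Z)^n}{Z^{m+1}}e^{-2r^2+2\sqrt2rZ}$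 ($\mathrm i\mathbb R$ oriented upwards, $\Gamma_0$ a small counterclockwise circle around $0$). $(\mathbb 1-K_0)^{-1}$ denotes the inverse of the $N\times N$ matrix $(\delta_{n,m}-K_0(n,m))_{n,m=0}^{N-1}$. *)

theory Defs
  imports "HOL-Probability.Probability"
begin

definition heat :: "real \<Rightarrow> real \<Rightarrow> real \<Rightarrow> real \<Rightarrow> real" where
  "heat D t x y = normal_density x (sqrt (D * t)) y"

definition detS :: "'i set \<Rightarrow> ('i \<Rightarrow> 'i \<Rightarrow> 'c::comm_ring_1) \<Rightarrow> 'c" where
  "detS I A = (\<Sum>p\<in>{p. p permutes I}. of_int (sign p) * (\<Prod>i\<in>I. A i (p i)))"

definition vandermonde :: "nat \<Rightarrow> (nat \<Rightarrow> real) \<Rightarrow> real" where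
  "vandermonde N y = (\<Prod>i\<in>{1..N}. \<Prod>j\<in>{i<..N}. y j - y i)"

section \<open>N non-intersecting Brownian bridges (Doob conditioning), via their
  finite-dimensional distributions (Karlin--McGregor)\<close>

text \<open>Unnormalised joint density of (B_i(s_l)) for i in 1..N, l in 1..k, 0<s_1<...<s_k<1.\<close>
definition nib_unnorm :: "nat \<Rightarrow> nat \<Rightarrow> (nat \<Rightarrow> real) \<Rightarrow> (nat \<times> nat \<Rightarrow> real) \<Rightarrow> real" where
  "nib_unnorm N k s x =
    (if (\<forall>l\<in>{1..k}. \<forall>i\<in>{1..<N}. x (i,l) < x (Suc i,l)) then
       vandermonde N (\<lambda>i. x (i,1)) * (\<Prod>i\<in>{1..N}. heat 1 (s 1) 0 (x (i,1)))
       * (\<Prod>l\<in>{1..<k}. detS {1..N} (\<lambda>i j. heat 1 (s (Suc l) - s l) (x (i,l)) (x (j, Suc l))))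
       * vandermonde N (\<lambda>i. x (i,k)) * (\<Prod>i\<in>{1..N}. heat 1 (1 - s k) (x (i,k)) 0)
     else 0)"

definition nib_density :: "nat \<Rightarrow> nat \<Rightarrow> (nat \<Rightarrow> real) \<Rightarrow> (nat \<times> nat \<Rightarrow> real) \<Rightarrow> real" where
  "nib_density N k s x = nib_unnorm N k s x /
     (\<integral>y. nib_unnorm N k s y \<partial>(PiM ({1..N}\<times>{1..k}) (\<lambda>_. lborel)))"

text \<open>B i (i = 1..N) are N standard Brownian bridges from 0 to 0 on [0,1] conditioned not
  to intersect; B N is the top path.\<close>
definition nonint_bridges :: "'a measure \<Rightarrow> nat \<Rightarrow> (nat \<Rightarrow> real \<Rightarrow> 'a \<Rightarrow> real) \<Rightarrow> bool" where
  "nonint_bridges M N B \<longleftrightarrow> prob_space M \<and>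
    (\<forall>i\<in>{1..N}. \<forall>t\<in>{0..1}. B i t \<in> borel_measurable M) \<and>
    (\<forall>i\<in>{1..N}. \<forall>\<omega>\<in>space M. continuous_on {0..1} (\<lambda>t. B i t \<omega>) \<and> B i 0 \<omega> = 0 \<and> B i 1 \<omega> = 0) \<and>
    (\<forall>k s. k \<ge> 1 \<and> 0 < s 1 \<and> s k < 1 \<and> (\<forall>l\<in>{1..<k}. s l < s (Suc l)) \<longrightarrow>
       distributed M (PiM ({1..N}\<times>{1..k}) (\<lambda>_. lborel))
         (\<lambda>\<omega>. restrict (\<lambda>(i,l). B i (s l) \<omega>) ({1..N}\<times>{1..k}))
         (\<lambda>x. ennreal (nib_density N k s x)))"

definition brownian_motion :: "'b measure \<Rightarrow> real \<Rightarrow> (real \<Rightarrow> 'b \<Rightarrow> real) \<Rightarrow> bool" where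
  "brownian_motion M D W \<longleftrightarrow> prob_space M \<and>
    (\<forall>t\<ge>0. W t \<in> borel_measurable M) \<and>
    (\<forall>\<omega>\<in>space M. W 0 \<omega> = 0 \<and> continuous_on {0..} (\<lambda>t. W t \<omega>)) \<and>
    (\<forall>k s. k \<ge> 1 \<and> 0 < s 1 \<and> (\<forall>l\<in>{1..<k}. s l < s (Suc l)) \<longrightarrow>
       distributed M (PiM {1..k} (\<lambda>_. lborel))
         (\<lambda>\<omega>. restrict (\<lambda>l. W (s l) \<omega>) {1..k})
         (\<lambda>x. ennreal (\<Prod>l\<in>{1..k}. heat D (s l - (if l = 1 then 0 else s (l - 1)))
                                        (if l = 1 then 0 else x (l - 1)) (x l))))"

definition H1_on :: "real \<Rightarrow> real \<Rightarrow> (real \<Rightarrow> real) \<Rightarrow> bool" where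
  "H1_on a b h \<longleftrightarrow> (\<exists>g. set_integrable lborel {a..b} g \<and>
      set_integrable lborel {a..b} (\<lambda>x. (g x)\<^sup>2) \<and>
      (\<forall>x\<in>{a..b}. h x = h a + (LBINT s=a..x. g s)))"

definition tau :: "real \<Rightarrow> real" where
  "tau t = (1/4) * (t / (1 - t))"

definition htilde :: "(real \<Rightarrow> real) \<Rightarrow> real \<Rightarrow> real \<Rightarrow> real" where
  "htilde h r \<tau> = (1 + 4*\<tau>) / sqrt 2 * (h (4*\<tau> / (1 + 4*\<tau>)) - r)"

text \<open>T^h_{\<tau>1,\<tau>2}(u,v), with btilde(\<tau>) = u + W(\<tau> - \<tau>1) for a Brownian motion W of
  diffusion coefficient 2 started at 0.\<close>
definition Th :: "'b measure \<Rightarrow> (real \<Rightarrow> 'b \<Rightarrow> real) \<Rightarrow> (real \<Rightarrow> real) \<Rightarrow> real \<Rightarrow> real \<Rightarrow> real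
                   \<Rightarrow> real \<Rightarrow> real \<Rightarrow> real" where
  "Th M W h r \<tau>1 \<tau>2 u v = deriv (\<lambda>v'. measure M {\<omega>\<in>space M.
       (\<forall>\<tau>\<in>{\<tau>1..\<tau>2}. u + W (\<tau> - \<tau>1) \<omega> \<le> 0) \<and>
       (\<forall>\<tau>\<in>{\<tau>1<..<\<tau>2}. u + W (\<tau> - \<tau>1) \<omega> \<le> htilde h r \<tau>) \<and>
       u + W (\<tau>2 - \<tau>1) \<omega> \<le> v'}) v"

text \<open>Contour integrals: along i\<real> oriented upwards (W = i y), and along the counterclockwise
  unit circle around 0 (the integrands below are holomorphic on \<complex> - {0}, so the radius of
  the small circle is immaterial).\<close>
definition iR_int :: "(complex \<Rightarrow> complex) \<Rightarrow> complex" where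
  "iR_int F = (\<integral>y. F (\<i> * of_real y) * \<i> \<partial>lborel)"

definition circle0_int :: "(complex \<Rightarrow> complex) \<Rightarrow> complex" where
  "circle0_int F = (LBINT \<theta>=0..2*pi. F (cis \<theta>) * (\<i> * cis \<theta>))"

definition fW :: "real \<Rightarrow> complex \<Rightarrow> real \<Rightarrow> complex" where
  "fW r W u = exp ((of_real (sqrt 2 * r) - 2*W) * of_real u)"

definition gZ :: "real \<Rightarrow> complex \<Rightarrow> real \<Rightarrow> complex" where
  "gZ r Z u = exp (- (of_real (sqrt 2 * r) - 2*Z) * of_real u)"

definition Phi :: "real \<Rightarrow> real \<Rightarrow> nat \<Rightarrow> real \<Rightarrow> complex" where
  "Phi r \<tau> n u = 1 / (of_real pi * \<i>) * iR_int (\<lambda>W. W ^ n *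
      exp (of_real \<tau> * (of_real (sqrt 2 * r) - 2*W)\<^sup>2 - of_real (sqrt 2 * r) * W) *
      (fW r W u - fW r W (-u)))"

definition Psi :: "real \<Rightarrow> real \<Rightarrow> nat \<Rightarrow> real \<Rightarrow> complex" where
  "Psi r \<tau> m u = 1 / (2 * of_real pi * \<i>) * circle0_int (\<lambda>Z. inverse (Z ^ (m + 1)) *
      exp (- of_real \<tau> * (of_real (sqrt 2 * r) - 2*Z)\<^sup>2 + of_real (sqrt 2 * r) * Z) *
      (gZ r Z u - gZ r Z (-u)))"

definition K0 :: "real \<Rightarrow> nat \<Rightarrow> nat \<Rightarrow> complex" where
  "K0 r n m = 1 / (2 * of_real pi * \<i>) * circle0_int (\<lambda>Z.
      (of_real (sqrt 2 * r) - Z) ^ n / Z ^ (m + 1) *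
      exp (- 2 * of_real (r\<^sup>2) + 2 * of_real (sqrt 2 * r) * Z))"

definition Minv :: "nat \<Rightarrow> real \<Rightarrow> nat \<Rightarrow> nat \<Rightarrow> complex" where
  "Minv N r = (SOME X. \<forall>n<N. \<forall>m<N.
      (\<Sum>k<N. ((if n = k then 1 else 0) - K0 r n k) * X k m) = (if n = m then 1 else 0) \<and>
      (\<Sum>k<N. X n k * ((if k = m then 1 else 0) - K0 r k m)) = (if n = m then 1 else 0))"

definition Kker :: "nat \<Rightarrow> real \<Rightarrow> real \<Rightarrow> real \<Rightarrow> real \<Rightarrow> real \<Rightarrow> complex" where
  "Kker N r \<sigma> \<sigma>' u v = (\<Sum>n<N. \<Sum>m<N. Psi r \<sigma> n u * Minv N r n m * Phi r \<sigma>' m v)"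

definition Aker :: "nat \<Rightarrow> real \<Rightarrow> 'b measure \<Rightarrow> (real \<Rightarrow> 'b \<Rightarrow> real) \<Rightarrow> (real \<Rightarrow> real)
                    \<Rightarrow> real \<Rightarrow> real \<Rightarrow> real \<Rightarrow> real \<Rightarrow> complex" where
  "Aker N r M W h t1 t2 u v =
     Kker N r (tau t1) (tau t1) u v
     - (LINT w:{..0}|lborel. of_real (Th M W h r (tau t1) (tau t2) u w) * Kker N r (tau t2) (tau t1) w v)"

definition fredholm_term :: "(real \<Rightarrow> real \<Rightarrow> complex) \<Rightarrow> nat \<Rightarrow> complex" where
  "fredholm_term A n = (-1) ^ n / of_real (fact n) *
     (\<integral>x. detS {..<n} (\<lambda>i j. A (x i) (x j)) \<partial>(PiM {..<n} (\<lambda>_. restrict_space lborel {..0})))"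

end

theory Submission
 imports Defs "Jordan_Normal_Form.Determinant" "HOL-Complex_Analysis.Complex_Analysis" "HOL-Real_Asymp.Real_Asymp"
begin

text \<open>Karlin--McGregor and Andreief express the probability that the top path stays below a barrier on a
 finite time mesh as an \<open>N\<close> by \<open>N\<close> determinant of one-dimensional iterated heat kernels. The change of
 variables \<open>x \<mapsto> (x - r) / (sqrt 2 (1 - t))\<close>, \<open>t \<mapsto> t / (4 (1 - t))\<close> turns bridges into Brownian motions of
 diffusivity 2, the level \<open>r\<close> into 0, and the entrance and exit weights into Hermite functions \<open>Ff\<close>, \<open>Gf\<close> which
 are biorthogonal on the line. As the mesh is refined, the time intervals on which the barrier is flat yield
 reflected heat kernels and the middle interval yields \<open>T\<close>; moving the reflected kernels onto the weights and
 exhausting the time interval gives \<open>P(B_N < h) = det E\<close>, where \<open>E(n,m)\<close> is the integral of \<open>Phi^n\<close> against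
 \<open>T Psi^m\<close> over the half-line. For \<open>h = r\<close>, biorthogonality makes \<open>E = 1 - K0\<close>. The Fredholm determinant has
 finite rank and equals \<open>det (E (1 - K0)^{-1})\<close>.\<close>

text \<open>Three obstacles shape the proof. Meshes yield closed conditions and the weights
  degenerate at times 0 and 1, while the event is strict on all of [0,1]. Hence paths are first
  lifted by \<open>\<epsilon>\<close> in the transformed coordinate and observed on a compact time
  window; then the window grows and \<open>\<epsilon>\<close> vanishes at once. Contact at the two
  ends of [0,1] is excluded by \<open>h = r > 0\<close>. Secondly, \<open>Th\<close> is a derivative
  of a distribution function, so a density has to be constructed: it is a decreasing limit over
  dyadic meshes, continuous off a countable set, which Lebesgue integrals do not see. Thirdly,
  \<open>Minv\<close> is a choice term, so \<open>1 - K0\<close> has to be proved invertible; since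
  its determinant is the conditioning probability, this also shows that the quotient has a nonzero
  denominator. The interchanges of limit and integral rest on one growth class,
  \<open>bnd \<kappa> C\<close>: \<open>cosh (\<kappa> * x)\<close> is an eigenfunction of the heat
  flow, so bounds on iterated kernels depend on the elapsed time and not on the number of mesh
  points.\<close>

hide_const (open) Determinant.det Determinants.det Matrix.mat Matrix.vec

hide_fact (open) Henstock_Kurzweil_Integration.integrable_add Henstock_Kurzweil_Integration.integrable_bound Henstock_Kurzweil_Integration.integrable_cong Henstock_Kurzweil_Integration.integrable_diff Henstock_Kurzweil_Integration.integrable_sum Henstock_Kurzweil_Integration.integral_add Henstock_Kurzweil_Integration.integral_cong Henstock_Kurzweil_Integration.integral_diff Henstock_Kurzweil_Integration.integral_sum

section \<open>Leibniz determinants over finite index sets and Fredholm determinants of finite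
  rank\<close>

lemma detS_eq_det: "A \<in> carrier_mat n n ==> Determinant.det A = detS {..<n} (\<lambda>i j. A $$ (i,j))"
 by (simp add: det_def' detS_def lessThan_atLeast0)

lemma det_mat_detS: "Determinant.det (Matrix.mat n n (\<lambda>(i,j). A i j)) = detS {..<n} A"
proof -
 have "Determinant.det (Matrix.mat n n (\<lambda>(i,j). A i j)) = detS {..<n} (\<lambda>i j. Matrix.mat n n (\<lambda>(i,j). A i j) $$ (i,j))"
  by (rule detS_eq_det) simp
 also have "\<dots> = detS {..<n} A"
  unfolding detS_def
 proof (intro sum.cong refl arg_cong2[where f="(*)"] prod.cong)
  fix p i assume "p \<in> {p. p permutes {..<n}}" "i \<in> {..<n}"
  then show "Matrix.mat n n (\<lambda>(i,j). A i j) $$ (i, p i) = A i (p i)"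
   using permutes_in_image[of p "{..<n}" i] by simp
 qed
 finally show ?thesis .
qed

lemma detS_cong:
 assumes "\<And>i j. i \<in> I ==> j \<in> I ==> A i j = B i j"
 shows "detS I A = detS I B"
 unfolding detS_def
 by (intro sum.cong refl arg_cong2[where f="(*)"] prod.cong assms)
  (auto simp: permutes_in_image)

lemma detS_mult:
 "detS {..<n::nat} (\<lambda>i j. \<Sum>k<n. A i k * B k j) = detS {..<n} A * detS {..<n} B"
proof -
 let ?A = "Matrix.mat n n (\<lambda>(i,j). A i j)" and ?B = "Matrix.mat n n (\<lambda>(i,j). B i j)"
 have "?A * ?B = Matrix.mat n n (\<lambda>(i,j). \<Sum>k<n. A i k * B k j)"
  by (rule eq_matI) (auto simp: scalar_prod_def lessThan_atLeast0)
 then show ?thesis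
  using det_mult[of ?A n ?B] by (simp add: det_mat_detS)
qed

lemma detS_transpose:
 fixes A :: "nat => nat => 'c::comm_ring_1"
 assumes "finite I"
 shows "detS I (\<lambda>i j. A j i) = detS I A"
proof -
 have "detS I (\<lambda>i j. A j i) = (\<Sum>p\<in>{p. p permutes I}. of_int (sign (Hilbert_Choice.inv p)) * (\<Prod>i\<in>I. A (Hilbert_Choice.inv p i) i))"
  unfolding detS_def by (rule sum_permutations_inverse)
 also have "\<dots> = detS I A"
  unfolding detS_def
 proof (intro sum.cong refl arg_cong2[where f="(*)"])
  fix p assume "p \<in> {p. p permutes I}"
  then have p: "p permutes I" by simp
  show "(of_int (sign (Hilbert_Choice.inv p)) :: 'c) = of_int (sign p)"
   using sign_inverse[of p] p assms permutation_permutes[of p] by metis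
  have "(\<Prod>i\<in>I. A (Hilbert_Choice.inv p i) i) = (\<Prod>i\<in>I. (\<lambda>i. A (Hilbert_Choice.inv p i) i) (p i))"
   using prod.permute[OF p, of "\<lambda>i. A (Hilbert_Choice.inv p i) i"] by (simp add: comp_def)
  also have "\<dots> = (\<Prod>i\<in>I. A i (p i))"
   by (simp add: permutes_inverses(2)[OF p])
  finally show "(\<Prod>i\<in>I. A (Hilbert_Choice.inv p i) i) = (\<Prod>i\<in>I. A i (p i))" .
 qed
 finally show ?thesis .
qed

text \<open>Conjugation by \<open>f\<close>, extended by the identity outside \<open>J\<close>, is
  undone by conjugation with \<open>inv_into I f\<close>; it carries Leibniz sums from one index set
  to another.\<close>

lemma bij_betw_permutation_conj:
 assumes f: "bij_betw f I J"
 shows "bij_betw (map_permutation I f) {p. p permutes I} {p. p permutes J}"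
proof (rule bij_betw_byWitness[where f'="map_permutation J (inv_into I f)"])
 have inj: "inj_on f I" and J: "J = f ` I" using f by (auto simp: bij_betw_def)
 have g: "bij_betw (inv_into I f) J I" by (rule bij_betw_inv_into[OF f])
 show "map_permutation I f ` {p. p permutes I} \<subseteq> {p. p permutes J}"
  using map_permutation_permutes[OF f] by auto
 show "map_permutation J (inv_into I f) ` {p. p permutes J} \<subseteq> {p. p permutes I}"
  using map_permutation_permutes[OF g] by auto
 show "\<forall>p\<in>{p. p permutes I}. map_permutation J (inv_into I f) (map_permutation I f p) = p"
 proof
  fix p assume "p \<in> {p. p permutes I}"
  then have p: "p permutes I" by simp
  have "map_permutation J (inv_into I f) (map_permutation I f p) = map_permutation I (inv_into I f \<circ> f) p"
   by (rule map_permutation_compose[OF f]) (use g in \<open>auto simp: bij_betw_def\<close>)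
  also have "\<dots> = map_permutation I id p"
   by (rule map_permutation_cong[OF _ p]) (use inj in \<open>auto intro: comp_inj_on inj_on_inv_into\<close>)
  finally show "map_permutation J (inv_into I f) (map_permutation I f p) = p" using p by simp
 qed
 show "\<forall>p\<in>{p. p permutes J}. map_permutation I f (map_permutation J (inv_into I f) p) = p"
 proof
  fix p assume "p \<in> {p. p permutes J}"
  then have p: "p permutes J" by simp
  have "map_permutation I f (map_permutation J (inv_into I f) p) = map_permutation J (f \<circ> inv_into I f) p"
   by (rule map_permutation_compose[OF g]) (use f in \<open>auto simp: bij_betw_def\<close>)
  also have "\<dots> = map_permutation J id p"
   by (rule map_permutation_cong[OF _ p]) (auto simp: J f_inv_into_f inj_on_def)
  finally show "map_permutation I f (map_permutation J (inv_into I f) p) = p" using p by simp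
 qed
qed

lemma detS_reindex:
 assumes f: "bij_betw f I J" and "finite I"
 shows "detS J A = detS I (\<lambda>i j. A (f i) (f j))"
proof -
 have inj: "inj_on f I" and J: "J = f ` I" using f by (auto simp: bij_betw_def)
 have "detS J A = (\<Sum>p\<in>{p. p permutes I}. of_int (sign (map_permutation I f p)) * (\<Prod>i\<in>J. A i (map_permutation I f p i)))"
  unfolding detS_def by (rule sum.reindex_bij_betw[OF bij_betw_permutation_conj[OF f], symmetric])
 also have "\<dots> = detS I (\<lambda>i j. A (f i) (f j))"
  unfolding detS_def
 proof (intro sum.cong refl arg_cong2[where f="(*)"])
  fix p assume "p \<in> {p. p permutes I}"
  then have p: "p permutes I" by simp
  show "of_int (sign (map_permutation I f p)) = of_int (sign p)"
   using sign_map_permutation[OF inj p \<open>finite I\<close>] by simp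
  have "(\<Prod>i\<in>J. A i (map_permutation I f p i)) = (\<Prod>i\<in>I. A (f i) (map_permutation I f p (f i)))"
   using inj by (simp add: J prod.reindex)
  also have "\<dots> = (\<Prod>i\<in>I. A (f i) (f (p i)))"
   using inj by (intro prod.cong) (auto simp: map_permutation_def restrict_id_def)
  finally show "(\<Prod>i\<in>J. A i (map_permutation I f p i)) = (\<Prod>i\<in>I. A (f i) (f (p i)))" .
 qed
 finally show ?thesis .
qed

text \<open>Expand each permutation term over the set \<open>S\<close> of factors taken from
  \<open>- C\<close>. The identity factors on \<open>I - S\<close> survive only if \<open>p\<close>
  fixes \<open>I - S\<close>, that is, if \<open>p permutes S\<close>; swapping the two sums
  collects the principal minors.\<close>

lemma detS_one_minus:
 fixes C :: "nat => nat => 'c::comm_ring_1"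
 assumes "finite I"
 shows "detS I (\<lambda>i j. (if i = j then 1 else 0) - C i j) = (\<Sum>S\<in>Pow I. (-1) ^ card S * detS S C)"
proof -
 have *: "(\<Prod>i\<in>I. (if i = p i then 1 else 0) - C i (p i)) =
  (\<Sum>S\<in>Pow I. (-1) ^ card S * (if p permutes S then \<Prod>i\<in>S. C i (p i) else 0))" if p: "p permutes I" for p
 proof -
  have "(\<Prod>i\<in>I. (if i = p i then 1 else 0) - C i (p i)) = (\<Prod>i\<in>I. - C i (p i) + (if i = p i then 1 else 0))"
   by (intro prod.cong) auto
  also have "\<dots> = (\<Sum>S\<in>Pow I. (\<Prod>i\<in>S. - C i (p i)) * (\<Prod>i\<in>I-S. (if i = p i then 1 else 0)))"
   by (rule prod_add[OF assms])
  also have "\<dots> = (\<Sum>S\<in>Pow I. (-1) ^ card S * (if p permutes S then \<Prod>i\<in>S. C i (p i) else 0))"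
  proof (intro sum.cong refl)
   fix S assume "S \<in> Pow I"
   then have S: "S \<subseteq> I" "finite S" using assms finite_subset by auto
   have "(\<forall>i\<in>I-S. i = p i) \<longleftrightarrow> p permutes S"
    using p S by (metis DiffI permutes_not_in permutes_superset DiffD1 DiffD2)
   moreover have "(\<Prod>i\<in>I-S. (if i = p i then 1 else 0)) = (if \<forall>i\<in>I-S. i = p i then 1 else (0::'c))"
   proof (cases "\<forall>i\<in>I-S. i = p i")
    case True then show ?thesis by simp
   next
    case False
    then have "(\<Prod>i\<in>I-S. (if i = p i then 1 else (0::'c))) = 0"
     using assms by (intro prod_zero) auto
    then show ?thesis using False by simp
   qed
   ultimately show "(\<Prod>i\<in>S. - C i (p i)) * (\<Prod>i\<in>I-S. (if i = p i then 1 else 0))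
     = (-1) ^ card S * (if p permutes S then \<Prod>i\<in>S. C i (p i) else 0)"
    by (simp add: prod_uminus)
  qed
  finally show ?thesis .
 qed
 have "detS I (\<lambda>i j. (if i = j then 1 else 0) - C i j)
  = (\<Sum>p\<in>{p. p permutes I}. \<Sum>S\<in>Pow I. of_int (sign p) * ((-1) ^ card S * (if p permutes S then \<Prod>i\<in>S. C i (p i) else 0)))"
  unfolding detS_def by (intro sum.cong refl) (simp add: * sum_distrib_left)
 also have "\<dots> = (\<Sum>S\<in>Pow I. \<Sum>p\<in>{p. p permutes I}. of_int (sign p) * ((-1) ^ card S * (if p permutes S then \<Prod>i\<in>S. C i (p i) else 0)))"
  by (rule sum.swap)
 also have "\<dots> = (\<Sum>S\<in>Pow I. (-1) ^ card S * detS S C)"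
 proof (intro sum.cong refl)
  fix S assume S: "S \<in> Pow I"
  have "(\<Sum>p\<in>{p. p permutes I}. of_int (sign p) * ((-1) ^ card S * (if p permutes S then \<Prod>i\<in>S. C i (p i) else 0)))
   = (\<Sum>p\<in>{p. p permutes S}. of_int (sign p) * ((-1) ^ card S * (\<Prod>i\<in>S. C i (p i))))"
   using S finite_permutations[OF assms] permutes_subset
   by (intro sum.mono_neutral_cong_right) auto
  then show "(\<Sum>p\<in>{p. p permutes I}. of_int (sign p) * ((-1) ^ card S * (if p permutes S then \<Prod>i\<in>S. C i (p i) else 0)))
   = (-1) ^ card S * detS S C"
   by (simp add: detS_def sum_distrib_left mult_ac)
 qed
 finally show ?thesis .
qed

lemma detS_identical:
 fixes C :: "nat => nat => 'c::comm_ring_1"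
 assumes "i < (n::nat)" "j < n" "i \<noteq> j" "\<And>k. k < n ==> A i k = A j k"
 shows "detS {..<n} A = (0::'c)"
proof -
 let ?A = "Matrix.mat n n (\<lambda>(i,j). A i j)"
 have "Determinant.det ?A = 0"
  by (rule det_identical_rows[of _ n i j]) (use assms in \<open>auto intro!: eq_vecI\<close>)
 then show ?thesis by (simp add: det_mat_detS)
qed

text \<open>Once a bijection \<open>g\<close> is fixed, all others are \<open>g\<close> after a
  permutation of \<open>{..<n}\<close>, restricted so as to be extensional.\<close>

lemma card_bij_PiE:
 assumes "finite S" "card S = n"
 shows "card {f \<in> {..<n} \<rightarrow>\<^sub>E S. bij_betw f {..<n} S} = fact n"
proof -
 obtain g where g: "bij_betw g {..<n} S" using assms
  by (metis card_lessThan finite_lessThan finite_same_card_bij)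
 have "bij_betw (\<lambda>p. restrict (g \<circ> p) {..<n}) {p. p permutes {..<n}} {f \<in> {..<n} \<rightarrow>\<^sub>E S. bij_betw f {..<n} S}"
 proof (rule bij_betw_byWitness[where f'="\<lambda>f i. if i < n then inv_into {..<n} g (f i) else i"])
  have gi: "inj_on g {..<n}" "g ` {..<n} = S" using g by (auto simp: bij_betw_def)
  show "\<forall>p\<in>{p. p permutes {..<n}}. (\<lambda>i. if i < n then inv_into {..<n} g (restrict (g \<circ> p) {..<n} i) else i) = p"
  proof (intro ballI ext)
   fix p i assume "p \<in> {p. p permutes {..<n}}"
   then have p: "p permutes {..<n}" by simp
   show "(if i < n then inv_into {..<n} g (restrict (g \<circ> p) {..<n} i) else i) = p i"
    using permutes_in_image[OF p, of i] permutes_not_in[OF p, of i] inv_into_f_f[OF gi(1), of "p i"] by auto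
  qed
  show "\<forall>f\<in>{f \<in> {..<n} \<rightarrow>\<^sub>E S. bij_betw f {..<n} S}. restrict (g \<circ> (\<lambda>i. if i < n then inv_into {..<n} g (f i) else i)) {..<n} = f"
  proof (intro ballI ext)
   fix f i assume f: "f \<in> {f \<in> {..<n} \<rightarrow>\<^sub>E S. bij_betw f {..<n} S}"
   show "restrict (g \<circ> (\<lambda>i. if i < n then inv_into {..<n} g (f i) else i)) {..<n} i = f i"
   proof (cases "i < n")
    case True
    then have "f i \<in> g ` {..<n}" using f gi by auto
    then show ?thesis using True by (simp add: f_inv_into_f)
   qed (use f in \<open>auto simp: PiE_def extensional_def\<close>)
  qed
  show "(\<lambda>p. restrict (g \<circ> p) {..<n}) ` {p. p permutes {..<n}} \<subseteq> {f \<in> {..<n} \<rightarrow>\<^sub>E S. bij_betw f {..<n} S}"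
  proof (rule image_subsetI)
   fix p assume "p \<in> {p. p permutes {..<n}}"
   then have p: "p permutes {..<n}" by simp
   have b: "bij_betw (g \<circ> p) {..<n} S" by (rule bij_betw_trans[OF permutes_imp_bij[OF p] g])
   then have "bij_betw (restrict (g \<circ> p) {..<n}) {..<n} S" by (simp add: bij_betw_restrict_eq)
   then show "restrict (g \<circ> p) {..<n} \<in> {f \<in> {..<n} \<rightarrow>\<^sub>E S. bij_betw f {..<n} S}"
    by (auto simp: bij_betw_def)
  qed
  show "(\<lambda>f i. if i < n then inv_into {..<n} g (f i) else i) ` {f \<in> {..<n} \<rightarrow>\<^sub>E S. bij_betw f {..<n} S} \<subseteq> {p. p permutes {..<n}}"
  proof (rule image_subsetI)
   fix f assume "f \<in> {f \<in> {..<n} \<rightarrow>\<^sub>E S. bij_betw f {..<n} S}"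
   then have f: "f \<in> {..<n} \<rightarrow>\<^sub>E S" "bij_betw f {..<n} S" by auto
   have "bij_betw (inv_into {..<n} g \<circ> f) {..<n} {..<n}"
    by (rule bij_betw_trans[OF f(2) bij_betw_inv_into[OF g]])
   then have "bij_betw (\<lambda>i. if i < n then inv_into {..<n} g (f i) else i) {..<n} {..<n}"
    by (subst bij_betw_cong[where g="inv_into {..<n} g \<circ> f"]) auto
   then have "(\<lambda>i. if i < n then inv_into {..<n} g (f i) else i) permutes {..<n}"
    by (rule bij_imp_permutes) auto
   then show "(\<lambda>i. if i < n then inv_into {..<n} g (f i) else i) \<in> {p. p permutes {..<n}}" by simp
  qed
 qed
 from bij_betw_same_card[OF this] show ?thesis by (simp add: card_permutations)
qed

text \<open>A non-injective index map repeats a row and contributes 0; each \<open>n\<close>-subset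
  is the image of \<open>fact n\<close> injective maps, all giving the same principal minor. The
  factorial cancels the one in \<open>fredholm_term\<close>.\<close>

lemma sum_detS_functions:
 fixes C :: "nat => nat => 'c::comm_ring_1"
 shows "(\<Sum>f\<in>{..<n} \<rightarrow>\<^sub>E {..<N}. detS {..<n} (\<lambda>i j. C (f i) (f j)))
  = of_nat (fact n) * (\<Sum>S\<in>{S. S \<subseteq> {..<N} \<and> card S = n}. detS S C)"
proof -
 let ?F = "{f \<in> {..<n} \<rightarrow>\<^sub>E {..<N}. inj_on f {..<n}}"
 let ?T = "{S. S \<subseteq> {..<N} \<and> card S = n}"
 have "(\<Sum>f\<in>{..<n} \<rightarrow>\<^sub>E {..<N}. detS {..<n} (\<lambda>i j. C (f i) (f j))) = (\<Sum>f\<in>?F. detS {..<n} (\<lambda>i j. C (f i) (f j)))"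
 proof (rule sum.mono_neutral_right)
  show "\<forall>f\<in>({..<n} \<rightarrow>\<^sub>E {..<N}) - ?F. detS {..<n} (\<lambda>i j. C (f i) (f j)) = 0"
  proof
   fix f assume "f \<in> ({..<n} \<rightarrow>\<^sub>E {..<N}) - ?F"
   then obtain i j where "i < n" "j < n" "i \<noteq> j" "f i = f j" by (auto simp: inj_on_def)
   then show "detS {..<n} (\<lambda>i j. C (f i) (f j)) = 0"
    by (intro detS_identical[of i n j]) auto
  qed
 qed (auto intro: finite_PiE)
 also have "\<dots> = (\<Sum>f\<in>?F. detS (f ` {..<n}) C)"
  by (intro sum.cong refl) (auto intro!: detS_reindex[symmetric] inj_on_imp_bij_betw)
 also have "\<dots> = (\<Sum>S\<in>?T. \<Sum>f\<in>{f \<in> ?F. f ` {..<n} = S}. detS (f ` {..<n}) C)"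
 proof (rule sum.group[symmetric])
  show "finite ?F" by (rule finite_subset[OF _ finite_PiE[of "{..<n}" "\<lambda>_. {..<N}"]]) auto
  show "finite ?T" by (rule finite_subset[of _ "Pow {..<N}"]) auto
  show "(\<lambda>f. f ` {..<n}) ` ?F \<subseteq> ?T"
  proof (rule image_subsetI)
   fix f assume f: "f \<in> ?F"
   then have "f ` {..<n} \<subseteq> {..<N}" by (simp add: PiE_def Pi_def image_subset_iff)
   moreover have "card (f ` {..<n}) = n" using f by (simp add: card_image)
   ultimately show "f ` {..<n} \<in> ?T" by simp
  qed
 qed
 also have "\<dots> = (\<Sum>S\<in>?T. of_nat (fact n) * detS S C)"
 proof (intro sum.cong refl)
  fix S assume S: "S \<in> ?T"
  then have "finite S" using finite_subset by auto
  have eq: "{f \<in> ?F. f ` {..<n} = S} = {f \<in> {..<n} \<rightarrow>\<^sub>E S. bij_betw f {..<n} S}"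
   using S by (auto simp: bij_betw_def)
  have "(\<Sum>f\<in>{f \<in> ?F. f ` {..<n} = S}. detS (f ` {..<n}) C) = (\<Sum>f\<in>{f \<in> ?F. f ` {..<n} = S}. detS S C)"
   by (intro sum.cong) auto
  also have "\<dots> = of_nat (fact n) * detS S C"
   using card_bij_PiE[of S n] S \<open>finite S\<close> unfolding eq by simp
  finally show "(\<Sum>f\<in>{f \<in> ?F. f ` {..<n} = S}. detS (f ` {..<n}) C) = of_nat (fact n) * detS S C" .
 qed
 finally show ?thesis by (simp add: sum_distrib_left)
qed

lemma sigma_finite_restrict_lborel: "A \<in> sets lborel ==> sigma_finite_measure (restrict_space lborel A)"
 by (rule sigma_finite_measure_restrict_space[OF sigma_finite_lborel])

text \<open>Expanding the rank \<open>N\<close> kernel in every entry makes the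
  \<open>n\<close>-fold integral factorise into entries of the pairing matrix \<open>C i j\<close>.
  The \<open>n\<close>-th term becomes a signed sum of its principal minors of size
  \<open>n\<close>, and these add up to the determinant of \<open>1 - C\<close>.\<close>

lemma fredholm_finite_rank:
 fixes a \<phi> :: "nat => real => complex"
 assumes int: "\<And>i j. i < N ==> j < N ==> integrable (restrict_space lborel {..0}) (\<lambda>x. \<phi> i x * a j x)"
 assumes A: "\<And>u v. u \<le> 0 ==> v \<le> 0 ==> A u v = (\<Sum>m<N. a m u * \<phi> m v)"
 shows "fredholm_term A sums detS {..<N} (\<lambda>i j. (if i = j then 1 else 0) -
      (\<integral>x. \<phi> i x * a j x \<partial>restrict_space lborel {..0}))"
proof -
 let ?L = "restrict_space lborel {..0::real}"
 define C where "C i j = (\<integral>x. \<phi> i x * a j x \<partial>?L)" for i j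
 have sf: "sigma_finite_measure ?L" by (rule sigma_finite_restrict_lborel) simp
 interpret product_sigma_finite "\<lambda>_::nat. ?L"
  by (rule product_sigma_finite.intro) (rule sf)
 have term_eq: "fredholm_term A n = (-1) ^ n * (\<Sum>S\<in>{S. S \<subseteq> {..<N} \<and> card S = n}. detS S C)" for n
 proof -
  have perm_inv: "Hilbert_Choice.inv p i < n" if "p permutes {..<n}" "i < n" for p i
   using permutes_in_image[OF permutes_inv[OF that(1)], of i] that(2) by simp
  have expand: "detS {..<n} (\<lambda>i j. A (x i) (x j)) =
   (\<Sum>f\<in>{..<n} \<rightarrow>\<^sub>E {..<N}. \<Sum>p\<in>{p. p permutes {..<n}}. of_int (sign p) *
    (\<Prod>i<n. \<phi> (f (Hilbert_Choice.inv p i)) (x i) * a (f i) (x i)))"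
   if x: "x \<in> space (PiM {..<n} (\<lambda>_. ?L))" for x
  proof -
   have x0: "x i \<le> 0" if "i < n" for i
    using x that by (auto simp: space_PiM space_restrict_space PiE_def Pi_def)
   have "(\<Prod>i<n. A (x i) (x (p i))) = (\<Sum>f\<in>{..<n} \<rightarrow>\<^sub>E {..<N}.
     (\<Prod>i<n. \<phi> (f (Hilbert_Choice.inv p i)) (x i) * a (f i) (x i)))" if p: "p permutes {..<n}" for p
   proof -
    have "(\<Prod>i<n. A (x i) (x (p i))) = (\<Prod>i<n. \<Sum>m<N. a m (x i) * \<phi> m (x (p i)))"
     using p by (intro prod.cong refl A x0) (auto simp: permutes_in_image[OF p, of _, simplified])
    also have "\<dots> = (\<Sum>f\<in>{..<n} \<rightarrow>\<^sub>E {..<N}. \<Prod>i<n. a (f i) (x i) * \<phi> (f i) (x (p i)))"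
     by (rule prod_sum_PiE) auto
    \<comment> \<open>Reindexing the second factor by \<open>p\<close> puts both factors at the same
      variable \<open>x i\<close>, so that the product integral splits.\<close>
    also have "\<dots> = (\<Sum>f\<in>{..<n} \<rightarrow>\<^sub>E {..<N}. (\<Prod>i<n. \<phi> (f (Hilbert_Choice.inv p i)) (x i) * a (f i) (x i)))"
    proof (intro sum.cong refl)
     fix f
     have "(\<Prod>i<n. \<phi> (f i) (x (p i))) = (\<Prod>i<n. (\<lambda>i. \<phi> (f (Hilbert_Choice.inv p i)) (x i)) (p i))"
      by (simp add: permutes_inverses(2)[OF p])
     also have "\<dots> = (\<Prod>i<n. \<phi> (f (Hilbert_Choice.inv p i)) (x i))"
      using prod.permute[OF p, of "\<lambda>i. \<phi> (f (Hilbert_Choice.inv p i)) (x i)"] by (simp add: comp_def)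
     finally show "(\<Prod>i<n. a (f i) (x i) * \<phi> (f i) (x (p i))) = (\<Prod>i<n. \<phi> (f (Hilbert_Choice.inv p i)) (x i) * a (f i) (x i))"
      by (simp add: prod.distrib)
    qed
    finally show ?thesis .
   qed
   then have "detS {..<n} (\<lambda>i j. A (x i) (x j)) = (\<Sum>p\<in>{p. p permutes {..<n}}. of_int (sign p) *
    (\<Sum>f\<in>{..<n} \<rightarrow>\<^sub>E {..<N}. (\<Prod>i<n. \<phi> (f (Hilbert_Choice.inv p i)) (x i) * a (f i) (x i))))"
    unfolding detS_def by (intro sum.cong) auto
   then show ?thesis
    unfolding sum_distrib_left by (subst sum.swap) simp
  qed
  have intp: "integrable (PiM {..<n} (\<lambda>_. ?L)) (\<lambda>x. \<Prod>i<n. \<phi> (f (Hilbert_Choice.inv p i)) (x i) * a (f i) (x i))"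
   if f: "f \<in> {..<n} \<rightarrow>\<^sub>E {..<N}" and p: "p permutes {..<n}" for f p
   by (rule product_integrable_prod) (use f perm_inv[OF p] in \<open>auto intro!: int simp: PiE_def Pi_def\<close>)
  have "(\<integral>x. detS {..<n} (\<lambda>i j. A (x i) (x j)) \<partial>PiM {..<n} (\<lambda>_. ?L)) =
   (\<integral>x. (\<Sum>f\<in>{..<n} \<rightarrow>\<^sub>E {..<N}. \<Sum>p\<in>{p. p permutes {..<n}}. of_int (sign p) *
    (\<Prod>i<n. \<phi> (f (Hilbert_Choice.inv p i)) (x i) * a (f i) (x i))) \<partial>PiM {..<n} (\<lambda>_. ?L))"
   by (intro integral_cong refl expand)
  also have "\<dots> = (\<Sum>f\<in>{..<n} \<rightarrow>\<^sub>E {..<N}. \<Sum>p\<in>{p. p permutes {..<n}}. of_int (sign p) *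
    (\<integral>x. (\<Prod>i<n. \<phi> (f (Hilbert_Choice.inv p i)) (x i) * a (f i) (x i)) \<partial>PiM {..<n} (\<lambda>_. ?L)))"
   by (subst integral_sum, (intro integrable_sum integrable_mult_right intp; auto),
     intro sum.cong refl, subst integral_sum, (intro integrable_mult_right intp; auto),
     intro sum.cong refl, rule integral_mult_right_zero)
  also have "\<dots> = (\<Sum>f\<in>{..<n} \<rightarrow>\<^sub>E {..<N}. \<Sum>p\<in>{p. p permutes {..<n}}. of_int (sign p) *
    (\<Prod>i<n. C (f (Hilbert_Choice.inv p i)) (f i)))"
  proof (intro sum.cong refl arg_cong2[where f="(*)"])
   fix f p assume f: "f \<in> {..<n} \<rightarrow>\<^sub>E {..<N}" and "p \<in> {p. p permutes {..<n}}"
   then have p: "p permutes {..<n}" by simp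
   show "(\<integral>x. (\<Prod>i<n. \<phi> (f (Hilbert_Choice.inv p i)) (x i) * a (f i) (x i)) \<partial>PiM {..<n} (\<lambda>_. ?L))
    = (\<Prod>i<n. C (f (Hilbert_Choice.inv p i)) (f i))"
    unfolding C_def
    by (rule product_integral_prod) (use f perm_inv[OF p] in \<open>auto intro!: int simp: PiE_def Pi_def\<close>)
  qed
  also have "\<dots> = (\<Sum>f\<in>{..<n} \<rightarrow>\<^sub>E {..<N}. detS {..<n} (\<lambda>i j. C (f i) (f j)))"
  proof (intro sum.cong refl)
   fix f
   have "(\<Prod>i<n. C (f (Hilbert_Choice.inv p i)) (f i)) = (\<Prod>i<n. C (f i) (f (p i)))" if p: "p permutes {..<n}" for p
    using prod.permute[OF p, of "\<lambda>i. C (f (Hilbert_Choice.inv p i)) (f i)"]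
    by (simp add: comp_def permutes_inverses(2)[OF p])
   then show "(\<Sum>p\<in>{p. p permutes {..<n}}. of_int (sign p) * (\<Prod>i<n. C (f (Hilbert_Choice.inv p i)) (f i)))
    = detS {..<n} (\<lambda>i j. C (f i) (f j))"
    unfolding detS_def by simp
  qed
  finally show ?thesis
   unfolding fredholm_term_def by (simp add: sum_detS_functions)
 qed
 \<comment> \<open>Beyond \<open>N\<close> there is no subset of size \<open>n\<close>, so the
   series is a finite sum.\<close>
 have zero: "fredholm_term A n = 0" if "n \<notin> {..N}" for n
 proof -
  have "{S. S \<subseteq> {..<N} \<and> card S = n} = {}"
   using that card_mono[of "{..<N}"] by fastforce
  then show ?thesis by (simp only: term_eq) simp
 qed
 have "(\<Sum>n\<le>N. fredholm_term A n) = (\<Sum>n\<le>N. \<Sum>S\<in>{S\<in>Pow {..<N}. card S = n}. (-1) ^ card S * detS S C)"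
  by (intro sum.cong refl) (simp add: term_eq sum_distrib_left Pow_def)
 also have "\<dots> = (\<Sum>S\<in>Pow {..<N}. (-1) ^ card S * detS S C)"
  by (rule sum.group) (use card_mono[of "{..<N}"] in \<open>auto\<close>)
 also have "\<dots> = detS {..<N} (\<lambda>i j. (if i = j then 1 else 0) - C i j)"
  by (rule detS_one_minus[symmetric]) simp
 finally have "(\<Sum>n\<le>N. fredholm_term A n) = detS {..<N} (\<lambda>i j. (if i = j then 1 else 0) - C i j)" .
 with sums_finite[of "{..N}" "fredholm_term A", OF _ zero] show ?thesis
  unfolding C_def by simp
qed

declare One_nat_def [simp del]

section \<open>Andreief's identity on the chamber of ordered points\<close>

lemma integrable_if_pred:
 fixes f :: "'a => 'b::{banach, second_countable_topology}"
 assumes f: "integrable M f" and P[measurable]: "Measurable.pred M P"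
 shows "integrable M (\<lambda>x. if P x then f x else 0)"
 using assms by (intro integrable_bound[OF f]) auto

definition ordered :: "nat => (nat => real) => bool" where
 "ordered N y \<longleftrightarrow> (\<forall>i\<in>{1..<N}. y i < y (Suc i))"

lemma ordered_less:
 assumes "ordered N y" "1 \<le> i" "i < j" "j \<le> N"
 shows "y i < y j"
proof -
 have "i < j \<longrightarrow> j \<le> N \<longrightarrow> y i < y j"
 proof (induction j)
  case (Suc j)
  have st: "y j < y (Suc j)" if "1 \<le> j" "j < N" using assms(1) that by (simp add: ordered_def)
  show ?case
  proof (intro impI)
   assume *: "i < Suc j" "Suc j \<le> N"
   then have "y j < y (Suc j)" using st assms(2) by simp
   then show "y i < y (Suc j)" using Suc * by (cases "i = j") (auto intro: less_trans)
  qed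
 qed simp
 with assms show ?thesis by simp
qed

text \<open>The rank map \<open>R\<close> is a permutation because the values are distinct, and a
  sorting permutation has to be its inverse. Hence unfolding the chamber counts almost every point
  exactly once.\<close>

lemma card_sorting_permutations:
 assumes inj: "inj_on y {1..N}"
 shows "card {p. p permutes {1..N} \<and> ordered N (y \<circ> p)} = 1"
proof -
 define R where "R a = (if a \<in> {1..N} then Suc (card {j\<in>{1..N}. y j < y a}) else a)" for a
 have lt: "R a < R b" if "a \<in> {1..N}" "b \<in> {1..N}" "y a < y b" for a b
 proof -
  have "{j\<in>{1..N}. y j < y a} \<subset> {j\<in>{1..N}. y j < y b}" using that by auto
  then have "card {j\<in>{1..N}. y j < y a} < card {j\<in>{1..N}. y j < y b}" by (intro psubset_card_mono) auto
  then show ?thesis using that by (simp add: R_def)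
 qed
 have Rinj: "inj_on R {1..N}"
 proof (rule inj_onI)
  fix a b assume ab: "a \<in> {1..N}" "b \<in> {1..N}" "R a = R b"
  then have "y a = y b" using lt[OF ab(1,2)] lt[OF ab(2,1)] by (metis less_irrefl linorder_neqE)
  then show "a = b" by (rule inj_onD[OF inj _ ab(1,2)])
 qed
 have Rrange: "R ` {1..N} \<subseteq> {1..N}"
 proof (rule image_subsetI)
  fix a assume a: "a \<in> {1..N}"
  have "{j\<in>{1..N}. y j < y a} \<subseteq> {1..N} - {a}" by auto
  then have "card {j\<in>{1..N}. y j < y a} \<le> card ({1..N} - {a})" by (intro card_mono) auto
  with a show "R a \<in> {1..N}" by (auto simp: R_def)
 qed
 have Rperm: "R permutes {1..N}"
  by (rule bij_imp_permutes[OF _])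
   (use Rinj Rrange endo_inj_surj[of "{1..N}" R] in \<open>simp add: bij_betw_def\<close>, simp only: R_def if_False)
 have eq: "ordered N (y \<circ> p) \<longleftrightarrow> p = Hilbert_Choice.inv R" if p: "p permutes {1..N}" for p
 proof
  assume o: "ordered N (y \<circ> p)"
  have "R (p i) = i" for i
  proof (cases "i \<in> {1..N}")
   case True
   then have pi: "p i \<in> {1..N}" using permutes_in_image[OF p] by simp
   have "{j\<in>{1..N}. y j < y (p i)} = p ` {1..<i}"
   proof (intro equalityI subsetI)
    fix j assume j: "j \<in> {j\<in>{1..N}. y j < y (p i)}"
    then obtain k where k: "j = p k" "k \<in> {1..N}" using permutes_image[OF p] by blast
    have "k < i"
    proof (rule ccontr)
     assume "\<not> k < i"
     then have "y (p i) \<le> y (p k)"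
      using ordered_less[OF o, of i k] True k(2) by (cases "i = k") auto
     then show False using j k by simp
    qed
    then show "j \<in> p ` {1..<i}" using k by auto
   next
    fix j assume "j \<in> p ` {1..<i}"
    then obtain k where k: "j = p k" "1 \<le> k" "k < i" by auto
    then show "j \<in> {j\<in>{1..N}. y j < y (p i)}"
     using ordered_less[OF o, of k i] True permutes_in_image[OF p, of k] by auto
   qed
   then have "card {j\<in>{1..N}. y j < y (p i)} = card {1..<i}"
    using permutes_inj[OF p] by (simp add: card_image inj_on_subset)
   then show ?thesis using pi True unfolding R_def by simp
  next
   case False
   then show ?thesis using permutes_not_in[OF p False] False by (simp only: R_def if_False)
  qed
  then show "p = Hilbert_Choice.inv R"
   using inv_f_f[OF permutes_inj[OF Rperm]] by (metis ext)
 next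
  assume pR: "p = Hilbert_Choice.inv R"
  show "ordered N (y \<circ> p)"
   unfolding ordered_def
  proof
   fix i assume i: "i \<in> {1..<N}"
   have R: "R (p i) = i" "R (p (Suc i)) = Suc i" unfolding pR by (simp_all add: permutes_inverses[OF Rperm])
   have I: "p i \<in> {1..N}" "p (Suc i) \<in> {1..N}" using permutes_in_image[OF p] i by auto
   have "y (p i) \<noteq> y (p (Suc i))" using R I inj by (metis inj_onD n_not_Suc_n)
   moreover have "\<not> y (p (Suc i)) < y (p i)" using lt[OF I(2,1)] R by auto
   ultimately show "(y \<circ> p) i < (y \<circ> p) (Suc i)" by simp
  qed
 qed
 have "{p. p permutes {1..N} \<and> ordered N (y \<circ> p)} = {Hilbert_Choice.inv R}"
  using eq permutes_inv[OF Rperm] by auto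
 then show ?thesis by simp
qed

text \<open>Checked on boxes, where both measures are the same product. It serves to permute
  particles and to drop the level from pairs \<open>(i, l)\<close>.\<close>

lemma distr_PiM_lborel_reindex:
 assumes f: "bij_betw f I J" and fin: "finite I"
 shows "distr (PiM J (\<lambda>_. lborel)) (PiM I (\<lambda>_. lborel)) (\<lambda>x. \<lambda>i\<in>I. x (f i)) = PiM I (\<lambda>_. lborel :: real measure)"
proof -
 have inj: "inj_on f I" and J: "J = f ` I" using f by (auto simp: bij_betw_def)
 have finJ: "finite J" using fin J by simp
 interpret product_sigma_finite "\<lambda>_. lborel :: real measure" by standard
 interpret Jf: finite_product_sigma_finite "\<lambda>_. lborel :: real measure" J by standard fact
 have meas: "(\<lambda>x. \<lambda>i\<in>I. x (f i)) \<in> PiM J (\<lambda>_. lborel) \<rightarrow>\<^sub>M PiM I (\<lambda>_. lborel :: real measure)"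
  by (rule measurable_restrict) (auto simp: J)
 show ?thesis
 proof (rule PiM_eqI)
  fix A :: "_ => real set" assume A: "\<And>i. i \<in> I ==> A i \<in> sets lborel"
  have vim: "(\<lambda>x. \<lambda>i\<in>I. x (f i)) -` Pi\<^sub>E I A \<inter> space (PiM J (\<lambda>_. lborel)) = PiE J (\<lambda>j. A (inv_into I f j))"
   using inj by (auto simp: J space_PiM PiE_def Pi_def inv_into_f_f)
  have "emeasure (distr (PiM J (\<lambda>_. lborel)) (PiM I (\<lambda>_. lborel)) (\<lambda>x. \<lambda>i\<in>I. x (f i))) (Pi\<^sub>E I A) =
    emeasure (PiM J (\<lambda>_. lborel)) (PiE J (\<lambda>j. A (inv_into I f j)))"
   using A fin by (subst emeasure_distr[OF meas]) (auto intro!: sets_PiM_I_finite simp: vim)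
  also have "\<dots> = (\<Prod>j\<in>J. emeasure lborel (A (inv_into I f j)))"
   using A inj by (intro Jf.measure_times) (auto simp: J inv_into_f_f)
  also have "\<dots> = (\<Prod>i\<in>I. emeasure lborel (A i))"
   using inj by (simp add: J prod.reindex inv_into_f_f)
  finally show "emeasure (distr (PiM J (\<lambda>_. lborel)) (PiM I (\<lambda>_. lborel)) (\<lambda>x. \<lambda>i\<in>I. x (f i))) (Pi\<^sub>E I A) = (\<Prod>i\<in>I. emeasure lborel (A i))" .
 qed (use fin in simp_all)
qed

lemma AE_PiM_lborel_distinct:
 assumes "finite I" "i \<in> I" "j \<in> I" "i \<noteq> j"
 shows "AE x in PiM I (\<lambda>_. lborel :: real measure). x i \<noteq> x j"
proof -
 interpret product_sigma_finite "\<lambda>_. lborel :: real measure" by standard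
 define K where "K = I - {i}"
 have I: "I = insert i K" and K: "finite K" "i \<notin> K" "j \<in> K" using assms by (auto simp: K_def)
 have m: "{x \<in> space (PiM I (\<lambda>_. lborel :: real measure)). x i = x j} \<in> sets (PiM I (\<lambda>_. lborel))"
  using assms by measurable
 have "emeasure (PiM I (\<lambda>_. lborel :: real measure)) {x \<in> space (PiM I (\<lambda>_. lborel)). x i = x j}
  = (\<integral>\<^sup>+x. indicator {x \<in> space (PiM I (\<lambda>_. lborel)). x i = x j} x \<partial>PiM I (\<lambda>_. lborel :: real measure))"
  using m by simp
 also have "\<dots> = (\<integral>\<^sup>+ x. (\<integral>\<^sup>+ y. indicator {x \<in> space (PiM I (\<lambda>_. lborel :: real measure)). x i = x j} (x(i := y)) \<partial>lborel) \<partial>(Pi\<^sub>M K (\<lambda>_. lborel)))"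
 proof -
  have "indicator {x \<in> space (PiM I (\<lambda>_. lborel :: real measure)). x i = x j} \<in> borel_measurable (PiM I (\<lambda>_. lborel))"
   using m by simp
  from product_nn_integral_insert[OF K(1,2) this[unfolded I]] show ?thesis unfolding I .
 qed
 also have "\<dots> = (\<integral>\<^sup>+ x. (\<integral>\<^sup>+ y. (0::ennreal) \<partial>(lborel::real measure)) \<partial>(Pi\<^sub>M K (\<lambda>_. lborel :: real measure)))"
 proof (rule nn_integral_cong, rule nn_integral_cong_AE)
  fix x assume "x \<in> space (Pi\<^sub>M K (\<lambda>_. lborel :: real measure))"
  show "AE y in lborel. indicator {x \<in> space (PiM I (\<lambda>_. lborel)). x i = x j} (x(i := y)) = (0::ennreal)"
   using AE_lborel_singleton[of "x j"] by eventually_elim (use K(3) K(2) in \<open>auto simp: indicator_def split: if_splits\<close>)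
 qed
 also have "\<dots> = 0" by simp
 finally show ?thesis using m by (intro AE_I'[of "{x \<in> space (PiM I (\<lambda>_. lborel :: real measure)). x i = x j}"]) (auto simp: null_sets_def)
qed

lemma AE_PiM_lborel_inj:
 assumes "finite I"
 shows "AE x in PiM I (\<lambda>_. lborel :: real measure). inj_on x I"
proof -
 have "AE x in PiM I (\<lambda>_. lborel :: real measure). \<forall>i\<in>I. \<forall>j\<in>I. i \<noteq> j \<longrightarrow> x i \<noteq> x j"
  using assms AE_PiM_lborel_distinct[OF assms] by (intro AE_finite_allI) (auto)
 then show ?thesis by eventually_elim (auto simp: inj_on_def)
qed

lemma detS_permute_columns:
 fixes y :: "nat => real" and g :: "nat => real => real"
 assumes p: "p permutes I" and fin: "finite I"
 shows "detS I (\<lambda>i j. g i (y (p j))) = of_int (sign p) * detS I (\<lambda>i j. g i (y j))"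
proof -
 have "detS I (\<lambda>i j. g i (y j)) = (\<Sum>q\<in>{q. q permutes I}. of_int (sign (p \<circ> q)) * (\<Prod>i\<in>I. g i (y (p (q i)))))"
  unfolding detS_def by (subst setum_permutations_compose_left[OF p]) (simp add: comp_def)
 also have "\<dots> = (\<Sum>q\<in>{q. q permutes I}. of_int (sign p) * (of_int (sign q) * (\<Prod>i\<in>I. g i (y (p (q i))))))"
  by (intro sum.cong refl) (use p fin in \<open>simp add: sign_compose permutation_permutes[THEN iffD2, OF exI[of _ I]]\<close>)
 also have "\<dots> = of_int (sign p) * detS I (\<lambda>i j. g i (y (p j)))"
  unfolding detS_def by (simp add: sum_distrib_left)
 finally have "of_int (sign p) * detS I (\<lambda>i j. g i (y j)) = of_int (sign p * sign p) * detS I (\<lambda>i j. g i (y (p j)))"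
  by (simp only: of_int_mult mult.assoc)
 then show ?thesis by (simp only: sign_idempotent of_int_1 mult_1_left)
qed

lemma integral_PiM_lborel_reindex:
 fixes F :: "('i => real) => real"
 assumes f: "bij_betw f I J" and fin: "finite I" and F[measurable]: "F \<in> borel_measurable (PiM I (\<lambda>_. lborel))"
 shows "(\<integral>x. F x \<partial>PiM I (\<lambda>_. lborel)) = (\<integral>x. F (\<lambda>i\<in>I. x (f i)) \<partial>PiM J (\<lambda>_. lborel))"
  and "integrable (PiM I (\<lambda>_. lborel)) F \<longleftrightarrow> integrable (PiM J (\<lambda>_. lborel)) (\<lambda>x. F (\<lambda>i\<in>I. x (f i)))"
proof -
 have J: "J = f ` I" using f by (auto simp: bij_betw_def)
 have meas[measurable]: "(\<lambda>x. \<lambda>i\<in>I. x (f i)) \<in> PiM J (\<lambda>_. lborel) \<rightarrow>\<^sub>M PiM I (\<lambda>_. lborel :: real measure)"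
  by (rule measurable_restrict) (auto simp: J)
 show "(\<integral>x. F x \<partial>PiM I (\<lambda>_. lborel)) = (\<integral>x. F (\<lambda>i\<in>I. x (f i)) \<partial>PiM J (\<lambda>_. lborel))"
  by (subst distr_PiM_lborel_reindex[OF f fin, symmetric]) (rule integral_distr[OF meas F])
 show "integrable (PiM I (\<lambda>_. lborel)) F \<longleftrightarrow> integrable (PiM J (\<lambda>_. lborel)) (\<lambda>x. F (\<lambda>i\<in>I. x (f i)))"
  by (subst (1) distr_PiM_lborel_reindex[OF f fin, symmetric]) (rule integrable_distr_eq[OF meas F])
qed

lemma measurable_ordered[measurable]:
 "Measurable.pred (PiM {1..N} (\<lambda>_. lborel :: real measure)) (ordered N)"
 unfolding ordered_def by measurable

text \<open>Since \<open>det (f i (y j))\<close> expands over the permutations \<open>p\<close> and \<open>det (g i (y j))\<close>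
 changes by \<open>sign p\<close> under \<open>p\<close>, the integral over the chamber unfolds to the whole space.\<close>

lemma andreief_ordered:
 fixes f g :: "nat => real => real"
 assumes int: "\<And>i j. i \<in> {1..N} ==> j \<in> {1..N} ==> integrable lborel (\<lambda>x. f i x * g j x)"
  and mf[measurable]: "\<And>i. i \<in> {1..N} ==> f i \<in> borel_measurable borel"
  and mg[measurable]: "\<And>i. i \<in> {1..N} ==> g i \<in> borel_measurable borel"
 shows "(\<integral>y. (if ordered N y then detS {1..N} (\<lambda>i j. f i (y j)) * detS {1..N} (\<lambda>i j. g i (y j)) else 0)
      \<partial>PiM {1..N} (\<lambda>_. lborel)) = detS {1..N} (\<lambda>i j. LBINT x. f i x * g j x)"
proof -
 let ?I = "{1..N}" and ?P = "PiM {1..N} (\<lambda>_. lborel :: real measure)"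
 let ?S = "{p. p permutes {1..N}}"
 interpret product_sigma_finite "\<lambda>_. lborel :: real measure" by standard
 \<comment> \<open>\<open>h\<close> keeps the diagonal term of the first determinant only. The
   second determinant absorbs the sign of a permutation of the coordinates, so the product of both
   determinants is the sum of \<open>h\<close> over all permuted points.\<close>
 define h where "h y = (\<Prod>i\<in>?I. f i (y i)) * detS ?I (\<lambda>i j. g i (y j))" for y
 have finS: "finite ?S" by (simp add: finite_permutations)
 have pin: "p i \<in> ?I" if "p permutes ?I" "i \<in> ?I" for p i using permutes_in_image[OF that(1), of i] that(2) by simp
 have pinv: "Hilbert_Choice.inv p i \<in> ?I" if "p permutes ?I" "i \<in> ?I" for p i
  using permutes_in_image[OF permutes_inv[OF that(1)], of i] that(2) by simp
 have hexp: "h y = (\<Sum>p\<in>?S. of_int (sign p) * (\<Prod>i\<in>?I. f i (y i) * g (Hilbert_Choice.inv p i) (y i)))" for y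
 proof -
  have "(\<Prod>i\<in>?I. g i (y (p i))) = (\<Prod>i\<in>?I. g (Hilbert_Choice.inv p i) (y i))" if p: "p permutes ?I" for p
   using prod.permute[OF p, of "\<lambda>i. g (Hilbert_Choice.inv p i) (y i)"]
   by (simp add: comp_def permutes_inverses(2)[OF p])
  then show ?thesis
   unfolding h_def detS_def sum_distrib_left
   by (intro sum.cong refl) (simp add: prod.distrib mult_ac)
 qed
 have intterm: "integrable ?P (\<lambda>y. \<Prod>i\<in>?I. f i (y i) * g (Hilbert_Choice.inv p i) (y i))" if p: "p permutes ?I" for p
  using pinv[OF p] by (intro product_integrable_prod[where f="\<lambda>i x. f i x * g (Hilbert_Choice.inv p i) x"] int) auto
 have inth: "integrable ?P h"
  unfolding hexp[abs_def] by (intro integrable_sum integrable_mult_right intterm) auto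
 then have mh[measurable]: "h \<in> borel_measurable ?P" by auto
 have hcong: "h (\<lambda>i\<in>?I. y i) = h y" for y
  unfolding h_def by (intro arg_cong2[where f="(*)"] prod.cong detS_cong) auto
 have ocong: "ordered N (\<lambda>i\<in>?I. y i) = ordered N y" for y
  unfolding ordered_def by (auto simp: Ball_def)
 have D: "detS ?I (\<lambda>i j. f i (y j)) * detS ?I (\<lambda>i j. g i (y j)) = (\<Sum>p\<in>?S. h (y \<circ> p))" for y
 proof -
  have "h (y \<circ> p) = of_int (sign p) * (\<Prod>i\<in>?I. f i (y (p i))) * detS ?I (\<lambda>i j. g i (y j))" if p: "p permutes ?I" for p
   using detS_permute_columns[OF p, of g y] by (simp add: h_def)
  then have "(\<Sum>p\<in>?S. h (y \<circ> p)) = (\<Sum>p\<in>?S. of_int (sign p) * (\<Prod>i\<in>?I. f i (y (p i))) * detS ?I (\<lambda>i j. g i (y j)))"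
   by (intro sum.cong) auto
  then show ?thesis by (simp add: sum_distrib_right detS_def)
 qed
 have res: "(\<lambda>y. \<lambda>i\<in>?I. y (p i)) \<in> ?P \<rightarrow>\<^sub>M ?P" if p: "p permutes ?I" for p
  by (rule measurable_restrict) (use pin[OF p] in auto)
 have bij: "bij_betw p ?I ?I" if "p permutes ?I" for p using that by (rule permutes_imp_bij)
 have intp: "integrable ?P (\<lambda>y. h (y \<circ> p))" if p: "p permutes ?I" for p
  using integral_PiM_lborel_reindex(2)[OF bij[OF p] _ mh] inth hcong[of "_ \<circ> p"] by (simp add: comp_def)
 have ordm: "Measurable.pred ?P (\<lambda>y. ordered N (y \<circ> p))" if p: "p permutes ?I" for p
 proof -
  have "(\<lambda>y. ordered N (y \<circ> p)) = (\<lambda>y. ordered N (\<lambda>i\<in>?I. y (p i)))"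
   using ocong[of "_ \<circ> p"] by (simp add: comp_def)
  then show ?thesis using measurable_compose[OF res[OF p] measurable_ordered] by simp
 qed
 have "(\<integral>y. (if ordered N y then detS ?I (\<lambda>i j. f i (y j)) * detS ?I (\<lambda>i j. g i (y j)) else 0) \<partial>?P)
   = (\<integral>y. (\<Sum>p\<in>?S. (if ordered N y then h (y \<circ> p) else 0)) \<partial>?P)"
  by (intro integral_cong refl) (auto simp: D)
 also have "\<dots> = (\<Sum>p\<in>?S. \<integral>y. (if ordered N y then h (y \<circ> p) else 0) \<partial>?P)"
  by (intro integral_sum)
   (auto intro!: integrable_if_pred intp)
 also have "\<dots> = (\<Sum>p\<in>?S. \<integral>y. (if ordered N (y \<circ> p) then h y else 0) \<partial>?P)"
 proof -
  have "(\<integral>y. (if ordered N y then h (y \<circ> p) else 0) \<partial>?P) = (\<integral>y. (if ordered N (y \<circ> Hilbert_Choice.inv p) then h y else 0) \<partial>?P)"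
   if p: "p permutes ?I" for p
  proof -
   have m: "(\<lambda>y. if ordered N (y \<circ> Hilbert_Choice.inv p) then h y else 0) \<in> borel_measurable ?P"
    using ordm[OF permutes_inv[OF p]] by measurable
   have 1: "ordered N ((\<lambda>i\<in>?I. y (p i)) \<circ> Hilbert_Choice.inv p) = ordered N y" for y
    unfolding ordered_def using pinv[OF p] by (auto simp: permutes_inverses[OF p])
   have 2: "h (\<lambda>i\<in>?I. y (p i)) = h (y \<circ> p)" for y using hcong[of "y \<circ> p"] by (simp add: comp_def)
   show ?thesis
    using integral_PiM_lborel_reindex(1)[OF bij[OF p] _ m] unfolding 1 2 by simp
  qed
  then have "(\<Sum>p\<in>?S. \<integral>y. (if ordered N y then h (y \<circ> p) else 0) \<partial>?P) =
    (\<Sum>p\<in>?S. \<integral>y. (if ordered N (y \<circ> Hilbert_Choice.inv p) then h y else 0) \<partial>?P)"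
   by (intro sum.cong) auto
  also have "\<dots> = (\<Sum>p\<in>?S. \<integral>y. (if ordered N (y \<circ> p) then h y else 0) \<partial>?P)"
   using sum_permutations_inverse[of "\<lambda>p. \<integral>y. (if ordered N (y \<circ> p) then h y else 0) \<partial>?P" ?I]
   by (rule sym)
  finally show ?thesis .
 qed
 also have "\<dots> = (\<integral>y. (\<Sum>p\<in>?S. if ordered N (y \<circ> p) then h y else 0) \<partial>?P)"
  by (rule integral_sum[symmetric])
   (use ordm in \<open>auto intro!: integrable_if_pred inth\<close>)
 also have "\<dots> = (\<integral>y. h y \<partial>?P)"
 proof (rule integral_cong_AE)
  show "(\<lambda>y. \<Sum>p\<in>?S. if ordered N (y \<circ> p) then h y else 0) \<in> borel_measurable ?P"
   by (intro borel_measurable_sum borel_measurable_integrable integrable_if_pred inth) (use ordm in \<open>simp\<close>)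
  show "AE y in ?P. (\<Sum>p\<in>?S. if ordered N (y \<circ> p) then h y else 0) = h y"
   using AE_PiM_lborel_inj[of ?I, simplified]
  proof eventually_elim
   case (elim y)
   have "(\<Sum>p\<in>?S. if ordered N (y \<circ> p) then h y else 0) = (\<Sum>p\<in>{p. p permutes ?I \<and> ordered N (y \<circ> p)}. h y)"
    using finS by (intro sum.mono_neutral_cong_right) auto
   then show ?case using card_sorting_permutations[of y N] elim by simp
  qed
 qed fact
 also have "\<dots> = (\<Sum>p\<in>?S. of_int (sign p) * (\<integral>y. (\<Prod>i\<in>?I. f i (y i) * g (Hilbert_Choice.inv p i) (y i)) \<partial>?P))"
  unfolding hexp[abs_def] using intterm by (subst integral_sum) auto
 also have "\<dots> = (\<Sum>p\<in>?S. of_int (sign p) * (\<Prod>i\<in>?I. LBINT x. f i x * g (Hilbert_Choice.inv p i) x))"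
 proof (rule sum.cong[OF refl])
  fix p assume "p \<in> ?S"
  then have "(\<integral>y. (\<Prod>i\<in>?I. f i (y i) * g (Hilbert_Choice.inv p i) (y i)) \<partial>?P) = (\<Prod>i\<in>?I. LBINT x. f i x * g (Hilbert_Choice.inv p i) x)"
   using pinv[of p] by (intro product_integral_prod[where f="\<lambda>i x. f i x * g (Hilbert_Choice.inv p i) x"] int) auto
  then show "of_int (sign p) * (\<integral>y. (\<Prod>i\<in>?I. f i (y i) * g (Hilbert_Choice.inv p i) (y i)) \<partial>?P) =
   of_int (sign p) * (\<Prod>i\<in>?I. LBINT x. f i x * g (Hilbert_Choice.inv p i) x)" by simp
 qed
 also have "\<dots> = (\<Sum>p\<in>?S. of_int (sign (Hilbert_Choice.inv p)) * (\<Prod>i\<in>?I. LBINT x. f i x * g (Hilbert_Choice.inv p i) x))"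
 proof (rule sum.cong[OF refl])
  fix p assume "p \<in> ?S"
  then have "sign (Hilbert_Choice.inv p) = sign p"
   by (intro sign_inverse permutes_imp_permutation[of ?I]) auto
  then show "of_int (sign p) * (\<Prod>i\<in>?I. LBINT x. f i x * g (Hilbert_Choice.inv p i) x) =
    of_int (sign (Hilbert_Choice.inv p)) * (\<Prod>i\<in>?I. LBINT x. f i x * g (Hilbert_Choice.inv p i) x)"
   by simp
 qed
 also have "\<dots> = detS ?I (\<lambda>i j. LBINT x. f i x * g j x)"
  using sum_permutations_inverse[of "\<lambda>p. of_int (sign p) * (\<Prod>i\<in>?I. LBINT x. f i x * g (p i) x)" ?I]
  unfolding detS_def by (rule sym)
 finally show ?thesis .
qed

section \<open>Integrating the particle levels one after the other\<close>

lemma detS_scale_columns: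
 fixes A :: "nat => nat => 'c::comm_ring_1"
 assumes "finite I"
 shows "detS I (\<lambda>i j. A i j * c j) = detS I A * (\<Prod>j\<in>I. c j)"
proof -
 have "(\<Prod>i\<in>I. A i (p i) * c (p i)) = (\<Prod>i\<in>I. A i (p i)) * (\<Prod>j\<in>I. c j)" if p: "p permutes I" for p
  using prod.permute[OF p, of c] by (simp add: prod.distrib comp_def)
 then show ?thesis
  unfolding detS_def sum_distrib_right
  by (intro sum.cong) (auto simp: mult.assoc)
qed

lemma prod_indicator_eq:
 assumes "finite I"
 shows "(\<Prod>i\<in>I. indicator A (y i) :: real) = (if \<forall>i\<in>I. y i \<in> A then 1 else 0)"
proof (cases "\<forall>i\<in>I. y i \<in> A")
 case False
 then have "(\<Prod>i\<in>I. indicator A (y i) :: real) = 0"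
  using assms by (intro prod_zero) (auto simp: indicator_def)
 then show ?thesis using False by simp
qed auto

text \<open>Backward composition: \<open>g\<close> lives at level \<open>l + m\<close> and the value
  at level \<open>l\<close>. The sets of levels \<open>l + 1\<close> to \<open>l + m\<close> are
  imposed, that of the starting level \<open>l\<close> is not and has to be inserted
  separately.\<close>

fun chain :: "(nat => real => real => real) => (nat => real set) => nat => nat => (real => real) => real => real" where
 "chain K A l 0 g = g"
| "chain K A l (Suc m) g = (\<lambda>x. LBINT y. K l x y * (indicator (A (Suc l)) y * chain K A (Suc l) m g y))"

lemma chain_add: "chain K A l (m + m') g = chain K A l m (chain K A (l + m) m' g)"
 by (induction m arbitrary: l) simp_all

lemma chain_snoc: "chain K A l (Suc m) g = chain K A l m (chain K A (l + m) 1 g)"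
 using chain_add[of K A l m 1 g] by (simp only: Suc_eq_plus1)

lemma chain_1: "chain K A l 1 g x = (LBINT y. K l x y * (indicator (A (Suc l)) y * g y))"
 by (simp add: One_nat_def)

text \<open>Abstract form of the bridge density times a barrier indicator. The Vandermonde factors
  are replaced by determinants of arbitrary weights, so that Andreief's identity applies at every
  level.\<close>

definition levels :: "nat => nat => (nat => real set) => (nat => real => real) => (nat => real => real => real) =>
  (nat => real => real) => (nat \<times> nat => real) => real" where
 "levels N k A \<phi> K \<psi> x = (if \<forall>l\<in>{1..k}. ordered N (\<lambda>i. x (i,l)) \<and> (\<forall>i\<in>{1..N}. x (i,l) \<in> A l)
  then detS {1..N} (\<lambda>i j. \<phi> i (x (j,1))) *
     (\<Prod>l\<in>{1..<k}. detS {1..N} (\<lambda>i j. K l (x (i,l)) (x (j, Suc l)))) *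
     detS {1..N} (\<lambda>i j. \<psi> i (x (j,k)))
  else 0)"

lemma andreief_restricted:
 fixes f g :: "nat => real => real"
 assumes int: "\<And>i j. i \<in> {1..N} ==> j \<in> {1..N} ==> integrable lborel (\<lambda>x. f i x * (indicator A x * g j x))"
  and mf[measurable]: "\<And>i. i \<in> {1..N} ==> f i \<in> borel_measurable borel"
  and mg[measurable]: "\<And>i. i \<in> {1..N} ==> g i \<in> borel_measurable borel"
  and A[measurable]: "A \<in> sets borel"
 shows "(\<integral>y. (if ordered N y \<and> (\<forall>i\<in>{1..N}. y i \<in> A) then detS {1..N} (\<lambda>i j. f i (y j)) * detS {1..N} (\<lambda>i j. g i (y j)) else 0)
      \<partial>PiM {1..N} (\<lambda>_. lborel)) = detS {1..N} (\<lambda>i j. LBINT x. f i x * (indicator A x * g j x))"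
proof -
 have "(if ordered N y \<and> (\<forall>i\<in>{1..N}. y i \<in> A) then detS {1..N} (\<lambda>i j. f i (y j)) * detS {1..N} (\<lambda>i j. g i (y j)) else 0)
  = (if ordered N y then detS {1..N} (\<lambda>i j. f i (y j) * indicator A (y j)) * detS {1..N} (\<lambda>i j. g i (y j)) else 0)" for y
  using detS_scale_columns[of "{1..N}" "\<lambda>i j. f i (y j)" "\<lambda>j. indicator A (y j)"] prod_indicator_eq[of "{1..N}" A y]
  by simp
 then show ?thesis
  using andreief_ordered[of N "\<lambda>i x. f i x * indicator A x" g] int
  by (simp add: mult.assoc)
qed

text \<open>The last level is integrated first, with the earlier ones frozen: Andreief merges the
  last transition determinant with the exit determinant and replaces each \<open>\<psi> j\<close> by
  its one-step chain. The predicate \<open>G\<close> stands for any growth class stable under such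
  steps; integrability of the whole density passes down by Fubini.\<close>

lemma integral_levels:
 fixes G :: "(real => real) => bool"
 assumes "k \<ge> 1"
  and A: "\<And>l. A l \<in> sets borel"
  and m\<phi>: "\<And>i. i \<in> {1..N} ==> \<phi> i \<in> borel_measurable borel"
  and mK: "\<And>l x. K l x \<in> borel_measurable borel"
  and Gm: "\<And>g. G g ==> g \<in> borel_measurable borel"
  and GK: "\<And>g l x. G g ==> 1 \<le> l ==> l < k ==> integrable lborel (\<lambda>y. K l x y * (indicator (A (Suc l)) y * g y))"
  and Gs: "\<And>g l. G g ==> 1 \<le> l ==> l < k ==> G (chain K A l 1 g)"
  and G\<phi>: "\<And>g i. G g ==> i \<in> {1..N} ==> integrable lborel (\<lambda>y. \<phi> i y * (indicator (A 1) y * g y))"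
  and G\<psi>: "\<And>i. i \<in> {1..N} ==> G (\<psi> i)"
  and int: "integrable (PiM ({1..N}\<times>{1..k}) (\<lambda>_. lborel)) (levels N k A \<phi> K \<psi>)"
 shows "(\<integral>x. levels N k A \<phi> K \<psi> x \<partial>PiM ({1..N}\<times>{1..k}) (\<lambda>_. lborel)) =
  detS {1..N} (\<lambda>i j. LBINT x. \<phi> i x * (indicator (A 1) x * chain K A 1 (k - 1) (\<psi> j) x))"
 using \<open>k \<ge> 1\<close> GK Gs G\<psi> int
proof (induction k arbitrary: \<psi> rule: dec_induct)
 case base
 interpret product_sigma_finite "\<lambda>_. lborel :: real measure" by standard
 have bij: "bij_betw fst ({1..N}\<times>{1::nat}) {1..N}"
  by (auto simp: bij_betw_def inj_on_def image_iff)
 have eq: "levels N 1 A \<phi> K \<psi> (\<lambda>i\<in>{1..N}\<times>{1}. y (fst i)) =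
  (if ordered N y \<and> (\<forall>i\<in>{1..N}. y i \<in> A 1) then detS {1..N} (\<lambda>i j. \<phi> i (y j)) * detS {1..N} (\<lambda>i j. \<psi> i (y j)) else 0)" for y
 proof -
  define w where "w = (\<lambda>i\<in>{1..N}\<times>{1::nat}. y (fst i))"
  have w: "w (i, 1) = y i" if "i \<in> {1..N}" for i using that by (simp add: w_def)
  have o: "ordered N (\<lambda>i. w (i, 1)) = ordered N y"
   by (auto simp: ordered_def w)
  have d: "detS {1..N} (\<lambda>i j. f i (w (j, 1))) = detS {1..N} (\<lambda>i j. f i (y j))" for f :: "nat => real => real"
   by (rule detS_cong) (simp add: w)
  have a: "(\<forall>i\<in>{1..N}. w (i,1) \<in> A 1) = (\<forall>i\<in>{1..N}. y i \<in> A 1)" by (simp add: w)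
  have "levels N 1 A \<phi> K \<psi> w = (if ordered N (\<lambda>i. w (i,1)) \<and> (\<forall>i\<in>{1..N}. w (i,1) \<in> A 1)
   then detS {1..N} (\<lambda>i j. \<phi> i (w (j,1))) * detS {1..N} (\<lambda>i j. \<psi> i (w (j,1))) else 0)"
   unfolding levels_def by simp
  then show ?thesis unfolding o d a by (simp only: w_def)
 qed
 have "(\<integral>x. levels N 1 A \<phi> K \<psi> x \<partial>PiM ({1..N}\<times>{1..1}) (\<lambda>_. lborel)) =
  (\<integral>y. levels N 1 A \<phi> K \<psi> (\<lambda>i\<in>{1..N}\<times>{1}. y (fst i)) \<partial>PiM {1..N} (\<lambda>_. lborel))"
  using integral_PiM_lborel_reindex(1)[OF bij, of "levels N 1 A \<phi> K \<psi>"] base by auto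
 also have "\<dots> = (\<integral>y. (if ordered N y \<and> (\<forall>i\<in>{1..N}. y i \<in> A 1) then detS {1..N} (\<lambda>i j. \<phi> i (y j)) * detS {1..N} (\<lambda>i j. \<psi> i (y j)) else 0) \<partial>PiM {1..N} (\<lambda>_. lborel))"
  by (simp only: eq)
 also have "(\<integral>y. (if ordered N y \<and> (\<forall>i\<in>{1..N}. y i \<in> A 1) then detS {1..N} (\<lambda>i j. \<phi> i (y j)) * detS {1..N} (\<lambda>i j. \<psi> i (y j)) else 0) \<partial>PiM {1..N} (\<lambda>_. lborel))
  = detS {1..N} (\<lambda>i j. LBINT x. \<phi> i x * (indicator (A 1) x * \<psi> j x))"
  by (rule andreief_restricted) (auto intro!: G\<phi> base Gm m\<phi> A)
 finally show ?case by simp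
next
 case (step k)
 let ?I = "{1..N}\<times>{1..k}" and ?J = "{1..N}\<times>{Suc k}"
 have IJ: "?I \<inter> ?J = {}" "finite ?I" "finite ?J" and un: "{1..N}\<times>{1..Suc k} = ?I \<union> ?J" by auto
 interpret product_sigma_finite "\<lambda>_. lborel :: real measure" by standard
 interpret I: finite_product_sigma_finite "\<lambda>_. lborel :: real measure" ?I by standard simp
 interpret J: finite_product_sigma_finite "\<lambda>_. lborel :: real measure" ?J by standard simp
 interpret P: pair_sigma_finite "Pi\<^sub>M ?I (\<lambda>_. lborel :: real measure)" "Pi\<^sub>M ?J (\<lambda>_. lborel :: real measure)" ..
 let ?F = "levels N (Suc k) A \<phi> K \<psi>"
 have intF: "integrable (PiM (?I \<union> ?J) (\<lambda>_. lborel)) ?F" using step.prems(4) un by simp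
 have intM: "integrable (Pi\<^sub>M ?I (\<lambda>_. lborel) \<Otimes>\<^sub>M Pi\<^sub>M ?J (\<lambda>_. lborel)) (\<lambda>p. ?F (merge ?I ?J p))"
  by (rule integrable_distr[OF measurable_merge]) (simp add: distr_merge[OF IJ] intF)
 define \<psi>' where "\<psi>' j = chain K A k 1 (\<psi> j)" for j
 have bij: "bij_betw fst ?J {1..N}" by (auto simp: bij_betw_def inj_on_def image_iff)
 have inner: "(\<integral>y. ?F (merge ?I ?J (x, y)) \<partial>PiM ?J (\<lambda>_. lborel)) = levels N k A \<phi> K \<psi>' x"
  if x: "x \<in> space (PiM ?I (\<lambda>_. lborel))" for x
 proof -
  have m: "(\<lambda>y. ?F (merge ?I ?J (x, y))) \<in> borel_measurable (PiM ?J (\<lambda>_. lborel))"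
   using measurable_compose[OF measurable_Pair1'[OF x] borel_measurable_integrable[OF intM]] by simp
  let ?c = "(if \<forall>l\<in>{1..k}. ordered N (\<lambda>i. x (i,l)) \<and> (\<forall>i\<in>{1..N}. x (i,l) \<in> A l)
   then detS {1..N} (\<lambda>i j. \<phi> i (x (j,1))) * (\<Prod>l\<in>{1..<k}. detS {1..N} (\<lambda>i j. K l (x (i,l)) (x (j, Suc l)))) else 0)"
  have split: "?F (merge ?I ?J (x, \<lambda>i\<in>?J. z (fst i))) = ?c * (if ordered N z \<and> (\<forall>i\<in>{1..N}. z i \<in> A (Suc k))
   then detS {1..N} (\<lambda>i j. K k (x (i,k)) (z j)) * detS {1..N} (\<lambda>i j. \<psi> i (z j)) else 0)" for z
  proof -
   define w where "w = merge ?I ?J (x, \<lambda>i\<in>?J. z (fst i))"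
   have w1: "w (i, l) = x (i, l)" if "i \<in> {1..N}" "l \<in> {1..k}" for i l
    using that by (auto simp: w_def merge_def)
   have w2: "w (i, Suc k) = z i" if "i \<in> {1..N}" for i
    using that by (auto simp: w_def merge_def)
   have o1: "ordered N (\<lambda>i. w (i,l)) = ordered N (\<lambda>i. x (i,l))" if "l \<in> {1..k}" for l
    using that by (auto simp: ordered_def w1)
   have o2: "ordered N (\<lambda>i. w (i,Suc k)) = ordered N z"
    by (auto simp: ordered_def w2)
   have all: "(\<forall>l\<in>{1..Suc k}. ordered N (\<lambda>i. w (i,l)) \<and> (\<forall>i\<in>{1..N}. w (i,l) \<in> A l)) \<longleftrightarrow>
    (\<forall>l\<in>{1..k}. ordered N (\<lambda>i. x (i,l)) \<and> (\<forall>i\<in>{1..N}. x (i,l) \<in> A l)) \<and>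
    (ordered N z \<and> (\<forall>i\<in>{1..N}. z i \<in> A (Suc k)))"
    by (simp add: atLeastAtMostSuc_conv o1 o2 w1 w2 conj_commute)
   have d1: "detS {1..N} (\<lambda>i j. \<phi> i (w (j,1))) = detS {1..N} (\<lambda>i j. \<phi> i (x (j,1)))"
    using step.hyps by (intro detS_cong) (simp add: w1)
   have d2: "detS {1..N} (\<lambda>i j. K l (w (i,l)) (w (j, Suc l))) = detS {1..N} (\<lambda>i j. K l (x (i,l)) (x (j, Suc l)))"
    if "l \<in> {1..<k}" for l
    using that by (intro detS_cong) (simp add: w1)
   have d3: "detS {1..N} (\<lambda>i j. K k (w (i,k)) (w (j, Suc k))) = detS {1..N} (\<lambda>i j. K k (x (i,k)) (z j))"
    using step.hyps by (intro detS_cong) (simp add: w1 w2)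
   have d4: "detS {1..N} (\<lambda>i j. \<psi> i (w (j, Suc k))) = detS {1..N} (\<lambda>i j. \<psi> i (z j))"
    by (intro detS_cong) (simp add: w2)
   have "(\<Prod>l\<in>{1..<Suc k}. detS {1..N} (\<lambda>i j. K l (w (i,l)) (w (j, Suc l)))) =
    (\<Prod>l\<in>{1..<k}. detS {1..N} (\<lambda>i j. K l (x (i,l)) (x (j, Suc l)))) * detS {1..N} (\<lambda>i j. K k (x (i,k)) (z j))"
    using step.hyps by (simp add: d2 d3)
   then have "levels N (Suc k) A \<phi> K \<psi> w = ?c * (if ordered N z \<and> (\<forall>i\<in>{1..N}. z i \<in> A (Suc k))
    then detS {1..N} (\<lambda>i j. K k (x (i,k)) (z j)) * detS {1..N} (\<lambda>i j. \<psi> i (z j)) else 0)"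
    unfolding levels_def all d1 d4 by (simp add: mult_ac)
   then show ?thesis unfolding w_def .
  qed
  have "(\<integral>y. ?F (merge ?I ?J (x, y)) \<partial>PiM ?J (\<lambda>_. lborel)) =
   (\<integral>z. ?F (merge ?I ?J (x, \<lambda>i\<in>?J. z (fst i))) \<partial>PiM {1..N} (\<lambda>_. lborel))"
   using integral_PiM_lborel_reindex(1)[OF bij _ m] by simp
  also have "\<dots> = ?c * detS {1..N} (\<lambda>i j. LBINT y. K k (x (i,k)) y * (indicator (A (Suc k)) y * \<psi> j y))"
   unfolding split integral_mult_right_zero
   by (subst andreief_restricted) (use step.hyps in \<open>auto intro!: step.prems Gm mK A\<close>)
  \<comment> \<open>Andreief produces the particle index first, while \<open>levels\<close> expects
    the weight index first; hence the transposition.\<close>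
  also have "detS {1..N} (\<lambda>i j. LBINT y. K k (x (i,k)) y * (indicator (A (Suc k)) y * \<psi> j y))
   = detS {1..N} (\<lambda>i j. \<psi>' i (x (j,k)))"
   by (subst detS_transpose[symmetric]) (simp_all only: \<psi>'_def chain_1 finite_atLeastAtMost)
  also have "?c * \<dots> = levels N k A \<phi> K \<psi>' x" by (simp add: levels_def)
  finally show ?thesis .
 qed
 have "integrable (PiM ?I (\<lambda>_. lborel)) (\<lambda>x. \<integral>y. ?F (merge ?I ?J (x, y)) \<partial>PiM ?J (\<lambda>_. lborel))"
  using P.integrable_fst'[OF intM] .
 then have int': "integrable (PiM ?I (\<lambda>_. lborel)) (levels N k A \<phi> K \<psi>')"
  by (subst (asm) integrable_cong[OF refl inner]) auto
 have "(\<integral>x. ?F x \<partial>PiM ({1..N}\<times>{1..Suc k}) (\<lambda>_. lborel)) = (\<integral>x. (\<integral>y. ?F (merge ?I ?J (x, y)) \<partial>PiM ?J (\<lambda>_. lborel)) \<partial>PiM ?I (\<lambda>_. lborel))"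
  unfolding un by (rule product_integral_fold[OF IJ intF])
 also have "\<dots> = (\<integral>x. levels N k A \<phi> K \<psi>' x \<partial>PiM ?I (\<lambda>_. lborel))"
  by (intro integral_cong refl inner)
 also have "\<dots> = detS {1..N} (\<lambda>i j. LBINT x. \<phi> i x * (indicator (A 1) x * chain K A 1 (k - 1) (\<psi>' j) x))"
 proof (intro step.IH int')
  show "G (\<psi>' i)" if "i \<in> {1..N}" for i
   unfolding \<psi>'_def using step.prems(2)[of "\<psi> i" k] step.prems(3) that step.hyps by simp
 qed (use step.prems(1,2) in \<open>auto simp del: chain.simps\<close>)
 also have "\<dots> = detS {1..N} (\<lambda>i j. LBINT x. \<phi> i x * (indicator (A 1) x * chain K A 1 (Suc k - 1) (\<psi> j) x))"
 proof -
  have "chain K A 1 (k - 1) (\<psi>' j) = chain K A 1 (Suc k - 1) (\<psi> j)" for j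
   using chain_snoc[of K A 1 "k - 1" "\<psi> j"] step.hyps by (simp add: \<psi>'_def del: chain.simps)
  then show ?thesis by (simp only:)
 qed
 finally show ?case .
qed

section \<open>Heat kernels, their exponential moments, and functions of exponential growth\<close>

lemma heat_eq: "0 < D * t ==> heat D t x y = 1 / sqrt (2 * pi * (D * t)) * exp (-(y - x)\<^sup>2 / (2 * (D * t)))"
 by (simp add: heat_def normal_density_def)

lemma heat_nonneg[simp]: "0 \<le> heat D t x y"
 by (simp add: heat_def)

lemma heat_pos: "0 < D * t ==> 0 < heat D t x y"
 by (simp add: heat_def normal_density_pos)

lemma measurable_heat[measurable (raw)]:
 assumes [measurable]: "f \<in> borel_measurable M" "g \<in> borel_measurable M"
 shows "(\<lambda>w. heat D t (f w) (g w)) \<in> borel_measurable M"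
 unfolding heat_def normal_density_def by measurable

lemma heat_sym: "heat D t x y = heat D t y x"
 by (simp add: heat_def normal_density_def power2_commute)

lemma heat_shift: "heat D t (x + a) (y + a) = heat D t x y"
 by (simp add: heat_def normal_density_def)

lemma heat_reflect: "heat D t (- x) (- y) = heat D t x y"
 by (simp add: heat_def normal_density_def power2_commute[of y])

lemma integrable_heat: "0 < D * t ==> integrable lborel (heat D t x)"
 unfolding heat_def[abs_def] by (intro integrable_normal_density) simp

lemma integral_heat: "0 < D * t ==> (LBINT y. heat D t x y) = 1"
 unfolding heat_def by (intro integral_normal_density) simp

text \<open>Completing the square: an exponential tilt moves the mean of a Gaussian by
  \<open>a * (D * t)\<close>.\<close>

lemma heat_mult_exp:
 assumes "0 < D * t"
 shows "heat D t x y * exp (a * y) = exp (a * x + D * t * a\<^sup>2 / 2) * heat D t (x + a * (D * t)) y"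
proof -
 define c where "c = D * t"
 have c: "c > 0" using assms by (simp add: c_def)
 have "-(y - x)\<^sup>2 / (2 * c) + a * y = (a * x + c * a\<^sup>2 / 2) + -(y - (x + a * c))\<^sup>2 / (2 * c)"
  using c by (simp add: field_simps power2_eq_square)
 then show ?thesis
  using assms by (simp add: heat_eq c_def[symmetric] exp_add[symmetric])
qed

lemma integrable_heat_exp: "0 < D * t ==> integrable lborel (\<lambda>y. heat D t x y * exp (a * y))"
 by (simp add: heat_mult_exp integrable_heat)

lemma integral_heat_exp: "0 < D * t ==> (LBINT y. heat D t x y * exp (a * y)) = exp (a * x + D * t * a\<^sup>2 / 2)"
 by (simp add: heat_mult_exp integral_heat)

lemma integrable_heat_cosh:
 assumes "0 < D * t" shows "integrable lborel (\<lambda>y. heat D t x y * cosh (\<kappa> * y))"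
proof -
 have "integrable lborel (\<lambda>y. (heat D t x y * exp (\<kappa> * y) + heat D t x y * exp ((-\<kappa>) * y)) / 2)"
  using integrable_heat_exp[OF assms, of x \<kappa>] integrable_heat_exp[OF assms, of x "-\<kappa>"]
  by (intro integrable_divide integrable_add) auto
 then show ?thesis by (simp add: cosh_def algebra_simps add_divide_distrib)
qed

lemma integral_heat_cosh:
 assumes "0 < D * t" shows "(LBINT y. heat D t x y * cosh (\<kappa> * y)) = exp (D * t * \<kappa>\<^sup>2 / 2) * cosh (\<kappa> * x)"
proof -
 have "(LBINT y. heat D t x y * cosh (\<kappa> * y)) =
  (LBINT y. (heat D t x y * exp (\<kappa> * y) + heat D t x y * exp ((-\<kappa>) * y)) / 2)"
  by (intro integral_cong refl) (simp add: cosh_def algebra_simps add_divide_distrib)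
 also have "\<dots> = (exp (\<kappa> * x + D * t * \<kappa>\<^sup>2 / 2) + exp ((-\<kappa>) * x + D * t * (-\<kappa>)\<^sup>2 / 2)) / 2"
  using integrable_heat_exp[OF assms, of x \<kappa>] integrable_heat_exp[OF assms, of x "-\<kappa>"]
   integral_heat_exp[OF assms, of x \<kappa>] integral_heat_exp[OF assms, of x "-\<kappa>"]
  by (simp only: integral_divide_zero integral_add)
 also have "\<dots> = exp (D * t * \<kappa>\<^sup>2 / 2) * cosh (\<kappa> * x)"
  by (simp add: cosh_def algebra_simps add_divide_distrib flip: exp_add)
 finally show ?thesis .
qed

text \<open>An affine substitution reduces this to the characteristic function of the standard
  normal distribution.\<close>

lemma integral_heat_iexp:
 assumes "0 < D * t"
 shows "(LBINT y. of_real (heat D t x y) * exp (\<i> * of_real (b * y))) = exp (\<i> * of_real (b * x) - of_real (D * t * b\<^sup>2 / 2))"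
proof -
 define \<sigma> where "\<sigma> = sqrt (D * t)"
 have \<sigma>: "\<sigma> > 0" "\<sigma>\<^sup>2 = D * t" using assms by (auto simp: \<sigma>_def)
 have "(LBINT y. of_real (heat D t x y) * exp (\<i> * of_real (b * y))) =
  \<bar>\<sigma>\<bar> *\<^sub>R (LBINT z. of_real (heat D t x (x + \<sigma> * z)) * exp (\<i> * of_real (b * (x + \<sigma> * z))))"
  using \<sigma> by (intro lborel_integral_real_affine) auto
 also have "\<dots> = (LBINT z. \<sigma> *\<^sub>R (of_real (heat D t x (x + \<sigma> * z)) * exp (\<i> * of_real (b * (x + \<sigma> * z)))))"
  using \<sigma>(1) by (subst integral_scaleR_right) simp
 also have "\<dots> = (LBINT z. exp (\<i> * of_real (b * x)) * (std_normal_density z *\<^sub>R iexp ((b * \<sigma>) * z)))"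
 proof (intro integral_cong refl)
  fix z
  have "\<sigma> * heat D t x (x + \<sigma> * z) = std_normal_density z"
   unfolding heat_def normal_density_def \<sigma>_def[symmetric]
   using \<sigma>(1) by (simp add: real_sqrt_mult power_mult_distrib)
  then have 1: "complex_of_real (std_normal_density z) = of_real \<sigma> * of_real (heat D t x (x + \<sigma> * z))"
   by (simp only: of_real_mult[symmetric])
  have "\<i> * complex_of_real (b * (x + \<sigma> * z)) = \<i> * of_real (b * x) + \<i> * of_real ((b * \<sigma>) * z)"
   by (simp add: algebra_simps)
  then have 2: "exp (\<i> * complex_of_real (b * (x + \<sigma> * z))) = exp (\<i> * of_real (b * x)) * iexp ((b * \<sigma>) * z)"
   by (simp only: exp_add)
  show "\<sigma> *\<^sub>R (of_real (heat D t x (x + \<sigma> * z)) * exp (\<i> * of_real (b * (x + \<sigma> * z)))) =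
   exp (\<i> * of_real (b * x)) * (std_normal_density z *\<^sub>R iexp ((b * \<sigma>) * z))"
   unfolding scaleR_conv_of_real 1 2 by (simp only: mult_ac)
 qed
 also have "\<dots> = exp (\<i> * of_real (b * x)) * (LBINT z. std_normal_density z *\<^sub>R iexp ((b * \<sigma>) * z))"
  by (rule integral_mult_right_zero)
 also have "(LBINT z. std_normal_density z *\<^sub>R iexp ((b * \<sigma>) * z)) = char std_normal_distribution (b * \<sigma>)"
  unfolding char_def by (subst integral_density) auto
 also have "\<dots> = exp (- of_real (D * t * b\<^sup>2 / 2))"
 proof -
  have "(b * \<sigma>)\<^sup>2 = D * t * b\<^sup>2" by (simp add: power_mult_distrib \<sigma>)
  then have "char std_normal_distribution (b * \<sigma>) = of_real (exp (- (D * t * b\<^sup>2 / 2)))"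
   by (simp add: char_std_normal_distribution)
  then show ?thesis by (simp only: exp_of_real[symmetric] of_real_minus)
 qed
 finally show ?thesis by (simp only: exp_add[symmetric] uminus_add_conv_diff add_uminus_conv_diff)
qed

text \<open>The real part of \<open>w\<close> is a tilt that shifts the mean, the imaginary part is
  then a Fourier transform. All contour computations below reduce to this formula.\<close>

lemma heat_exp_complex:
 fixes w :: complex
 assumes "0 < D * t"
 shows integrable_heat_cexp: "integrable lborel (\<lambda>y. of_real (heat D t x y) * exp (w * of_real y))"
  and integral_heat_cexp: "(LBINT y. of_real (heat D t x y) * exp (w * of_real y)) = exp (w * of_real x + of_real (D * t) * w\<^sup>2 / 2)"
proof -
 show "integrable lborel (\<lambda>y. of_real (heat D t x y) * exp (w * of_real y))"
  by (rule integrable_bound[OF integrable_heat_exp[OF assms, of x "Re w"]]) (auto simp: norm_mult)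
 define a b where "a = Re w" "b = Im w"
 have w: "w = of_real a + \<i> * of_real b" by (simp add: a_b_def complex_eq_iff)
 have "of_real (heat D t x y) * exp (w * of_real y) =
  of_real (exp (a * x + D * t * a\<^sup>2 / 2)) * (of_real (heat D t (x + a * (D * t)) y) * exp (\<i> * of_real (b * y)))" for y
 proof -
  have "of_real (heat D t x y) * exp (w * of_real y) = of_real (heat D t x y * exp (a * y)) * exp (\<i> * of_real (b * y))"
  proof -
   have "w * of_real y = of_real (a * y) + \<i> * of_real (b * y)" by (simp add: w algebra_simps)
   then show ?thesis by (simp only: exp_add exp_of_real of_real_mult[of "heat D t x y"] mult.assoc)
  qed
  then show ?thesis using heat_mult_exp[OF assms, of x y a] by simp
 qed
 then have "(LBINT y. of_real (heat D t x y) * exp (w * of_real y)) =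
  of_real (exp (a * x + D * t * a\<^sup>2 / 2)) * exp (\<i> * of_real (b * (x + a * (D * t))) - of_real (D * t * b\<^sup>2 / 2))"
  by (simp only: integral_mult_right_zero integral_heat_iexp[OF assms])
 also have "\<dots> = exp (of_real (a * x + D * t * a\<^sup>2 / 2) + (\<i> * of_real (b * (x + a * (D * t))) - of_real (D * t * b\<^sup>2 / 2)))"
  by (simp only: exp_add exp_of_real)
 also have "of_real (a * x + D * t * a\<^sup>2 / 2) + (\<i> * of_real (b * (x + a * (D * t))) - of_real (D * t * b\<^sup>2 / 2)) = w * of_real x + of_real (D * t) * w\<^sup>2 / 2"
  unfolding w by (simp add: complex_eq_iff power2_eq_square algebra_simps add_divide_distrib diff_divide_distrib)
 finally show "(LBINT y. of_real (heat D t x y) * exp (w * of_real y)) = exp (w * of_real x + of_real (D * t) * w\<^sup>2 / 2)" .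
qed

text \<open>The joint density of an intermediate and a final position is the end-to-end kernel times
  the density of the Brownian bridge at the intermediate time, which has variance
  \<open>D * (s * t / (s + t))\<close>.\<close>

lemma heat_product:
 assumes "0 < D" "0 < s" "0 < t"
 shows "heat D s x y * heat D t y z = heat D (s + t) x z * heat D (s * t / (s + t)) ((t * x + s * z) / (s + t)) y"
proof -
 have st: "s + t \<noteq> 0" "s + t > 0" using assms by auto
 have sq: "sqrt (2 * pi * (D * s)) * sqrt (2 * pi * (D * t)) = sqrt (2 * pi * (D * (s + t))) * sqrt (2 * pi * (D * (s * t / (s + t))))"
  using assms by (simp add: real_sqrt_mult[symmetric] field_simps)
 have ex: "-(y - x)\<^sup>2 / (2 * (D * s)) + -(z - y)\<^sup>2 / (2 * (D * t)) =
  -(z - x)\<^sup>2 / (2 * (D * (s + t))) + -(y - (t * x + s * z) / (s + t))\<^sup>2 / (2 * (D * (s * t / (s + t))))"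
 proof -
  define p where "p = (t * x + s * z) / (s + t)"
  have p: "t * x = p * (s + t) - s * z" using st by (simp add: p_def)
  have "(t * (y - x)\<^sup>2 + s * (z - y)\<^sup>2) * (s + t) = s * t * (z - x)\<^sup>2 + (s + t)\<^sup>2 * (y - p)\<^sup>2"
  proof -
   have "(s + t) * (y - p) = (s + t) * y - t * x - s * z" using p by (simp add: algebra_simps)
   then have "(s + t)\<^sup>2 * (y - p)\<^sup>2 = ((s + t) * y - t * x - s * z)\<^sup>2" by (metis power_mult_distrib)
   then show ?thesis by (simp add: power2_eq_square algebra_simps)
  qed
  moreover have "- X / (2 * (D * s)) + - Y / (2 * (D * t)) = - ((t * X + s * Y) * (s + t)) / (2 * D * s * t * (s + t))" for X Y
   using assms st by (simp add: divide_simps; simp add: algebra_simps)?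
  moreover have "- (s * t * X + (s + t)\<^sup>2 * Y) / (2 * D * s * t * (s + t)) = - X / (2 * (D * (s + t))) + - Y / (2 * (D * (s * t / (s + t))))" for X Y
   using assms st by (simp add: divide_simps) (simp add: algebra_simps power2_eq_square)
  ultimately show ?thesis unfolding p_def by (simp only: minus_divide_left[symmetric])
 qed
 have pos: "0 < D * s" "0 < D * t" "0 < D * (s + t)" "0 < D * (s * t / (s + t))" using assms by auto
 have "heat D s x y * heat D t y z = 1 / (sqrt (2 * pi * (D * s)) * sqrt (2 * pi * (D * t))) *
   exp (-(y - x)\<^sup>2 / (2 * (D * s)) + -(z - y)\<^sup>2 / (2 * (D * t)))"
  unfolding heat_eq[OF pos(1)] heat_eq[OF pos(2)] exp_add by simp
 also have "\<dots> = heat D (s + t) x z * heat D (s * t / (s + t)) ((t * x + s * z) / (s + t)) y"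
  unfolding heat_eq[OF pos(3)] heat_eq[OF pos(4)] sq ex exp_add by simp
 finally show ?thesis .
qed

lemma heat_ck:
 assumes "0 < D" "0 < s" "0 < t"
 shows "(LBINT y. heat D s x y * heat D t y z) = heat D (s + t) x z"
  and "integrable lborel (\<lambda>y. heat D s x y * heat D t y z)"
 using assms by (simp_all add: heat_product integral_heat integrable_heat)

text \<open>The heat flow multiplies \<open>cosh (\<kappa> * x)\<close> by
  \<open>exp (D * t * \<kappa>\<^sup>2 / 2)\<close>. The class with fixed \<open>\<kappa>\<close> is
  therefore stable, with constants that multiply along a semigroup and stay bounded under mesh
  refinement.\<close>

definition bnd :: "real => real => (real => real) => bool" where
 "bnd \<kappa> C g \<longleftrightarrow> g \<in> borel_measurable borel \<and> (\<forall>x. \<bar>g x\<bar> \<le> C * cosh (\<kappa> * x))"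

definition heat_op :: "real => real => (real => real) => real => real" where
 "heat_op D t g x = (LBINT y. heat D t x y * g y)"

lemma bndD: "bnd \<kappa> C g ==> \<bar>g x\<bar> \<le> C * cosh (\<kappa> * x)"
 and bnd_measurable: "bnd \<kappa> C g ==> g \<in> borel_measurable borel"
 by (auto simp: bnd_def)

lemma bnd_const_nonneg: "bnd \<kappa> C g ==> 0 \<le> C"
 using bndD[of \<kappa> C g 0] by (auto dest: order_trans[OF abs_ge_zero])

lemma bnd_mono: "bnd \<kappa> C g ==> C \<le> C' ==> bnd \<kappa> C' g"
 unfolding bnd_def by (auto intro: order_trans[OF _ mult_right_mono])

lemma bnd_dominated: "bnd \<kappa> C g ==> f \<in> borel_measurable borel ==> (\<And>x. \<bar>f x\<bar> \<le> \<bar>g x\<bar>) ==> bnd \<kappa> C f"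
 unfolding bnd_def by (auto intro: order_trans)

lemma bnd_indicator_mult: "bnd \<kappa> C g ==> A \<in> sets borel ==> bnd \<kappa> C (\<lambda>y. indicator A y * g y)"
 by (rule bnd_dominated) (auto simp: bnd_def indicator_def)

lemma bnd_add: "bnd \<kappa> C f ==> bnd \<kappa> C' g ==> bnd \<kappa> (C + C') (\<lambda>x. f x + g x)"
 unfolding bnd_def by (auto simp: algebra_simps intro: order_trans[OF abs_triangle_ineq] add_mono)

lemma bnd_uminus: "bnd \<kappa> C f ==> bnd \<kappa> C (\<lambda>x. - f x)"
 unfolding bnd_def by auto

lemma bnd_diff: "bnd \<kappa> C f ==> bnd \<kappa> C' g ==> bnd \<kappa> (C + C') (\<lambda>x. f x - g x)"
 using bnd_add[of \<kappa> C f C' "\<lambda>x. - g x"] by (simp add: bnd_uminus)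

lemma bnd_reflect: "bnd \<kappa> C f ==> bnd \<kappa> C (\<lambda>x. f (- x))"
 unfolding bnd_def by (auto dest: spec[of _ "- _"])

lemma bnd_integrable:
 assumes "0 < D * t" "bnd \<kappa> C g"
 shows "integrable lborel (\<lambda>y. heat D t x y * g y)"
proof (rule integrable_bound)
 show "integrable lborel (\<lambda>y. C * (heat D t x y * cosh (\<kappa> * y)))"
  using integrable_heat_cosh[OF assms(1)] by simp
 show "(\<lambda>y. heat D t x y * g y) \<in> borel_measurable lborel"
  using bnd_measurable[OF assms(2)] by measurable
 show "AE y in lborel. norm (heat D t x y * g y) \<le> norm (C * (heat D t x y * cosh (\<kappa> * y)))"
  using bndD[OF assms(2)] bnd_const_nonneg[OF assms(2)]
  by (auto simp: abs_mult mult.left_commute[of C] intro!: mult_left_mono)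
qed

lemma bnd_heat_op:
 assumes "0 < D * t" "bnd \<kappa> C g"
 shows "bnd \<kappa> (C * exp (D * t * \<kappa>\<^sup>2 / 2)) (heat_op D t g)"
 unfolding bnd_def
proof (intro conjI allI)
 have [measurable]: "g \<in> borel_measurable borel" using assms(2) by (rule bnd_measurable)
 show "heat_op D t g \<in> borel_measurable borel"
  unfolding heat_op_def[abs_def] by measurable
 fix x
 have "\<bar>heat_op D t g x\<bar> \<le> (LBINT y. \<bar>heat D t x y * g y\<bar>)"
  unfolding heat_op_def using integral_norm_bound[of lborel "\<lambda>y. heat D t x y * g y"] by simp
 also have "\<dots> \<le> (LBINT y. C * (heat D t x y * cosh (\<kappa> * y)))"
  using bndD[OF assms(2)] integrable_abs[OF bnd_integrable[OF assms]] integrable_mult_right[OF integrable_heat_cosh[OF assms(1)], of C]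
  by (intro integral_mono) (auto simp: abs_mult mult.left_commute[of C] intro!: mult_left_mono)
 also have "\<dots> = C * exp (D * t * \<kappa>\<^sup>2 / 2) * cosh (\<kappa> * x)"
  using integral_heat_cosh[OF assms(1)] by simp
 finally show "\<bar>heat_op D t g x\<bar> \<le> C * exp (D * t * \<kappa>\<^sup>2 / 2) * cosh (\<kappa> * x)" .
qed

text \<open>Fubini and the symmetry of the kernel. \<open>F\<close> has to be integrable against
  \<open>cosh (\<kappa> * u)\<close>, which compensates the growth of \<open>g\<close>.\<close>

lemma heat_op_dual:
 assumes Dt: "0 < D * t" and g: "bnd \<kappa> C g" and F[measurable]: "F \<in> borel_measurable borel"
  and int: "integrable lborel (\<lambda>u. \<bar>F u\<bar> * cosh (\<kappa> * u))"
 shows "(LBINT u. F u * heat_op D t g u) = (LBINT v. heat_op D t F v * g v)"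
  and "integrable lborel (\<lambda>v. heat_op D t F v * g v)"
  and "integrable lborel (\<lambda>u. F u * heat_op D t g u)"
proof -
 have [measurable]: "g \<in> borel_measurable borel" using g by (rule bnd_measurable)
 have ga: "bnd \<kappa> C (\<lambda>x. \<bar>g x\<bar>)" using g by (auto simp: bnd_def)
 let ?f = "\<lambda>(u, v). F u * (heat D t u v * g v)"
 have I: "integrable (lborel \<Otimes>\<^sub>M lborel) ?f"
 proof (rule lborel_pair.Fubini_integrable)
  show "?f \<in> borel_measurable (lborel \<Otimes>\<^sub>M lborel)" by measurable
  have eq: "(LBINT v. norm (?f (u, v))) = \<bar>F u\<bar> * heat_op D t (\<lambda>x. \<bar>g x\<bar>) u" for u
   by (simp add: heat_op_def abs_mult)
  have [measurable]: "heat_op D t (\<lambda>x. \<bar>g x\<bar>) \<in> borel_measurable borel"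
   using bnd_measurable[OF bnd_heat_op[OF Dt ga]] .
  show "integrable lborel (\<lambda>u. LBINT v. norm (?f (u, v)))"
   unfolding eq
  proof (rule integrable_bound)
   show "integrable lborel (\<lambda>u. (C * exp (D * t * \<kappa>\<^sup>2 / 2)) * (\<bar>F u\<bar> * cosh (\<kappa> * u)))"
    using int by simp
   show "AE u in lborel. norm (\<bar>F u\<bar> * heat_op D t (\<lambda>x. \<bar>g x\<bar>) u) \<le> norm ((C * exp (D * t * \<kappa>\<^sup>2 / 2)) * (\<bar>F u\<bar> * cosh (\<kappa> * u)))"
   proof (rule AE_I2)
    fix u
    have "\<bar>F u\<bar> * \<bar>heat_op D t (\<lambda>x. \<bar>g x\<bar>) u\<bar> \<le> \<bar>F u\<bar> * (C * exp (D * t * \<kappa>\<^sup>2 / 2) * cosh (\<kappa> * u))"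
     by (intro mult_left_mono bndD[OF bnd_heat_op[OF Dt ga]]) simp
    then show "norm (\<bar>F u\<bar> * heat_op D t (\<lambda>x. \<bar>g x\<bar>) u) \<le> norm ((C * exp (D * t * \<kappa>\<^sup>2 / 2)) * (\<bar>F u\<bar> * cosh (\<kappa> * u)))"
     using bnd_const_nonneg[OF g] by (simp add: abs_mult mult_ac)
   qed
  qed measurable
  show "AE u in lborel. integrable lborel (\<lambda>v. ?f (u, v))"
   using bnd_integrable[OF Dt g] by simp
 qed
 have I': "integrable (lborel \<Otimes>\<^sub>M lborel) (case_prod (\<lambda>u v. F u * (heat D t u v * g v)))" using I .
 have "(LBINT u. F u * heat_op D t g u) = (LBINT u. (LBINT v. F u * (heat D t u v * g v)))"
  by (simp add: heat_op_def)
 also have "\<dots> = (LBINT v. (LBINT u. F u * (heat D t u v * g v)))"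
  using lborel_pair.Fubini_integral[OF I'] by simp
 finally have eq1: "(LBINT u. F u * heat_op D t g u) = (LBINT v. (LBINT u. F u * (heat D t u v * g v)))" .
 have eq2: "(LBINT u. F u * (heat D t u v * g v)) = heat_op D t F v * g v" for v
 proof -
  have "(LBINT u. F u * (heat D t u v * g v)) = (LBINT u. (heat D t v u * F u) * g v)"
   by (intro integral_cong refl) (simp add: heat_sym[of D t v] mult_ac)
  then show ?thesis by (simp add: heat_op_def)
 qed
 show "(LBINT u. F u * heat_op D t g u) = (LBINT v. heat_op D t F v * g v)" by (simp only: eq1 eq2)
 show "integrable lborel (\<lambda>v. heat_op D t F v * g v)"
  using lborel_pair.integrable_snd[OF I'] by (simp add: eq2)
 show "integrable lborel (\<lambda>u. F u * heat_op D t g u)"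
  using lborel_pair.integrable_fst[OF I'] by (simp add: heat_op_def)
qed

lemma heat_op_semigroup:
 assumes D: "0 < D" "0 < s" "0 < t" and g: "bnd \<kappa> C g"
 shows "heat_op D s (heat_op D t g) x = heat_op D (s + t) g x"
proof -
 have "heat_op D s (heat_op D t g) x = (LBINT u. heat D s x u * heat_op D t g u)"
  by (simp add: heat_op_def)
 also have "\<dots> = (LBINT v. heat_op D t (heat D s x) v * g v)"
  using D integrable_heat_cosh[of D s x \<kappa>] by (intro heat_op_dual[OF _ g]) auto
 also have "\<dots> = (LBINT v. heat D (s + t) x v * g v)"
 proof -
  have "heat_op D t (heat D s x) v = heat D (s + t) x v" for v
   using heat_ck(1)[OF D, of x v] unfolding heat_op_def by (simp add: heat_sym[of D t v] mult.commute)
  then show ?thesis by simp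
 qed
 finally show ?thesis by (simp add: heat_op_def)
qed

lemma heat_op_mono:
 assumes "0 < D * t" "bnd \<kappa> C f" "bnd \<kappa> C' g" "\<And>x. f x \<le> g x"
 shows "heat_op D t f x \<le> heat_op D t g x"
 unfolding heat_op_def using assms bnd_integrable
 by (intro integral_mono bnd_integrable mult_left_mono) auto

lemma heat_op_nonneg: "(\<And>x. 0 \<le> g x) ==> 0 \<le> heat_op D t g x"
 unfolding heat_op_def by (intro integral_nonneg_AE) auto

lemma heat_op_diff:
 assumes "0 < D * t" "bnd \<kappa> C f" "bnd \<kappa> C' g"
 shows "heat_op D t (\<lambda>x. f x - g x) x = heat_op D t f x - heat_op D t g x"
 unfolding heat_op_def using bnd_integrable[OF assms(1,2)] bnd_integrable[OF assms(1,3)]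
 by (simp add: right_diff_distrib)

lemma heat_op_cmult: "heat_op D t (\<lambda>x. c * g x) x = c * heat_op D t g x"
 unfolding heat_op_def by (simp add: mult.left_commute)

lemma heat_op_reflect: "heat_op D t (\<lambda>x. g (- x)) x = heat_op D t g (- x)"
proof -
 have "heat_op D t (\<lambda>x. g (- x)) x = (LBINT y. heat D t x (- y) * g (- (- y)))"
  unfolding heat_op_def
  using lborel_integral_real_affine[of "-1" "\<lambda>y. heat D t x y * g (- y)" 0] by simp
 also have "\<dots> = heat_op D t g (- x)"
  unfolding heat_op_def using heat_reflect[of D t "- x"] by (intro integral_cong refl) simp
 finally show ?thesis .
qed

lemma heat_op_tendsto:
 assumes Dt: "0 < D * t" and g: "\<And>n. bnd \<kappa> C (g n)" and lim: "\<And>x. (\<lambda>n. g n x) \<longlonglongrightarrow> g' x"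
 shows "(\<lambda>n. heat_op D t (g n) x) \<longlonglongrightarrow> heat_op D t g' x"
 unfolding heat_op_def
proof (rule integral_dominated_convergence)
 show "integrable lborel (\<lambda>y. C * (heat D t x y * cosh (\<kappa> * y)))"
  using integrable_heat_cosh[OF Dt] by simp
 have [measurable]: "g n \<in> borel_measurable borel" for n using g by (rule bnd_measurable)
 show "(\<lambda>y. heat D t x y * g n y) \<in> borel_measurable lborel" for n by measurable
 have "g' \<in> borel_measurable borel" by (rule borel_measurable_LIMSEQ_real[OF lim]) measurable
 then show "(\<lambda>y. heat D t x y * g' y) \<in> borel_measurable lborel" by measurable
 show "AE y in lborel. (\<lambda>n. heat D t x y * g n y) \<longlonglongrightarrow> heat D t x y * g' y"
  using lim by (auto intro!: tendsto_mult)
 show "AE y in lborel. norm (heat D t x y * g n y) \<le> C * (heat D t x y * cosh (\<kappa> * y))" for n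
  using bndD[OF g] by (auto simp: abs_mult mult.left_commute[of C] intro!: mult_left_mono)
qed

lemma bnd_lim:
 assumes g: "\<And>n. bnd \<kappa> C (g n)" and lim: "\<And>x. (\<lambda>n. g n x) \<longlonglongrightarrow> g' x"
 shows "bnd \<kappa> C g'"
 unfolding bnd_def
proof (intro conjI allI)
 have [measurable]: "g n \<in> borel_measurable borel" for n using g by (rule bnd_measurable)
 show "g' \<in> borel_measurable borel" by (rule borel_measurable_LIMSEQ_real[OF lim]) measurable
 show "\<bar>g' x\<bar> \<le> C * cosh (\<kappa> * x)" for x
  by (rule LIMSEQ_le_const2[OF tendsto_rabs[OF lim]]) (use bndD[OF g] in auto)
qed

section \<open>Chains of heat kernels with barriers tested at mesh times\<close>

abbreviation hchain :: "real => (nat => real) => (nat => real set) => nat => nat => (real => real) => real => real" where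
 "hchain D s A l m g \<equiv> chain (\<lambda>l. heat D (s (Suc l) - s l)) A l m g"

lemma hchain_Suc: "hchain D s A l (Suc m) g = heat_op D (s (Suc l) - s l) (\<lambda>y. indicator (A (Suc l)) y * hchain D s A (Suc l) m g y)"
 by (simp add: heat_op_def fun_eq_iff)

definition incr :: "(nat => real) => nat => nat => bool" where
 "incr s l m \<longleftrightarrow> (\<forall>j. l \<le> j \<and> j < l + m \<longrightarrow> s j < s (Suc j))"

definition bsets :: "(nat => real set) => bool" where
 "bsets A \<longleftrightarrow> (\<forall>j. A j \<in> sets borel)"

lemma incr_Suc: "incr s l (Suc m) ==> incr s (Suc l) m"
 and incr_first: "incr s l (Suc m) ==> s l < s (Suc l)"
 by (auto simp: incr_def)

lemma incr_less: "incr s l m ==> 0 < m ==> s l < s (l + m)"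
proof (induction m arbitrary: l)
 case (Suc m)
 then show ?case using incr_first[OF Suc.prems(1)] Suc.IH[OF incr_Suc[OF Suc.prems(1)]]
  by (cases m) auto
qed simp

lemma bsetsD: "bsets A ==> A j \<in> sets borel"
 by (simp add: bsets_def)

text \<open>Indicators do not increase the bound, and the exponential factors of the single steps
  multiply to one that depends only on the elapsed time. This makes it uniform over all
  meshes.\<close>

lemma bnd_hchain:
 assumes "0 < D" "incr s l m" "bsets A" "bnd \<kappa> C g"
 shows "bnd \<kappa> (C * exp (D * (s (l + m) - s l) * \<kappa>\<^sup>2 / 2)) (hchain D s A l m g)"
 using assms(2)
proof (induction m arbitrary: l)
 case 0
 then show ?case using assms by simp
next
 case (Suc m)
 have st: "s l < s (Suc l)" using Suc.prems by (rule incr_first)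
 have "bnd \<kappa> (C * exp (D * (s (Suc l + m) - s (Suc l)) * \<kappa>\<^sup>2 / 2)) (hchain D s A (Suc l) m g)"
  by (rule Suc.IH) (rule incr_Suc[OF Suc.prems])
 from bnd_heat_op[OF _ bnd_indicator_mult[OF this bsetsD[OF assms(3), of "Suc l"]], of D "s (Suc l) - s l"]
 have "bnd \<kappa> (C * exp (D * (s (Suc l + m) - s (Suc l)) * \<kappa>\<^sup>2 / 2) * exp (D * (s (Suc l) - s l) * \<kappa>\<^sup>2 / 2)) (hchain D s A l (Suc m) g)"
  unfolding hchain_Suc using assms(1) st by simp
 moreover have "exp (D * (s (Suc l + m) - s (Suc l)) * \<kappa>\<^sup>2 / 2) * exp (D * (s (Suc l) - s l) * \<kappa>\<^sup>2 / 2) = exp (D * (s (l + Suc m) - s l) * \<kappa>\<^sup>2 / 2)"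
  unfolding exp_add[symmetric] by (simp add: algebra_simps diff_divide_distrib add_divide_distrib[symmetric])
 ultimately show ?case by (simp only: mult.assoc)
qed

lemma hchain_cong:
 assumes "\<And>j. j < m ==> s (Suc (l + j)) - s (l + j) = s' (Suc (l' + j)) - s' (l' + j)"
  and "\<And>j. j < m ==> A (Suc (l + j)) = A' (Suc (l' + j))"
 shows "hchain D s A l m g = hchain D s' A' l' m g"
 using assms
proof (induction m arbitrary: l l')
 case (Suc m)
 have "hchain D s A (Suc l) m g = hchain D s' A' (Suc l') m g"
  by (rule Suc.IH) (use Suc.prems(1)[of "Suc _"] Suc.prems(2)[of "Suc _"] in auto)
 then show ?case using Suc.prems(1)[of 0] Suc.prems(2)[of 0] unfolding hchain_Suc by simp
qed simp

lemma hchain_nonneg: "(\<And>x. 0 \<le> g x) ==> 0 \<le> hchain D s A l m g x"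
proof (induction m arbitrary: l x)
 case (Suc m)
 then show ?case unfolding hchain_Suc by (intro heat_op_nonneg) auto
qed simp

lemma hchain_diff:
 assumes "0 < D" "incr s l m" "bsets A" "bnd \<kappa> C f" "bnd \<kappa> C' g"
 shows "hchain D s A l m (\<lambda>x. f x - g x) x = hchain D s A l m f x - hchain D s A l m g x"
 using assms(2)
proof (induction m arbitrary: l x)
 case (Suc m)
 have st: "0 < D * (s (Suc l) - s l)" using incr_first[OF Suc.prems] assms(1) by simp
 note lt = incr_Suc[OF Suc.prems]
 have "hchain D s A (Suc l) m (\<lambda>x. f x - g x) = (\<lambda>x. hchain D s A (Suc l) m f x - hchain D s A (Suc l) m g x)"
  by (rule ext, rule Suc.IH) (rule lt)
 then show ?case
  using heat_op_diff[OF st bnd_indicator_mult[OF bnd_hchain[OF assms(1) lt assms(3,4)] bsetsD[OF assms(3), of "Suc l"]]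
    bnd_indicator_mult[OF bnd_hchain[OF assms(1) lt assms(3,5)] bsetsD[OF assms(3), of "Suc l"]], of x]
  unfolding hchain_Suc by (simp only: right_diff_distrib)
qed simp

lemma hchain_cmult: "hchain D s A l m (\<lambda>x. c * g x) x = c * hchain D s A l m g x"
proof (induction m arbitrary: l x)
 case (Suc m)
 have "hchain D s A (Suc l) m (\<lambda>x. c * g x) = (\<lambda>x. c * hchain D s A (Suc l) m g x)" by (rule ext) (rule Suc.IH)
 then show ?case unfolding hchain_Suc by (simp add: mult.left_commute[of _ c] heat_op_cmult)
qed simp

lemma hchain_mono:
 assumes "0 < D" "incr s l m" "bsets A" "bsets A'"
  "\<And>j. A j \<subseteq> A' j" "bnd \<kappa> C f" "bnd \<kappa> C' g" "\<And>x. 0 \<le> g x" "\<And>x. f x \<le> g x"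
 shows "hchain D s A l m f x \<le> hchain D s A' l m g x"
 using assms(2)
proof (induction m arbitrary: l x)
 case 0 then show ?case using assms by simp
next
 case (Suc m)
 have st: "0 < D * (s (Suc l) - s l)" using incr_first[OF Suc.prems] assms(1) by simp
 note lt = incr_Suc[OF Suc.prems]
 have "indicator (A (Suc l)) y * hchain D s A (Suc l) m f y \<le> indicator (A' (Suc l)) y * hchain D s A' (Suc l) m g y" for y
  using Suc.IH[OF lt, of y] assms(5)[of "Suc l"] hchain_nonneg[of g D s A' "Suc l" m y] assms(8)
  by (auto simp: indicator_def)
 then show ?case
  unfolding hchain_Suc
  by (intro heat_op_mono[OF st bnd_indicator_mult[OF bnd_hchain[OF assms(1) lt assms(3,6)] bsetsD[OF assms(3), of "Suc l"]]
    bnd_indicator_mult[OF bnd_hchain[OF assms(1) lt assms(4,7)] bsetsD[OF assms(4), of "Suc l"]]]) simp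
qed

lemma hchain_UNIV:
 assumes "0 < D" "incr s l (Suc m)" "bnd \<kappa> C g"
 shows "hchain D s (\<lambda>_. UNIV) l (Suc m) g x = heat_op D (s (l + Suc m) - s l) g x"
 using assms(2)
proof (induction m arbitrary: l x)
 case 0
 then show ?case unfolding hchain_Suc by simp
next
 case (Suc m)
 note lt = incr_Suc[OF Suc.prems]
 have "s l < s (Suc l)" using Suc.prems by (rule incr_first)
 moreover have "s (Suc l) < s (Suc l + Suc m)" using incr_less[OF lt] by simp
 moreover have "hchain D s (\<lambda>_. UNIV) (Suc l) (Suc m) g = heat_op D (s (Suc l + Suc m) - s (Suc l)) g"
  by (rule ext, rule Suc.IH) (rule lt)
 ultimately show ?case
  using heat_op_semigroup[OF assms(1) _ _ assms(3), of "s (Suc l) - s l" "s (Suc l + Suc m) - s (Suc l)" x]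
  by (subst hchain_Suc) simp
qed

lemma bsets_UNIV: "bsets (\<lambda>_. UNIV)" by (simp add: bsets_def)

text \<open>Removing the barriers can only increase a chain of nonnegative functions, so the free
  flow of the absolute value dominates the chains of \<open>g\<close> and of
  \<open>- g\<close>.\<close>

lemma hchain_abs_le:
 assumes "0 < D" "incr s l (Suc m)" "bsets A" "bnd \<kappa> C g"
 shows "\<bar>hchain D s A l (Suc m) g x\<bar> \<le> heat_op D (s (l + Suc m) - s l) (\<lambda>x. \<bar>g x\<bar>) x"
proof -
 have [measurable]: "g \<in> borel_measurable borel" using bnd_measurable[OF assms(4)] .
 have ga: "bnd \<kappa> C (\<lambda>x. \<bar>g x\<bar>)" using assms(4) by (auto simp: bnd_def)
 have gu: "bnd \<kappa> C (\<lambda>x. - g x)" by (rule bnd_uminus[OF assms(4)])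
 have eq: "hchain D s A l (Suc m) (\<lambda>x. - g x) x = - hchain D s A l (Suc m) g x"
  using hchain_cmult[of D s A l "Suc m" "-1" g x] by simp
 have 1: "hchain D s A l (Suc m) g x \<le> hchain D s (\<lambda>_. UNIV) l (Suc m) (\<lambda>x. \<bar>g x\<bar>) x"
  by (rule hchain_mono[OF assms(1,2,3) bsets_UNIV _ assms(4) ga]) auto
 have 2: "hchain D s A l (Suc m) (\<lambda>x. - g x) x \<le> hchain D s (\<lambda>_. UNIV) l (Suc m) (\<lambda>x. \<bar>g x\<bar>) x"
  by (rule hchain_mono[OF assms(1,2,3) bsets_UNIV _ gu ga]) auto
 show ?thesis using 1 2 unfolding eq hchain_UNIV[OF assms(1,2) ga] by linarith
qed

lemma cosh_shift_le: "cosh (a + b) \<le> exp \<bar>a\<bar> * cosh (b::real)"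
proof -
 have "exp (a + b) \<le> exp \<bar>a\<bar> * exp b" "exp (- (a + b)) \<le> exp \<bar>a\<bar> * exp (- b)"
  unfolding exp_add[symmetric] by auto
 then show ?thesis by (simp add: cosh_def algebra_simps)
qed

lemma bnd_shift: "bnd \<kappa> C f ==> bnd \<kappa> (C * exp \<bar>\<kappa> * a\<bar>) (\<lambda>x. f (a + x))"
 unfolding bnd_def
proof (intro conjI allI)
 assume f: "f \<in> borel_measurable borel \<and> (\<forall>x. \<bar>f x\<bar> \<le> C * cosh (\<kappa> * x))"
 then have [measurable]: "f \<in> borel_measurable borel" by simp
 show "(\<lambda>x. f (a + x)) \<in> borel_measurable borel" by measurable
 fix x
 have "C \<ge> 0" using f[THEN conjunct2, rule_format, of 0] by (auto dest: order_trans[OF abs_ge_zero])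
 have "\<bar>f (a + x)\<bar> \<le> C * cosh (\<kappa> * a + \<kappa> * x)" using f by (metis distrib_left)
 also have "\<dots> \<le> C * (exp \<bar>\<kappa> * a\<bar> * cosh (\<kappa> * x))" using \<open>C \<ge> 0\<close> by (intro mult_left_mono cosh_shift_le)
 finally show "\<bar>f (a + x)\<bar> \<le> C * exp \<bar>\<kappa> * a\<bar> * cosh (\<kappa> * x)" by (simp add: mult.assoc)
qed

lemma bnd_reflect_at: "bnd \<kappa> C f ==> bnd \<kappa> (C * exp \<bar>\<kappa> * a\<bar>) (\<lambda>x. f (a - x))"
 using bnd_reflect[OF bnd_shift[of \<kappa> C f a]] by simp

lemma heat_op_shift: "heat_op D t (\<lambda>x. g (a + x)) x = heat_op D t g (a + x)"
proof -
 have "heat_op D t g (a + x) = (LBINT y. heat D t (a + x) (a + 1 * y) * g (a + 1 * y))"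
  unfolding heat_op_def using lborel_integral_real_affine[of 1 "\<lambda>y. heat D t (a + x) y * g y" a] by simp
 then show ?thesis unfolding heat_op_def using heat_shift[of D t x a] by (simp add: add.commute)
qed

lemma heat_op_reflect_at: "heat_op D t (\<lambda>x. g (a - x)) x = heat_op D t g (a - x)"
 using heat_op_reflect[of D t "\<lambda>x. g (a + x)" x] heat_op_shift[of D t g a "- x"] by simp

text \<open>Doubling the variance absorbs a shift of the mean by at most 1, since \<open>(y -
  x)\<^sup>2 \<le> 2 * (y - (x + h))\<^sup>2 + 2 * h\<^sup>2\<close>. This supplies dominating
  functions uniform in small shifts.\<close>

lemma heat_perturb_le:
 assumes "0 < D * t" "\<bar>h\<bar> \<le> 1"
 shows "heat D t (x + h) y \<le> (sqrt 2 * exp (1 / (2 * (D * t)))) * heat D (2 * t) x y"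
proof -
 define c where "c = D * t"
 have c: "c > 0" using assms by (simp add: c_def)
 have "(y - x)\<^sup>2 \<le> 2 * (y - (x + h))\<^sup>2 + 2 * h\<^sup>2"
  using zero_le_power2[of "(y - (x + h)) - h"] by (simp add: power2_eq_square algebra_simps)
 moreover have "h\<^sup>2 \<le> 1" using assms(2) by (simp add: abs_square_le_1)
 ultimately have "(y - x)\<^sup>2 - 2 * (y - (x + h))\<^sup>2 \<le> 2" by simp
 then have "((y - x)\<^sup>2 - 2 * (y - (x + h))\<^sup>2) / (4 * c) \<le> 2 / (4 * c)" using c by (intro divide_right_mono) auto
 then have "-(y - (x + h))\<^sup>2 / (2 * c) \<le> 1 / (2 * c) + -(y - x)\<^sup>2 / (4 * c)"
 proof -
  have a: "((y - x)\<^sup>2 - 2 * (y - (x + h))\<^sup>2) / (4 * c) = (y - x)\<^sup>2 / (4 * c) - (y - (x + h))\<^sup>2 / (2 * c)"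
   using c by (simp add: diff_divide_distrib)
  have b: "2 / (4 * c) = 1 / (2 * c)" using c by simp
  show ?thesis using \<open>_ \<le> 2 / (4 * c)\<close> unfolding a b by (simp add: minus_divide_left[symmetric])
 qed
 then have "exp (-(y - (x + h))\<^sup>2 / (2 * c)) \<le> exp (1 / (2 * c)) * exp (-(y - x)\<^sup>2 / (4 * c))"
  by (simp add: exp_add[symmetric])
 then have "1 / sqrt (2 * pi * c) * exp (-(y - (x + h))\<^sup>2 / (2 * c)) \<le> 1 / sqrt (2 * pi * c) * (exp (1 / (2 * c)) * exp (-(y - x)\<^sup>2 / (4 * c)))"
  using c by (intro mult_left_mono) auto
 also have "\<dots> = (sqrt 2 * exp (1 / (2 * c))) * (1 / sqrt (2 * pi * (2 * c)) * exp (-(y - x)\<^sup>2 / (2 * (2 * c))))"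
  using c by (simp add: real_sqrt_mult field_simps)
 finally show ?thesis
  using assms by (simp add: heat_eq c_def mult.left_commute[of D 2])
qed

lemma heat_op_continuous:
 assumes Dt: "0 < D * t" and g: "bnd \<kappa> C g" and x: "xs \<longlonglongrightarrow> x"
 shows "(\<lambda>n. heat_op D t g (xs n)) \<longlonglongrightarrow> heat_op D t g x"
proof -
 \<comment> \<open>Far points are replaced by \<open>x\<close>, so that the domination for shifts of
   size at most 1 holds for every \<open>n\<close>; the two sequences agree eventually.\<close>
 define ys where "ys n = (if \<bar>xs n - x\<bar> \<le> 1 then xs n else x)" for n
 have ev: "\<forall>\<^sub>F n in sequentially. ys n = xs n"
  using tendstoD[OF x, of 1] by (auto simp: ys_def dist_real_def elim!: eventually_mono)
 then have y: "ys \<longlonglongrightarrow> x" by (intro Lim_transform_eventually[OF x]) (auto elim: eventually_mono)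
 have yb: "\<bar>ys n - x\<bar> \<le> 1" for n by (simp add: ys_def)
 have [measurable]: "g \<in> borel_measurable borel" using g by (rule bnd_measurable)
 have Dt2: "0 < D * (2 * t)" using Dt by simp
 have "(\<lambda>n. heat_op D t g (ys n)) \<longlonglongrightarrow> heat_op D t g x"
  unfolding heat_op_def
 proof (rule integral_dominated_convergence)
  show "integrable lborel (\<lambda>y. (sqrt 2 * exp (1 / (2 * (D * t)))) * \<bar>heat D (2 * t) x y * g y\<bar>)"
   using bnd_integrable[OF Dt2 g] by simp
  show "AE y in lborel. (\<lambda>n. heat D t (ys n) y * g y) \<longlonglongrightarrow> heat D t x y * g y"
   unfolding heat_eq[OF Dt] using y Dt by (intro AE_I2 tendsto_intros) auto
  show "AE y in lborel. norm (heat D t (ys n) y * g y) \<le> (sqrt 2 * exp (1 / (2 * (D * t)))) * \<bar>heat D (2 * t) x y * g y\<bar>" for n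
   using heat_perturb_le[OF Dt yb[of n], of x] by (auto simp: abs_mult mult.assoc[symmetric] intro!: mult_right_mono)
 qed measurable
 then show ?thesis by (rule Lim_transform_eventually) (use ev in \<open>auto elim: eventually_mono\<close>)
qed

section \<open>The heat kernel on a half-line\<close>

text \<open>The heat semigroup with absorption at \<open>\<eta>\<close>, by the method of images.
  The formula is kept for all real \<open>u\<close>, where it is odd about
  \<open>\<eta>\<close>.\<close>

definition refl_op :: "real => real => real => (real => real) => real => real" where
 "refl_op \<eta> D t f u = heat_op D t (\<lambda>v. indicator {..\<eta>} v * f v) u - heat_op D t (\<lambda>v. indicator {..\<eta>} v * f v) (2 * \<eta> - u)"

lemma refl_op_eq_integral:
 assumes "0 < D * t" "bnd \<kappa> C f"
 shows "refl_op \<eta> D t f u = (LBINT v. (heat D t u v - heat D t (2 * \<eta> - u) v) * (indicator {..\<eta>} v * f v))"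
  and "integrable lborel (\<lambda>v. (heat D t u v - heat D t (2 * \<eta> - u) v) * (indicator {..\<eta>} v * f v))"
proof -
 note b = bnd_integrable[OF assms(1) bnd_indicator_mult[OF assms(2), of "{..\<eta>}"]]
 show "refl_op \<eta> D t f u = (LBINT v. (heat D t u v - heat D t (2 * \<eta> - u) v) * (indicator {..\<eta>} v * f v))"
  unfolding refl_op_def heat_op_def left_diff_distrib by (subst integral_diff[OF b b]) auto
 show "integrable lborel (\<lambda>v. (heat D t u v - heat D t (2 * \<eta> - u) v) * (indicator {..\<eta>} v * f v))"
  unfolding left_diff_distrib by (rule integrable_diff[OF b b]) auto
qed

lemma heat_reflected_le:
 assumes "0 < D * t" "u \<le> \<eta>" "v \<le> \<eta>"
 shows "heat D t (2 * \<eta> - u) v \<le> heat D t u v"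
proof -
 have "(v - u)\<^sup>2 \<le> (v - (2 * \<eta> - u))\<^sup>2"
 proof -
  have "(v - (2 * \<eta> - u))\<^sup>2 - (v - u)\<^sup>2 = 4 * ((\<eta> - u) * (\<eta> - v))" by (simp add: power2_eq_square algebra_simps)
  moreover have "0 \<le> (\<eta> - u) * (\<eta> - v)" using assms(2,3) by (intro mult_nonneg_nonneg) auto
  ultimately show ?thesis by simp
 qed
 then show ?thesis
  unfolding heat_eq[OF assms(1)] using assms(1) by (intro mult_left_mono) (auto intro!: divide_right_mono)
qed

text \<open>Between points below 0 the squared distances to the mirror image and to the point itself
  differ by \<open>4 * (\<eta> - u) * (\<eta> - v) \<ge> 4 * \<eta>\<^sup>2\<close>.\<close>

lemma heat_reflected_le_exp:
 assumes "0 < D * t" "u \<le> 0" "v \<le> 0" "0 \<le> \<eta>"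
 shows "heat D t (2 * \<eta> - u) v \<le> exp (- (2 * \<eta>\<^sup>2 / (D * t))) * heat D t u v"
proof -
 define c where "c = D * t"
 have c: "c > 0" using assms by (simp add: c_def)
 have "0 \<le> u * v - \<eta> * u - \<eta> * v"
  using mult_nonpos_nonpos[OF assms(2,3)] mult_nonneg_nonpos[OF assms(4,2)] mult_nonneg_nonpos[OF assms(4,3)] by linarith
 then have "(v - u)\<^sup>2 + 4 * \<eta>\<^sup>2 \<le> (v - (2 * \<eta> - u))\<^sup>2" by (simp add: power2_eq_square algebra_simps)
 then have "((v - u)\<^sup>2 + 4 * \<eta>\<^sup>2) / (2 * c) \<le> (v - (2 * \<eta> - u))\<^sup>2 / (2 * c)" using c by (intro divide_right_mono) auto
 then have "-(v - (2 * \<eta> - u))\<^sup>2 / (2 * c) \<le> - (2 * \<eta>\<^sup>2 / c) + -(v - u)\<^sup>2 / (2 * c)"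
  using c by (simp add: add_divide_distrib)
 then have "exp (-(v - (2 * \<eta> - u))\<^sup>2 / (2 * c)) \<le> exp (- (2 * \<eta>\<^sup>2 / c)) * exp (-(v - u)\<^sup>2 / (2 * c))"
  unfolding exp_add[symmetric] by simp
 then have "1 / sqrt (2 * pi * c) * exp (-(v - (2 * \<eta> - u))\<^sup>2 / (2 * c)) \<le> 1 / sqrt (2 * pi * c) * (exp (- (2 * \<eta>\<^sup>2 / c)) * exp (-(v - u)\<^sup>2 / (2 * c)))"
  using c by (intro mult_left_mono) auto
 then show ?thesis unfolding heat_eq[OF assms(1)] c_def[symmetric] by (simp add: mult_ac)
qed

lemma refl_op_nonneg:
 assumes "0 < D * t" "bnd \<kappa> C f" "u \<le> \<eta>" "\<And>v. v \<le> \<eta> ==> 0 \<le> f v"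
 shows "0 \<le> refl_op \<eta> D t f u"
 unfolding refl_op_eq_integral(1)[OF assms(1,2)]
 by (intro integral_nonneg_AE AE_I2) (use assms heat_reflected_le[OF assms(1,3)] in \<open>auto simp: indicator_def\<close>)

lemma refl_op_diff:
 assumes "0 < D * t" "bnd \<kappa> C f" "bnd \<kappa> C' g"
 shows "refl_op \<eta> D t (\<lambda>x. f x - g x) u = refl_op \<eta> D t f u - refl_op \<eta> D t g u"
 unfolding refl_op_def right_diff_distrib
 using heat_op_diff[OF assms(1) bnd_indicator_mult[OF assms(2), of "{..\<eta>}"] bnd_indicator_mult[OF assms(3), of "{..\<eta>}"]]
 by simp

lemma refl_op_mono:
 assumes "0 < D * t" "bnd \<kappa> C f" "bnd \<kappa> C' g" "u \<le> \<eta>" "\<And>v. v \<le> \<eta> ==> f v \<le> g v"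
 shows "refl_op \<eta> D t f u \<le> refl_op \<eta> D t g u"
 using refl_op_nonneg[OF assms(1) bnd_diff[OF assms(3,2)] assms(4)] refl_op_diff[OF assms(1,3,2)] assms(5) by simp

lemma refl_op_cmult: "refl_op \<eta> D t (\<lambda>x. c * f x) u = c * refl_op \<eta> D t f u"
 unfolding refl_op_def by (simp add: mult.left_commute[of _ c] heat_op_cmult right_diff_distrib)

lemma bnd_refl_op:
 assumes "0 < D * t" "bnd \<kappa> C f"
 shows "bnd \<kappa> (C * exp (D * t * \<kappa>\<^sup>2 / 2) + C * exp (D * t * \<kappa>\<^sup>2 / 2) * exp \<bar>\<kappa> * (2 * \<eta>)\<bar>) (refl_op \<eta> D t f)"
proof -
 note b = bnd_heat_op[OF assms(1) bnd_indicator_mult[OF assms(2), of "{..\<eta>}"]]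
 show ?thesis unfolding refl_op_def[abs_def] by (rule bnd_diff[OF b bnd_reflect_at[OF b]]) auto
qed

text \<open>The image of \<open>refl_op\<close> is odd about \<open>\<eta>\<close>, and on functions
  odd about \<open>\<eta>\<close> the reflected flow coincides with the free one; so the free
  semigroup law applies.\<close>

lemma refl_op_semigroup:
 assumes D: "0 < D" "0 < s" "0 < t" and f: "bnd \<kappa> C f"
 shows "refl_op \<eta> D s (refl_op \<eta> D t f) u = refl_op \<eta> D (s + t) f u"
proof -
 define h where "h = refl_op \<eta> D t f"
 define q where "q = heat_op D t (\<lambda>v. indicator {..\<eta>} v * f v)"
 have Dt: "0 < D * t" "0 < D * s" using D by auto
 obtain C1 where h: "bnd \<kappa> C1 h" using bnd_refl_op[OF Dt(1) f] unfolding h_def by blast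
 obtain C2 where q: "bnd \<kappa> C2 q" using bnd_heat_op[OF Dt(1) bnd_indicator_mult[OF f, of "{..\<eta>}"]] unfolding q_def by auto
 have hq: "h v = q v - q (2 * \<eta> - v)" for v by (simp add: h_def q_def refl_op_def)
 have hodd: "indicator {..\<eta>} v * h v - indicator {..\<eta>} (2 * \<eta> - v) * h (2 * \<eta> - v) = h v" for v
  by (cases v \<eta> rule: linorder_cases) (auto simp: indicator_def hq)
 have ih: "bnd \<kappa> C1 (\<lambda>v. indicator {..\<eta>} v * h v)" by (rule bnd_indicator_mult[OF h]) simp
 have "refl_op \<eta> D s h u = heat_op D s (\<lambda>v. indicator {..\<eta>} v * h v) u - heat_op D s (\<lambda>v. indicator {..\<eta>} (2 * \<eta> - v) * h (2 * \<eta> - v)) u"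
  unfolding refl_op_def using heat_op_reflect_at[of D s "\<lambda>v. indicator {..\<eta>} v * h v" "2 * \<eta>" u] by simp
 also have "\<dots> = heat_op D s h u"
  using heat_op_diff[OF Dt(2) ih bnd_reflect_at[OF ih, of "2 * \<eta>"]] hodd by simp
 also have "\<dots> = heat_op D s q u - heat_op D s q (2 * \<eta> - u)"
  unfolding hq using heat_op_diff[OF Dt(2) q bnd_reflect_at[OF q, of "2 * \<eta>"]]
   heat_op_reflect_at[of D s q "2 * \<eta>" u] by simp
 also have "\<dots> = refl_op \<eta> D (s + t) f u"
  unfolding q_def refl_op_def
  by (simp add: heat_op_semigroup[OF D bnd_indicator_mult[OF f, of "{..\<eta>}"]])
 finally show ?thesis unfolding h_def .
qed

text \<open>With absorption at \<open>\<eta> > 0\<close> a step between points below 0 loses only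
  the relative amount \<open>exp (- (2 * \<eta>\<^sup>2 / (D * t)))\<close>, so the free step is
  bounded by the absorbed one up to the inverse factor.\<close>

lemma heat_op_le_refl_op:
 assumes "0 < D * t" "bnd \<kappa> C f" "u \<le> 0" "0 < \<eta>" "\<And>v. v \<le> 0 ==> 0 \<le> f v"
 shows "heat_op D t (\<lambda>v. indicator {..0} v * f v) u \<le>
  1 / (1 - exp (- (2 * \<eta>\<^sup>2 / (D * t)))) * refl_op \<eta> D t (\<lambda>v. indicator {..0} v * f v) u"
proof -
 define q where "q = exp (- (2 * \<eta>\<^sup>2 / (D * t)))"
 have q: "0 < 1 - q" using assms by (simp add: q_def)
 have bi: "bnd \<kappa> C (\<lambda>v. indicator {..0} v * f v)" by (rule bnd_indicator_mult[OF assms(2)]) simp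
 have "(1 - q) * heat_op D t (\<lambda>v. indicator {..0} v * f v) u = (LBINT v. (1 - q) * (heat D t u v * (indicator {..0} v * f v)))"
  by (simp add: heat_op_def)
 also have "\<dots> \<le> refl_op \<eta> D t (\<lambda>v. indicator {..0} v * f v) u"
  unfolding refl_op_eq_integral(1)[OF assms(1) bi]
 proof (intro integral_mono integrable_mult_right bnd_integrable[OF assms(1) bi] refl_op_eq_integral(2)[OF assms(1) bi])
  fix v
  show "(1 - q) * (heat D t u v * (indicator {..0} v * f v)) \<le> (heat D t u v - heat D t (2 * \<eta> - u) v) * (indicator {..\<eta>} v * (indicator {..0} v * f v))"
  proof (cases "v \<le> 0")
   case True
   have "heat D t (2 * \<eta> - u) v \<le> q * heat D t u v"
    using heat_reflected_le_exp[OF assms(1,3) True] assms(4) unfolding q_def by simp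
   then have "(1 - q) * heat D t u v \<le> heat D t u v - heat D t (2 * \<eta> - u) v" by (simp add: algebra_simps)
   from mult_right_mono[OF this assms(5)[OF True]] True assms(4) show ?thesis by (simp add: mult.assoc)
  qed simp
 qed
 finally show ?thesis using q unfolding q_def[symmetric] by (simp add: field_simps)
qed

text \<open>A sandwich for the chain that tests the level 0 at multiples of \<open>\<delta>\<close>
  only. Absorption at 0 in continuous time kills more, which is the lower bound; absorption at a
  slightly higher level \<open>\<eta>\<close> compares step by step with the free kernel, at the
  cost of one factor per step.\<close>

lemma hchain_halfline_bounds:
 fixes l :: nat
 assumes D: "0 < D" "0 < \<delta>" and g: "bnd \<kappa> C g" and g0: "\<And>x. 0 \<le> g x" and u: "u \<le> 0"
 defines "Q \<equiv> \<lambda>m. hchain D (\<lambda>l. real l * \<delta>) (\<lambda>_. {..0}) l m g"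
 shows "refl_op 0 D (real (Suc m) * \<delta>) g u \<le> Q (Suc m) u"
  and "0 < \<eta> ==> Q (Suc m) u \<le> (1 / (1 - exp (- (2 * \<eta>\<^sup>2 / (D * \<delta>))))) ^ Suc m * refl_op \<eta> D (real (Suc m) * \<delta>) (\<lambda>v. indicator {..0} v * g v) u"
proof -
 define Q' where "Q' m = hchain D (\<lambda>l. real l * \<delta>) (\<lambda>_. {..0}) 0 m g" for m
 have QQ: "Q m = Q' m" for m unfolding Q_def Q'_def by (rule hchain_cong) (simp_all add: algebra_simps)
 have Dd: "0 < D * \<delta>" using D by simp
 have step: "Q' (Suc m) = heat_op D \<delta> (\<lambda>y. indicator {..0} y * Q' m y)" for m
 proof -
  have "hchain D (\<lambda>l. real l * \<delta>) (\<lambda>_. {..0}) (Suc 0) m g = Q' m"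
   unfolding Q'_def by (rule hchain_cong) (simp_all add: algebra_simps)
  then show ?thesis unfolding Q'_def by (simp add: heat_op_def fun_eq_iff algebra_simps)
 qed
 have inc: "incr (\<lambda>l. real l * \<delta>) 0 m" for m using D by (simp add: incr_def)
 have bs: "bsets (\<lambda>_. {..0::real})" by (simp add: bsets_def)
 define CQ where "CQ m = C * exp (D * (real (0 + m) * \<delta> - real 0 * \<delta>) * \<kappa>\<^sup>2 / 2)" for m
 have bQ: "bnd \<kappa> (CQ m) (Q' m)" for m
  using bnd_hchain[OF D(1) inc bs g, of m] unfolding Q'_def CQ_def .
 have Q0: "0 \<le> Q' m x" for m x unfolding Q'_def by (rule hchain_nonneg) (rule g0)
 have sm: "0 < real (Suc m) * \<delta>" for m using D by simp
 have Dsm: "0 < D * (real (Suc m) * \<delta>)" for m using D by simp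
 have add: "\<delta> + real (Suc m) * \<delta> = real (Suc (Suc m)) * \<delta>" for m by (simp add: algebra_simps)
 have heat_ge: "refl_op 0 D \<delta> f u \<le> heat_op D \<delta> (\<lambda>y. indicator {..0} y * f y) u" if "\<And>x. 0 \<le> f x" for f u
  unfolding refl_op_def using heat_op_nonneg[of "\<lambda>v. indicator {..0} v * f v"] that by simp
 show "refl_op 0 D (real (Suc m) * \<delta>) g u \<le> Q (Suc m) u"
  unfolding QQ using u
 proof (induction m arbitrary: u)
  case 0
  have "Q' 0 = g" by (simp add: Q'_def)
  then show ?case using heat_ge[OF g0] by (simp add: step)
 next
  case (Suc m)
  have "refl_op 0 D (real (Suc (Suc m)) * \<delta>) g u = refl_op 0 D \<delta> (refl_op 0 D (real (Suc m) * \<delta>) g) u"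
   using refl_op_semigroup[OF D(1,2) sm g, of 0 m u] add[of m] by simp
  also have "\<dots> \<le> refl_op 0 D \<delta> (Q' (Suc m)) u"
   by (rule refl_op_mono[OF Dd bnd_refl_op[OF Dsm g] bQ Suc.prems Suc.IH])
  also have "\<dots> \<le> Q' (Suc (Suc m)) u"
   unfolding step[of "Suc m"] by (rule heat_ge) (rule Q0)
  finally show ?case .
 qed
 assume \<eta>: "0 < \<eta>"
 define c where "c = 1 / (1 - exp (- (2 * \<eta>\<^sup>2 / (D * \<delta>))))"
 have c: "0 \<le> c" using \<eta> Dd by (simp add: c_def)
 have gi: "bnd \<kappa> C (\<lambda>v. indicator {..0} v * g v)" by (rule bnd_indicator_mult[OF g]) simp
 have "Q' (Suc m) u \<le> c ^ Suc m * refl_op \<eta> D (real (Suc m) * \<delta>) (\<lambda>v. indicator {..0} v * g v) u"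
  using u
 proof (induction m arbitrary: u)
  case 0
  have "Q' 0 = g" by (simp add: Q'_def)
  then show ?case using heat_op_le_refl_op[OF Dd g 0 \<eta>] g0 by (simp add: step c_def)
 next
  case (Suc m)
  let ?f = "refl_op \<eta> D (real (Suc m) * \<delta>) (\<lambda>v. indicator {..0} v * g v)"
  have bf: "bnd \<kappa> (c ^ Suc m * (C * exp (D * (real (Suc m) * \<delta>) * \<kappa>\<^sup>2 / 2) + C * exp (D * (real (Suc m) * \<delta>) * \<kappa>\<^sup>2 / 2) * exp \<bar>\<kappa> * (2 * \<eta>)\<bar>)) (\<lambda>x. c ^ Suc m * ?f x)"
   using bnd_refl_op[OF Dsm gi, of m \<eta>] c by (auto simp: bnd_def abs_mult mult.assoc intro!: mult_left_mono)
  have "Q' (Suc (Suc m)) u \<le> c * refl_op \<eta> D \<delta> (\<lambda>v. indicator {..0} v * Q' (Suc m) v) u"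
   unfolding step[of "Suc m"] c_def by (rule heat_op_le_refl_op[OF Dd bQ Suc.prems \<eta>]) (rule Q0)
  also have "\<dots> \<le> c * refl_op \<eta> D \<delta> (\<lambda>x. c ^ Suc m * ?f x) u"
  proof (intro mult_left_mono c refl_op_mono[OF Dd bnd_indicator_mult[OF bQ, of "{..0}"] bf])
   show "u \<le> \<eta>" using Suc.prems \<eta> by simp
   fix v assume v: "v \<le> \<eta>"
   have "0 \<le> ?f v" by (rule refl_op_nonneg[OF Dsm gi v]) (simp add: g0)
   then show "indicator {..0} v * Q' (Suc m) v \<le> c ^ Suc m * ?f v"
    using Suc.IH[of v] c by (cases "v \<le> 0") (auto simp del: power_Suc)
  qed simp
  also have "\<dots> = c ^ Suc (Suc m) * refl_op \<eta> D \<delta> ?f u"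
   unfolding refl_op_cmult by simp
  also have "refl_op \<eta> D \<delta> ?f u = refl_op \<eta> D (real (Suc (Suc m)) * \<delta>) (\<lambda>v. indicator {..0} v * g v) u"
   using refl_op_semigroup[OF D(1,2) sm gi, of \<eta> m u] add[of m] by simp
  finally show ?case .
 qed
 then show "Q (Suc m) u \<le> (1 / (1 - exp (- (2 * \<eta>\<^sup>2 / (D * \<delta>))))) ^ Suc m * refl_op \<eta> D (real (Suc m) * \<delta>) (\<lambda>v. indicator {..0} v * g v) u"
  unfolding QQ c_def .
qed

text \<open>The number of steps grows linearly while the defect of each step is exponentially small
  in \<open>n\<close>, because the step length is of order \<open>1 / n\<close>.\<close>

lemma power_tendsto_one_aux:
 assumes "0 < a"
 shows "(\<lambda>n. (1 / (1 - exp (- (a * real (Suc n))))) ^ Suc n) \<longlonglongrightarrow> 1"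
proof -
 have "(\<lambda>n::nat. (1 / (1 - exp (- (a * (real n + 1))))) powr (real n + 1)) \<longlonglongrightarrow> 1"
  using assms by real_asymp
 moreover have "(1 / (1 - exp (- (a * (real n + 1))))) powr (real n + 1) = (1 / (1 - exp (- (a * real (Suc n))))) ^ Suc n" for n
 proof -
  have "0 < 1 / (1 - exp (- (a * real (Suc n))))" using assms by (simp add: mult_pos_pos)
  from powr_realpow[OF this, of "Suc n"] show ?thesis by (simp add: add.commute)
 qed
 ultimately show ?thesis by simp
qed

lemma hchain_halfline_tendsto_pos:
 assumes D: "0 < D" "0 < T" and g: "bnd \<kappa> C g" and g0: "\<And>x. 0 \<le> g x" and u: "u \<le> 0"
 shows "(\<lambda>n. hchain D (\<lambda>l. real l * (T / real (Suc n))) (\<lambda>_. {..0}) l (Suc n) g u) \<longlonglongrightarrow> refl_op 0 D T g u"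
proof -
 let ?Q = "\<lambda>n. hchain D (\<lambda>l. real l * (T / real (Suc n))) (\<lambda>_. {..0}) l (Suc n) g u"
 let ?R = "\<lambda>\<eta>. refl_op \<eta> D T (\<lambda>v. indicator {..0} v * g v) u"
 have DT: "0 < D * T" using D by simp
 have d: "0 < T / real (Suc n)" for n using D by simp
 have e: "real (Suc n) * (T / real (Suc n)) = T" for n by simp
 have gi: "bnd \<kappa> C (\<lambda>v. indicator {..0} v * g v)" by (rule bnd_indicator_mult[OF g]) simp
 have lower: "refl_op 0 D T g u \<le> ?Q n" for n
  using hchain_halfline_bounds(1)[OF D(1) d[of n] g g0 u, where m=n and l=l] unfolding e .
 have upper: "?Q n \<le> (1 / (1 - exp (- (2 * \<eta>\<^sup>2 / (D * T) * real (Suc n))))) ^ Suc n * ?R \<eta>" if "0 < \<eta>" for \<eta> n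
 proof -
  have "2 * \<eta>\<^sup>2 / (D * (T / real (Suc n))) = 2 * \<eta>\<^sup>2 / (D * T) * real (Suc n)" by simp
  then show ?thesis using hchain_halfline_bounds(2)[OF D(1) d[of n] g g0 u that, where m=n and l=l] unfolding e by (simp only:)
 qed
 have R0: "(\<lambda>n. ?R (1 / real (Suc n))) \<longlonglongrightarrow> refl_op 0 D T g u"
 proof -
  have "(\<lambda>n. 2 * (1 / real (Suc n)) - u) \<longlonglongrightarrow> 2 * 0 - u"
   by (intro tendsto_intros LIMSEQ_Suc[OF lim_1_over_n])
  from heat_op_continuous[OF DT gi this]
  have "(\<lambda>n. heat_op D T (\<lambda>v. indicator {..0} v * g v) u - heat_op D T (\<lambda>v. indicator {..0} v * g v) (2 * (1 / real (Suc n)) - u)) \<longlonglongrightarrow>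
   heat_op D T (\<lambda>v. indicator {..0} v * g v) u - heat_op D T (\<lambda>v. indicator {..0} v * g v) (2 * 0 - u)"
   by (intro tendsto_intros)
  moreover have "(\<lambda>v. indicator {..1 / real (Suc n)} v * (indicator {..0} v * g v)) = (\<lambda>v. indicator {..0} v * g v)" for n
   by (auto simp: fun_eq_iff indicator_def intro: order_trans)
  ultimately show ?thesis unfolding refl_op_def by simp
 qed
 show ?thesis
 proof (rule order_tendstoI)
  fix a assume "a < refl_op 0 D T g u"
  then show "\<forall>\<^sub>F n in sequentially. a < ?Q n" using lower by (intro always_eventually allI) (auto intro: less_le_trans)
 next
  fix a assume "refl_op 0 D T g u < a"
  \<comment> \<open>First fix a level \<open>\<eta>\<close> whose absorbed value lies below
    \<open>a\<close>, then refine the mesh at this fixed \<open>\<eta>\<close>.\<close>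
  from order_tendstoD(2)[OF R0 this] obtain k where k: "?R (1 / real (Suc k)) < a"
   by (auto simp: eventually_sequentially)
  define \<eta> where "\<eta> = 1 / real (Suc k)"
  have \<eta>: "0 < \<eta>" by (simp add: \<eta>_def)
  have "(\<lambda>n. (1 / (1 - exp (- (2 * \<eta>\<^sup>2 / (D * T) * real (Suc n))))) ^ Suc n * ?R \<eta>) \<longlonglongrightarrow> 1 * ?R \<eta>"
   by (intro tendsto_mult power_tendsto_one_aux tendsto_const) (use \<eta> DT in simp)
  from order_tendstoD(2)[OF this, of a] k
  have "\<forall>\<^sub>F n in sequentially. (1 / (1 - exp (- (2 * \<eta>\<^sup>2 / (D * T) * real (Suc n))))) ^ Suc n * ?R \<eta> < a"
   unfolding \<eta>_def by simp
  then show "\<forall>\<^sub>F n in sequentially. ?Q n < a"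
   by eventually_elim (use upper[OF \<eta>] in \<open>auto intro: le_less_trans\<close>)
 qed
qed

text \<open>Positive and negative parts remove the sign condition. Replacing \<open>g n\<close> by
  the limit costs at most the free flow of \<open>\<bar>g n - g'\<bar>\<close>, which vanishes;
  varying terminal functions are needed because pieces of the time interval are refined
  simultaneously.\<close>

lemma hchain_halfline_tendsto:
 assumes D: "0 < D" "0 < T" and g: "\<And>n. bnd \<kappa> C (g n)" and lim: "\<And>x. (\<lambda>n. g n x) \<longlonglongrightarrow> g' x" and u: "u \<le> 0"
 shows "(\<lambda>n. hchain D (\<lambda>l. real l * (T / real (Suc n))) (\<lambda>_. {..0}) l (Suc n) (g n) u) \<longlonglongrightarrow> refl_op 0 D T g' u"
proof -
 let ?H = "\<lambda>n f. hchain D (\<lambda>l. real l * (T / real (Suc n))) (\<lambda>_. {..0}) l (Suc n) f u"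
 have DT: "0 < D * T" using D by simp
 have g': "bnd \<kappa> C g'" by (rule bnd_lim[OF g lim])
 have [measurable]: "g' \<in> borel_measurable borel" by (rule bnd_measurable[OF g'])
 define p m where "p x = max (g' x) 0" and "m x = max (- g' x) 0" for x
 have bp: "bnd \<kappa> C p" "bnd \<kappa> C m"
  unfolding p_def[abs_def] m_def[abs_def] by (rule bnd_dominated[OF g']; auto)+
 have pm: "g' = (\<lambda>x. p x - m x)" and pos: "0 \<le> p x" "0 \<le> m x" for x by (auto simp: p_def m_def fun_eq_iff)
 have inc: "incr (\<lambda>l. real l * (T / real (Suc n))) l k" for n k
 proof -
  have "0 < T / real (Suc n)" using D by simp
  then show ?thesis unfolding incr_def by (auto intro!: mult_strict_right_mono simp del: times_divide_eq_right)
 qed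
 have bs: "bsets (\<lambda>_. {..0::real})" by (simp add: bsets_def)
 have "(\<lambda>n. ?H n p - ?H n m) \<longlonglongrightarrow> refl_op 0 D T p u - refl_op 0 D T m u"
  by (intro tendsto_diff hchain_halfline_tendsto_pos[OF D bp(1) pos(1) u] hchain_halfline_tendsto_pos[OF D bp(2) pos(2) u])
 then have 1: "(\<lambda>n. ?H n g') \<longlonglongrightarrow> refl_op 0 D T g' u"
  unfolding pm refl_op_diff[OF DT bp] hchain_diff[OF D(1) inc bs bp] .
 have bd: "bnd \<kappa> (C + C) (\<lambda>x. g n x - g' x)" for n by (rule bnd_diff[OF g g'])
 have "(\<lambda>n. heat_op D T (\<lambda>x. \<bar>g n x - g' x\<bar>) u) \<longlonglongrightarrow> heat_op D T (\<lambda>x. 0) u"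
 proof (rule heat_op_tendsto[OF DT, of \<kappa> "C + C"])
  show "bnd \<kappa> (C + C) (\<lambda>x. \<bar>g n x - g' x\<bar>)" for n using bd[of n] by (auto simp: bnd_def)
  show "(\<lambda>n. \<bar>g n x - g' x\<bar>) \<longlonglongrightarrow> 0" for x
   using lim[of x] by (auto intro!: tendsto_rabs_zero LIM_zero)
 qed
 then have 2: "(\<lambda>n. heat_op D T (\<lambda>x. \<bar>g n x - g' x\<bar>) u) \<longlonglongrightarrow> 0" by (simp add: heat_op_def)
 have "\<bar>?H n (g n) - ?H n g'\<bar> \<le> heat_op D T (\<lambda>x. \<bar>g n x - g' x\<bar>) u" for n
 proof -
  have "real (l + Suc n) * (T / real (Suc n)) - real l * (T / real (Suc n)) = T"
   by (simp add: field_simps del: of_nat_Suc) (simp add: algebra_simps)?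
  then show ?thesis
   using hchain_abs_le[OF D(1) inc[of n "Suc n"] bs bd[of n], of u] unfolding hchain_diff[OF D(1) inc bs g g'] by (simp only:)
 qed
 then have "(\<lambda>n. ?H n (g n) - ?H n g') \<longlonglongrightarrow> 0"
  by (intro Lim_null_comparison[OF _ 2] always_eventually allI) simp
 from tendsto_add[OF this 1] show ?thesis by simp
qed

section \<open>Brownian paths below a moving barrier, as limits of heat chains\<close>

context
 fixes M :: "'b measure" and W :: "real => 'b => real" and D :: real
 assumes bm: "brownian_motion M D W" and D: "0 < D"
begin

lemma bm_measurable: "0 \<le> t ==> W t \<in> borel_measurable M"
 and bm_continuous: "\<omega> \<in> space M ==> continuous_on {0..} (\<lambda>t. W t \<omega>)"
 using bm unfolding brownian_motion_def by auto

lemma bm_distributed: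
 assumes "k \<ge> 1" "0 < s 1" "\<And>l. l \<in> {1..<k} ==> s l < s (Suc l)"
 shows "distributed M (PiM {1..k} (\<lambda>_. lborel)) (\<lambda>\<omega>. restrict (\<lambda>l. W (s l) \<omega>) {1..k})
    (\<lambda>x. ennreal (\<Prod>l\<in>{1..k}. heat D (s l - (if l = 1 then 0 else s (l - 1))) (if l = 1 then 0 else x (l - 1)) (x l)))"
 using bm assms unfolding brownian_motion_def by auto

lemma bm_integrable:
 assumes t: "0 < t" and g: "bnd \<kappa> C g"
 shows "integrable M (\<lambda>\<omega>. g (u + W t \<omega>))"
proof -
 interpret P: product_sigma_finite "\<lambda>_::nat. lborel :: real measure" by standard
 have [measurable]: "g \<in> borel_measurable borel" by (rule bnd_measurable[OF g])
 have d: "distributed M (PiM {1..1::nat} (\<lambda>_. lborel)) (\<lambda>\<omega>. restrict (\<lambda>l. W t \<omega>) {1..1}) (\<lambda>x. ennreal (heat D t 0 (x 1)))"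
  using bm_distributed[of 1 "\<lambda>_. t"] t by simp
 have "integrable lborel (\<lambda>y. heat D t 0 y * g (u + y))"
  using D t by (intro bnd_integrable[OF _ bnd_shift[OF g]]) simp
 then have "integrable (PiM {1..1::nat} (\<lambda>_. lborel)) (\<lambda>x. \<Prod>i\<in>{1..1}. (\<lambda>y. heat D t 0 y * g (u + y)) (x i))"
  by (intro P.product_integrable_prod[where f="\<lambda>_ y. heat D t 0 y * g (u + y)"]) auto
 then have "integrable (PiM {1..1::nat} (\<lambda>_. lborel)) (\<lambda>x. heat D t 0 (x 1) * g (u + x 1))" by simp
 then have "integrable M (\<lambda>\<omega>. g (u + restrict (\<lambda>l. W t \<omega>) {1..1::nat} 1))"
  using distributed_integrable[OF d, of "\<lambda>x. g (u + x 1)"] by simp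
 then show ?thesis by simp
qed

text \<open>Finite-dimensional densities are peeled off at the last time, which turns
  \<open>g\<close> into a one-step chain \<open>g'\<close>; \<open>chain_snoc\<close> reconciles
  this with the recursion of \<open>chain\<close>, which works from the first time.\<close>

lemma bm_chain:
 assumes k: "k \<ge> 1" and s: "s 0 = 0" "incr s 0 k" and A: "bsets A" and g: "bnd \<kappa> C g"
 shows "(\<integral>\<omega>. (\<Prod>l\<in>{1..k}. indicator (A l) (u + W (s l) \<omega>)) * g (u + W (s k) \<omega>) \<partial>M) = hchain D s A 0 k g u"
proof -
 interpret P: product_sigma_finite "\<lambda>_::nat. lborel :: real measure" by standard
 define dens where "dens k x = (\<Prod>l\<in>{1..k}. heat D (s l - (if l = 1 then 0 else s (l - 1))) (if l = 1 then 0 else x (l - 1)) (x l))" for k and x :: "nat => real"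
 define \<Phi> where "\<Phi> k g x = (\<Prod>l\<in>{1..k}. indicator (A l) (u + x l)) * g (u + x k)" for k and g :: "real => real" and x :: "nat => real"
 have st: "s l < s (Suc l)" if "l < k" for l using s(2) that by (simp add: incr_def)
 have spos: "0 < s l" if "1 \<le> l" "l \<le> k" for l
  using incr_less[of s 0 l] s that by (simp add: incr_def)
 have [measurable]: "A l \<in> sets borel" for l using A by (rule bsetsD)
 have dd: "distributed M (PiM {1..k'} (\<lambda>_. lborel)) (\<lambda>\<omega>. restrict (\<lambda>l. W (s l) \<omega>) {1..k'}) (\<lambda>x. ennreal (dens k' x))"
  if "1 \<le> k'" "k' \<le> k" for k'
  unfolding dens_def using that spos[of 1] st by (intro bm_distributed) auto
 have dens0: "0 \<le> dens k' x" for k' x unfolding dens_def by (intro prod_nonneg) auto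
 have mPhi: "\<Phi> k' g \<in> borel_measurable (PiM {1..k'} (\<lambda>_. lborel))" if [measurable]: "g \<in> borel_measurable borel" and "1 \<le> k'" for k' g
 proof -
  have "k' \<in> {1..k'}" using that(2) by simp
  then show ?thesis unfolding \<Phi>_def by measurable
 qed
 have int: "integrable (PiM {1..k'} (\<lambda>_. lborel)) (\<lambda>x. dens k' x * \<Phi> k' g x)"
  if "1 \<le> k'" "k' \<le> k" and g: "bnd \<kappa> C g" for k' g C
 proof -
  have sk: "0 < s k'" using spos that by simp
  have [measurable]: "W (s l) \<in> borel_measurable M" if "l \<in> {1..k'}" for l
   using spos[of l] that \<open>k' \<le> k\<close> by (intro bm_measurable) auto
  have [measurable]: "W (s k') \<in> borel_measurable M" using sk by (intro bm_measurable) auto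
  have [measurable]: "g \<in> borel_measurable borel" by (rule bnd_measurable[OF g])
  have "integrable M (\<lambda>\<omega>. (\<Prod>l\<in>{1..k'}. indicator (A l) (u + W (s l) \<omega>)) * g (u + W (s k') \<omega>))"
  proof (rule integrable_bound[OF bm_integrable[OF sk g, of u]])
   show "AE \<omega> in M. norm ((\<Prod>l\<in>{1..k'}. indicator (A l) (u + W (s l) \<omega>)) * g (u + W (s k') \<omega>)) \<le> norm (g (u + W (s k') \<omega>))"
    by (rule AE_I2) (auto simp: abs_mult abs_prod intro!: mult_left_le_one_le prod_le_1 prod_nonneg)
  qed measurable
  then have "integrable M (\<lambda>\<omega>. \<Phi> k' g (restrict (\<lambda>l. W (s l) \<omega>) {1..k'}))"
   unfolding \<Phi>_def using that(1) by simp
  then show ?thesis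
   using distributed_integrable[OF dd[OF that(1,2)] mPhi[OF _ that(1)], of g] dens0 by simp
 qed
 have main: "(\<integral>x. dens k' x * \<Phi> k' g x \<partial>PiM {1..k'} (\<lambda>_. lborel)) = hchain D s A 0 k' g u"
  if "1 \<le> k'" "k' \<le> k" and g: "bnd \<kappa> C g" for k' g C
  using that
 proof (induction k' arbitrary: g C rule: dec_induct)
  case base
  have [measurable]: "g \<in> borel_measurable borel" by (rule bnd_measurable[OF base(2)])
  have "(\<integral>x. dens 1 x * \<Phi> 1 g x \<partial>PiM {1..1} (\<lambda>_. lborel)) = (\<integral>x. (\<lambda>y. heat D (s 1) 0 y * (indicator (A 1) (u + y) * g (u + y))) (x 1) \<partial>PiM {1::nat} (\<lambda>_. lborel))"
   unfolding dens_def \<Phi>_def by simp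
  also have "\<dots> = (LBINT y. heat D (s 1) 0 y * (indicator (A 1) (u + y) * g (u + y)))"
   by (rule P.product_integral_singleton) measurable
  also have "\<dots> = heat_op D (s 1) (\<lambda>y. indicator (A 1) y * g y) u"
   using heat_op_shift[of D "s 1" "\<lambda>y. indicator (A 1) y * g y" u 0] by (simp add: heat_op_def)
  finally show ?case using s(1) by (simp add: heat_op_def One_nat_def)
 next
  case (step k')
  note g = step.prems(2)
  have [measurable]: "g \<in> borel_measurable borel" by (rule bnd_measurable[OF g])
  have k': "k' \<le> k" "k' < k" using step.prems by auto
  have Ds: "0 < D * (s (Suc k') - s k')" using st[of k'] D k' by simp
  have ins: "{1..Suc k'} = insert (Suc k') {1..k'}" by auto
  define g' where "g' = heat_op D (s (Suc k') - s k') (\<lambda>y. indicator (A (Suc k')) y * g y)"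
  have g': "bnd \<kappa> (C * exp (D * (s (Suc k') - s k') * \<kappa>\<^sup>2 / 2)) g'"
   unfolding g'_def by (rule bnd_heat_op[OF Ds bnd_indicator_mult[OF g]]) simp
  have dens_upd: "dens (Suc k') (x(Suc k' := y)) = dens k' x * heat D (s (Suc k') - s k') (x k') y" for x y
  proof -
   have "dens (Suc k') (x(Suc k' := y)) = heat D (s (Suc k') - s k') (x k') y *
    (\<Prod>l\<in>{1..k'}. heat D (s l - (if l = 1 then 0 else s (l - 1))) (if l = 1 then 0 else (x(Suc k' := y)) (l - 1)) ((x(Suc k' := y)) l))"
    unfolding dens_def ins using step.hyps by (subst prod.insert) auto
   also have "(\<Prod>l\<in>{1..k'}. heat D (s l - (if l = 1 then 0 else s (l - 1))) (if l = 1 then 0 else (x(Suc k' := y)) (l - 1)) ((x(Suc k' := y)) l)) = dens k' x"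
    unfolding dens_def by (intro prod.cong refl) auto
   finally show ?thesis by (simp only: mult.commute)
  qed
  have Phi_upd: "\<Phi> (Suc k') g (x(Suc k' := y)) = (\<Prod>l\<in>{1..k'}. indicator (A l) (u + x l)) * (indicator (A (Suc k')) (u + y) * g (u + y))" for x y
  proof -
   have "(\<Prod>l\<in>{1..Suc k'}. indicator (A l) (u + (x(Suc k' := y)) l)) = indicator (A (Suc k')) (u + y) * (\<Prod>l\<in>{1..k'}. indicator (A l) (u + (x(Suc k' := y)) l) :: real)"
    unfolding ins by (subst prod.insert) auto
   also have "(\<Prod>l\<in>{1..k'}. indicator (A l) (u + (x(Suc k' := y)) l) :: real) = (\<Prod>l\<in>{1..k'}. indicator (A l) (u + x l))"
    by (intro prod.cong refl) auto
   finally show ?thesis unfolding \<Phi>_def by simp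
  qed
  have "(\<integral>x. dens (Suc k') x * \<Phi> (Suc k') g x \<partial>PiM {1..Suc k'} (\<lambda>_. lborel)) =
   (\<integral>x. (LBINT y. dens (Suc k') (x(Suc k' := y)) * \<Phi> (Suc k') g (x(Suc k' := y))) \<partial>PiM {1..k'} (\<lambda>_. lborel))"
   unfolding ins by (rule P.product_integral_insert) (use int[of "Suc k'" C g] step.prems ins in auto)
  also have "\<dots> = (\<integral>x. dens k' x * \<Phi> k' g' x \<partial>PiM {1..k'} (\<lambda>_. lborel))"
  proof (intro integral_cong refl)
   fix x :: "nat => real"
   have "(LBINT y. dens (Suc k') (x(Suc k' := y)) * \<Phi> (Suc k') g (x(Suc k' := y))) =
    (LBINT y. (dens k' x * (\<Prod>l\<in>{1..k'}. indicator (A l) (u + x l))) * (heat D (s (Suc k') - s k') (x k') y * (indicator (A (Suc k')) (u + y) * g (u + y))))"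
    unfolding dens_upd Phi_upd by (intro integral_cong refl) (simp only: mult_ac)
   also have "\<dots> = (dens k' x * (\<Prod>l\<in>{1..k'}. indicator (A l) (u + x l))) * heat_op D (s (Suc k') - s k') (\<lambda>y. (\<lambda>z. indicator (A (Suc k')) z * g z) (u + y)) (x k')"
    unfolding integral_mult_right_zero heat_op_def ..
   also have "\<dots> = dens k' x * \<Phi> k' g' x"
    using heat_op_shift[of D "s (Suc k') - s k'" "\<lambda>z. indicator (A (Suc k')) z * g z" u "x k'"]
    unfolding \<Phi>_def g'_def by simp
   finally show "(LBINT y. dens (Suc k') (x(Suc k' := y)) * \<Phi> (Suc k') g (x(Suc k' := y))) = dens k' x * \<Phi> k' g' x" .
  qed
  also have "\<dots> = hchain D s A 0 k' g' u"
   by (rule step.IH[OF k'(1) g'])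
  also have "\<dots> = hchain D s A 0 (Suc k') g u"
  proof -
   have "chain (\<lambda>l. heat D (s (Suc l) - s l)) A (0 + k') 1 g = g'"
    unfolding g'_def heat_op_def by (rule ext) (simp add: chain_1)
   then show ?thesis unfolding chain_snoc by simp
  qed
  finally show ?case .
 qed
 have "(\<integral>\<omega>. \<Phi> k g (restrict (\<lambda>l. W (s l) \<omega>) {1..k}) \<partial>M) = (\<integral>x. dens k x * \<Phi> k g x \<partial>PiM {1..k} (\<lambda>_. lborel))"
  using distributed_integral[OF dd[OF k order_refl] mPhi[OF bnd_measurable[OF g] k]] dens0 by simp
 moreover have "\<Phi> k g (restrict (\<lambda>l. W (s l) \<omega>) {1..k}) = (\<Prod>l\<in>{1..k}. indicator (A l) (u + W (s l) \<omega>)) * g (u + W (s k) \<omega>)" for \<omega>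
  unfolding \<Phi>_def using k by simp
 ultimately show ?thesis using main[OF k order_refl g] by simp
qed

end

text \<open>A violation \<open>f t0 > 0\<close> persists on a neighbourhood, and every sufficiently
  fine mesh has a point in it. Time 0 is not a mesh point here, but a violation there is caught for
  the same reason.\<close>

lemma mesh_indicator_tendsto:
 fixes f :: "real => real"
 assumes T: "0 < T" and f: "continuous_on {0..T} f"
 shows "(\<lambda>n. \<Prod>l\<in>{1..Suc n}. indicator {..0} (f (real l * (T / real (Suc n)))) :: real) \<longlonglongrightarrow> (if \<forall>t\<in>{0..T}. f t \<le> 0 then 1 else 0)"
proof (cases "\<forall>t\<in>{0..T}. f t \<le> 0")
 case True
 have "f (real l * (T / real (Suc n))) \<le> 0" if "l \<in> {1..Suc n}" for l n
 proof -
  have "real l * (T / real (Suc n)) \<le> real (Suc n) * (T / real (Suc n))"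
   using that T by (intro mult_right_mono) auto
  then have "real l * (T / real (Suc n)) \<in> {0..T}" using T by (simp del: of_nat_Suc)
  then show ?thesis using True by blast
 qed
 then have "(\<Prod>l\<in>{1..Suc n}. indicator {..0} (f (real l * (T / real (Suc n)))) :: real) = 1" for n
  by (intro prod.neutral) auto
 then show ?thesis using True by (simp only:) simp
next
 case False
 then obtain t0 where t0: "t0 \<in> {0..T}" "0 < f t0" by force
 obtain d where d: "d > 0" "\<And>t. t \<in> {0..T} ==> \<bar>t - t0\<bar> < d ==> 0 < f t"
 proof -
  have "\<exists>d>0. \<forall>t\<in>{0..T}. dist t t0 < d \<longrightarrow> dist (f t) (f t0) < f t0"
   using f t0 unfolding continuous_on_iff by auto
  then obtain d where d: "d > 0" "\<And>t. t \<in> {0..T} ==> \<bar>t - t0\<bar> < d ==> \<bar>f t - f t0\<bar> < f t0"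
   unfolding dist_real_def by blast
  show ?thesis by (rule that[OF d(1)]) (use d(2) in fastforce)
 qed
 have ev: "\<forall>\<^sub>F n in sequentially. T / real (Suc n) < d"
  using order_tendstoD(2)[OF tendsto_mult_right_zero[OF LIMSEQ_Suc[OF lim_1_over_n], of T] d(1)] by simp
 have "\<forall>\<^sub>F n in sequentially. (\<Prod>l\<in>{1..Suc n}. indicator {..0} (f (real l * (T / real (Suc n)))) :: real) = 0"
  using ev
 proof eventually_elim
  case (elim n)
  define q where "q = T / real (Suc n)"
  have q: "0 < q" "q < d" "real (Suc n) * q = T" using T elim by (auto simp: q_def)
  \<comment> \<open>The first mesh point at or after \<open>t0\<close>; the maximum with 1 covers
    \<open>t0 = 0\<close>, since the product starts at index 1.\<close>
  define l where "l = max 1 (nat \<lceil>t0 / q\<rceil>)"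
  have l1: "l \<ge> 1" by (simp add: l_def)
  have "t0 / q \<le> real (Suc n)" using t0 q by (simp add: pos_divide_le_eq)
  then have l2: "l \<le> Suc n" unfolding l_def by (simp add: nat_le_iff ceiling_le_iff)
  have l3: "real l * q \<le> t0 + q" "t0 \<le> real l * q"
  proof -
   have c: "real (nat \<lceil>t0 / q\<rceil>) \<le> t0 / q + 1" "t0 / q \<le> real (nat \<lceil>t0 / q\<rceil>)"
    using t0 q of_int_ceiling_le_add_one[of "t0 / q"] by (auto simp: of_nat_nat)
   have "real l \<le> t0 / q + 1" using c t0 q by (auto simp: l_def max_def)
   then have "real l * q \<le> (t0 / q + 1) * q" using q by (intro mult_right_mono) auto
   then show "real l * q \<le> t0 + q" using q by (simp add: algebra_simps)
   have "t0 / q \<le> real l" using c by (auto simp: l_def max_def)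
   then show "t0 \<le> real l * q" using q by (simp add: pos_divide_le_eq)
  qed
  have "real l * q \<le> T" using mult_right_mono[of "real l" "real (Suc n)" q] l2 q by (simp del: of_nat_Suc)
  then have "0 < f (real l * q)" using d(2)[of "real l * q"] l3 t0 q by auto
  then have "indicator {..0} (f (real l * (T / real (Suc n)))) = (0::real)" by (simp add: q_def)
  then show ?case using l1 l2 by (intro prod_zero) auto
 qed
 then show ?thesis using False by (simp only: if_False) (rule tendsto_eventually)
qed

lemma bnd_bounded:
 assumes [measurable]: "g \<in> borel_measurable borel" and "\<And>x. \<bar>g x\<bar> \<le> C"
 shows "bnd \<kappa> C g"
proof -
 have "C * 1 \<le> C * cosh (\<kappa> * x)" for x
  using assms(2)[of 0] by (intro mult_left_mono cosh_real_ge_1) (auto dest: order_trans[OF abs_ge_zero])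
 then show ?thesis using assms by (auto simp: bnd_def intro: order_trans)
qed

lemma bnd_heat: "0 < D * t ==> bnd \<kappa> (1 / sqrt (2 * pi * (D * t))) (\<lambda>z. heat D t z v)"
 by (rule bnd_bounded) (auto simp: heat_eq divide_simps)

lemma hchain_heat_le:
 assumes "0 < D" "incr s l m" "bsets A" "0 < d"
 shows "hchain D s A l m (\<lambda>z. heat D d z v) x \<le> heat D (s (l + m) - s l + d) x v"
proof (cases m)
 case 0
 then show ?thesis by simp
next
 case (Suc m')
 have b: "bnd 0 (1 / sqrt (2 * pi * (D * d))) (\<lambda>z. heat D d z v)" using assms by (intro bnd_heat) simp
 have "hchain D s A l m (\<lambda>z. heat D d z v) x \<le> hchain D s (\<lambda>_. UNIV) l m (\<lambda>z. heat D d z v) x"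
  by (rule hchain_mono[OF assms(1-3) bsets_UNIV _ b b]) auto
 also have "\<dots> = heat_op D (s (l + m) - s l) (\<lambda>z. heat D d z v) x"
  unfolding Suc by (rule hchain_UNIV[OF assms(1) _ b]) (use assms Suc in simp)
 also have "\<dots> = heat D (s (l + m) - s l + d) x v"
  unfolding heat_op_def using incr_less[OF assms(2)] Suc assms by (intro heat_ck(1)) auto
 finally show ?thesis .
qed

lemma measurable_hchain_pair:
 assumes "bsets A"
 shows "(\<lambda>(y, v). hchain D s A l m (\<lambda>z. heat D d z v) y) \<in> borel_measurable (borel \<Otimes>\<^sub>M borel)"
proof (induction m arbitrary: l)
 case (Suc m)
 define h where "h p = hchain D s A (Suc l) m (\<lambda>z. heat D d z (snd p)) (fst p)" for p
 have "h = (\<lambda>(y, v). hchain D s A (Suc l) m (\<lambda>z. heat D d z v) y)" by (auto simp: h_def)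
 then have [measurable]: "h \<in> borel_measurable (borel \<Otimes>\<^sub>M borel)" using Suc.IH[of "Suc l"] by simp
 note [measurable] = bsetsD[OF assms, of "Suc l"]
 have "(\<lambda>yv. LBINT z. heat D (s (Suc l) - s l) (fst yv) z * (indicator (A (Suc l)) z * h (z, snd yv)))
  \<in> borel_measurable (borel \<Otimes>\<^sub>M borel)"
  by measurable
 then show ?case by (simp add: case_prod_beta h_def)
qed simp

text \<open>Splitting off a free last step of length \<open>d\<close> makes the chain an integral
  operator, with density the chain of \<open>\<lambda>z. heat D d z v\<close>. Domination by the
  free heat kernel justifies Fubini.\<close>

lemma hchain_kernel:
 assumes D: "0 < D" and inc: "incr s l m" and A: "bsets A" and d: "0 < d" and f: "bnd \<kappa> C f"
 shows "hchain D s A l m (heat_op D d f) x = (LBINT v. hchain D s A l m (\<lambda>z. heat D d z v) x * f v)"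
 using inc
proof (induction m arbitrary: l x)
 case 0
 then show ?case by (simp add: heat_op_def)
next
 case (Suc m)
 let ?q = "\<lambda>y v. hchain D s A (Suc l) m (\<lambda>z. heat D d z v) y"
 let ?d = "s (Suc l) - s l"
 have dl: "0 < ?d" "0 < D * ?d" using incr_first[OF Suc.prems] D by auto
 note inc' = incr_Suc[OF Suc.prems]
 define e where "e = s (Suc l + m) - s (Suc l) + d"
 have e: "0 < e" "0 < D * e" using incr_less[OF inc'] d D by (cases m; simp add: e_def)+
 have q0: "0 \<le> ?q y v" for y v by (rule hchain_nonneg) simp
 have qle: "?q y v \<le> heat D e y v" for y v unfolding e_def by (rule hchain_heat_le[OF D inc' A d])
 have fa: "bnd \<kappa> C (\<lambda>v. \<bar>f v\<bar>)" using f by (auto simp: bnd_def)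
 have [measurable]: "f \<in> borel_measurable borel" by (rule bnd_measurable[OF f])
 note [measurable] = measurable_hchain_pair[OF A, of D s "Suc l" m d] bsetsD[OF A, of "Suc l"]
 have [measurable]: "(\<lambda>yv. ?q (fst yv) (snd yv)) \<in> borel_measurable (lborel \<Otimes>\<^sub>M lborel)"
  using measurable_hchain_pair[OF A, of D s "Suc l" m d] by (simp add: case_prod_beta)
 have qm: "(\<lambda>v. ?q y v) \<in> borel_measurable lborel" for y
  using measurable_compose[OF measurable_Pair1'[of y borel borel] measurable_hchain_pair[OF A, of D s "Suc l" m d]] by simp
 let ?F = "\<lambda>(y, v). heat D ?d x y * (indicator (A (Suc l)) y * (?q y v * f v))"
 have bq: "integrable lborel (\<lambda>v. ?q y v * f v)" for y
 proof (rule integrable_bound[OF bnd_integrable[OF e(2) fa, of y]])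
  show "AE v in lborel. norm (?q y v * f v) \<le> norm (heat D e y v * \<bar>f v\<bar>)"
   using q0 qle by (auto simp: abs_mult intro!: mult_right_mono)
  show "(\<lambda>v. ?q y v * f v) \<in> borel_measurable lborel" using qm by measurable
 qed
 have hb: "bnd \<kappa> (C * exp (D * e * \<kappa>\<^sup>2 / 2)) (heat_op D e (\<lambda>v. \<bar>f v\<bar>))" by (rule bnd_heat_op[OF e(2) fa])
 have I: "integrable (lborel \<Otimes>\<^sub>M lborel) ?F"
 proof (rule lborel_pair.Fubini_integrable)
  show m: "?F \<in> borel_measurable (lborel \<Otimes>\<^sub>M lborel)"
   by (simp add: case_prod_beta)
  show "integrable lborel (\<lambda>y. LBINT v. norm (?F (y, v)))"
  proof (rule integrable_bound[OF bnd_integrable[OF dl(2) hb, of x]])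
   show "(\<lambda>y. LBINT v. norm (?F (y, v))) \<in> borel_measurable lborel"
    using m by measurable
   show "AE y in lborel. norm (LBINT v. norm (?F (y, v))) \<le> norm (heat D ?d x y * heat_op D e (\<lambda>v. \<bar>f v\<bar>) y)"
   proof (rule AE_I2)
    fix y
    have "(LBINT v. norm (?F (y, v))) \<le> (LBINT v. heat D ?d x y * (heat D e y v * \<bar>f v\<bar>))"
    proof (rule integral_mono)
     show "integrable lborel (\<lambda>v. norm (?F (y, v)))" using bq[of y] by simp
     show "integrable lborel (\<lambda>v. heat D ?d x y * (heat D e y v * \<bar>f v\<bar>))" using bnd_integrable[OF e(2) fa, of y] by simp
     fix v
     have "\<bar>indicator (A (Suc l)) y * (?q y v * f v)\<bar> \<le> heat D e y v * \<bar>f v\<bar>"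
      using q0[where y=y and v=v] qle[where y=y and v=v] by (auto simp: abs_mult indicator_def intro!: mult_right_mono)
     then show "norm (?F (y, v)) \<le> heat D ?d x y * (heat D e y v * \<bar>f v\<bar>)"
      by (simp add: abs_mult mult_left_mono)
    qed
    also have "\<dots> = heat D ?d x y * heat_op D e (\<lambda>v. \<bar>f v\<bar>) y" by (simp add: heat_op_def)
    finally show "norm (LBINT v. norm (?F (y, v))) \<le> norm (heat D ?d x y * heat_op D e (\<lambda>v. \<bar>f v\<bar>) y)"
     by (smt (verit) integral_nonneg_AE AE_I2 norm_ge_zero real_norm_def)
   qed
  qed
  show "AE y in lborel. integrable lborel (\<lambda>v. ?F (y, v))" using bq by simp
 qed
 have "hchain D s A l (Suc m) (heat_op D d f) x = (LBINT y. heat D ?d x y * (indicator (A (Suc l)) y * hchain D s A (Suc l) m (heat_op D d f) y))"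
  by simp
 also have "\<dots> = (LBINT y. (LBINT v. heat D ?d x y * (indicator (A (Suc l)) y * (?q y v * f v))))"
  unfolding Suc.IH[OF inc'] integral_mult_right_zero ..
 also have "\<dots> = (LBINT v. (LBINT y. heat D ?d x y * (indicator (A (Suc l)) y * (?q y v * f v))))"
  using lborel_pair.Fubini_integral[of "\<lambda>y v. heat D ?d x y * (indicator (A (Suc l)) y * (?q y v * f v))"] I by simp
 also have "\<dots> = (LBINT v. (LBINT y. (heat D ?d x y * (indicator (A (Suc l)) y * ?q y v)) * f v))"
  by (simp only: mult.assoc)
 also have "\<dots> = (LBINT v. hchain D s A l (Suc m) (\<lambda>z. heat D d z v) x * f v)"
  unfolding integral_mult_left_zero by simp
 finally show ?case .
qed

text \<open>The one-step Cameron--Martin density of a linear drift of slope \<open>e\<close>: its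
  exponent is additive along a path, so the factors of consecutive steps telescope.\<close>

lemma heat_drift:
 assumes "0 < D" "0 < d"
 shows "heat D d (x + e * a) (y + e * (a + d)) = exp (- (e * (y - x)) / D - e\<^sup>2 * d / (2 * D)) * heat D d x y"
proof -
 have "-(y + e * (a + d) - (x + e * a))\<^sup>2 / (2 * (D * d)) = (- (e * (y - x)) / D - e\<^sup>2 * d / (2 * D)) + -(y - x)\<^sup>2 / (2 * (D * d))"
  using assms by (simp add: field_simps power2_eq_square)
 moreover have "0 < D * d" using assms by simp
 ultimately show ?thesis unfolding heat_eq[OF \<open>0 < D * d\<close>] by (simp only: exp_add mult_ac)
qed

text \<open>The Cameron--Martin shift by a linear function, at the level of the discretised kernels.\<close>

lemma hchain_drift:
 assumes "0 < D" "incr s l m" "0 < d"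
 shows "hchain D s (\<lambda>j. {..c j}) l m (\<lambda>z. heat D d z (v + e * (s (l + m) + d))) (x + e * s l) =
  exp (- (e * (v - x)) / D - e\<^sup>2 * (s (l + m) + d - s l) / (2 * D)) * hchain D s (\<lambda>j. {..c j - e * s j}) l m (\<lambda>z. heat D d z v) x"
 using assms(2)
proof (induction m arbitrary: l x)
 case 0
 show ?case using heat_drift[OF assms(1,3), of x e "s l" v] by simp
next
 case (Suc m)
 let ?d = "s (Suc l) - s l"
 let ?G = "\<lambda>z. heat D d z (v + e * (s (l + Suc m) + d))"
 have d: "0 < ?d" using incr_first[OF Suc.prems] by simp
 have IH: "hchain D s (\<lambda>j. {..c j}) (Suc l) m ?G (z + e * s (Suc l)) =
  exp (- (e * (v - z)) / D - e\<^sup>2 * (s (l + Suc m) + d - s (Suc l)) / (2 * D)) * hchain D s (\<lambda>j. {..c j - e * s j}) (Suc l) m (\<lambda>z. heat D d z v) z" for z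
  using Suc.IH[OF incr_Suc[OF Suc.prems], of z] by simp
 have "hchain D s (\<lambda>j. {..c j}) l (Suc m) ?G (x + e * s l) =
  (LBINT y. heat D ?d (x + e * s l) y * (indicator {..c (Suc l)} y * hchain D s (\<lambda>j. {..c j}) (Suc l) m ?G y))"
  by simp
 also have "\<dots> = (LBINT z. heat D ?d (x + e * s l) (z + e * s (Suc l)) * (indicator {..c (Suc l)} (z + e * s (Suc l)) * hchain D s (\<lambda>j. {..c j}) (Suc l) m ?G (z + e * s (Suc l))))"
  using lborel_integral_real_affine[of 1 "\<lambda>y. heat D ?d (x + e * s l) y * (indicator {..c (Suc l)} y * hchain D s (\<lambda>j. {..c j}) (Suc l) m ?G y)" "e * s (Suc l)"]
  by (simp add: add.commute[of "e * s (Suc l)"] del: chain.simps)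
 also have "\<dots> = (LBINT z. exp (- (e * (v - x)) / D - e\<^sup>2 * (s (l + Suc m) + d - s l) / (2 * D)) * (heat D ?d x z * (indicator {..c (Suc l) - e * s (Suc l)} z * hchain D s (\<lambda>j. {..c j - e * s j}) (Suc l) m (\<lambda>z. heat D d z v) z)))"
 proof (intro integral_cong refl)
  fix z
  have h: "heat D ?d (x + e * s l) (z + e * s (Suc l)) = exp (- (e * (z - x)) / D - e\<^sup>2 * ?d / (2 * D)) * heat D ?d x z"
   using heat_drift[OF assms(1) d, of x e "s l" z] by simp
  have i: "indicator {..c (Suc l)} (z + e * s (Suc l)) = (indicator {..c (Suc l) - e * s (Suc l)} z :: real)"
   by (auto simp: indicator_def)
  have ex: "(- (e * (z - x)) / D - e\<^sup>2 * ?d / (2 * D)) + (- (e * (v - z)) / D - e\<^sup>2 * (s (l + Suc m) + d - s (Suc l)) / (2 * D)) =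
   - (e * (v - x)) / D - e\<^sup>2 * (s (l + Suc m) + d - s l) / (2 * D)"
   using assms(1) by (simp add: field_simps)
  show "heat D ?d (x + e * s l) (z + e * s (Suc l)) * (indicator {..c (Suc l)} (z + e * s (Suc l)) * hchain D s (\<lambda>j. {..c j}) (Suc l) m ?G (z + e * s (Suc l)))
   = exp (- (e * (v - x)) / D - e\<^sup>2 * (s (l + Suc m) + d - s l) / (2 * D)) * (heat D ?d x z * (indicator {..c (Suc l) - e * s (Suc l)} z * hchain D s (\<lambda>j. {..c j - e * s j}) (Suc l) m (\<lambda>z. heat D d z v) z))"
   unfolding h i IH ex[symmetric] exp_add by (simp only: mult_ac)
 qed
 finally show ?case by simp
qed

text \<open>Halving the mesh adds tests at the midpoints; dropping these tests increases the kernel,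
  and the semigroup law then restores the coarse steps. \<open>m\<close> interior points become
  \<open>2 * m + 1\<close>.\<close>

lemma hchain_refine:
 assumes D: "0 < D" "0 < \<delta>" and A: "bsets A" "bsets A'" "\<And>j. A' (2 * j) = A j"
 shows "hchain D (\<lambda>l. real l * (\<delta> / 2)) A' (2 * l) (Suc (2 * m)) (\<lambda>z. heat D (\<delta> / 2) z v) x \<le>
  hchain D (\<lambda>l. real l * \<delta>) A l m (\<lambda>z. heat D \<delta> z v) x"
proof (induction m arbitrary: l x)
 let ?s' = "\<lambda>l. real l * (\<delta> / 2)" and ?s = "\<lambda>l. real l * \<delta>"
 have Dd: "0 < D * (\<delta> / 2)" using D by simp
 have d': "?s' (Suc l) - ?s' l = \<delta> / 2" for l by (simp add: algebra_simps)
 have d: "?s (Suc l) - ?s l = \<delta>" for l by (simp add: algebra_simps)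
 have inc: "incr ?s' l m" "incr ?s l m" for l m using D by (auto simp: incr_def)
 have inc0: "incr ?s' l m" "incr ?s l m" for l m using D by (auto simp: incr_def)
 have step': "hchain D ?s' A' l (Suc m) g = heat_op D (\<delta> / 2) (\<lambda>y. indicator (A' (Suc l)) y * hchain D ?s' A' (Suc l) m g y)" for l m g
  using hchain_Suc[of D ?s' A' l m g] unfolding d' .
 have step: "hchain D ?s A l (Suc m) g = heat_op D \<delta> (\<lambda>y. indicator (A (Suc l)) y * hchain D ?s A (Suc l) m g y)" for l m g
  using hchain_Suc[of D ?s A l m g] unfolding d .
 have b: "bnd 0 (1 / sqrt (2 * pi * (D * (\<delta> / 2)))) (\<lambda>z. heat D (\<delta> / 2) z v)" by (rule bnd_heat[OF Dd])
 have b2: "bnd 0 (1 / sqrt (2 * pi * (D * \<delta>))) (\<lambda>z. heat D \<delta> z v)" using D by (intro bnd_heat) simp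
 have Ddd: "0 < D * \<delta>" using D by simp
 {
  case 0
  have "hchain D ?s' A' (2 * l) (Suc (2 * 0)) (\<lambda>z. heat D (\<delta> / 2) z v) x = heat_op D (\<delta> / 2) (\<lambda>y. indicator (A' (Suc (2 * l))) y * heat D (\<delta> / 2) y v) x"
   unfolding step' by simp
  also have "\<dots> \<le> heat_op D (\<delta> / 2) (\<lambda>y. heat D (\<delta> / 2) y v) x"
   by (rule heat_op_mono[OF Dd bnd_indicator_mult[OF b bsetsD[OF A(2)]] b]) (simp add: indicator_def)
  also have "\<dots> = heat D \<delta> x v" unfolding heat_op_def using heat_ck(1)[OF D(1), of "\<delta> / 2" "\<delta> / 2" x v] D by simp
  finally show ?case by simp
 next
  case (Suc m)
  let ?h = "hchain D ?s' A' (2 * Suc l) (Suc (2 * m)) (\<lambda>z. heat D (\<delta> / 2) z v)"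
  let ?k = "hchain D ?s A (Suc l) m (\<lambda>z. heat D \<delta> z v)"
  obtain C1 where bh: "bnd 0 C1 ?h" using bnd_hchain[OF D(1) inc(1) A(2) b] by blast
  obtain C2 where bk: "bnd 0 C2 ?k" using bnd_hchain[OF D(1) inc(2) A(1) b2] by blast
  have h0: "0 \<le> ?h y" for y by (rule hchain_nonneg) simp
  have bih: "bnd 0 C1 (\<lambda>y. indicator (A (Suc l)) y * ?h y)" by (rule bnd_indicator_mult[OF bh bsetsD[OF A(1)]])
  have bP: "bnd 0 (C1 * exp (D * (\<delta> / 2) * 0\<^sup>2 / 2)) (heat_op D (\<delta> / 2) (\<lambda>y. indicator (A (Suc l)) y * ?h y))"
   by (rule bnd_heat_op[OF Dd bih])
  have "Suc (2 * Suc m) = Suc (Suc (Suc (2 * m)))" "2 * Suc l = Suc (Suc (2 * l))" by simp_all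
  then have "hchain D ?s' A' (2 * l) (Suc (2 * Suc m)) (\<lambda>z. heat D (\<delta> / 2) z v) x =
   heat_op D (\<delta> / 2) (\<lambda>y. indicator (A' (Suc (2 * l))) y * heat_op D (\<delta> / 2) (\<lambda>y. indicator (A (Suc l)) y * ?h y) y) x"
   using A(3)[of "Suc l"] by (simp only: step')
  also have "\<dots> \<le> heat_op D (\<delta> / 2) (heat_op D (\<delta> / 2) (\<lambda>y. indicator (A (Suc l)) y * ?h y)) x"
   by (rule heat_op_mono[OF Dd bnd_indicator_mult[OF bP bsetsD[OF A(2)]] bP])
    (use heat_op_nonneg[of "\<lambda>y. indicator (A (Suc l)) y * ?h y"] h0 in \<open>auto simp: indicator_def\<close>)
  also have "\<dots> = heat_op D \<delta> (\<lambda>y. indicator (A (Suc l)) y * ?h y) x"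
   using heat_op_semigroup[OF D(1) _ _ bih, of "\<delta> / 2" "\<delta> / 2" x] D by simp
  also have "\<dots> \<le> heat_op D \<delta> (\<lambda>y. indicator (A (Suc l)) y * ?k y) x"
   by (rule heat_op_mono[OF Ddd bih bnd_indicator_mult[OF bk bsetsD[OF A(1)]]]) (rule mult_left_mono[OF Suc.IH], simp)
  also have "\<dots> = hchain D ?s A l (Suc m) (\<lambda>z. heat D \<delta> z v) x" by (simp only: step)
  finally show ?case .
 }
qed

text \<open>The expectation of \<open>g\<close> at the end of a path from \<open>u\<close> that is
  absorbed above \<open>b\<close>; the time argument of \<open>b\<close> runs from the start of the
  path.\<close>

definition killed_op :: "'b measure => (real => 'b => real) => (real => real) => real => (real => real) => real => real" where
 "killed_op M W b T g u = (\<integral>\<omega>. (if \<forall>t\<in>{0..T}. u + W t \<omega> \<le> b t then g (u + W T \<omega>) else 0) \<partial>M)"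

text \<open>Near \<open>v\<close> the integral is a constant, the mass below \<open>v - 1\<close>,
  plus an integral over a compact interval. Continuity at the single point \<open>v\<close>
  suffices, which matters because the densities below may have jumps.\<close>

lemma has_real_derivative_integral_atMost:
 fixes f :: "real => real"
 assumes f: "integrable lborel f" and c: "isCont f v"
 shows "((\<lambda>x. LBINT y. indicator {..x} y * f y) has_real_derivative f v) (at v)"
proof -
 let ?a = "v - 1" and ?b = "v + 1"
 have si: "set_integrable lborel S f" if "S \<in> sets borel" for S
  using f that unfolding set_integrable_def by (intro integrable_mult_indicator) auto
 have ei: "f integrable_on {?a..?b}" using set_borel_integral_eq_integral(1)[OF si[of "{?a..?b}"]] by simp
 have "((\<lambda>x. integral {?a..x} f) has_vector_derivative f v) (at v within {?a..?b} - {})"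
  using c by (intro integral_has_vector_derivative_continuous_at[OF ei]) (auto intro: continuous_at_imp_continuous_at_within)
 then have "((\<lambda>x. integral {?a..x} f) has_real_derivative f v) (at v within {?a..?b})"
  by (simp add: has_real_derivative_iff_has_vector_derivative)
 then have "((\<lambda>x. integral {?a..x} f) has_real_derivative f v) (at v)"
  using at_within_interior[of v "{?a..?b}"] by simp
 then have d: "((\<lambda>x. (LBINT y. indicator {..<?a} y * f y) + integral {?a..x} f) has_real_derivative f v) (at v)"
  by (auto intro!: derivative_eq_intros)
 have eq: "(LBINT y. indicator {..x} y * f y) = (LBINT y. indicator {..<?a} y * f y) + integral {?a..x} f" if "x \<in> {?a<..<?b}" for x
 proof -
  have "integral {?a..x} f = (LINT y:{?a..x}|lborel. f y)"
   using set_borel_integral_eq_integral(2)[OF si[of "{?a..x}"]] by simp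
  also have "\<dots> = (LBINT y. indicator {?a..x} y * f y)" by (simp add: set_lebesgue_integral_def)
  finally have e: "integral {?a..x} f = (LBINT y. indicator {?a..x} y * f y)" .
  have "(LBINT y. indicator {..<?a} y * f y) + (LBINT y. indicator {?a..x} y * f y) = (LBINT y. indicator {..<?a} y * f y + indicator {?a..x} y * f y)"
   using si[of "{..<?a}"] si[of "{?a..x}"] unfolding set_integrable_def by (intro integral_add[symmetric]) auto
  also have "\<dots> = (LBINT y. indicator {..x} y * f y)"
   using that by (intro integral_cong refl) (auto simp: indicator_def)
  finally show ?thesis unfolding e by simp
 qed
 show ?thesis
  by (rule has_field_derivative_transform_within_open[OF d, of "{?a<..<?b}"]) (use eq in auto)
qed

context
 fixes M :: "'b measure" and W :: "real => 'b => real" and D T :: real and b :: "real => real"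
 assumes bm: "brownian_motion M D W" and D: "0 < D" and T: "0 < T" and b: "continuous_on {0..T} b"
begin

lemma mesh_path_tendsto:
 assumes "\<omega> \<in> space M"
 shows "(\<lambda>n. \<Prod>l\<in>{1..Suc n}. indicator {..b (real l * (T / real (Suc n)))} (u + W (real l * (T / real (Suc n))) \<omega>) :: real)
  \<longlonglongrightarrow> (if \<forall>t\<in>{0..T}. u + W t \<omega> \<le> b t then 1 else 0)"
proof -
 have "continuous_on {0..T} (\<lambda>t. u + W t \<omega> - b t)"
  by (intro continuous_intros b continuous_on_subset[OF bm_continuous[OF bm D assms]]) auto
 from mesh_indicator_tendsto[OF T this]
 show ?thesis by (simp add: indicator_def)
qed

lemma mesh_time_measurable: "W (real l * (T / real (Suc n))) \<in> borel_measurable M"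
 using T by (intro bm_measurable[OF bm D]) (simp add: zero_le_mult_iff)

lemma killed_event_measurable: "(\<lambda>\<omega>. if \<forall>t\<in>{0..T}. u + W t \<omega> \<le> b t then 1 else 0 :: real) \<in> borel_measurable M"
proof (rule borel_measurable_LIMSEQ_real[OF mesh_path_tendsto])
 fix n
 note [measurable] = mesh_time_measurable
 show "(\<lambda>\<omega>. \<Prod>l\<in>{1..Suc n}. indicator {..b (real l * (T / real (Suc n)))} (u + W (real l * (T / real (Suc n))) \<omega>) :: real) \<in> borel_measurable M"
  by measurable
qed

lemma killed_integrable:
 assumes g: "bnd \<kappa> C g"
 shows "integrable M (\<lambda>\<omega>. if \<forall>t\<in>{0..T}. u + W t \<omega> \<le> b t then g (u + W T \<omega>) else 0)"
proof -
 have [measurable]: "g \<in> borel_measurable borel" by (rule bnd_measurable[OF g])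
 have [measurable]: "W T \<in> borel_measurable M" using T by (intro bm_measurable[OF bm D]) simp
 note [measurable] = killed_event_measurable
 have eq: "(if \<forall>t\<in>{0..T}. u + W t \<omega> \<le> b t then g (u + W T \<omega>) else 0) = (if \<forall>t\<in>{0..T}. u + W t \<omega> \<le> b t then 1 else 0) * g (u + W T \<omega>)" for \<omega>
  by simp
 show ?thesis
  unfolding eq
 proof (rule integrable_bound[OF bm_integrable[OF bm D T g, of u]])
  show "(\<lambda>\<omega>. (if \<forall>t\<in>{0..T}. u + W t \<omega> \<le> b t then 1 else 0) * g (u + W T \<omega>)) \<in> borel_measurable M"
   by (rule borel_measurable_times[OF killed_event_measurable]) measurable
 qed auto
qed

lemma incr_mesh: "incr (\<lambda>l. real l * (T / real (Suc n))) l m"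
proof -
 have "0 < T / real (Suc n)" using T by simp
 then show ?thesis unfolding incr_def by (auto intro!: mult_strict_right_mono simp del: times_divide_eq_right)
qed

text \<open>Path continuity turns the tests at mesh times into a condition at all times, and
  \<open>C * cosh\<close> of the endpoint dominates. The terminal functions may vary with the
  mesh.\<close>

lemma killed_op_tendsto:
 assumes g: "\<And>n. bnd \<kappa> C (g n)" and lim: "\<And>x. (\<lambda>n. g n x) \<longlonglongrightarrow> g' x"
 shows "(\<lambda>n. hchain D (\<lambda>l. real l * (T / real (Suc n))) (\<lambda>l. {..b (real l * (T / real (Suc n)))}) 0 (Suc n) (g n) u) \<longlonglongrightarrow> killed_op M W b T g' u"
proof -
 let ?I = "\<lambda>n \<omega>. (\<Prod>l\<in>{1..Suc n}. indicator {..b (real l * (T / real (Suc n)))} (u + W (real l * (T / real (Suc n))) \<omega>)) :: real"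
 have eq: "hchain D (\<lambda>l. real l * (T / real (Suc n))) (\<lambda>l. {..b (real l * (T / real (Suc n)))}) 0 (Suc n) (g n) u = (\<integral>\<omega>. ?I n \<omega> * g n (u + W T \<omega>) \<partial>M)" for n
 proof -
  have "(\<integral>\<omega>. ?I n \<omega> * g n (u + W (real (Suc n) * (T / real (Suc n))) \<omega>) \<partial>M) =
   hchain D (\<lambda>l. real l * (T / real (Suc n))) (\<lambda>l. {..b (real l * (T / real (Suc n)))}) 0 (Suc n) (g n) u"
   by (rule bm_chain[OF bm D _ _ incr_mesh _ g]) (auto simp: bsets_def)
  then show ?thesis by simp
 qed
 have g': "bnd \<kappa> C g'" by (rule bnd_lim[OF g lim])
 have [measurable]: "g n \<in> borel_measurable borel" for n by (rule bnd_measurable[OF g])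
 have [measurable]: "W T \<in> borel_measurable M" using T by (intro bm_measurable[OF bm D]) simp
 note [measurable] = mesh_time_measurable
 have bc: "bnd \<kappa> C (\<lambda>x. C * cosh (\<kappa> * x))"
  using bnd_const_nonneg[OF g[of 0]]
  by (auto simp: bnd_def abs_mult intro!: borel_measurable_continuous_onI continuous_intros)
 have "(\<lambda>n. \<integral>\<omega>. ?I n \<omega> * g n (u + W T \<omega>) \<partial>M) \<longlonglongrightarrow> (\<integral>\<omega>. (if \<forall>t\<in>{0..T}. u + W t \<omega> \<le> b t then g' (u + W T \<omega>) else 0) \<partial>M)"
 proof (rule integral_dominated_convergence)
  show "integrable M (\<lambda>\<omega>. C * cosh (\<kappa> * (u + W T \<omega>)))" by (rule bm_integrable[OF bm D T bc])
  show "(\<lambda>\<omega>. if \<forall>t\<in>{0..T}. u + W t \<omega> \<le> b t then g' (u + W T \<omega>) else 0) \<in> borel_measurable M"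
   using killed_integrable[OF g'] by (rule borel_measurable_integrable)
  show "AE \<omega> in M. (\<lambda>n. ?I n \<omega> * g n (u + W T \<omega>)) \<longlonglongrightarrow> (if \<forall>t\<in>{0..T}. u + W t \<omega> \<le> b t then g' (u + W T \<omega>) else 0)"
  proof (rule AE_I2)
   fix \<omega> assume "\<omega> \<in> space M"
   have ifm: "(if P then 1 else 0) * x = (if P then x else 0)" for P and x :: real by simp
   from tendsto_mult[OF mesh_path_tendsto[OF \<open>\<omega> \<in> space M\<close>, of u] lim[of "u + W T \<omega>"]]
   show "(\<lambda>n. ?I n \<omega> * g n (u + W T \<omega>)) \<longlonglongrightarrow> (if \<forall>t\<in>{0..T}. u + W t \<omega> \<le> b t then g' (u + W T \<omega>) else 0)"
    unfolding ifm .
  qed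
  show "AE \<omega> in M. norm (?I n \<omega> * g n (u + W T \<omega>)) \<le> C * cosh (\<kappa> * (u + W T \<omega>))" for n
  proof (rule AE_I2)
   fix \<omega>
   have "0 \<le> ?I n \<omega>" "?I n \<omega> \<le> 1" by (auto intro!: prod_nonneg prod_le_1 simp del: prod.cl_ivl_Suc)
   then have "norm (?I n \<omega> * g n (u + W T \<omega>)) \<le> \<bar>g n (u + W T \<omega>)\<bar>"
    unfolding real_norm_def abs_mult by (intro mult_left_le_one_le) (simp_all only: abs_of_nonneg abs_ge_zero)
   also have "\<dots> \<le> C * cosh (\<kappa> * (u + W T \<omega>))" by (rule bndD[OF g])
   finally show "norm (?I n \<omega> * g n (u + W T \<omega>)) \<le> C * cosh (\<kappa> * (u + W T \<omega>))" .
  qed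
 qed measurable
 then show ?thesis unfolding eq killed_op_def .
qed

lemma bnd_killed_op:
 assumes g: "bnd \<kappa> C g"
 shows "bnd \<kappa> (C * exp (D * T * \<kappa>\<^sup>2 / 2)) (killed_op M W b T g)"
proof (rule bnd_lim)
 fix n
 have "bnd \<kappa> (C * exp (D * (real (0 + Suc n) * (T / real (Suc n)) - real 0 * (T / real (Suc n))) * \<kappa>\<^sup>2 / 2))
  (hchain D (\<lambda>l. real l * (T / real (Suc n))) (\<lambda>l. {..b (real l * (T / real (Suc n)))}) 0 (Suc n) g)"
  by (rule bnd_hchain[OF D incr_mesh _ g]) (simp add: bsets_def)
 then show "bnd \<kappa> (C * exp (D * T * \<kappa>\<^sup>2 / 2)) (hchain D (\<lambda>l. real l * (T / real (Suc n))) (\<lambda>l. {..b (real l * (T / real (Suc n)))}) 0 (Suc n) g)"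
  by (simp del: chain.simps)
next
 show "(\<lambda>n. hchain D (\<lambda>l. real l * (T / real (Suc n))) (\<lambda>l. {..b (real l * (T / real (Suc n)))}) 0 (Suc n) g x) \<longlonglongrightarrow> killed_op M W b T g x" for x
  by (rule killed_op_tendsto[OF g]) simp
qed

text \<open>On the nested dyadic meshes the transition densities decrease, and by the Cameron--Martin
 shift their ratio to the heat kernel is antitone in the endpoint; both pass to the limit.\<close>

lemma killed_op_kernel:
 obtains q :: "real => real => real" where
  "\<And>u v. 0 \<le> q u v" "\<And>u v. q u v \<le> heat D T u v" "\<And>u. q u \<in> borel_measurable borel"
  "\<And>u. countable {v. \<not> isCont (q u) v}"
  "\<And>\<kappa> C g u. bnd \<kappa> C g ==> killed_op M W b T g u = (LBINT v. q u v * (indicator {..b T} v * g v))"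
proof -
 \<comment> \<open>\<open>Nn p\<close> counts the interior mesh points of a division into
   \<open>2 ^ p\<close> steps; the last step is left free to obtain a density.\<close>
 define Nn :: "nat => nat" where "Nn p = 2 ^ p - 1" for p
 have Nn: "Suc (Nn p) = 2 ^ p" for p by (simp add: Nn_def)
 define \<delta> where "\<delta> p = T / real (Suc (Nn p))" for p
 have \<delta>: "0 < \<delta> p" for p using T by (simp add: \<delta>_def)
 define A where "A p l = {..b (real l * \<delta> p)}" for p and l :: nat
 have bA: "bsets (A p)" for p by (simp add: bsets_def A_def)
 define Q where "Q p u v = hchain D (\<lambda>l. real l * \<delta> p) (A p) 0 (Nn p) (\<lambda>z. heat D (\<delta> p) z v) u" for p u v
 have inc: "incr (\<lambda>l. real l * \<delta> p) l m" for p l m unfolding \<delta>_def by (rule incr_mesh)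
 have tot: "real (Nn p) * \<delta> p + \<delta> p = T" for p
 proof -
  have "real (Nn p) * \<delta> p + \<delta> p = real (Suc (Nn p)) * \<delta> p" by (simp add: algebra_simps)
  then show ?thesis by (simp add: \<delta>_def del: of_nat_Suc)
 qed
 have Q0: "0 \<le> Q p u v" for p u v unfolding Q_def by (rule hchain_nonneg) simp
 have Qle: "Q p u v \<le> heat D T u v" for p u v
  using hchain_heat_le[OF D inc[of p 0 "Nn p"] bA[of p] \<delta>[of p], of v u] tot[of p] unfolding Q_def by (simp only: add_0 of_nat_0 mult_zero_left diff_zero)
 have Qdec: "Q (Suc p) u v \<le> Q p u v" for p u v
 proof -
  have h: "\<delta> (Suc p) = \<delta> p / 2" unfolding \<delta>_def Nn by simp
  have n: "Nn (Suc p) = Suc (2 * Nn p)" using Nn[of p] Nn[of "Suc p"] by simp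
  have "A (Suc p) (2 * j) = A p j" for j unfolding A_def h by (simp add: mult.assoc)
  from hchain_refine[OF D \<delta>[of p] bA[of p] bA[of "Suc p"] this, of 0 "Nn p" v u]
  show ?thesis unfolding Q_def h n by (simp del: chain.simps)
 qed
 have "\<exists>l. (\<lambda>p. Q p u v) \<longlonglongrightarrow> l" for u v
  using decseq_convergent[of "\<lambda>p. Q p u v" 0] Q0 Qdec by (metis decseq_SucI)
 then obtain q where q: "\<And>u v. (\<lambda>p. Q p u v) \<longlonglongrightarrow> q u v" by metis
 have q0: "0 \<le> q u v" for u v by (rule LIMSEQ_le_const[OF q]) (use Q0 in auto)
 have qle: "q u v \<le> heat D T u v" for u v by (rule LIMSEQ_le_const2[OF q]) (use Qle in auto)
 have Qm: "(\<lambda>v. Q p u v) \<in> borel_measurable borel" for p u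
  using measurable_compose[OF measurable_Pair1'[of u borel borel] measurable_hchain_pair[OF bA[of p], of D "\<lambda>l. real l * \<delta> p" 0 "Nn p" "\<delta> p"]]
  unfolding Q_def by (simp only: prod.case space_borel UNIV_I)
 have qm: "q u \<in> borel_measurable borel" for u by (rule borel_measurable_LIMSEQ_real[OF q Qm])
 have DT: "0 < D * T" using D T by simp
 have hpos: "0 < heat D T u v" for u v by (rule heat_pos[OF DT])
 have Qratio: "Q p u v' / heat D T u v' \<le> Q p u v / heat D T u v" if "v \<le> v'" for p u v v'
 proof -
  \<comment> \<open>The linear drift of slope \<open>e\<close> moves the endpoint from
    \<open>v\<close> to \<open>v'\<close> and fixes the start. As \<open>e \<ge> 0\<close>, undoing
    it lowers the barrier, so the chain decreases; the exponential factor is the same for the free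
    kernel and cancels in the ratio.\<close>
  define e where "e = (v' - v) / T"
  have e: "0 \<le> e" "v' = v + e * T" using that T by (simp_all add: e_def)
  let ?E = "exp (- (e * (v - u)) / D - e\<^sup>2 * T / (2 * D))"
  let ?Q' = "hchain D (\<lambda>l. real l * \<delta> p) (\<lambda>j. {..b (real j * \<delta> p) - e * (real j * \<delta> p)}) 0 (Nn p) (\<lambda>z. heat D (\<delta> p) z v) u"
  have t: "real (0 + Nn p) * \<delta> p + \<delta> p = T" using tot by simp
  have "Q p u v' = ?E * ?Q'"
   using hchain_drift[OF D inc[of p 0 "Nn p"] \<delta>[of p], of "\<lambda>j. b (real j * \<delta> p)" v e u]
   unfolding t e(2) Q_def A_def by simp
  moreover have "heat D T u v' = ?E * heat D T u v"
   using heat_drift[OF D T, of u e 0 v] unfolding e(2) by simp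
  moreover have "?Q' \<le> Q p u v"
   unfolding Q_def
  proof (rule hchain_mono[OF D inc _ bA])
   show "bsets (\<lambda>j. {..b (real j * \<delta> p) - e * (real j * \<delta> p)})" by (simp add: bsets_def)
   show "{..b (real j * \<delta> p) - e * (real j * \<delta> p)} \<subseteq> A p j" for j
    using e(1) \<delta>[of p] by (auto simp: A_def intro: order_trans)
   show "bnd 0 (1 / sqrt (2 * pi * (D * \<delta> p))) (\<lambda>z. heat D (\<delta> p) z v)" using D \<delta>[of p] by (intro bnd_heat) simp
   then show "bnd 0 (1 / sqrt (2 * pi * (D * \<delta> p))) (\<lambda>z. heat D (\<delta> p) z v)" .
  qed auto
  ultimately show ?thesis using hpos[of u v] by (simp add: divide_right_mono)
 qed
 have qratio: "q u v' / heat D T u v' \<le> q u v / heat D T u v" if "v \<le> v'" for u v v'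
  by (rule LIMSEQ_le[OF tendsto_divide[OF q tendsto_const] tendsto_divide[OF q tendsto_const]])
   (use Qratio[OF that] hpos[of u v] hpos[of u v'] in auto)
 have cnt: "countable {v. \<not> isCont (q u) v}" for u
 proof -
  \<comment> \<open>A monotone function has countably many discontinuities, and the heat kernel is
    continuous and positive, so the density inherits this.\<close>
  have "mono (\<lambda>v. - (q u v / heat D T u v))" by (rule monoI) (use qratio in simp)
  then have c: "countable {v. \<not> isCont (\<lambda>v. - (q u v / heat D T u v)) v}" by (rule mono_ctble_discont)
  have hc: "isCont (heat D T u) v" for v
   unfolding heat_eq[OF DT, abs_def] using DT by (intro continuous_intros) auto
  have "isCont (q u) v" if "isCont (\<lambda>v. - (q u v / heat D T u v)) v" for v
  proof -
   have "isCont (\<lambda>v. - (- (q u v / heat D T u v)) * heat D T u v) v"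
    by (intro continuous_intros that hc)
   moreover have "(\<lambda>v. - (- (q u v / heat D T u v)) * heat D T u v) = q u" using hpos[of u] by (auto simp: fun_eq_iff less_imp_neq[symmetric])
   ultimately show ?thesis by simp
  qed
  then show ?thesis by (intro countable_subset[OF _ c]) auto
 qed
 have op: "killed_op M W b T g u = (LBINT v. q u v * (indicator {..b T} v * g v))" if g: "bnd \<kappa> C g" for \<kappa> C g u
 proof -
  have [measurable]: "g \<in> borel_measurable borel" by (rule bnd_measurable[OF g])
  note [measurable] = qm Qm
  have ig: "bnd \<kappa> C (\<lambda>v. indicator {..b T} v * g v)" by (rule bnd_indicator_mult[OF g]) simp
  have iga: "bnd \<kappa> C (\<lambda>v. \<bar>indicator {..b T} v * g v\<bar>)" using ig unfolding bnd_def by auto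
  \<comment> \<open>The meshes of the killed-path limit include the dyadic ones as a
    subsequence.\<close>
  have "filterlim Nn sequentially sequentially"
   by (rule filterlim_subseq) (auto simp: strict_mono_def Nn_def intro!: diff_less_mono)
  then have "(\<lambda>p. hchain D (\<lambda>l. real l * \<delta> p) (A p) 0 (Suc (Nn p)) g u) \<longlonglongrightarrow> killed_op M W b T g u"
   using filterlim_compose[OF killed_op_tendsto[OF g tendsto_const, of u]] unfolding \<delta>_def A_def by simp
  moreover have "hchain D (\<lambda>l. real l * \<delta> p) (A p) 0 (Suc (Nn p)) g u = (LBINT v. Q p u v * (indicator {..b T} v * g v))" for p
  proof -
   have AT: "A p (Suc (Nn p)) = {..b T}" unfolding A_def \<delta>_def by simp
   have "chain (\<lambda>l. heat D (real (Suc l) * \<delta> p - real l * \<delta> p)) (A p) (0 + Nn p) 1 g = heat_op D (\<delta> p) (\<lambda>v. indicator {..b T} v * g v)"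
    unfolding chain_1 heat_op_def by (rule ext) (simp add: chain_1 AT heat_op_def algebra_simps)
   then have "hchain D (\<lambda>l. real l * \<delta> p) (A p) 0 (Suc (Nn p)) g u = hchain D (\<lambda>l. real l * \<delta> p) (A p) 0 (Nn p) (heat_op D (\<delta> p) (\<lambda>v. indicator {..b T} v * g v)) u"
    unfolding chain_snoc by simp
   also have "\<dots> = (LBINT v. Q p u v * (indicator {..b T} v * g v))"
    unfolding Q_def by (rule hchain_kernel[OF D inc bA \<delta> ig])
   finally show ?thesis .
  qed
  ultimately have 1: "(\<lambda>p. LBINT v. Q p u v * (indicator {..b T} v * g v)) \<longlonglongrightarrow> killed_op M W b T g u" by simp
  have 2: "(\<lambda>p. LBINT v. Q p u v * (indicator {..b T} v * g v)) \<longlonglongrightarrow> (LBINT v. q u v * (indicator {..b T} v * g v))"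
  proof (rule integral_dominated_convergence)
   show "integrable lborel (\<lambda>v. heat D T u v * \<bar>indicator {..b T} v * g v\<bar>)" by (rule bnd_integrable[OF DT iga])
   show "AE v in lborel. (\<lambda>p. Q p u v * (indicator {..b T} v * g v)) \<longlonglongrightarrow> q u v * (indicator {..b T} v * g v)"
    by (intro AE_I2 tendsto_mult q tendsto_const)
   show "AE v in lborel. norm (Q p u v * (indicator {..b T} v * g v)) \<le> heat D T u v * \<bar>indicator {..b T} v * g v\<bar>" for p
    using Q0[of p u] Qle[of p u] by (intro AE_I2) (auto simp: abs_mult intro!: mult_right_mono)
  qed measurable
  show ?thesis by (rule LIMSEQ_unique[OF 1 2])
 qed
 show ?thesis by (rule that[OF q0 qle qm cnt op])
qed

end

section \<open>Hermite functions and contour integrals\<close>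

text \<open>\<open>He n p q\<close> is the coefficient of \<open>Z^n\<close> in \<open>exp (p Z - q Z^2 / 2)\<close>.\<close>

fun He :: "nat => 'a::field_char_0 => 'a => 'a" where
 "He 0 p q = 1"
| "He (Suc 0) p q = p"
| "He (Suc (Suc n)) p q = (p * He (Suc n) p q - q * He n p q) / of_nat (n + 2)"

lemma of_real_He: "of_real (He n p q) = (He n (of_real p) (of_real q) :: complex)"
 by (induction n p q rule: He.induct) simp_all

lemma He_zero: "He n p 0 = p ^ n / fact n"
 by (induction n p "0::'a" rule: He.induct) (auto simp: field_simps)

lemma He_abs_le: "\<bar>He n p q\<bar> \<le> (\<bar>p\<bar> + \<bar>q\<bar> + 1 :: real) ^ n"
proof (induction n p q rule: He.induct)
 case (3 n p q)
 let ?A = "\<bar>p\<bar> + \<bar>q\<bar> + 1"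
 have "\<bar>He (Suc (Suc n)) p q\<bar> \<le> \<bar>p * He (Suc n) p q - q * He n p q\<bar>"
  by (simp add: abs_divide divide_le_eq)
   (metis abs_ge_zero add.commute le_add_same_cancel1 mult.right_neutral mult_left_mono of_nat_0_le_iff one_le_numeral add_increasing)
 also have "\<dots> \<le> \<bar>p\<bar> * \<bar>He (Suc n) p q\<bar> + \<bar>q\<bar> * \<bar>He n p q\<bar>"
  by (metis abs_mult abs_triangle_ineq4)
 also have "\<dots> \<le> \<bar>p\<bar> * ?A ^ Suc n + \<bar>q\<bar> * ?A ^ Suc n"
 proof (intro add_mono mult_left_mono)
  show "\<bar>He (Suc n) p q\<bar> \<le> ?A ^ Suc n" by (rule 3(1))
  have "?A ^ n \<le> ?A ^ Suc n" by (rule power_increasing) auto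
  with 3(2) show "\<bar>He n p q\<bar> \<le> ?A ^ Suc n" by (rule order_trans)
 qed auto
 also have "\<dots> \<le> ?A ^ Suc (Suc n)" by (simp add: algebra_simps)
 finally show ?case .
qed auto

lemma continuous_on_He[continuous_intros]:
 fixes f g :: "'a::topological_space => real"
 assumes "continuous_on A f" "continuous_on A g"
 shows "continuous_on A (\<lambda>x. He n (f x) (g x))"
proof (induction n rule: less_induct)
 case (less n)
 show ?case
 proof (cases n)
  case (Suc m)
  then show ?thesis using less[of m] less[of "m - 1"] assms
   by (cases m) (auto intro!: continuous_intros)
 qed simp
qed

lemma measurable_He[measurable]: "(\<lambda>p. He n p q) \<in> borel_measurable (borel :: real measure)"
 by (intro borel_measurable_continuous_onI continuous_intros)

lemma circle0_int_eq: "circle0_int F = (LBINT \<theta>. indicator {0..2*pi} \<theta> *\<^sub>R (F (cis \<theta>) * (\<i> * cis \<theta>)))"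
 unfolding circle0_int_def zero_ereal_def by (subst interval_integral_Icc) (auto simp: set_lebesgue_integral_def)

lemma cis_continuous: "continuous_on A cis"
 unfolding cis_conv_exp[abs_def] by (intro continuous_intros)

lemma circle0_continuous:
 assumes "continuous_on (sphere 0 1) F"
 shows "continuous_on {0..2*pi} (\<lambda>\<theta>. F (cis \<theta>) * (\<i> * cis \<theta>))"
 by (intro continuous_intros continuous_on_compose2[OF assms cis_continuous] cis_continuous) auto

lemma circle0_integrable:
 assumes "continuous_on (sphere 0 1) F"
 shows "integrable lborel (\<lambda>\<theta>. indicator {0..2*pi} \<theta> *\<^sub>R (F (cis \<theta>) * (\<i> * cis \<theta>)))"
 using borel_integrable_compact[OF _ circle0_continuous[OF assms]] by (simp add: indicator_scaleR_eq_if)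

lemma circle0_int_diff:
 assumes "continuous_on (sphere 0 1) F" "continuous_on (sphere 0 1) G"
 shows "circle0_int (\<lambda>Z. F Z - G Z) = circle0_int F - circle0_int G"
 unfolding circle0_int_eq
 by (subst integral_diff[OF circle0_integrable[OF assms(1)] circle0_integrable[OF assms(2)], symmetric])
  (simp add: algebra_simps scaleR_diff_right)

lemma circle0_int_cmult: "circle0_int (\<lambda>Z. c * F Z) = c * circle0_int F"
 unfolding circle0_int_eq
 by (subst integral_mult_right_zero[symmetric]) (simp add: mult.assoc)

lemma circle0_int_cong:
 assumes "\<And>Z. norm Z = 1 ==> F Z = G Z" shows "circle0_int F = circle0_int G"
 unfolding circle0_int_eq by (intro integral_cong refl) (simp add: assms)

lemma circle0_int_contour:
 assumes "continuous_on (sphere 0 1) F" "(F has_contour_integral I) (circlepath 0 1)"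
 shows "circle0_int F = I"
proof -
 have "((\<lambda>t. F (cis t) * (\<i> * cis t)) has_integral I) {0..2*pi}"
  using assms(2) has_contour_integral_part_circlepath_iff[of 0 "2*pi" F I 0 1]
  unfolding circlepath_def by (simp add: mult.assoc)
 moreover have "set_integrable lborel {0..2*pi} (\<lambda>t. F (cis t) * (\<i> * cis t))"
  using circle0_integrable[OF assms(1)] unfolding set_integrable_def .
 ultimately show ?thesis
  using set_borel_integral_eq_integral(2)[of "{0..2*pi}" "\<lambda>t. F (cis t) * (\<i> * cis t)"]
  by (simp add: circle0_int_eq set_lebesgue_integral_def integral_unique)
qed

lemma circle0_coeff:
 assumes "f holomorphic_on UNIV"
 shows "1 / (2 * of_real pi * \<i>) * circle0_int (\<lambda>Z. inverse (Z ^ (n + 1)) * f Z) = (deriv ^^ n) f 0 / fact n"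
proof -
 have cf: "continuous_on A f" for A using assms holomorphic_on_imp_continuous_on continuous_on_subset by blast
 have "((\<lambda>u. f u / (u - 0) ^ Suc n) has_contour_integral ((2 * pi * \<i>) / fact n * (deriv ^^ n) f 0)) (circlepath 0 1)"
  by (rule Cauchy_has_contour_integral_higher_derivative_circlepath) (use assms cf holomorphic_on_subset in auto)
 then have "((\<lambda>Z. inverse (Z ^ (n + 1)) * f Z) has_contour_integral ((2 * pi * \<i>) / fact n * (deriv ^^ n) f 0)) (circlepath 0 1)"
  by (simp add: field_simps power_add)
 then have "circle0_int (\<lambda>Z. inverse (Z ^ (n + 1)) * f Z) = (2 * pi * \<i>) / fact n * (deriv ^^ n) f 0"
  by (intro circle0_int_contour) (auto intro!: continuous_intros cf)
 then show ?thesis by simp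
qed

text \<open>The generating function satisfies \<open>E' = (p - q * z) * E\<close>. Leibniz' rule
  stops after two terms since \<open>p - q * z\<close> is linear, and division by factorials gives
  the recursion of \<open>He\<close>.\<close>

lemma circle0_exp_quadratic:
 fixes p q :: complex
 shows "1 / (2 * of_real pi * \<i>) * circle0_int (\<lambda>Z. inverse (Z ^ (n + 1)) * exp (p * Z - q * Z\<^sup>2 / 2)) = He n p q"
proof -
 define E where "E Z = exp (p * Z - q * Z\<^sup>2 / 2)" for Z
 have hol: "E holomorphic_on UNIV" unfolding E_def by (intro holomorphic_intros) auto
 have dE: "deriv E = (\<lambda>z. (p - q * z) * E z)"
 proof
  fix z show "deriv E z = (p - q * z) * E z"
   unfolding E_def by (rule DERIV_imp_deriv) (auto intro!: derivative_eq_intros simp: power2_eq_square)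
 qed
 have dl: "(deriv ^^ i) (\<lambda>z. p - q * z) = (\<lambda>z. if i = 0 then p - q * z else if i = 1 then - q else 0)" for i
 proof (induction i)
  case (Suc i)
  have "deriv (\<lambda>z. p - q * z) = (\<lambda>z. - q)"
   by (rule ext, rule DERIV_imp_deriv) (auto intro!: derivative_eq_intros)
  then show ?case using Suc by auto
 qed simp
 have rec: "(deriv ^^ Suc n) E 0 = p * (deriv ^^ n) E 0 - (if n = 0 then 0 else of_nat n * q * (deriv ^^ (n - 1)) E 0)" for n
 proof -
  have "(deriv ^^ Suc n) E 0 = (deriv ^^ n) (\<lambda>z. (p - q * z) * E z) 0"
   unfolding funpow_Suc_right comp_def dE ..
  also have "\<dots> = (\<Sum>i = 0..n. of_nat (n choose i) * (deriv ^^ i) (\<lambda>z. p - q * z) 0 * (deriv ^^ (n-i)) E 0)"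
   by (rule higher_deriv_mult[of _ UNIV]) (use hol in \<open>auto intro!: holomorphic_intros\<close>)
  also have "\<dots> = (\<Sum>i = 0..n. if i = 0 then p * (deriv ^^ n) E 0 else if i = 1 then - of_nat n * q * (deriv ^^ (n-1)) E 0 else 0)"
   unfolding dl by (intro sum.cong) (auto simp: One_nat_def)
  also have "\<dots> = p * (deriv ^^ n) E 0 - (if n = 0 then 0 else of_nat n * q * (deriv ^^ (n - 1)) E 0)"
  proof (cases n)
   case (Suc m)
   have "{0..Suc m} = insert 0 (insert 1 {2..Suc m})" by auto
   then show ?thesis unfolding Suc by (simp add: algebra_simps)
  qed simp
  finally show ?thesis .
 qed
 have E0: "E 0 = 1" by (simp add: E_def)
 have "(deriv ^^ n) E 0 / fact n = He n p q"
 proof (induction n rule: less_induct)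
  case (less n)
  consider "n = 0" | "n = 1" | m where "n = Suc (Suc m)"
   by (cases n; cases "n - 1") auto
  then show ?case
  proof cases
   case 1 then show ?thesis by (simp add: E0)
  next
   case 2
   then show ?thesis using rec[of 0] by (simp add: E0 One_nat_def)
  next
   case (3 m)
   have a: "(deriv ^^ Suc m) E 0 = He (Suc m) p q * fact (Suc m)" "(deriv ^^ m) E 0 = He m p q * fact m"
    using less[of "Suc m"] less[of m] 3 by (simp_all add: nonzero_divide_eq_eq del: funpow.simps fact_Suc)
   have "(deriv ^^ Suc (Suc m)) E 0 = p * (He (Suc m) p q * fact (Suc m)) - of_nat (Suc m) * q * (He m p q * fact m)"
    using rec[of "Suc m"] a by (simp del: funpow.simps fact_Suc)
   also have "\<dots> = fact (Suc m) * (p * He (Suc m) p q - q * He m p q)" by (simp add: algebra_simps)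
   finally have "(deriv ^^ Suc (Suc m)) E 0 / fact (Suc (Suc m)) = fact (Suc m) * (p * He (Suc m) p q - q * He m p q) / (of_nat (Suc (Suc m)) * fact (Suc m))"
    by (simp only: fact_Suc[of "Suc m"])
   then show ?thesis unfolding 3 by (simp del: funpow.simps fact_Suc)
  qed
 qed
 then show ?thesis using circle0_coeff[OF hol, of n] by (simp add: E_def)
qed

lemma cosh_mono_abs: "\<bar>x\<bar> \<le> \<bar>y\<bar> ==> cosh x \<le> cosh (y::real)"
 using cosh_real_nonneg_le_iff[of "\<bar>x\<bar>" "\<bar>y\<bar>"] by (simp add: cosh_real_abs)

lemma exp_le_cosh: "exp x \<le> 2 * cosh (x::real)"
 by (simp add: cosh_def)

lemma norm_exp_bound: fixes w :: complex shows "norm (exp (w * of_real u)) \<le> 2 * cosh (norm w * u)"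
proof -
 have "norm (exp (w * of_real u)) \<le> 2 * cosh (Re w * u)" using exp_le_cosh[of "Re w * u"] by simp
 also have "cosh (Re w * u) \<le> cosh (norm w * u)"
  using abs_Re_le_cmod[of w] by (intro cosh_mono_abs) (auto simp: abs_mult intro!: mult_right_mono)
 finally show ?thesis by simp
qed

text \<open>On the unit circle the exponential is at most
  \<open>2 * exp (Re \<alpha> * u) * cosh (norm \<beta> * u)\<close>, uniformly in the angle, so the
  assumed integrability in \<open>u\<close> gives absolute convergence of the double
  integral.\<close>

lemma circle_fubini:
 fixes F :: "real => complex" and h :: "complex => complex"
 assumes F[measurable]: "F \<in> borel_measurable borel"
  and int: "integrable lborel (\<lambda>u. norm (F u) * exp (Re \<alpha> * u) * cosh (norm \<beta> * u))"
  and h: "continuous_on (sphere 0 1) h"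
 shows "(LBINT u. F u * circle0_int (\<lambda>Z. h Z * exp ((\<alpha> + \<beta> * Z) * of_real u))) = circle0_int (\<lambda>Z. h Z * (LBINT u. F u * exp ((\<alpha> + \<beta> * Z) * of_real u)))"
  and "integrable lborel (\<lambda>u. F u * circle0_int (\<lambda>Z. h Z * exp ((\<alpha> + \<beta> * Z) * of_real u)))"
proof -
 let ?e = "\<lambda>\<theta> u. exp ((\<alpha> + \<beta> * cis \<theta>) * of_real u)"
 let ?w = "\<lambda>u. norm (F u) * exp (Re \<alpha> * u) * cosh (norm \<beta> * u)"
 let ?f = "\<lambda>u \<theta>. F u * (indicator {0..2*pi} \<theta> *\<^sub>R (h (cis \<theta>) * ?e \<theta> u * (\<i> * cis \<theta>)))"
 have hc: "continuous_on {0..2*pi} (\<lambda>\<theta>. h (cis \<theta>))" by (intro continuous_on_compose2[OF h cis_continuous]) auto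
 have "bounded ((\<lambda>\<theta>. h (cis \<theta>)) ` {0..2*pi})"
  using compact_imp_bounded[OF compact_continuous_image[OF hc]] by simp
 then obtain B where B: "\<And>\<theta>. \<theta> \<in> {0..2*pi} ==> norm (h (cis \<theta>)) \<le> B"
  unfolding bounded_iff by blast
 have hm: "(\<lambda>\<theta>. indicator {0..2*pi} \<theta> *\<^sub>R h (cis \<theta>)) \<in> borel_measurable borel"
  using hc by (intro borel_measurable_continuous_on_indicator) auto
 have cm[measurable]: "cis \<in> borel_measurable borel" by (intro borel_measurable_continuous_onI cis_continuous)
 note hm[measurable]
 have eqf: "?f u \<theta> = F u * ((indicator {0..2*pi} \<theta> *\<^sub>R h (cis \<theta>)) * (?e \<theta> u * (\<i> * cis \<theta>)))" for u \<theta>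
  by (simp add: mult.assoc)
 have m: "(\<lambda>(u, \<theta>). ?f u \<theta>) \<in> borel_measurable (lborel \<Otimes>\<^sub>M lborel)"
  unfolding eqf by measurable
 have bound: "norm (?f u \<theta>) \<le> indicator {0..2*pi} \<theta> * (2 * B * (?w u))" for u \<theta>
 proof (cases "\<theta> \<in> {0..2*pi}")
  case True
  have "norm (?e \<theta> u) = exp (Re \<alpha> * u) * norm (exp ((\<beta> * cis \<theta>) * of_real u))"
   by (simp add: distrib_right exp_add norm_mult)
  also have "\<dots> \<le> exp (Re \<alpha> * u) * (2 * cosh (norm \<beta> * u))"
   using norm_exp_bound[of "\<beta> * cis \<theta>" u] by (intro mult_left_mono) (auto simp: norm_mult)
  finally have 1: "norm (?e \<theta> u) \<le> exp (Re \<alpha> * u) * (2 * cosh (norm \<beta> * u))" .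
  have "norm (?f u \<theta>) = norm (F u) * (norm (h (cis \<theta>)) * norm (?e \<theta> u))"
   using True by (simp add: norm_mult del: norm_exp_eq_Re)
  also have "\<dots> \<le> norm (F u) * (B * (exp (Re \<alpha> * u) * (2 * cosh (norm \<beta> * u))))"
   using B[OF True] 1 by (intro mult_left_mono mult_mono) (auto intro: order_trans[OF norm_ge_zero])
  finally show ?thesis using True by (simp add: mult_ac)
 qed simp
 have I: "integrable (lborel \<Otimes>\<^sub>M lborel) (\<lambda>(u, \<theta>). ?f u \<theta>)"
 proof (rule integrable_bound)
  show "integrable (lborel \<Otimes>\<^sub>M lborel) (\<lambda>(u, \<theta>). indicator {0..2*pi} \<theta> * (2 * B * (?w u)))"
  proof (rule lborel_pair.Fubini_integrable)
   show "(\<lambda>(u, \<theta>). indicator {0..2*pi} \<theta> * (2 * B * (?w u))) \<in> borel_measurable (lborel \<Otimes>\<^sub>M lborel)"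
    unfolding cosh_def by measurable
   have fi: "integrable lborel (indicator {0..2*pi} :: real => real)" by (simp add: integrable_real_indicator)
   have "(LBINT \<theta>. norm (indicator {0..2*pi} \<theta> * (2 * B * (?w u)))) =
    2 * pi * (2 * \<bar>B\<bar> * (?w u))" for u
    by (simp add: abs_mult)
   then show "integrable lborel (\<lambda>u. LBINT \<theta>. norm (case (u, \<theta>) of (u, \<theta>) => indicator {0..2*pi} \<theta> * (2 * B * (?w u))))"
    using int by (simp add: mult.assoc)
   show "AE u in lborel. integrable lborel (\<lambda>\<theta>. case (u, \<theta>) of (u, \<theta>) => indicator {0..2*pi} \<theta> * (2 * B * (?w u)))"
    using fi by simp
  qed
  show "AE x in lborel \<Otimes>\<^sub>M lborel. norm (case x of (u, \<theta>) => ?f u \<theta>) \<le> norm (case x of (u, \<theta>) => indicator {0..2*pi} \<theta> * (2 * B * (?w u)))"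
   by (rule AE_I2) (use bound in \<open>auto intro: order_trans[OF _ abs_ge_self]\<close>)
 qed (rule m)
 have c0: "F u * circle0_int (\<lambda>Z. h Z * exp ((\<alpha> + \<beta> * Z) * of_real u)) = (LBINT \<theta>. ?f u \<theta>)" for u
  unfolding circle0_int_eq by (rule integral_mult_right_zero[symmetric])
 have c1: "(LBINT u. ?f u \<theta>) = indicator {0..2*pi} \<theta> *\<^sub>R (h (cis \<theta>) * (LBINT u. F u * ?e \<theta> u) * (\<i> * cis \<theta>))" for \<theta>
 proof -
  have "(LBINT u. ?f u \<theta>) = (LBINT u. (indicator {0..2*pi} \<theta> *\<^sub>R (h (cis \<theta>) * (\<i> * cis \<theta>))) * (F u * ?e \<theta> u))"
   by (intro integral_cong refl) (simp add: mult_ac)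
  also have "\<dots> = (indicator {0..2*pi} \<theta> *\<^sub>R (h (cis \<theta>) * (\<i> * cis \<theta>))) * (LBINT u. F u * ?e \<theta> u)"
   by (rule integral_mult_right_zero)
  finally show ?thesis by (simp add: mult_ac)
 qed
 show "(LBINT u. F u * circle0_int (\<lambda>Z. h Z * exp ((\<alpha> + \<beta> * Z) * of_real u))) = circle0_int (\<lambda>Z. h Z * (LBINT u. F u * exp ((\<alpha> + \<beta> * Z) * of_real u)))"
  unfolding c0 using lborel_pair.Fubini_integral[OF I] unfolding c1 circle0_int_eq by simp
 show "integrable lborel (\<lambda>u. F u * circle0_int (\<lambda>Z. h Z * exp ((\<alpha> + \<beta> * Z) * of_real u)))"
  unfolding c0 using lborel_pair.integrable_fst[OF I] .
qed

text \<open>Closed form of the contour integral in \<open>Psi\<close> with \<open>gZ r Z u\<close>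
  alone in place of the difference, for \<open>s = sqrt 2 * r\<close>; \<open>Psi\<close> is
  \<open>Gf s \<tau> m u - Gf s \<tau> m (- u)\<close>.\<close>

definition Gf :: "real => real => nat => real => real" where
 "Gf s \<tau> m u = exp (- (\<tau> * s\<^sup>2) - s * u) * He m (2 * u + s + 4 * \<tau> * s) (8 * \<tau>)"

text \<open>Closed form of the integral in \<open>Phi\<close> with \<open>fW r W u\<close> alone.
  The Gaussian is centred at \<open>- s / 2\<close>, the transformed starting point of the bridges,
  and has variance \<open>2 * \<tau>\<close>.\<close>

definition Ff :: "real => real => nat => real => real" where
 "Ff s \<tau> n u = exp (- s\<^sup>2 / 2) * fact n * He n ((2 * u + s + 4 * \<tau> * s) / (8 * \<tau>)) (1 / (8 * \<tau>)) * heat 2 \<tau> (- s / 2) u"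

lemma measurable_Gf[measurable]: "Gf s \<tau> m \<in> borel_measurable borel"
 unfolding Gf_def[abs_def] by (intro borel_measurable_continuous_onI continuous_intros)

lemma measurable_Ff[measurable]: "Ff s \<tau> m \<in> borel_measurable borel"
proof -
 have [measurable]: "(\<lambda>u. He m ((2 * u + s + 4 * \<tau> * s) / (8 * \<tau>)) (1 / (8 * \<tau>))) \<in> borel_measurable borel"
  using measurable_compose[OF _ measurable_He, of "\<lambda>u. (2 * u + s + 4 * \<tau> * s) / (8 * \<tau>)" borel m "1 / (8 * \<tau>)"] by simp
 show ?thesis unfolding Ff_def[abs_def] by measurable
qed

lemma power_le_fact_exp: "0 \<le> y ==> y ^ n \<le> fact n * exp (y::real)"
proof -
 assume y: "0 \<le> y"
 have "y ^ n / fact n \<le> (\<Sum>k. y ^ k / fact k)"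
  using sum_le_suminf[of "\<lambda>k. y ^ k / fact k" "{n}"] summable_exp_generic[of y] y by (simp add: divide_inverse mult.commute scaleR_conv_of_real)
 also have "\<dots> = exp y" by (simp add: exp_def divide_inverse mult.commute)
 finally show ?thesis by (simp add: divide_le_eq mult.commute)
qed

lemma exp_abs_le_cosh: "exp \<bar>u\<bar> \<le> 2 * cosh (u::real)"
 using exp_le_cosh[of "\<bar>u\<bar>"] by (simp add: cosh_real_abs)

text \<open>The inequality \<open>y ^ n \<le> fact n * exp y\<close> trades any power for one
  exponential, so Hermite factors cost exactly 1 in the growth exponent.\<close>

lemma He_affine_bound:
 obtains C :: real where "0 \<le> C" "\<And>u. \<bar>He n (a * u + b) q\<bar> \<le> C * cosh u"
proof
 let ?K = "\<bar>b\<bar> + \<bar>q\<bar> + 1"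
 let ?C = "(\<bar>a\<bar> + 1) ^ n * (fact n * (exp ?K * 2))"
 show "0 \<le> ?C" by simp
 fix u
 have "\<bar>He n (a * u + b) q\<bar> \<le> (\<bar>a * u + b\<bar> + \<bar>q\<bar> + 1) ^ n" by (rule He_abs_le)
 also have "\<dots> \<le> ((\<bar>a\<bar> + 1) * (\<bar>u\<bar> + ?K)) ^ n"
 proof (rule power_mono)
  have "\<bar>a * u + b\<bar> \<le> \<bar>a\<bar> * \<bar>u\<bar> + \<bar>b\<bar>" by (metis abs_mult abs_triangle_ineq)
  moreover have "0 \<le> \<bar>a\<bar> * ?K" by simp
  moreover have "(\<bar>a\<bar> + 1) * (\<bar>u\<bar> + ?K) = \<bar>a\<bar> * \<bar>u\<bar> + \<bar>a\<bar> * ?K + \<bar>u\<bar> + ?K" by (simp add: algebra_simps)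
  ultimately show "\<bar>a * u + b\<bar> + \<bar>q\<bar> + 1 \<le> (\<bar>a\<bar> + 1) * (\<bar>u\<bar> + ?K)" using abs_ge_zero[of u] by linarith
 qed simp
 also have "\<dots> \<le> (\<bar>a\<bar> + 1) ^ n * (fact n * exp (\<bar>u\<bar> + ?K))"
  unfolding power_mult_distrib by (intro mult_left_mono power_le_fact_exp) auto
 also have "exp (\<bar>u\<bar> + ?K) \<le> 2 * cosh u * exp ?K"
  unfolding exp_add[of "\<bar>u\<bar>"] by (intro mult_right_mono exp_abs_le_cosh) simp
 finally show "\<bar>He n (a * u + b) q\<bar> \<le> ?C * cosh u" by (simp add: mult_ac)
qed

lemma cosh_mult_le: "cosh a * cosh b \<le> cosh (\<bar>a\<bar> + \<bar>b\<bar> :: real)"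
proof -
 have "cosh a * cosh b = (cosh (a + b) + cosh (a - b)) / 2" by (simp add: cosh_add cosh_diff)
 moreover have "cosh (a + b) \<le> cosh (\<bar>a\<bar> + \<bar>b\<bar>)" "cosh (a - b) \<le> cosh (\<bar>a\<bar> + \<bar>b\<bar>)" by (auto intro!: cosh_mono_abs)
 ultimately show ?thesis by simp
qed

lemma abs_succ_mult: "\<bar>(\<bar>b\<bar> + 1) * u\<bar> = \<bar>b * u\<bar> + \<bar>u :: real\<bar>"
 unfolding abs_mult[of "_ + _"] by (subst abs_of_nonneg) (auto simp: abs_mult distrib_right)

text \<open>The exponent \<open>\<bar>s\<bar> + 1\<close> comes from \<open>exp (- s * u)\<close>
  and from the polynomial factor, respectively.\<close>

lemma bnd_Gf: obtains C where "bnd (\<bar>s\<bar> + 1) C (Gf s \<tau> m)"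
proof -
 obtain C where C: "0 \<le> C" "\<And>u. \<bar>He m (2 * u + (s + 4 * \<tau> * s)) (8 * \<tau>)\<bar> \<le> C * cosh u"
  using He_affine_bound[of m 2 "s + 4 * \<tau> * s" "8 * \<tau>"] by metis
 have "\<bar>Gf s \<tau> m u\<bar> \<le> (exp (- (\<tau> * s\<^sup>2)) * (2 * C)) * cosh ((\<bar>s\<bar> + 1) * u)" for u
 proof -
  have "\<bar>Gf s \<tau> m u\<bar> = exp (- (\<tau> * s\<^sup>2)) * (exp (- (s * u)) * \<bar>He m (2 * u + (s + 4 * \<tau> * s)) (8 * \<tau>)\<bar>)"
   by (simp add: Gf_def abs_mult exp_diff exp_minus field_simps add.assoc)
  also have "\<dots> \<le> exp (- (\<tau> * s\<^sup>2)) * (2 * cosh (- (s * u)) * (C * cosh u))"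
   using C exp_le_cosh[of "- (s * u)"] by (intro mult_left_mono mult_mono) auto
  also have "\<dots> = (exp (- (\<tau> * s\<^sup>2)) * (2 * C)) * (cosh (s * u) * cosh u)" by simp
  also have "\<dots> \<le> (exp (- (\<tau> * s\<^sup>2)) * (2 * C)) * cosh (\<bar>s * u\<bar> + \<bar>u\<bar>)"
   using C by (intro mult_left_mono cosh_mult_le) auto
  also have "cosh (\<bar>s * u\<bar> + \<bar>u\<bar>) = cosh ((\<bar>s\<bar> + 1) * u)"
   using cosh_real_abs[of "(\<bar>s\<bar> + 1) * u"] unfolding abs_succ_mult by simp
  finally show ?thesis .
 qed
 then have "bnd (\<bar>s\<bar> + 1) (exp (- (\<tau> * s\<^sup>2)) * (2 * C)) (Gf s \<tau> m)" by (simp add: bnd_def)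
 then show ?thesis by (rule that)
qed

lemma Ff_abs_le: obtains C where "0 \<le> C" "\<And>u. \<bar>Ff s \<tau> n u\<bar> \<le> C * (heat 2 \<tau> (- s / 2) u * cosh u)"
proof -
 obtain C where C: "0 \<le> C" "\<And>u. \<bar>He n (1 / (4 * \<tau>) * u + (s + 4 * \<tau> * s) / (8 * \<tau>)) (1 / (8 * \<tau>))\<bar> \<le> C * cosh u"
  using He_affine_bound[of n "1 / (4 * \<tau>)" "(s + 4 * \<tau> * s) / (8 * \<tau>)" "1 / (8 * \<tau>)"] by metis
 have eq: "(2 * u + s + 4 * \<tau> * s) / (8 * \<tau>) = 1 / (4 * \<tau>) * u + (s + 4 * \<tau> * s) / (8 * \<tau>)" for u
  by (simp add: add_divide_distrib)
 have "\<bar>Ff s \<tau> n u\<bar> \<le> (exp (- s\<^sup>2 / 2) * fact n * C) * (heat 2 \<tau> (- s / 2) u * cosh u)" for u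
 proof -
  have "\<bar>Ff s \<tau> n u\<bar> = exp (- s\<^sup>2 / 2) * fact n * heat 2 \<tau> (- s / 2) u * \<bar>He n (1 / (4 * \<tau>) * u + (s + 4 * \<tau> * s) / (8 * \<tau>)) (1 / (8 * \<tau>))\<bar>"
   unfolding Ff_def eq by (simp add: abs_mult)
  also have "\<dots> \<le> exp (- s\<^sup>2 / 2) * fact n * heat 2 \<tau> (- s / 2) u * (C * cosh u)"
   using C by (intro mult_left_mono) auto
  finally show ?thesis by (simp add: mult_ac)
 qed
 then show ?thesis using C by (intro that[of "exp (- s\<^sup>2 / 2) * fact n * C"]) auto
qed

lemma integrable_heat_exp_cosh:
 assumes "0 < D * t"
 shows "integrable lborel (\<lambda>u. heat D t x u * exp (a * u) * cosh (b * u))"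
 unfolding heat_mult_exp[OF assms] mult.assoc using integrable_heat_cosh[OF assms] by simp

lemma Ff_integrable:
 assumes "0 < \<tau>"
 shows "integrable lborel (\<lambda>u. \<bar>Ff s \<tau> n u\<bar> * exp (a * u) * cosh (b * u))"
proof -
 obtain C where C: "0 \<le> C" "\<And>u. \<bar>Ff s \<tau> n u\<bar> \<le> C * (heat 2 \<tau> (- s / 2) u * cosh u)" using Ff_abs_le by metis
 have i: "integrable lborel (\<lambda>u. C * (heat 2 \<tau> (- s / 2) u * exp (a * u) * cosh ((\<bar>b\<bar> + 1) * u)))"
  using assms by (intro integrable_mult_right integrable_heat_exp_cosh) simp
 show ?thesis
 proof (rule integrable_bound[OF i])
  show "(\<lambda>u. \<bar>Ff s \<tau> n u\<bar> * exp (a * u) * cosh (b * u)) \<in> borel_measurable lborel"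
   unfolding cosh_def by measurable
  show "AE u in lborel. norm (\<bar>Ff s \<tau> n u\<bar> * exp (a * u) * cosh (b * u)) \<le> norm (C * (heat 2 \<tau> (- s / 2) u * exp (a * u) * cosh ((\<bar>b\<bar> + 1) * u)))"
  proof (rule AE_I2)
   fix u
   have "\<bar>Ff s \<tau> n u\<bar> * exp (a * u) * cosh (b * u) \<le> C * (heat 2 \<tau> (- s / 2) u * cosh u) * exp (a * u) * cosh (b * u)"
    using C by (intro mult_right_mono) auto
   also have "\<dots> = C * heat 2 \<tau> (- s / 2) u * exp (a * u) * (cosh (b * u) * cosh u)" by (simp add: mult_ac)
   also have "\<dots> \<le> C * heat 2 \<tau> (- s / 2) u * exp (a * u) * cosh (\<bar>b * u\<bar> + \<bar>u\<bar>)"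
    using C by (intro mult_left_mono cosh_mult_le) auto
   also have "cosh (\<bar>b * u\<bar> + \<bar>u\<bar>) = cosh ((\<bar>b\<bar> + 1) * u)"
    using cosh_real_abs[of "(\<bar>b\<bar> + 1) * u"] unfolding abs_succ_mult by simp
   finally show "norm (\<bar>Ff s \<tau> n u\<bar> * exp (a * u) * cosh (b * u)) \<le> norm (C * (heat 2 \<tau> (- s / 2) u * exp (a * u) * cosh ((\<bar>b\<bar> + 1) * u)))"
    using C by (simp add: abs_mult mult_ac)
  qed
 qed
qed

lemma Ff_integrable_cosh: "0 < \<tau> ==> integrable lborel (\<lambda>u. \<bar>Ff s \<tau> n u\<bar> * cosh (b * u))"
 using Ff_integrable[of \<tau> s n 0 b] by simp

text \<open>\<open>hG\<close> and \<open>hF\<close> are the parts of the contour integrands of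
  \<open>Gf\<close> and of the Hermite factor of \<open>Ff\<close> that do not depend on
  \<open>u\<close>; what remains is a pure exponential in \<open>u\<close>.\<close>

definition hG :: "real => real => nat => complex => complex" where
 "hG s \<tau> m Z = inverse (Z ^ (m + 1)) * exp (- of_real \<tau> * (of_real s - 2 * Z)\<^sup>2 + of_real s * Z)"

definition hF :: "real => real => nat => complex => complex" where
 "hF s \<tau> n Z = inverse (Z ^ (n + 1)) * exp (of_real (s / (8 * \<tau>) + s / 2) * Z - of_real (1 / (8 * \<tau>)) * Z\<^sup>2 / 2)"

lemma hG_cont: "continuous_on (sphere 0 1) (hG s \<tau> m)"
 unfolding hG_def by (intro continuous_intros) auto

lemma hF_cont: "continuous_on (sphere 0 1) (hF s \<tau> m)"
 unfolding hF_def by (intro continuous_intros) auto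

lemma Gf_contour:
 "of_real (Gf s \<tau> m u) = 1 / (2 * of_real pi * \<i>) * circle0_int (\<lambda>Z. hG s \<tau> m Z * exp ((of_real (- s) + 2 * Z) * of_real u))"
proof -
 let ?J = "circle0_int (\<lambda>Z. inverse (Z ^ (m + 1)) * exp (of_real (2 * u + s + 4 * \<tau> * s) * Z - of_real (8 * \<tau>) * Z\<^sup>2 / 2))"
 let ?E = "complex_of_real (exp (- (\<tau> * s\<^sup>2) - s * u))"
 have "circle0_int (\<lambda>Z. hG s \<tau> m Z * exp ((of_real (- s) + 2 * Z) * of_real u)) =
  circle0_int (\<lambda>Z. ?E * (inverse (Z ^ (m + 1)) * exp (of_real (2 * u + s + 4 * \<tau> * s) * Z - of_real (8 * \<tau>) * Z\<^sup>2 / 2)))"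
 proof (rule circle0_int_cong)
  fix Z :: complex
  have e: "- of_real \<tau> * (of_real s - 2 * Z)\<^sup>2 + of_real s * Z + (of_real (- s) + 2 * Z) * of_real u =
   of_real (- (\<tau> * s\<^sup>2) - s * u) + (of_real (2 * u + s + 4 * \<tau> * s) * Z - of_real (8 * \<tau>) * Z\<^sup>2 / 2)"
   by (simp add: power2_eq_square algebra_simps)
  show "hG s \<tau> m Z * exp ((of_real (- s) + 2 * Z) * of_real u) =
   ?E * (inverse (Z ^ (m + 1)) * exp (of_real (2 * u + s + 4 * \<tau> * s) * Z - of_real (8 * \<tau>) * Z\<^sup>2 / 2))"
   unfolding hG_def exp_of_real[symmetric] mult.left_commute[of "exp (of_real _)"] mult.assoc exp_add[symmetric] e ..
 qed
 also have "\<dots> = ?E * ?J" by (rule circle0_int_cmult)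
 finally have eq: "circle0_int (\<lambda>Z. hG s \<tau> m Z * exp ((of_real (- s) + 2 * Z) * of_real u)) = ?E * ?J" .
 have "complex_of_real (Gf s \<tau> m u) = ?E * (1 / (2 * of_real pi * \<i>) * ?J)"
  unfolding Gf_def of_real_mult[of "exp _"] of_real_He circle0_exp_quadratic ..
 then show ?thesis unfolding eq by (simp only: mult.left_commute)
qed

lemma Ff_contour:
 assumes "0 < \<tau>"
 shows "of_real (Ff s \<tau> n u) = 1 / (2 * of_real pi * \<i>) * (of_real (exp (- s\<^sup>2 / 2) * fact n * heat 2 \<tau> (- s / 2) u) *
  circle0_int (\<lambda>Z. hF s \<tau> n Z * exp ((0 + of_real (1 / (4 * \<tau>)) * Z) * of_real u)))"
proof -
 let ?J = "circle0_int (\<lambda>Z. inverse (Z ^ (n + 1)) * exp (of_real ((2 * u + s + 4 * \<tau> * s) / (8 * \<tau>)) * Z - of_real (1 / (8 * \<tau>)) * Z\<^sup>2 / 2))"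
 have J: "circle0_int (\<lambda>Z. hF s \<tau> n Z * exp ((0 + of_real (1 / (4 * \<tau>)) * Z) * of_real u)) = ?J"
 proof (rule circle0_int_cong)
  fix Z :: complex
  have r: "(2 * u + s + 4 * \<tau> * s) / (8 * \<tau>) = (s / (8 * \<tau>) + s / 2) + 1 / (4 * \<tau>) * u"
   using assms by (simp add: field_simps)
  have rc: "complex_of_real ((2 * u + s + 4 * \<tau> * s) / (8 * \<tau>)) = of_real (s / (8 * \<tau>) + s / 2) + of_real (1 / (4 * \<tau>)) * of_real u"
   by (simp only: r of_real_add of_real_mult)
  have "a * Z - q + (0 + b * Z) * w = (a + b * w) * Z - q" for a b q w :: complex by (simp add: algebra_simps)
  then show "hF s \<tau> n Z * exp ((0 + of_real (1 / (4 * \<tau>)) * Z) * of_real u) =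
   inverse (Z ^ (n + 1)) * exp (of_real ((2 * u + s + 4 * \<tau> * s) / (8 * \<tau>)) * Z - of_real (1 / (8 * \<tau>)) * Z\<^sup>2 / 2)"
   unfolding rc unfolding hF_def mult.assoc exp_add[symmetric] by (simp only:)
 qed
 have m: "exp (- s\<^sup>2 / 2) * fact n * h * x = (exp (- s\<^sup>2 / 2) * fact n * x) * h" for h x :: real by (simp only: mult_ac)
 have "complex_of_real (Ff s \<tau> n u) = of_real (exp (- s\<^sup>2 / 2) * fact n * heat 2 \<tau> (- s / 2) u) * (1 / (2 * of_real pi * \<i>) * ?J)"
  unfolding Ff_def m of_real_mult[of "_ * heat _ _ _ _"] of_real_He circle0_exp_quadratic ..
 then show ?thesis unfolding J by (simp only: mult.left_commute)
qed

lemma circle_fubini_const: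
 fixes F :: "real => complex" and h :: "complex => complex"
 assumes F: "F \<in> borel_measurable borel"
  and int: "integrable lborel (\<lambda>u. norm (F u) * exp (Re \<alpha> * u) * cosh (norm \<beta> * u))"
  and h: "continuous_on (sphere 0 1) h"
  and inner: "\<And>Z. norm Z = 1 ==> h Z * (LBINT u. F u * exp ((\<alpha> + \<beta> * Z) * of_real u)) = R Z"
 shows "(LBINT u. F u * (k * circle0_int (\<lambda>Z. h Z * exp ((\<alpha> + \<beta> * Z) * of_real u)))) = k * circle0_int R"
proof -
 have "(LBINT u. F u * (k * circle0_int (\<lambda>Z. h Z * exp ((\<alpha> + \<beta> * Z) * of_real u)))) =
  k * (LBINT u. F u * circle0_int (\<lambda>Z. h Z * exp ((\<alpha> + \<beta> * Z) * of_real u)))"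
  by (subst integral_mult_right_zero[symmetric]) (simp only: mult.left_commute)
 also have "\<dots> = k * circle0_int R"
  unfolding circle_fubini(1)[OF F int h] using circle0_int_cong[of _ R, OF inner] by simp
 finally show ?thesis .
qed

text \<open>\<open>exp ((2 * Z - s) * u)\<close> is an eigenfunction of the heat flow with factor
  \<open>exp (\<delta> * (2 * Z - s)\<^sup>2)\<close>, which cancels the difference of the time
  factors of \<open>hG\<close>. So \<open>Gf\<close> solves the backward equation.\<close>

lemma Gf_heat:
 assumes "0 < \<delta>"
 shows "heat_op 2 \<delta> (Gf s (\<tau> + \<delta>) m) v = Gf s \<tau> m v"
proof -
 let ?k = "1 / (2 * of_real pi * \<i>) :: complex"
 have d: "0 < 2 * \<delta>" using assms by simp
 have i: "integrable lborel (\<lambda>u. norm (complex_of_real (heat 2 \<delta> v u)) * exp (Re (of_real (- s)) * u) * cosh (norm (2::complex) * u))"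
  using integrable_heat_exp_cosh[OF d, of v "-s" 2] by simp
 have "complex_of_real (heat_op 2 \<delta> (Gf s (\<tau> + \<delta>) m) v) = (LBINT u. of_real (heat 2 \<delta> v u * Gf s (\<tau> + \<delta>) m u))"
  unfolding heat_op_def by (rule integral_complex_of_real[symmetric])
 also have "\<dots> = (LBINT u. of_real (heat 2 \<delta> v u) * (?k * circle0_int (\<lambda>Z. hG s (\<tau> + \<delta>) m Z * exp ((of_real (- s) + 2 * Z) * of_real u))))"
  unfolding of_real_mult Gf_contour ..
 also have "\<dots> = ?k * circle0_int (\<lambda>Z. hG s \<tau> m Z * exp ((of_real (- s) + 2 * Z) * of_real v))"
 proof (rule circle_fubini_const[OF _ i hG_cont])
  fix Z :: complex
  have h: "complex_of_real (2 * \<delta>) * w\<^sup>2 / 2 = of_real \<delta> * w\<^sup>2" for w by simp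
  have e: "- of_real (\<tau> + \<delta>) * (of_real s - 2 * Z)\<^sup>2 + of_real s * Z + ((of_real (- s) + 2 * Z) * of_real v + of_real \<delta> * (of_real (- s) + 2 * Z)\<^sup>2)
   = - of_real \<tau> * (of_real s - 2 * Z)\<^sup>2 + of_real s * Z + (of_real (- s) + 2 * Z) * of_real v"
   by (simp add: power2_eq_square algebra_simps)
  show "hG s (\<tau> + \<delta>) m Z * (LBINT u. of_real (heat 2 \<delta> v u) * exp ((of_real (- s) + 2 * Z) * of_real u)) = hG s \<tau> m Z * exp ((of_real (- s) + 2 * Z) * of_real v)"
   unfolding hG_def integral_heat_cexp[OF d] h mult.assoc exp_add[symmetric] e ..
 qed simp
 also have "\<dots> = of_real (Gf s \<tau> m v)" by (rule Gf_contour[symmetric])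
 finally show ?thesis by (simp only: of_real_eq_iff)
qed

text \<open>By \<open>heat_product\<close>, the two Gaussians split into the one at time
  \<open>\<sigma> + \<delta>\<close> and a bridge density in \<open>u\<close>. Averaging the
  generating function of the Hermite factor over that density changes its parameters from
  \<open>\<sigma>\<close> to \<open>\<sigma> + \<delta>\<close>. So \<open>Ff\<close> evolves
  forward.\<close>

lemma Ff_heat:
 assumes "0 < \<sigma>" "0 < \<delta>"
 shows "heat_op 2 \<delta> (Ff s \<sigma> n) v = Ff s (\<sigma> + \<delta>) n v"
proof -
 let ?l = "\<lambda>Z. 0 + of_real (1 / (4 * \<sigma>)) * Z :: complex"
 define \<rho> where "\<rho> = \<sigma> * \<delta> / (\<sigma> + \<delta>)"
 define \<mu> where "\<mu> = (\<delta> * (- s / 2) + \<sigma> * v) / (\<sigma> + \<delta>)"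
 define c0 where "c0 = exp (- s\<^sup>2 / 2) * fact n"
 let ?k = "1 / (2 * of_real pi * \<i>) :: complex"
 have \<rho>: "0 < 2 * \<rho>" using assms by (simp add: \<rho>_def)
 have prod: "heat 2 \<delta> v u * heat 2 \<sigma> (- s / 2) u = heat 2 (\<sigma> + \<delta>) (- s / 2) v * heat 2 \<rho> \<mu> u" for u
  using heat_product[of 2 \<sigma> \<delta> "- s / 2" u v] assms heat_sym[of 2 \<delta> v u] unfolding \<rho>_def \<mu>_def by (simp add: mult.commute)
 define H where "H = c0 * heat 2 (\<sigma> + \<delta>) (- s / 2) v"
 have i: "integrable lborel (\<lambda>u. norm (complex_of_real (H * heat 2 \<rho> \<mu> u)) * exp (Re 0 * u) * cosh (norm (complex_of_real (1 / (4 * \<sigma>))) * u))"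
  using integrable_heat_exp_cosh[OF \<rho>, of \<mu> 0] by (simp add: norm_mult mult.assoc)
 have "complex_of_real (heat_op 2 \<delta> (Ff s \<sigma> n) v) = (LBINT u. of_real (heat 2 \<delta> v u * Ff s \<sigma> n u))"
  unfolding heat_op_def by (rule integral_complex_of_real[symmetric])
 also have "\<dots> = (LBINT u. of_real (H * heat 2 \<rho> \<mu> u) * (?k * circle0_int (\<lambda>Z. hF s \<sigma> n Z * exp ((?l Z) * of_real u))))"
 proof (intro integral_cong refl)
  fix u
  let ?J = "circle0_int (\<lambda>Z. hF s \<sigma> n Z * exp ((?l Z) * of_real u))"
  have "heat 2 \<delta> v u * (c0 * heat 2 \<sigma> (- s / 2) u) = H * heat 2 \<rho> \<mu> u"
   unfolding mult.left_commute[of _ c0] prod H_def by (simp only: mult.assoc)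
  then have "complex_of_real (H * heat 2 \<rho> \<mu> u) * (?k * ?J) = of_real (heat 2 \<delta> v u) * (?k * (of_real (c0 * heat 2 \<sigma> (- s / 2) u) * ?J))"
   by (simp only: of_real_mult[symmetric, of "heat 2 \<delta> v u"] mult.left_commute[of ?k] mult.assoc[symmetric, of "of_real (heat 2 \<delta> v u)"])
  then show "complex_of_real (heat 2 \<delta> v u * Ff s \<sigma> n u) = of_real (H * heat 2 \<rho> \<mu> u) * (?k * ?J)"
   unfolding of_real_mult[of "heat 2 \<delta> v u"] Ff_contour[OF assms(1)] c0_def by (simp only:)
 qed
 also have "\<dots> = ?k * circle0_int (\<lambda>Z. of_real H * (hF s (\<sigma> + \<delta>) n Z * exp ((0 + of_real (1 / (4 * (\<sigma> + \<delta>))) * Z) * of_real v)))"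
 proof (rule circle_fubini_const[OF _ i hF_cont])
  fix Z :: complex
  have "(LBINT u. of_real (H * heat 2 \<rho> \<mu> u) * exp ((?l Z) * of_real u)) =
   of_real H * (LBINT u. of_real (heat 2 \<rho> \<mu> u) * exp ((?l Z) * of_real u))"
   by (subst integral_mult_right_zero[symmetric]) (simp add: mult.assoc)
  also have "\<dots> = of_real H * exp ((?l Z) * of_real \<mu> + of_real (2 * \<rho>) * (?l Z)\<^sup>2 / 2)"
   unfolding integral_heat_cexp[OF \<rho>] ..
  finally have I: "(LBINT u. of_real (H * heat 2 \<rho> \<mu> u) * exp ((?l Z) * of_real u)) =
   of_real H * exp ((?l Z) * of_real \<mu> + of_real (2 * \<rho>) * (?l Z)\<^sup>2 / 2)" .
  have sd: "\<sigma> + \<delta> \<noteq> 0" "\<sigma> \<noteq> 0" using assms by auto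
  have a: "s / (8 * \<sigma>) + s / 2 + 1 / (4 * \<sigma>) * \<mu> = s / (8 * (\<sigma> + \<delta>)) + s / 2 + 1 / (4 * (\<sigma> + \<delta>)) * v"
   unfolding \<mu>_def using sd by (simp add: divide_simps; simp add: algebra_simps)
  have b: "1 / (8 * \<sigma>) - 2 * \<rho> * (1 / (4 * \<sigma>))\<^sup>2 = 1 / (8 * (\<sigma> + \<delta>))"
   unfolding \<rho>_def using sd by (simp add: divide_simps power2_eq_square; simp add: algebra_simps)
  have "of_real (s / (8 * \<sigma>) + s / 2) * Z - of_real (1 / (8 * \<sigma>)) * Z\<^sup>2 / 2 + ((?l Z) * of_real \<mu> + of_real (2 * \<rho>) * (?l Z)\<^sup>2 / 2)
   = of_real (s / (8 * \<sigma>) + s / 2 + 1 / (4 * \<sigma>) * \<mu>) * Z - of_real (1 / (8 * \<sigma>) - 2 * \<rho> * (1 / (4 * \<sigma>))\<^sup>2) * Z\<^sup>2 / 2"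
  proof -
   have "A * Z - B * Z\<^sup>2 / 2 + ((0 + C * Z) * m + R * (0 + C * Z)\<^sup>2 / 2) = (A + C * m) * Z - (B - R * C\<^sup>2) * Z\<^sup>2 / 2" for A B C m R :: complex
    by (simp add: power2_eq_square algebra_simps diff_divide_distrib add_divide_distrib)
   then show ?thesis by (simp only: of_real_add of_real_diff of_real_mult of_real_power)
  qed
  also have "\<dots> = of_real (s / (8 * (\<sigma> + \<delta>)) + s / 2) * Z - of_real (1 / (8 * (\<sigma> + \<delta>))) * Z\<^sup>2 / 2 + (0 + of_real (1 / (4 * (\<sigma> + \<delta>))) * Z) * of_real v"
  proof -
   have "A * Z - B + (0 + C * Z) * v = (A + C * v) * Z - B" for A B C v :: complex by (simp add: algebra_simps)
   then show ?thesis unfolding a b by (simp only: of_real_add of_real_mult)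
  qed
  finally show "hF s \<sigma> n Z * (LBINT u. of_real (H * heat 2 \<rho> \<mu> u) * exp ((?l Z) * of_real u)) =
   of_real H * (hF s (\<sigma> + \<delta>) n Z * exp ((0 + of_real (1 / (4 * (\<sigma> + \<delta>))) * Z) * of_real v))"
   unfolding I hF_def mult.left_commute[of _ "of_real H"] mult.assoc exp_add[symmetric] by (simp only:)
 qed simp
 also have "\<dots> = of_real (Ff s (\<sigma> + \<delta>) n v)"
 proof -
  have sd: "0 < \<sigma> + \<delta>" using assms by simp
  show ?thesis unfolding Ff_contour[OF sd] circle0_int_cmult H_def c0_def ..
 qed
 finally show ?thesis by (simp only: of_real_eq_iff)
qed

text \<open>Integrating the generating function against the exponential cancels its quadratic part;
  the remaining exponent is linear in \<open>Z\<close>, with slope \<open>V = (s - w) / 2\<close>,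
  and extracting the coefficient leaves \<open>V ^ n\<close>.\<close>

lemma Ff_laplace:
 fixes w :: complex
 assumes "0 < \<tau>"
 shows "(LBINT u. of_real (Ff s \<tau> n u) * exp (- w * of_real u)) = ((of_real s - w) / 2) ^ n * exp (of_real \<tau> * w\<^sup>2 - of_real s * ((of_real s - w) / 2))"
proof -
 let ?q = "w * of_real s / 2 + of_real \<tau> * w\<^sup>2"
 let ?l = "\<lambda>Z. - w + of_real (1 / (4 * \<tau>)) * Z"
 define c0 where "c0 = exp (- s\<^sup>2 / 2) * fact n"
 define V where "V = (of_real s - w) / 2"
 let ?k = "1 / (2 * of_real pi * \<i>) :: complex"
 let ?F = "\<lambda>u. complex_of_real (c0 * heat 2 \<tau> (- s / 2) u)"
 have t: "0 < 2 * \<tau>" using assms by simp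
 have i: "integrable lborel (\<lambda>u. norm (?F u) * exp (Re (- w) * u) * cosh (norm (complex_of_real (1 / (4 * \<tau>))) * u))"
  using integrable_heat_exp_cosh[OF t, of "- s / 2" "Re (- w)"] by (simp add: norm_mult mult.assoc)
 have "(LBINT u. of_real (Ff s \<tau> n u) * exp (- w * of_real u)) =
  (LBINT u. ?F u * (?k * circle0_int (\<lambda>Z. hF s \<tau> n Z * exp ((?l Z) * of_real u))))"
 proof (intro integral_cong refl)
  fix u
  have "circle0_int (\<lambda>Z. hF s \<tau> n Z * exp ((?l Z) * of_real u)) =
   circle0_int (\<lambda>Z. exp (- w * of_real u) * (hF s \<tau> n Z * exp ((0 + of_real (1 / (4 * \<tau>)) * Z) * of_real u)))"
   by (rule circle0_int_cong) (simp add: distrib_right exp_add exp_minus exp_diff field_simps)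
  then have J: "circle0_int (\<lambda>Z. hF s \<tau> n Z * exp ((?l Z) * of_real u)) =
   exp (- w * of_real u) * circle0_int (\<lambda>Z. (hF s \<tau> n Z * exp ((0 + of_real (1 / (4 * \<tau>)) * Z) * of_real u)))"
   unfolding circle0_int_cmult .
  show "of_real (Ff s \<tau> n u) * exp (- w * of_real u) = ?F u * (?k * circle0_int (\<lambda>Z. hF s \<tau> n Z * exp ((?l Z) * of_real u)))"
   unfolding J Ff_contour[OF assms] c0_def by (simp only: mult_ac)
 qed
 also have "\<dots> = ?k * circle0_int (\<lambda>Z. (of_real c0 * exp ?q) * (inverse (Z ^ (n + 1)) * exp (V * Z - 0 * Z\<^sup>2 / 2)))"
 proof (rule circle_fubini_const[OF _ i hF_cont])
  fix Z :: complex
  have "(LBINT u. ?F u * exp ((?l Z) * of_real u)) =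
   of_real c0 * (LBINT u. of_real (heat 2 \<tau> (- s / 2) u) * exp ((?l Z) * of_real u))"
   by (subst integral_mult_right_zero[symmetric]) (simp add: mult.assoc)
  also have "\<dots> = of_real c0 * exp ((?l Z) * of_real (- s / 2) + of_real (2 * \<tau>) * (?l Z)\<^sup>2 / 2)"
   unfolding integral_heat_cexp[OF t] ..
  finally have I: "(LBINT u. ?F u * exp ((?l Z) * of_real u)) =
   of_real c0 * exp ((?l Z) * of_real (- s / 2) + of_real (2 * \<tau>) * (?l Z)\<^sup>2 / 2)" .
  have e: "of_real (s / (8 * \<tau>) + s / 2) * Z - of_real (1 / (8 * \<tau>)) * Z\<^sup>2 / 2 +
   ((?l Z) * of_real (- s / 2) + of_real (2 * \<tau>) * (?l Z)\<^sup>2 / 2)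
   = ?q + (V * Z - 0 * Z\<^sup>2 / 2)"
  proof -
   define t where "t = complex_of_real \<tau>"
   have t: "t \<noteq> 0" using assms by (simp add: t_def)
   show ?thesis
    unfolding V_def of_real_add of_real_divide of_real_mult of_real_minus t_def[symmetric]
    using t by (simp add: divide_simps power2_eq_square) (simp add: algebra_simps)
  qed
  show "hF s \<tau> n Z * (LBINT u. ?F u * exp ((?l Z) * of_real u)) =
   (of_real c0 * exp ?q) * (inverse (Z ^ (n + 1)) * exp (V * Z - 0 * Z\<^sup>2 / 2))"
  proof -
   have "x * exp a * (c * exp b) = (c * exp p) * (x * exp q)" if "a + b = p + q" for x a b c p q :: complex
   proof -
    have "exp a * exp b = exp p * exp q" unfolding exp_add[symmetric] that ..
    then show ?thesis by (simp add: mult_ac)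
   qed
   from this[OF e] show ?thesis unfolding I hF_def .
  qed
 qed simp
 also have "\<dots> = (of_real c0 * exp ?q) * (?k * circle0_int (\<lambda>Z. inverse (Z ^ (n + 1)) * exp (V * Z - 0 * Z\<^sup>2 / 2)))"
  unfolding circle0_int_cmult by (rule mult.left_commute)
 also have "?k * circle0_int (\<lambda>Z. inverse (Z ^ (n + 1)) * exp (V * Z - 0 * Z\<^sup>2 / 2)) = V ^ n / fact n"
  unfolding circle0_exp_quadratic He_zero ..
 also have "(of_real c0 * exp ?q) * (V ^ n / fact n) = V ^ n * exp (of_real \<tau> * w\<^sup>2 - of_real s * V)"
 proof -
  have "of_real (- s\<^sup>2 / 2) + ?q = of_real \<tau> * w\<^sup>2 - of_real s * V"
   unfolding V_def by (simp add: power2_eq_square algebra_simps diff_divide_distrib)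
  then have "exp (of_real \<tau> * w\<^sup>2 - of_real s * V) = of_real (exp (- s\<^sup>2 / 2)) * exp ?q"
   unfolding exp_of_real[symmetric] exp_add[symmetric] by (simp only:)
  then show ?thesis unfolding c0_def by simp
 qed
 finally show ?thesis unfolding V_def .
qed

lemma circle0_monomial:
 "1 / (2 * of_real pi * \<i>) * circle0_int (\<lambda>Z. inverse (Z ^ (m + 1)) * Z ^ n) = (if n = m then 1 else 0)"
proof -
 have "(deriv ^^ m) (\<lambda>Z::complex. Z ^ n) 0 = (if n = m then fact m else 0)"
 proof -
  have h: "(deriv ^^ m) (\<lambda>Z::complex. (Z - 0) ^ n) 0 = pochhammer (of_nat (Suc n - m)) m * (0 - 0) ^ (n - m)"
   by (rule higher_deriv_power)
  consider "m < n" | "m = n" | "n < m" by linarith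
  then show ?thesis
  proof cases
   case 2
   then show ?thesis using h by (simp add: pochhammer_fact)
  next
   case 3
   then have "Suc n - m = 0" "m \<noteq> 0" by auto
   then show ?thesis using h 3 by (simp add: pochhammer_0_left)
  qed (use h in simp)
 qed
 then show ?thesis using circle0_coeff[of "\<lambda>Z. Z ^ n" m] by (simp add: holomorphic_on_power)
qed

lemma Ff_Gf_integrable:
 assumes "0 < \<tau>" shows "integrable lborel (\<lambda>u. Ff s \<tau> n u * Gf s \<tau>' m (a * u))"
proof -
 obtain C where C: "bnd (\<bar>s\<bar> + 1) C (Gf s \<tau>' m)" by (rule bnd_Gf)
 show ?thesis
 proof (rule integrable_bound)
  show "integrable lborel (\<lambda>u. C * (\<bar>Ff s \<tau> n u\<bar> * cosh ((\<bar>s\<bar> + 1) * a * u)))"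
   using Ff_integrable_cosh[OF assms] by simp
  show "AE u in lborel. norm (Ff s \<tau> n u * Gf s \<tau>' m (a * u)) \<le> norm (C * (\<bar>Ff s \<tau> n u\<bar> * cosh ((\<bar>s\<bar> + 1) * a * u)))"
  proof (rule AE_I2)
   fix u
   have "\<bar>Ff s \<tau> n u\<bar> * \<bar>Gf s \<tau>' m (a * u)\<bar> \<le> \<bar>Ff s \<tau> n u\<bar> * (C * cosh ((\<bar>s\<bar> + 1) * (a * u)))"
    by (intro mult_left_mono bndD[OF C]) simp
   then show "norm (Ff s \<tau> n u * Gf s \<tau>' m (a * u)) \<le> norm (C * (\<bar>Ff s \<tau> n u\<bar> * cosh ((\<bar>s\<bar> + 1) * a * u)))"
    using bnd_const_nonneg[OF C] by (simp add: abs_mult mult_ac)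
  qed
 qed measurable
qed

text \<open>With \<open>w = s - 2 * Z\<close> the transform of \<open>Ff\<close> is
  \<open>Z ^ n\<close> times the inverse of the exponential in \<open>hG\<close>, so only a monomial
  remains under the contour integral.\<close>

lemma Ff_Gf_orthonormal:
 assumes "0 < \<tau>"
 shows "(LBINT u. Ff s \<tau> n u * Gf s \<tau> m u) = (if n = m then 1 else 0)"
proof -
 let ?k = "1 / (2 * of_real pi * \<i>) :: complex"
 have i: "integrable lborel (\<lambda>u. norm (complex_of_real (Ff s \<tau> n u)) * exp (Re (of_real (- s)) * u) * cosh (norm (2::complex) * u))"
  using Ff_integrable[OF assms, of s n "-s" 2] by simp
 have "complex_of_real (LBINT u. Ff s \<tau> n u * Gf s \<tau> m u) = (LBINT u. of_real (Ff s \<tau> n u * Gf s \<tau> m u))"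
  by (rule integral_complex_of_real[symmetric])
 also have "\<dots> = (LBINT u. of_real (Ff s \<tau> n u) * (?k * circle0_int (\<lambda>Z. hG s \<tau> m Z * exp ((of_real (- s) + 2 * Z) * of_real u))))"
  unfolding of_real_mult Gf_contour ..
 also have "\<dots> = ?k * circle0_int (\<lambda>Z. inverse (Z ^ (m + 1)) * Z ^ n)"
 proof (rule circle_fubini_const[OF _ i hG_cont])
  fix Z :: complex
  have "(LBINT u. of_real (Ff s \<tau> n u) * exp ((of_real (- s) + 2 * Z) * of_real u)) = (LBINT u. of_real (Ff s \<tau> n u) * exp (- (of_real s - 2 * Z) * of_real u))"
   by (intro integral_cong refl) (simp add: algebra_simps)
  also have "\<dots> = Z ^ n * exp (of_real \<tau> * (of_real s - 2 * Z)\<^sup>2 - of_real s * Z)"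
   unfolding Ff_laplace[OF assms] by simp
  finally have I: "(LBINT u. of_real (Ff s \<tau> n u) * exp ((of_real (- s) + 2 * Z) * of_real u)) = Z ^ n * exp (of_real \<tau> * (of_real s - 2 * Z)\<^sup>2 - of_real s * Z)" .
  have "exp (- of_real \<tau> * (of_real s - 2 * Z)\<^sup>2 + of_real s * Z) * exp (of_real \<tau> * (of_real s - 2 * Z)\<^sup>2 - of_real s * Z) = 1"
   unfolding exp_add[symmetric] by simp
  then show "hG s \<tau> m Z * (LBINT u. of_real (Ff s \<tau> n u) * exp ((of_real (- s) + 2 * Z) * of_real u)) = inverse (Z ^ (m + 1)) * Z ^ n"
   unfolding I hG_def by (simp only: mult_ac) simp
 qed simp
 also have "\<dots> = of_real (if n = m then 1 else 0)" unfolding circle0_monomial by simp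
 finally show ?thesis by (simp only: of_real_eq_iff)
qed

text \<open>Reflecting \<open>u\<close> replaces \<open>w\<close> by \<open>2 * Z - s\<close>, hence
  \<open>Z ^ n\<close> by \<open>(s - Z) ^ n\<close>. The time-dependent exponents still cancel,
  which is why \<open>K0\<close> does not involve \<open>\<tau>\<close>.\<close>

lemma Ff_Gf_reflected:
 assumes "0 < \<tau>" and s: "s = sqrt 2 * r"
 shows "complex_of_real (LBINT u. Ff s \<tau> n u * Gf s \<tau> m (- u)) = K0 r n m"
proof -
 let ?e = "\<lambda>Z. exp (of_real \<tau> * (2 * Z - of_real s)\<^sup>2 - of_real s * (of_real s - Z)) :: complex"
 let ?k = "1 / (2 * of_real pi * \<i>) :: complex"
 have i: "integrable lborel (\<lambda>u. norm (complex_of_real (Ff s \<tau> n u)) * exp (Re (of_real s) * u) * cosh (norm (- 2::complex) * u))"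
  using Ff_integrable[OF assms(1), of s n s 2] by simp
 have "complex_of_real (LBINT u. Ff s \<tau> n u * Gf s \<tau> m (- u)) = (LBINT u. of_real (Ff s \<tau> n u * Gf s \<tau> m (- u)))"
  by (rule integral_complex_of_real[symmetric])
 also have "\<dots> = (LBINT u. of_real (Ff s \<tau> n u) * (?k * circle0_int (\<lambda>Z. hG s \<tau> m Z * exp ((of_real s + (- 2) * Z) * of_real u))))"
 proof -
  have "(of_real (- s) + 2 * Z) * of_real (- u) = (of_real s + (- 2) * Z) * of_real u" for Z :: complex and u by (simp add: algebra_simps)
  then show ?thesis unfolding of_real_mult Gf_contour by (simp only:)
 qed
 also have "\<dots> = ?k * circle0_int (\<lambda>Z. (of_real s - Z) ^ n / Z ^ (m + 1) * exp (- 2 * of_real (r\<^sup>2) + 2 * of_real (sqrt 2 * r) * Z))"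
 proof (rule circle_fubini_const[OF _ i hG_cont])
  fix Z :: complex
  have "(LBINT u. of_real (Ff s \<tau> n u) * exp ((of_real s + (- 2) * Z) * of_real u)) = (LBINT u. of_real (Ff s \<tau> n u) * exp (- (2 * Z - of_real s) * of_real u))"
   by (intro integral_cong refl) (simp add: algebra_simps)
  also have "\<dots> = (of_real s - Z) ^ n * ?e Z"
  proof -
   have "(of_real s - (2 * Z - of_real s)) / 2 = of_real s - Z" by (simp add: field_simps)
   then show ?thesis unfolding Ff_laplace[OF assms(1)] by (simp only:)
  qed
  finally have I: "(LBINT u. of_real (Ff s \<tau> n u) * exp ((of_real s + (- 2) * Z) * of_real u)) = (of_real s - Z) ^ n * ?e Z" .
  have s2: "complex_of_real s * of_real s = 2 * of_real (r\<^sup>2)"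
  proof -
   have "s * s = 2 * r\<^sup>2" unfolding s power2_eq_square[symmetric] by (simp add: power_mult_distrib)
   then have "complex_of_real (s * s) = of_real (2 * r\<^sup>2)" by (simp only:)
   then show ?thesis by (simp only: of_real_mult of_real_numeral)
  qed
  have "- of_real \<tau> * (of_real s - 2 * Z)\<^sup>2 + of_real s * Z + (of_real \<tau> * (2 * Z - of_real s)\<^sup>2 - of_real s * (of_real s - Z)) = - (of_real s * of_real s) + 2 * of_real s * Z"
   by (simp add: power2_eq_square algebra_simps)
  also have "\<dots> = - 2 * of_real (r\<^sup>2) + 2 * of_real (sqrt 2 * r) * Z" unfolding s2 unfolding s by simp
  finally have "exp (- of_real \<tau> * (of_real s - 2 * Z)\<^sup>2 + of_real s * Z) * ?e Z = exp (- 2 * of_real (r\<^sup>2) + 2 * of_real (sqrt 2 * r) * Z)"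
   unfolding exp_add[symmetric] by (simp only:)
  then have "inverse (Z ^ (m + 1)) * exp (- of_real \<tau> * (of_real s - 2 * Z)\<^sup>2 + of_real s * Z) * ((of_real s - Z) ^ n * ?e Z)
   = (of_real s - Z) ^ n / Z ^ (m + 1) * exp (- 2 * of_real (r\<^sup>2) + 2 * of_real (sqrt 2 * r) * Z)"
  proof -
   have "a * e * (b * f) = b * a * g" if "e * f = g" for a b e f g :: complex using that by (simp add: mult_ac)
   then show ?thesis unfolding divide_inverse using \<open>exp _ * exp _ = _\<close> by blast
  qed
  then show "hG s \<tau> m Z * (LBINT u. of_real (Ff s \<tau> n u) * exp ((of_real s + (- 2) * Z) * of_real u)) = (of_real s - Z) ^ n / Z ^ (m + 1) * exp (- 2 * of_real (r\<^sup>2) + 2 * of_real (sqrt 2 * r) * Z)"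
   unfolding I hG_def .
 qed simp
 finally show ?thesis unfolding K0_def s .
qed

lemma Psi_eq: "Psi r \<tau> m u = of_real (Gf (sqrt 2 * r) \<tau> m u - Gf (sqrt 2 * r) \<tau> m (- u))"
proof -
 define s where "s = sqrt 2 * r"
 have c: "continuous_on (sphere 0 1) (\<lambda>Z. hG s \<tau> m Z * exp ((of_real (- s) + 2 * Z) * of_real u))" for u
  unfolding hG_def by (intro continuous_intros) auto
 have "Psi r \<tau> m u = 1 / (2 * of_real pi * \<i>) * circle0_int (\<lambda>Z. hG s \<tau> m Z * exp ((of_real (- s) + 2 * Z) * of_real u) - hG s \<tau> m Z * exp ((of_real (- s) + 2 * Z) * of_real (- u)))"
  unfolding Psi_def hG_def gZ_def s_def[symmetric] right_diff_distrib by simp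
 also have "\<dots> = of_real (Gf s \<tau> m u) - of_real (Gf s \<tau> m (- u))"
  unfolding circle0_int_diff[OF c c] right_diff_distrib Gf_contour[symmetric] ..
 finally show ?thesis unfolding s_def by simp
qed

text \<open>The power \<open>(\<i> * y) ^ n\<close> is \<open>fact n\<close> times the coefficient
  of \<open>Z ^ n\<close> in \<open>exp (\<i> * y * Z)\<close>; the remaining Gaussian Fourier
  integral in \<open>y\<close> yields the generating function of \<open>He\<close>.\<close>

lemma Ff_line_integral:
 fixes s \<tau> :: real and n :: nat
 assumes t: "0 < \<tau>"
 defines "I \<equiv> \<lambda>u y. (\<i> * of_real y) ^ n * exp (of_real \<tau> * (of_real s - 2 * (\<i> * of_real y))\<^sup>2 - of_real s * (\<i> * of_real y)) * exp ((of_real s - 2 * (\<i> * of_real y)) * of_real u)"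
 shows "integrable lborel (I u)" and "(LBINT y. I u y) = of_real (pi * Ff s \<tau> n u)"
proof -
 let ?k = "1 / (2 * of_real pi * \<i>) :: complex"
 define c where "c = 2 * u + s + 4 * \<tau> * s"
 \<comment> \<open>Chosen so that \<open>heat 2 d 0\<close> has variance
   \<open>1 / (8 * \<tau>)\<close>, that is, shape
   \<open>exp (- 4 * \<tau> * y\<^sup>2)\<close>.\<close>
 define d where "d = 1 / (16 * \<tau>)"
 have d: "0 < 2 * d" using t by (simp add: d_def)
 define K where "K = exp (\<tau> * s\<^sup>2 + s * u) * sqrt (pi / (4 * \<tau>)) * fact n"
 have gauss: "exp (- 4 * \<tau> * y\<^sup>2) = sqrt (pi / (4 * \<tau>)) * heat 2 d 0 y" for y
 proof -
  have dd: "2 * d = 1 / (8 * \<tau>)" using t by (simp add: d_def)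
  have "sqrt (2 * pi * (2 * d)) = sqrt (pi / (4 * \<tau>))" unfolding dd using t by (simp add: field_simps)
  moreover have "- (y - 0)\<^sup>2 / (2 * (2 * d)) = - 4 * \<tau> * y\<^sup>2" unfolding dd using t by (simp add: field_simps)
  moreover have "sqrt (pi / (4 * \<tau>)) \<noteq> 0" using t by simp
  ultimately show ?thesis unfolding heat_eq[OF d] by simp
 qed
 have hc: "continuous_on (sphere 0 1) (\<lambda>Z::complex. inverse (Z ^ (n + 1)))" by (intro continuous_intros) auto
 have i: "integrable lborel (\<lambda>y. norm (complex_of_real (heat 2 d 0 y)) * exp (Re (- \<i> * of_real c) * y) * cosh (norm \<i> * y))"
  using integrable_heat_exp_cosh[OF d, of 0 0 1] by simp
 have I_eq: "I u y = of_real K * (of_real (heat 2 d 0 y) * (?k * circle0_int (\<lambda>Z. inverse (Z ^ (n + 1)) * exp ((- \<i> * of_real c + \<i> * Z) * of_real y))))" for y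
 proof -
  have "circle0_int (\<lambda>Z. inverse (Z ^ (n + 1)) * exp ((- \<i> * of_real c + \<i> * Z) * of_real y)) =
   circle0_int (\<lambda>Z. exp (- \<i> * of_real c * of_real y) * (inverse (Z ^ (n + 1)) * exp ((\<i> * of_real y) * Z - 0 * Z\<^sup>2 / 2)))"
  proof (rule circle0_int_cong)
   fix Z :: complex
   have "exp ((- \<i> * of_real c + \<i> * Z) * of_real y) = exp (- \<i> * of_real c * of_real y) * exp ((\<i> * of_real y) * Z - 0 * Z\<^sup>2 / 2)"
    unfolding exp_add[symmetric] by (simp add: algebra_simps)
   then show "inverse (Z ^ (n + 1)) * exp ((- \<i> * of_real c + \<i> * Z) * of_real y) = exp (- \<i> * of_real c * of_real y) * (inverse (Z ^ (n + 1)) * exp ((\<i> * of_real y) * Z - 0 * Z\<^sup>2 / 2))"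
    by (simp only: mult.left_commute)
  qed
  also have "\<dots> = exp (- \<i> * of_real c * of_real y) * circle0_int (\<lambda>Z. inverse (Z ^ (n + 1)) * exp ((\<i> * of_real y) * Z - 0 * Z\<^sup>2 / 2))"
   by (rule circle0_int_cmult)
  finally have "?k * circle0_int (\<lambda>Z. inverse (Z ^ (n + 1)) * exp ((- \<i> * of_real c + \<i> * Z) * of_real y)) =
   exp (- \<i> * of_real c * of_real y) * (?k * circle0_int (\<lambda>Z. inverse (Z ^ (n + 1)) * exp ((\<i> * of_real y) * Z - 0 * Z\<^sup>2 / 2)))"
   by (simp only: mult.left_commute)
  also have "\<dots> = exp (- \<i> * of_real c * of_real y) * ((\<i> * of_real y) ^ n / fact n)"
   unfolding circle0_exp_quadratic He_zero ..
  finally have J: "?k * circle0_int (\<lambda>Z. inverse (Z ^ (n + 1)) * exp ((- \<i> * of_real c + \<i> * Z) * of_real y)) = exp (- \<i> * of_real c * of_real y) * ((\<i> * of_real y) ^ n / fact n)" .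
  have "of_real \<tau> * (of_real s - 2 * (\<i> * of_real y))\<^sup>2 - of_real s * (\<i> * of_real y) + (of_real s - 2 * (\<i> * of_real y)) * of_real u
   = of_real (\<tau> * s\<^sup>2 + s * u) + of_real (- 4 * \<tau> * y\<^sup>2) + (- \<i> * of_real c * of_real y)"
   unfolding c_def by (simp add: power2_eq_square algebra_simps)
  then have "exp (of_real \<tau> * (of_real s - 2 * (\<i> * of_real y))\<^sup>2 - of_real s * (\<i> * of_real y)) * exp ((of_real s - 2 * (\<i> * of_real y)) * of_real u)
   = of_real (exp (\<tau> * s\<^sup>2 + s * u)) * of_real (sqrt (pi / (4 * \<tau>)) * heat 2 d 0 y) * exp (- \<i> * of_real c * of_real y)"
   unfolding gauss[symmetric] exp_of_real[symmetric] exp_add[symmetric] by (simp only:)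
  then have "I u y = (\<i> * of_real y) ^ n * (of_real (exp (\<tau> * s\<^sup>2 + s * u)) * of_real (sqrt (pi / (4 * \<tau>)) * heat 2 d 0 y) * exp (- \<i> * of_real c * of_real y))"
   unfolding I_def mult.assoc by (simp only:)
  then show ?thesis unfolding J K_def by (simp add: field_simps)
 qed
 show "integrable lborel (I u)"
  unfolding I_eq[abs_def] mult.left_commute[of "of_real (heat _ _ _ _)" ?k]
  by (intro integrable_mult_right circle_fubini(2)[OF _ i hc]) simp
 have "(LBINT y. I u y) = of_real K * (LBINT y. of_real (heat 2 d 0 y) * (?k * circle0_int (\<lambda>Z. inverse (Z ^ (n + 1)) * exp ((- \<i> * of_real c + \<i> * Z) * of_real y))))"
  unfolding I_eq by (rule integral_mult_right_zero)
 also have "(LBINT y. of_real (heat 2 d 0 y) * (?k * circle0_int (\<lambda>Z. inverse (Z ^ (n + 1)) * exp ((- \<i> * of_real c + \<i> * Z) * of_real y)))) =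
  ?k * circle0_int (\<lambda>Z. of_real (exp (- (c\<^sup>2 / (16 * \<tau>)))) * (inverse (Z ^ (n + 1)) * exp (of_real (c / (8 * \<tau>)) * Z - of_real (1 / (8 * \<tau>)) * Z\<^sup>2 / 2)))"
 proof (rule circle_fubini_const[OF _ i hc])
  fix Z :: complex
  have "(- \<i> * of_real c + \<i> * Z) * of_real 0 + of_real (2 * d) * (- \<i> * of_real c + \<i> * Z)\<^sup>2 / 2 =
   of_real (- (c\<^sup>2 / (16 * \<tau>))) + (of_real (c / (8 * \<tau>)) * Z - of_real (1 / (8 * \<tau>)) * Z\<^sup>2 / 2)"
  proof -
   have "(- \<i> * of_real c + \<i> * Z)\<^sup>2 = - ((of_real c)\<^sup>2) + 2 * of_real c * Z - Z\<^sup>2"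
    by (simp add: power2_eq_square algebra_simps)
   then have "(- \<i> * of_real c + \<i> * Z) * of_real 0 + of_real (2 * d) * (- \<i> * of_real c + \<i> * Z)\<^sup>2 / 2 = of_real d * (- ((of_real c)\<^sup>2) + 2 * of_real c * Z - Z\<^sup>2)"
    by simp
   also have "\<dots> = of_real (- (c\<^sup>2 / (16 * \<tau>))) + (of_real (c / (8 * \<tau>)) * Z - of_real (1 / (8 * \<tau>)) * Z\<^sup>2 / 2)"
    unfolding d_def by (simp add: algebra_simps add_divide_distrib diff_divide_distrib)
   finally show ?thesis .
  qed
  then show "inverse (Z ^ (n + 1)) * (LBINT y. of_real (heat 2 d 0 y) * exp ((- \<i> * of_real c + \<i> * Z) * of_real y)) =
   of_real (exp (- (c\<^sup>2 / (16 * \<tau>)))) * (inverse (Z ^ (n + 1)) * exp (of_real (c / (8 * \<tau>)) * Z - of_real (1 / (8 * \<tau>)) * Z\<^sup>2 / 2))"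
   unfolding integral_heat_cexp[OF d] exp_of_real[symmetric] mult.left_commute[of "exp (of_real _)"] exp_add[symmetric] by (simp only:)
 qed simp
 also have "\<dots> = of_real (exp (- (c\<^sup>2 / (16 * \<tau>)))) * of_real (He n (c / (8 * \<tau>)) (1 / (8 * \<tau>)))"
  unfolding circle0_int_cmult mult.left_commute[of ?k] circle0_exp_quadratic of_real_He ..
 finally have fin: "(LBINT y. I u y) = of_real (K * (exp (- (c\<^sup>2 / (16 * \<tau>))) * He n (c / (8 * \<tau>)) (1 / (8 * \<tau>))))" by simp
 have "K * exp (- (c\<^sup>2 / (16 * \<tau>))) = pi * (exp (- s\<^sup>2 / 2) * fact n * heat 2 \<tau> (- s / 2) u)"
 proof -
  have tt: "0 < 2 * \<tau>" using t by simp
  have e: "(\<tau> * s\<^sup>2 + s * u) + - (c\<^sup>2 / (16 * \<tau>)) = - s\<^sup>2 / 2 + - (u - - s / 2)\<^sup>2 / (2 * (2 * \<tau>))"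
   unfolding c_def using t by (simp add: field_simps power2_eq_square)
  have q: "sqrt (pi / (4 * \<tau>)) = pi * (1 / sqrt (2 * pi * (2 * \<tau>)))"
  proof -
   have "sqrt (pi / (4 * \<tau>)) * sqrt (2 * pi * (2 * \<tau>)) = pi"
    using t by (simp add: real_sqrt_mult[symmetric] power2_eq_square[symmetric])
   then show ?thesis using t by (simp add: field_simps)
  qed
  have "exp (\<tau> * s\<^sup>2 + s * u) * exp (- (c\<^sup>2 / (16 * \<tau>))) = exp (- s\<^sup>2 / 2) * exp (- (u - - s / 2)\<^sup>2 / (2 * (2 * \<tau>)))"
   unfolding exp_add[symmetric] e ..
  then show ?thesis unfolding K_def heat_eq[OF tt] q by (simp add: mult_ac) 
 qed
 then show "(LBINT y. I u y) = of_real (pi * Ff s \<tau> n u)"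
  unfolding fin Ff_def c_def[symmetric] of_real_eq_iff by (simp add: mult_ac)
qed

lemma Phi_eq:
 assumes t: "0 < \<tau>"
 shows "Phi r \<tau> n u = of_real (Ff (sqrt 2 * r) \<tau> n u - Ff (sqrt 2 * r) \<tau> n (- u))"
proof -
 define s where "s = sqrt 2 * r"
 define I where "I u y = (\<i> * of_real y) ^ n * exp (of_real \<tau> * (of_real s - 2 * (\<i> * of_real y))\<^sup>2 - of_real s * (\<i> * of_real y)) * exp ((of_real s - 2 * (\<i> * of_real y)) * of_real u)" for u y
 have i: "integrable lborel (I u)" "(LBINT y. I u y) = of_real (pi * Ff s \<tau> n u)" for u
  using Ff_line_integral[OF t, of n s u] unfolding I_def by auto
 have "Phi r \<tau> n u = 1 / (of_real pi * \<i>) * (LBINT y. (I u y - I (- u) y) * \<i>)"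
  unfolding Phi_def iR_int_def I_def fW_def s_def[symmetric] by (simp only: right_diff_distrib)
 also have "\<dots> = 1 / (of_real pi * \<i>) * ((of_real (pi * Ff s \<tau> n u) - of_real (pi * Ff s \<tau> n (- u))) * \<i>)"
  unfolding integral_mult_left_zero integral_diff[OF i(1) i(1)] i(2) ..
 also have "complex_of_real (pi * Ff s \<tau> n u) - of_real (pi * Ff s \<tau> n (- u)) = of_real pi * of_real (Ff s \<tau> n u - Ff s \<tau> n (- u))"
  by (simp add: algebra_simps)
 finally show ?thesis unfolding s_def by simp
qed

lemma power_affine_le_cosh:
 assumes "0 \<le> a" "0 \<le> b"
 obtains C :: real where "0 \<le> C" "\<And>u. (a * \<bar>u\<bar> + b) ^ n \<le> C * cosh u"
proof
 let ?K = "b"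
 let ?C = "(a + 1) ^ n * (fact n * (exp ?K * 2))"
 show "0 \<le> ?C" using assms by simp
 fix u
 have "(a * \<bar>u\<bar> + b) ^ n \<le> ((a + 1) * (\<bar>u\<bar> + b)) ^ n"
 proof (rule power_mono)
  have "(a + 1) * (\<bar>u\<bar> + b) = a * \<bar>u\<bar> + b + \<bar>u\<bar> + a * b" by (simp add: algebra_simps)
  moreover have "0 \<le> a * b" using assms by simp
  ultimately show "a * \<bar>u\<bar> + b \<le> (a + 1) * (\<bar>u\<bar> + b)" using abs_ge_zero[of u] by linarith
 qed (use assms in simp)
 also have "\<dots> \<le> (a + 1) ^ n * (fact n * exp (\<bar>u\<bar> + b))"
  unfolding power_mult_distrib using assms by (intro mult_left_mono power_le_fact_exp) auto
 also have "\<dots> \<le> (a + 1) ^ n * (fact n * (2 * cosh u * exp b))"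
  unfolding exp_add[of "\<bar>u\<bar>"] using assms by (intro mult_left_mono mult_right_mono exp_abs_le_cosh) auto
 finally show "(a * \<bar>u\<bar> + b) ^ n \<le> ?C * cosh u" by (simp add: mult_ac)
qed

text \<open>To the right \<open>exp (- s * w)\<close> beats the polynomial, and for large times the
  prefactor \<open>exp (- (\<beta> * s\<^sup>2))\<close> wins. It makes the exit weight negligible
  on the positive half-line; the margin down to -1 accommodates the lift by
  \<open>\<epsilon>\<close>.\<close>

lemma Gf_small:
 assumes s: "0 < s"
 obtains C where "0 \<le> C" "\<And>\<beta> w. 0 < \<beta> ==> - 1 \<le> w ==> \<bar>Gf s \<beta> m w\<bar> \<le> C * ((1 + \<beta>) ^ m * exp (- (\<beta> * s\<^sup>2)))"
proof
 \<comment> \<open>Collects the coefficients in the argument of \<open>He\<close>, so that its bound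
   separates into a factor in \<open>w\<close> and a factor in \<open>\<beta>\<close>.\<close>
 define L where "L = 4 * s + 9"
 define C where "C = (2 / s) ^ m * fact m * exp (s / 2) * exp (2 * s) * L ^ m"
 show C0: "0 \<le> C" using s by (simp add: C_def L_def)
 fix \<beta> w :: real assume b: "0 < \<beta>" and w: "- 1 \<le> w"
 have "\<bar>2 * w + s + 4 * \<beta> * s\<bar> + \<bar>8 * \<beta>\<bar> + 1 \<le> (2 * \<bar>w\<bar> + 1) * (L * (1 + \<beta>))"
 proof -
  have "\<bar>2 * w + s + 4 * \<beta> * s\<bar> \<le> 2 * \<bar>w\<bar> + s + 4 * \<beta> * s"
   using b s by (simp add: abs_le_iff) (use abs_ge_self[of w] abs_ge_minus_self[of w] mult_pos_pos[OF b s] in linarith)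
  moreover have "(2 * \<bar>w\<bar> + 1) * (L * (1 + \<beta>)) = 2 * (\<bar>w\<bar> * (L * (1 + \<beta>))) + L * (1 + \<beta>)" by (simp add: algebra_simps)
  moreover have "L * (1 + \<beta>) = 4 * s + 9 + 4 * \<beta> * s + 9 * \<beta>" by (simp add: L_def algebra_simps)
  moreover have "\<bar>w\<bar> * 1 \<le> \<bar>w\<bar> * (L * (1 + \<beta>))"
  proof (rule mult_left_mono)
   have "0 \<le> \<beta> * s" using b s by simp
   then show "1 \<le> L * (1 + \<beta>)" using b s \<open>L * (1 + \<beta>) = _\<close> by linarith
  qed simp
  ultimately show ?thesis using b s by linarith
 qed
 then have He: "\<bar>He m (2 * w + s + 4 * \<beta> * s) (8 * \<beta>)\<bar> \<le> (2 * \<bar>w\<bar> + 1) ^ m * (L * (1 + \<beta>)) ^ m"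
  unfolding power_mult_distrib[symmetric] by (intro order_trans[OF He_abs_le] power_mono) auto
 have "(2 * \<bar>w\<bar> + 1) ^ m = (2 / s) ^ m * (s * \<bar>w\<bar> + s / 2) ^ m"
 proof -
  have "(2 / s) * (s * \<bar>w\<bar> + s / 2) = 2 * \<bar>w\<bar> + 1" using s by (simp add: field_simps)
  then show ?thesis unfolding power_mult_distrib[symmetric] by (simp only:)
 qed
 also have "\<dots> \<le> (2 / s) ^ m * (fact m * exp (s * \<bar>w\<bar> + s / 2))"
  using s by (intro mult_left_mono power_le_fact_exp) auto
 finally have p: "(2 * \<bar>w\<bar> + 1) ^ m * exp (- (s * w)) \<le> (2 / s) ^ m * (fact m * exp (s * \<bar>w\<bar> + s / 2)) * exp (- (s * w))"
  by (rule mult_right_mono) simp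
 have "exp (s * \<bar>w\<bar> + s / 2) * exp (- (s * w)) \<le> exp (s / 2) * exp (2 * s)"
 proof -
  have "s * (\<bar>w\<bar> - w) \<le> s * 2" using s w by (intro mult_left_mono) auto
  then show ?thesis unfolding exp_add[symmetric] by (simp add: algebra_simps)
 qed
 then have "(2 / s) ^ m * fact m * (exp (s * \<bar>w\<bar> + s / 2) * exp (- (s * w))) \<le> (2 / s) ^ m * fact m * (exp (s / 2) * exp (2 * s))"
  using s by (intro mult_left_mono) auto
 from order_trans[OF p[unfolded mult.assoc] this[unfolded mult.assoc]]
 have p2: "(2 * \<bar>w\<bar> + 1) ^ m * exp (- (s * w)) \<le> (2 / s) ^ m * fact m * (exp (s / 2) * exp (2 * s))" by (simp only: mult.assoc)
 have "\<bar>Gf s \<beta> m w\<bar> = exp (- (\<beta> * s\<^sup>2)) * exp (- (s * w)) * \<bar>He m (2 * w + s + 4 * \<beta> * s) (8 * \<beta>)\<bar>"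
  unfolding Gf_def by (simp add: abs_mult exp_diff exp_minus field_simps)
 also have "\<dots> \<le> exp (- (\<beta> * s\<^sup>2)) * exp (- (s * w)) * ((2 * \<bar>w\<bar> + 1) ^ m * (L * (1 + \<beta>)) ^ m)"
  by (intro mult_left_mono He) simp
 also have "\<dots> = (exp (- (\<beta> * s\<^sup>2)) * (L * (1 + \<beta>)) ^ m) * ((2 * \<bar>w\<bar> + 1) ^ m * exp (- (s * w)))" by (simp only: mult_ac)
 also have "\<dots> \<le> (exp (- (\<beta> * s\<^sup>2)) * (L * (1 + \<beta>)) ^ m) * ((2 / s) ^ m * fact m * (exp (s / 2) * exp (2 * s)))"
  using b s by (intro mult_left_mono p2) (auto simp: L_def)
 also have "\<dots> = C * ((1 + \<beta>) ^ m * exp (- (\<beta> * s\<^sup>2)))" unfolding C_def power_mult_distrib by (simp only: mult_ac)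
 finally show "\<bar>Gf s \<beta> m w\<bar> \<le> C * ((1 + \<beta>) ^ m * exp (- (\<beta> * s\<^sup>2)))" .
qed

text \<open>As \<open>\<alpha>\<close> tends to 0 the Gaussian concentrates at
  \<open>- s / 2\<close>, at distance at least \<open>s / 4\<close> from \<open>y\<close>. From
  \<open>(y + s / 2)\<^sup>2 \<ge> (y + s / 4)\<^sup>2 + s\<^sup>2 / 16\<close> the second term
  gives the small factor, with 64 = 4 * 16, and the first keeps integrability. The power of
  \<open>1 / \<alpha>\<close> pays for \<open>He\<close> and for the normalisation.\<close>

lemma Ff_small:
 assumes s: "0 < s"
 obtains C where "0 \<le> C" "\<And>\<alpha> y. 0 < \<alpha> ==> \<alpha> \<le> 1 ==> - (s / 4) \<le> y ==>
  \<bar>Ff s \<alpha> n y\<bar> \<le> C * ((1 / \<alpha>) ^ Suc n * exp (- (s\<^sup>2 / (64 * \<alpha>)))) * (heat 2 1 (- s / 4) y * cosh y)"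
proof -
 obtain C0 where C0: "0 \<le> C0" "\<And>y. (2 * \<bar>y\<bar> + (5 * s + 9)) ^ n \<le> C0 * cosh y"
  using power_affine_le_cosh[of 2 "5 * s + 9" n] s by auto
 define C where "C = exp (- s\<^sup>2 / 2) * fact n * C0"
 have bound: "\<bar>Ff s \<alpha> n y\<bar> \<le> C * ((1 / \<alpha>) ^ Suc n * exp (- (s\<^sup>2 / (64 * \<alpha>)))) * (heat 2 1 (- s / 4) y * cosh y)"
  if a: "0 < \<alpha>" "\<alpha> \<le> 1" and y: "- (s / 4) \<le> y" for \<alpha> y
 proof -
  define z where "z = y + s / 4"
  have z: "0 \<le> z" using y by (simp add: z_def)
  have a2: "0 < 2 * \<alpha>" "0 < 2 * (1::real)" using a by auto
  have h: "heat 2 \<alpha> (- s / 2) y \<le> (1 / \<alpha>) * exp (- (s\<^sup>2 / (64 * \<alpha>))) * heat 2 1 (- s / 4) y"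
  proof -
   have "z\<^sup>2 + s\<^sup>2 / 16 \<le> (y - - s / 2)\<^sup>2"
   proof -
    have "(y - - s / 2)\<^sup>2 = z\<^sup>2 + s\<^sup>2 / 16 + z * s / 2" by (simp add: z_def power2_eq_square field_simps)
    then show ?thesis using z s by simp
   qed
   then have "(z\<^sup>2 + s\<^sup>2 / 16) / (4 * \<alpha>) \<le> (y - - s / 2)\<^sup>2 / (4 * \<alpha>)" using a by (intro divide_right_mono) auto
   moreover have "z\<^sup>2 / 4 \<le> z\<^sup>2 / (4 * \<alpha>)" using a by (intro divide_left_mono) auto
   ultimately have "- (y - - s / 2)\<^sup>2 / (2 * (2 * \<alpha>)) \<le> - (s\<^sup>2 / (64 * \<alpha>)) + - (y - - s / 4)\<^sup>2 / (2 * (2 * 1))"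
    using a by (simp add: z_def add_divide_distrib)
   then have e: "exp (- (y - - s / 2)\<^sup>2 / (2 * (2 * \<alpha>))) \<le> exp (- (s\<^sup>2 / (64 * \<alpha>))) * exp (- (y - - s / 4)\<^sup>2 / (2 * (2 * 1)))"
    unfolding exp_add[symmetric] by simp
   have q: "1 / sqrt (2 * pi * (2 * \<alpha>)) \<le> (1 / \<alpha>) * (1 / sqrt (2 * pi * (2 * 1)))"
   proof -
    have "\<alpha> \<le> sqrt \<alpha>" using a by (intro real_le_rsqrt) (simp add: power2_eq_square mult_left_le)
    then have "1 / sqrt \<alpha> \<le> 1 / \<alpha>" using a by (intro divide_left_mono) auto
    then have "1 / sqrt \<alpha> * (1 / sqrt (2 * pi * (2 * 1))) \<le> (1 / \<alpha>) * (1 / sqrt (2 * pi * (2 * 1)))" by (intro mult_right_mono) auto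
    moreover have "sqrt (2 * pi * (2 * \<alpha>)) = sqrt \<alpha> * sqrt (2 * pi * (2 * 1))" by (simp add: real_sqrt_mult[symmetric] mult_ac)
    ultimately show ?thesis by simp
   qed
   have "heat 2 \<alpha> (- s / 2) y \<le> ((1 / \<alpha>) * (1 / sqrt (2 * pi * (2 * 1)))) * (exp (- (s\<^sup>2 / (64 * \<alpha>))) * exp (- (y - - s / 4)\<^sup>2 / (2 * (2 * 1))))"
    unfolding heat_eq[OF a2(1)] using a by (intro mult_mono q e) auto
   also have "\<dots> = (1 / \<alpha>) * exp (- (s\<^sup>2 / (64 * \<alpha>))) * heat 2 1 (- s / 4) y"
    unfolding heat_eq[OF a2(2)] by (simp only: mult_ac)
   finally show ?thesis .
  qed
  have He: "\<bar>He n ((2 * y + s + 4 * \<alpha> * s) / (8 * \<alpha>)) (1 / (8 * \<alpha>))\<bar> \<le> (1 / \<alpha>) ^ n * (C0 * cosh y)"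
  proof -
   have as: "\<alpha> * s \<le> s" "0 \<le> \<alpha> * s" using a s by (auto simp: mult_left_le_one_le)
   have "\<bar>2 * y + s + 4 * \<alpha> * s\<bar> \<le> 2 * \<bar>y\<bar> + 5 * s"
   proof (rule abs_leI)
    have e: "4 * \<alpha> * s = 4 * (\<alpha> * s)" by simp
    show "2 * y + s + 4 * \<alpha> * s \<le> 2 * \<bar>y\<bar> + 5 * s" using as s abs_ge_self[of y] unfolding e by linarith
    show "- (2 * y + s + 4 * \<alpha> * s) \<le> 2 * \<bar>y\<bar> + 5 * s" using as s abs_ge_minus_self[of y] unfolding e by linarith
   qed
   then have "\<bar>(2 * y + s + 4 * \<alpha> * s) / (8 * \<alpha>)\<bar> \<le> (2 * \<bar>y\<bar> + 5 * s) / (8 * \<alpha>)" using a by (simp add: abs_divide divide_right_mono)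
   moreover have "1 \<le> 8 / (8 * \<alpha>)" using a by simp
   moreover have "\<bar>1 / (8 * \<alpha>)\<bar> = 1 / (8 * \<alpha>)" using a by simp
   ultimately have "\<bar>(2 * y + s + 4 * \<alpha> * s) / (8 * \<alpha>)\<bar> + \<bar>1 / (8 * \<alpha>)\<bar> + 1 \<le> (2 * \<bar>y\<bar> + 5 * s) / (8 * \<alpha>) + 1 / (8 * \<alpha>) + 8 / (8 * \<alpha>)"
    by linarith
   also have "\<dots> = (2 * \<bar>y\<bar> + (5 * s + 9)) / (8 * \<alpha>)" by (simp add: add_divide_distrib)
   also have "\<dots> \<le> (1 / \<alpha>) * (2 * \<bar>y\<bar> + (5 * s + 9))" using a s by (simp add: field_simps)
   finally have "\<bar>He n ((2 * y + s + 4 * \<alpha> * s) / (8 * \<alpha>)) (1 / (8 * \<alpha>))\<bar> \<le> ((1 / \<alpha>) * (2 * \<bar>y\<bar> + (5 * s + 9))) ^ n"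
    by (intro order_trans[OF He_abs_le] power_mono) auto
   also have "\<dots> \<le> (1 / \<alpha>) ^ n * (C0 * cosh y)"
    unfolding power_mult_distrib using C0(2)[of y] a by (intro mult_left_mono) auto
   finally show ?thesis .
  qed
  have "\<bar>Ff s \<alpha> n y\<bar> = exp (- s\<^sup>2 / 2) * fact n * (\<bar>He n ((2 * y + s + 4 * \<alpha> * s) / (8 * \<alpha>)) (1 / (8 * \<alpha>))\<bar> * heat 2 \<alpha> (- s / 2) y)"
   unfolding Ff_def by (simp add: abs_mult)
  also have "\<dots> \<le> exp (- s\<^sup>2 / 2) * fact n * (((1 / \<alpha>) ^ n * (C0 * cosh y)) * ((1 / \<alpha>) * exp (- (s\<^sup>2 / (64 * \<alpha>))) * heat 2 1 (- s / 4) y))"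
   using C0 a by (intro mult_left_mono mult_mono He h) auto
  also have "\<dots> = C * ((1 / \<alpha>) ^ Suc n * exp (- (s\<^sup>2 / (64 * \<alpha>)))) * (heat 2 1 (- s / 4) y * cosh y)"
   unfolding C_def power_Suc by (simp only: mult_ac)
  finally show ?thesis .
 qed
 have "0 \<le> C" using C0 by (simp add: C_def)
 from that[OF this bound] show ?thesis .
qed

lemma Ff_shift_le:
 assumes t: "0 < \<tau>"
 obtains C where "0 \<le> C" "\<And>\<epsilon> v. \<bar>\<epsilon>\<bar> \<le> 1 ==> \<bar>Ff s \<tau> n (v - \<epsilon>)\<bar> \<le> C * (heat 2 (2 * \<tau>) (- s / 2) v * cosh v)"
proof -
 obtain C0 where C0: "0 \<le> C0" "\<And>u. \<bar>Ff s \<tau> n u\<bar> \<le> C0 * (heat 2 \<tau> (- s / 2) u * cosh u)" using Ff_abs_le by metis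
 define B where "B = sqrt 2 * exp (1 / (2 * (2 * \<tau>)))"
 have "\<bar>Ff s \<tau> n (v - \<epsilon>)\<bar> \<le> (C0 * B * exp 1) * (heat 2 (2 * \<tau>) (- s / 2) v * cosh v)" if e: "\<bar>\<epsilon>\<bar> \<le> 1" for \<epsilon> v
 proof -
  have h: "heat 2 \<tau> (- s / 2) (v - \<epsilon>) \<le> B * heat 2 (2 * \<tau>) (- s / 2) v"
  proof -
   have "heat 2 \<tau> (- s / 2) (v - \<epsilon>) = heat 2 \<tau> (- s / 2 + \<epsilon>) v" using heat_shift[of 2 \<tau> "- s / 2" \<epsilon> "v - \<epsilon>"] by simp
   then show ?thesis using heat_perturb_le[of 2 \<tau> \<epsilon> "- s / 2" v] t e by (simp add: B_def)
  qed
  have c: "cosh (v - \<epsilon>) \<le> exp 1 * cosh v"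
   using cosh_shift_le[of "- \<epsilon>" v] e by (auto intro: order_trans mult_right_mono)
  have "\<bar>Ff s \<tau> n (v - \<epsilon>)\<bar> \<le> C0 * (heat 2 \<tau> (- s / 2) (v - \<epsilon>) * cosh (v - \<epsilon>))" by (rule C0(2))
  also have "\<dots> \<le> C0 * ((B * heat 2 (2 * \<tau>) (- s / 2) v) * (exp 1 * cosh v))"
   using C0(1) by (intro mult_left_mono mult_mono h c) (auto simp: B_def)
  finally show ?thesis by (simp only: mult_ac)
 qed
 moreover have "0 \<le> C0 * B * exp 1" using C0 by (simp add: B_def)
 ultimately show ?thesis by (rule that[rotated])
qed

section \<open>From the bridges to determinants\<close>

lemma detS_triangular:
 fixes A :: "nat => nat => real"
 assumes "\<And>i j. i < j ==> j < N ==> A i j = 0"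
 shows "detS {..<N} A = (\<Prod>i<N. A i i)"
proof -
 let ?M = "Matrix.mat N N (\<lambda>(i,j). A i j)"
 have "Determinant.det ?M = prod_list (diag_mat ?M)"
  by (rule det_lower_triangular[of N]) (use assms in auto)
 also have "\<dots> = (\<Prod>i<N. A i i)"
  by (simp add: diag_mat_def prod.distinct_set_conv_list[symmetric] lessThan_atLeast0 cong: map_cong)
 finally show ?thesis by (simp add: det_mat_detS)
qed

text \<open>The coefficient matrix is triangular, so a change of basis respecting degrees only
  contributes the leading coefficients.\<close>

lemma detS_polynomials:
 fixes p :: "nat => real poly" and y :: "nat => real"
 assumes deg: "\<And>i. i < N ==> degree (p i) \<le> i"
 shows "detS {..<N} (\<lambda>i j. poly (p i) (y j)) = (\<Prod>i<N. coeff (p i) i) * detS {..<N} (\<lambda>i j. y j ^ i)"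
proof -
 have "detS {..<N} (\<lambda>i j. poly (p i) (y j)) = detS {..<N} (\<lambda>i j. \<Sum>k<N. coeff (p i) k * y j ^ k)"
 proof (rule detS_cong)
  fix i j assume "i \<in> {..<N}" "j \<in> {..<N}"
  then have d: "degree (p i) < N" using deg[of i] by auto
  show "poly (p i) (y j) = (\<Sum>k<N. coeff (p i) k * y j ^ k)"
   unfolding poly_altdef using d by (intro sum.mono_neutral_left) (auto simp: coeff_eq_0)
 qed
 also have "\<dots> = detS {..<N} (\<lambda>i j. coeff (p i) j) * detS {..<N} (\<lambda>i j. y j ^ i)" by (rule detS_mult)
 also have "detS {..<N} (\<lambda>i j. coeff (p i) j) = (\<Prod>i<N. coeff (p i) i)"
  proof (rule detS_triangular)
  fix i j assume "i < j" "j < N"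
  then have "degree (p i) < j" using deg[of i] by auto
  then show "coeff (p i) j = 0" by (rule coeff_eq_0)
 qed
 finally show ?thesis .
qed

lemma newton_degree: "degree (\<Prod>k<i. [:- y k, 1:] :: real poly) = i \<and> coeff (\<Prod>k<i. [:- y k, 1:]) i = 1"
proof -
 have "degree (\<Prod>k<i. [:- y k, 1:] :: real poly) = i"
  by (subst degree_prod_eq_sum_degree) auto
 moreover have "lead_coeff (\<Prod>k<i. [:- y k, 1:] :: real poly) = 1" by (simp add: lead_coeff_prod)
 ultimately show ?thesis by simp
qed

text \<open>In the Newton basis attached to the nodes themselves the evaluation matrix is
  triangular.\<close>

lemma detS_vandermonde:
 fixes y :: "nat => real"
 shows "detS {..<N} (\<lambda>i j. y j ^ i) = (\<Prod>j<N. \<Prod>i<j. y j - y i)"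
proof -
 define p where "p i = (\<Prod>k<i. [:- y k, 1:])" for i
 have "detS {..<N} (\<lambda>i j. poly (p i) (y j)) = (\<Prod>i<N. coeff (p i) i) * detS {..<N} (\<lambda>i j. y j ^ i)"
  by (rule detS_polynomials) (simp add: p_def newton_degree)
 also have "(\<Prod>i<N. coeff (p i) i) = 1" by (intro prod.neutral) (simp add: p_def newton_degree)
 finally have "detS {..<N} (\<lambda>i j. y j ^ i) = detS {..<N} (\<lambda>i j. poly (p i) (y j))" by simp
 also have "\<dots> = detS {..<N} (\<lambda>i j. poly (p j) (y i))" by (rule detS_transpose[symmetric]) simp
 also have "\<dots> = (\<Prod>i<N. poly (p i) (y i))"
  by (rule detS_triangular) (auto simp: p_def poly_prod intro!: prod_zero)
 finally show ?thesis by (simp add: p_def poly_prod)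
qed

lemma vandermonde_eq_detS: "vandermonde N y = detS {..<N} (\<lambda>i j. y (Suc j) ^ i)"
proof -
 have "vandermonde N y = (\<Prod>(i, j)\<in>(SIGMA i:{1..N}. {i<..N}). y j - y i)"
  unfolding vandermonde_def by (rule prod.Sigma) auto
 also have "\<dots> = (\<Prod>(j, i)\<in>(SIGMA j:{..<N}. {..<j}). y (Suc j) - y (Suc i))"
  by (rule prod.reindex_bij_witness[of _ "\<lambda>(j, i). (Suc i, Suc j)" "\<lambda>(i, j). (j - 1, i - 1)"]) auto
 also have "\<dots> = (\<Prod>j<N. \<Prod>i<j. y (Suc j) - y (Suc i))"
  by (rule prod.Sigma[symmetric]) auto
 finally show ?thesis by (simp add: detS_vandermonde)
qed

lemma He_poly:
 fixes a b q :: real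
 obtains p :: "real poly" where "degree p \<le> n" "coeff p n = a ^ n / fact n" "\<And>x. poly p x = He n (a * x + b) q"
proof -
 define l where "l = [:b, a:]"
 have l: "degree l \<le> 1" "coeff l (Suc 0) = a" by (simp_all add: l_def)
 have "\<exists>p :: real poly. degree p \<le> n \<and> coeff p n = a ^ n / fact n \<and> (\<forall>x. poly p x = He n (a * x + b) q)"
 proof (induction n rule: less_induct)
  case (less n)
  consider "n = 0" | "n = Suc 0" | m where "n = Suc (Suc m)" by (cases n; cases "n - 1") auto
  then show ?case
  proof cases
   case 1 then show ?thesis by (intro exI[of _ 1]) auto
  next
   case 2 then show ?thesis by (intro exI[of _ l]) (auto simp: l_def)
  next
   case (3 m)
   obtain p1 where p1: "degree p1 \<le> Suc m" "coeff p1 (Suc m) = a ^ Suc m / fact (Suc m)" "\<And>x. poly p1 x = He (Suc m) (a * x + b) q"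
    using less[of "Suc m"] 3 by auto
   obtain p0 where p0: "degree p0 \<le> m" "coeff p0 m = a ^ m / fact m" "\<And>x. poly p0 x = He m (a * x + b) q"
    using less[of m] 3 by auto
   define p where "p = Polynomial.smult (1 / of_nat (m + 2)) (l * p1 - Polynomial.smult q p0)"
   have dlp: "degree (l * p1) \<le> Suc (Suc m)" using degree_mult_le[of l p1] l p1 by linarith
   have "degree p \<le> Suc (Suc m)"
    unfolding p_def using dlp p0(1) by (intro order_trans[OF degree_smult_le] degree_diff_le) auto
   moreover have "coeff p (Suc (Suc m)) = a ^ Suc (Suc m) / fact (Suc (Suc m))"
   proof -
    have "coeff (l * p1) (Suc (Suc m)) = a * coeff p1 (Suc m)"
     unfolding l_def using p1(1) by (simp add: coeff_eq_0)
    moreover have "coeff p0 (Suc (Suc m)) = 0" using p0(1) by (simp add: coeff_eq_0)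
    ultimately show ?thesis unfolding p_def p1(2) by (simp add: p1(2) field_simps)
   qed
   moreover have "poly p x = He (Suc (Suc m)) (a * x + b) q" for x
    unfolding p_def by (simp add: p1(3) p0(3) l_def algebra_simps diff_divide_distrib add_divide_distrib)
   ultimately show ?thesis unfolding 3 by blast
  qed
 qed
 then show ?thesis using that by blast
qed

text \<open>The leading coefficients \<open>a ^ i / fact i\<close> do not vanish. Hence Hermite
  weights may replace the Vandermonde factors of the bridge density up to a constant.\<close>

lemma detS_He_vandermonde:
 assumes "a \<noteq> 0"
 obtains c where "c \<noteq> 0" "\<And>y. detS {1..N} (\<lambda>i j. He (i - 1) (a * y j + b) q) = c * vandermonde N y"
proof -
 have "\<exists>p. \<forall>i. degree (p i) \<le> i \<and> coeff (p i) i = a ^ i / fact i \<and> (\<forall>x. poly (p i) x = He i (a * x + b) q)"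
  by (rule choice) (metis He_poly)
 then obtain p where p: "\<And>i. degree (p i) \<le> i" "\<And>i. coeff (p i) i = a ^ i / fact i" "\<And>i x. poly (p i) x = He i (a * x + b) q" by blast
 have bij: "bij_betw Suc {..<N} {1..N}" by (auto simp: bij_betw_def image_Suc_lessThan)
 have "detS {1..N} (\<lambda>i j. He (i - 1) (a * y j + b) q) = (\<Prod>i<N. a ^ i / fact i) * vandermonde N y" for y
  unfolding detS_reindex[OF bij finite_lessThan] vandermonde_eq_detS
  using detS_polynomials[of N p "\<lambda>j. y (Suc j)"] p by simp
 moreover have "(\<Prod>i<N. a ^ i / fact i) \<noteq> 0" using assms by simp
 ultimately show ?thesis using that by blast
qed

definition Uc :: "real => real => real => real" where
 "Uc r t x = (x - r) / (sqrt 2 * (1 - t))"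

text \<open>For \<open>t < 1\<close>, completing the square gives
  \<open>exp (- r\<^sup>2 / 2) * heat 1 (1 - t) x r\<close>: the weight of ending at 0 is tilted
  into that of ending at \<open>r\<close>, the point about which \<open>Uc\<close> is
  centred.\<close>

definition rhoc :: "real => real => real => real" where
 "rhoc r t x = heat 1 (1 - t) x 0 * exp (sqrt 2 * r * Uc r t x + (sqrt 2 * r)\<^sup>2 * tau t)"

lemma rhoc_pos: "t < 1 ==> 0 < rhoc r t x"
 unfolding rhoc_def by (simp add: heat_pos)

lemma tau_diff: "t < 1 ==> t' < 1 ==> tau t' - tau t = ((1 - t) - (1 - t')) / (4 * (1 - t) * (1 - t'))"
 unfolding tau_def by (simp add: divide_simps) (simp add: algebra_simps)

lemma tau_strict_mono: "t < t' ==> t' < 1 ==> tau t < tau t'"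
proof -
 assume *: "t < t'" "t' < 1"
 then have "0 < ((1 - t) - (1 - t')) / (4 * (1 - t) * (1 - t'))" by (intro divide_pos_pos mult_pos_pos) auto
 then show "tau t < tau t'" using tau_diff[of t t'] * by linarith
qed

text \<open>The bridge transition density turns into the heat kernel under the space-time change
 \<open>x \<mapsto> Uc r t x\<close>, up to the cocycle \<open>rhoc\<close>.\<close>

lemma heat_cocycle:
 assumes "t < t'" "t' < 1"
 shows "heat 1 (t' - t) x y * rhoc r t' y = rhoc r t x * (heat 2 (tau t' - tau t) (Uc r t x) (Uc r t' y) / (sqrt 2 * (1 - t')))"
proof -
 define b where "b = 1 - t'"
 define d where "d = t' - t"
 have b: "0 < b" "0 < d" using assms by (auto simp: b_def d_def)
 have a: "1 - t = b + d" "t' - t = d" "1 - t' = b" by (auto simp: b_def d_def)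
 have ta: "tau t = (1 / (b + d) - 1) / 4" "tau t' = (1 / b - 1) / 4"
  unfolding tau_def a using assms b by (simp_all add: b_def d_def field_simps)
 have td: "tau t' - tau t = d / (4 * (b + d) * b)" using tau_diff[of t t'] assms unfolding a by simp
 define X where "X = x - r"
 define Y where "Y = y - r"
 have s: "sqrt 2 * r * Uc r t x = r * X / (b + d)" "sqrt 2 * r * Uc r t' y = r * Y / b" "(sqrt 2 * r)\<^sup>2 = 2 * r\<^sup>2"
  unfolding Uc_def a X_def Y_def using b by (simp_all add: power_mult_distrib)
 have dU: "(Uc r t' y - Uc r t x)\<^sup>2 = (Y / b - X / (b + d))\<^sup>2 / 2"
 proof -
  have "Uc r t' y - Uc r t x = (Y / b - X / (b + d)) / sqrt 2"
   unfolding Uc_def a X_def Y_def using b by (simp add: diff_divide_distrib mult.commute)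
  then show ?thesis by (simp add: power_divide)
 qed
 have pos: "0 < 1 * d" "0 < 1 * b" "0 < 1 * (b + d)" "0 < 2 * (d / (4 * (b + d) * b))" using b by auto
 have ex: "-(y - x)\<^sup>2 / (2 * (1 * d)) + (-(0 - y)\<^sup>2 / (2 * (1 * b)) + (r * Y / b + 2 * r\<^sup>2 * ((1 / b - 1) / 4)))
  = (-(0 - x)\<^sup>2 / (2 * (1 * (b + d))) + (r * X / (b + d) + 2 * r\<^sup>2 * ((1 / (b + d) - 1) / 4)))
   + -((Y / b - X / (b + d))\<^sup>2 / 2) / (2 * (2 * (d / (4 * (b + d) * b))))"
 proof -
  \<comment> \<open>The tilted weight becomes a Gaussian centred at \<open>r\<close>, up to a factor
    independent of time; this factor then cancels between the two times.\<close>
  have e1: "-(0 - (Z + r))\<^sup>2 / (2 * (1 * a)) + (r * Z / a + 2 * r\<^sup>2 * ((1 / a - 1) / 4)) = - (Z\<^sup>2 / (2 * a)) - r\<^sup>2 / 2" if "0 < a" for a Z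
   using that by (simp add: field_simps power2_eq_square)
  define a where "a = b + d"
  have a0: "a \<noteq> 0" "b \<noteq> 0" "d \<noteq> 0" using b by (auto simp: a_def)
  have "2 * (2 * (d / (4 * a * b))) = d / (a * b)" using a0 by simp
  then have "((Y / b - X / a)\<^sup>2 / 2) / (2 * (2 * (d / (4 * a * b)))) = (Y * a - X * b)\<^sup>2 / (2 * d * a * b)"
   using a0 by (simp add: divide_simps power2_eq_square)
  moreover have "(Y - X)\<^sup>2 / (2 * (1 * d)) + Y\<^sup>2 / (2 * b) = X\<^sup>2 / (2 * a) + (Y * a - X * b)\<^sup>2 / (2 * d * a * b)"
  proof -
   have "(Y - X)\<^sup>2 * a * b + Y\<^sup>2 * d * a = X\<^sup>2 * d * b + (Y * a - X * b)\<^sup>2"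
    unfolding a_def by (simp add: power2_eq_square algebra_simps)
   then have "((Y - X)\<^sup>2 * a * b + Y\<^sup>2 * d * a) / (2 * d * a * b) = (X\<^sup>2 * d * b + (Y * a - X * b)\<^sup>2) / (2 * d * a * b)" by simp
   then show ?thesis using a0 by (simp add: add_divide_distrib)
  qed
  ultimately have e2: "(Y - X)\<^sup>2 / (2 * (1 * d)) + Y\<^sup>2 / (2 * b) = X\<^sup>2 / (2 * (b + d)) + ((Y / b - X / (b + d))\<^sup>2 / 2) / (2 * (2 * (d / (4 * (b + d) * b))))"
   unfolding a_def by simp
  have xy: "x = X + r" "y = Y + r" by (simp_all add: X_def Y_def)
  have yx: "y - x = Y - X" by (simp add: xy)
  have ba: "0 < b + d" using b by simp
  show ?thesis unfolding yx unfolding xy minus_divide_left[symmetric] e1[OF b(1), unfolded minus_divide_left[symmetric]] e1[OF ba, unfolded minus_divide_left[symmetric]] using e2 by linarith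
 qed
 have sq: "1 / sqrt (2 * pi * (1 * d)) * (1 / sqrt (2 * pi * (1 * b))) = 1 / sqrt (2 * pi * (1 * (b + d))) * (1 / sqrt (2 * pi * (2 * (d / (4 * (b + d) * b)))) / (sqrt 2 * b))"
 proof -
  define D where "D = 2 * pi * (2 * (d / (4 * (b + d) * b)))"
  have "2 * pi * (b + d) * D * (2 * b\<^sup>2) = (2 * pi * d) * (2 * pi * b) * ((b + d) / (b + d)) * (b / b)"
   unfolding D_def power2_eq_square using b by (simp add: divide_simps)
  also have "\<dots> = (2 * pi * d) * (2 * pi * b)" using b by simp
  finally have "sqrt (2 * pi * (b + d) * D * (2 * b\<^sup>2)) = sqrt ((2 * pi * d) * (2 * pi * b))" by (rule arg_cong)
  then have "sqrt (2 * pi * (b + d)) * sqrt D * (sqrt 2 * sqrt (b\<^sup>2)) = sqrt (2 * pi * d) * sqrt (2 * pi * b)"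
   by (simp only: real_sqrt_mult)
  then have *: "sqrt (2 * pi * (1 * (b + d))) * sqrt D * (sqrt 2 * b) = sqrt (2 * pi * (1 * d)) * sqrt (2 * pi * (1 * b))"
   using b by (simp only: mult_1_left real_sqrt_abs abs_of_pos)
  have gen: "1 / x * (1 / y) = 1 / z * (1 / w / v)" if "z * w * v = x * y" for x y z w v :: real
   using that by (simp add: mult.assoc)
  show ?thesis using gen[OF *] unfolding D_def .
 qed
 have L: "heat 1 (t' - t) x y * rhoc r t' y = (1 / sqrt (2 * pi * (1 * d)) * (1 / sqrt (2 * pi * (1 * b)))) *
  exp (-(y - x)\<^sup>2 / (2 * (1 * d)) + (-(0 - y)\<^sup>2 / (2 * (1 * b)) + (r * Y / b + 2 * r\<^sup>2 * ((1 / b - 1) / 4))))"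
  unfolding rhoc_def s ta a heat_eq[OF pos(1)] heat_eq[OF pos(2)] exp_add by (simp only: mult_ac)
 have R: "rhoc r t x * (heat 2 (tau t' - tau t) (Uc r t x) (Uc r t' y) / (sqrt 2 * (1 - t'))) =
  (1 / sqrt (2 * pi * (1 * (b + d))) * (1 / sqrt (2 * pi * (2 * (d / (4 * (b + d) * b)))) / (sqrt 2 * b))) *
  exp ((-(0 - x)\<^sup>2 / (2 * (1 * (b + d))) + (r * X / (b + d) + 2 * r\<^sup>2 * ((1 / (b + d) - 1) / 4)))
   + -((Y / b - X / (b + d))\<^sup>2 / 2) / (2 * (2 * (d / (4 * (b + d) * b)))))"
  unfolding rhoc_def s td heat_eq[OF pos(4)] dU unfolding ta a heat_eq[OF pos(3)] exp_add
  by (simp only: mult_ac times_divide_eq_left times_divide_eq_right mult_1_left divide_divide_eq_left)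
 show ?thesis unfolding L R sq ex ..
qed

lemma integral_Uc:
 assumes "t < 1"
 shows "1 / (sqrt 2 * (1 - t)) * (LBINT y. f (Uc r t y + \<epsilon>)) = (\<integral>v. f v \<partial>lborel :: real)"
proof -
 define c where "c = sqrt 2 * (1 - t)"
 have c: "0 < c" using assms by (simp add: c_def)
 have "Uc r t y + \<epsilon> = (\<epsilon> - r / c) + (1 / c) * y" for y
  unfolding Uc_def c_def by (simp add: diff_divide_distrib algebra_simps)
 then have "(LBINT y. f (Uc r t y + \<epsilon>)) = (LBINT y. f ((\<epsilon> - r / c) + (1 / c) * y))" by (simp only:)
 moreover have "(LBINT v. f v) = 1 / c * (LBINT y. f ((\<epsilon> - r / c) + (1 / c) * y))"
  using c lborel_integral_real_affine[of "1 / c" f "\<epsilon> - r / c"] by simp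
 ultimately show ?thesis by (simp add: c_def)
qed

text \<open>Each step trades the weight at its end for the weight at its start, so the weights
  telescope along the chain. The extra translation by \<open>\<epsilon>\<close> is harmless because
  the heat kernel is translation invariant.\<close>

lemma chain_cocycle:
 assumes t: "incr t l m" "\<And>j. l \<le> j ==> j \<le> l + m ==> t j < 1"
  and A: "\<And>j x. l < j ==> j \<le> l + m ==> x \<in> A j \<longleftrightarrow> Uc r (t j) x + \<epsilon> \<in> A' j"
 shows "hchain 1 t A l m (\<lambda>x. rhoc r (t (l + m)) x * g (Uc r (t (l + m)) x + \<epsilon>)) x =
  rhoc r (t l) x * hchain 2 (\<lambda>j. tau (t j)) A' l m g (Uc r (t l) x + \<epsilon>)"
 using assms
proof (induction m arbitrary: l x)
 case 0 then show ?case by simp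
next
 case (Suc m)
 let ?t = "t l" and ?t' = "t (Suc l)"
 let ?c = "sqrt 2 * (1 - ?t')"
 have tt: "?t < ?t'" "?t' < 1" using incr_first[OF Suc.prems(1)] Suc.prems(2)[of "Suc l"] by auto
 have c: "0 < ?c" using tt by simp
 let ?h = "hchain 2 (\<lambda>j. tau (t j)) A' (Suc l) m g"
 have IH: "hchain 1 t A (Suc l) m (\<lambda>x. rhoc r (t (l + Suc m)) x * g (Uc r (t (l + Suc m)) x + \<epsilon>)) y =
  rhoc r ?t' y * ?h (Uc r ?t' y + \<epsilon>)" for y
  using Suc.IH[OF incr_Suc[OF Suc.prems(1)]] Suc.prems(2,3) by simp
 have "hchain 1 t A l (Suc m) (\<lambda>x. rhoc r (t (l + Suc m)) x * g (Uc r (t (l + Suc m)) x + \<epsilon>)) x =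
  (LBINT y. heat 1 (?t' - ?t) x y * (indicator (A (Suc l)) y * (rhoc r ?t' y * ?h (Uc r ?t' y + \<epsilon>))))"
  unfolding chain.simps IH ..
 also have "\<dots> = (LBINT y. rhoc r ?t x * ((1 / ?c) * (heat 2 (tau ?t' - tau ?t) (Uc r ?t x + \<epsilon>) (Uc r ?t' y + \<epsilon>) * (indicator (A' (Suc l)) (Uc r ?t' y + \<epsilon>) * ?h (Uc r ?t' y + \<epsilon>)))))"
 proof (intro integral_cong refl)
  fix y
  have i: "indicator (A (Suc l)) y = (indicator (A' (Suc l)) (Uc r ?t' y + \<epsilon>) :: real)"
   using Suc.prems(3)[of "Suc l" y] by (simp add: indicator_def)
  have "heat 1 (?t' - ?t) x y * (i * (rhoc r ?t' y * h)) = (heat 1 (?t' - ?t) x y * rhoc r ?t' y) * (i * h)" for i h by simp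
  then show "heat 1 (?t' - ?t) x y * (indicator (A (Suc l)) y * (rhoc r ?t' y * ?h (Uc r ?t' y + \<epsilon>))) =
   rhoc r ?t x * ((1 / ?c) * (heat 2 (tau ?t' - tau ?t) (Uc r ?t x + \<epsilon>) (Uc r ?t' y + \<epsilon>) * (indicator (A' (Suc l)) (Uc r ?t' y + \<epsilon>) * ?h (Uc r ?t' y + \<epsilon>))))"
   unfolding i heat_cocycle[OF tt] heat_shift by simp
 qed
 also have "\<dots> = rhoc r ?t x * ((1 / ?c) * (LBINT y. heat 2 (tau ?t' - tau ?t) (Uc r ?t x + \<epsilon>) (Uc r ?t' y + \<epsilon>) * (indicator (A' (Suc l)) (Uc r ?t' y + \<epsilon>) * ?h (Uc r ?t' y + \<epsilon>))))"
  unfolding integral_mult_right_zero ..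
 also have "(1 / ?c) * (LBINT y. heat 2 (tau ?t' - tau ?t) (Uc r ?t x + \<epsilon>) (Uc r ?t' y + \<epsilon>) * (indicator (A' (Suc l)) (Uc r ?t' y + \<epsilon>) * ?h (Uc r ?t' y + \<epsilon>)))
  = (LBINT v. heat 2 (tau ?t' - tau ?t) (Uc r ?t x + \<epsilon>) v * (indicator (A' (Suc l)) v * ?h v))"
  using integral_Uc[OF tt(2), where r = r and \<epsilon> = \<epsilon> and f = "\<lambda>v. heat 2 (tau ?t' - tau ?t) (Uc r ?t x + \<epsilon>) v * (indicator (A' (Suc l)) v * ?h v)"] by simp
 finally show ?case by simp
qed

text \<open>\<open>nib_density\<close> divides by an integral not known to exist. A vanishing
  integral would make the density 0 by the convention for division, against total mass 1; so the
  integral is nonzero and \<open>f\<close> integrable. Comparing the mass with the integral then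
  shows that the density is nonnegative almost everywhere.\<close>

lemma distributed_normalised:
 fixes f :: "'b => real"
 assumes "prob_space M" and d: "distributed M P X (\<lambda>x. ennreal (f x / (\<integral>y. f y \<partial>P)))"
 shows "integrable P f" "(\<integral>y. f y \<partial>P) \<noteq> 0"
  "\<And>S. S \<in> sets P ==> measure M {\<omega> \<in> space M. X \<omega> \<in> S} = (\<integral>x. f x * indicator S x \<partial>P) / (\<integral>y. f y \<partial>P)"
proof -
 interpret prob_space M by fact
 define Z where "Z = (\<integral>y. f y \<partial>P)"
 define g where "g x = f x / Z" for x
 have X[measurable]: "X \<in> measurable M P" using distributed_measurable[OF d] .
 have em: "emeasure M (X -` S \<inter> space M) = (\<integral>\<^sup>+x. ennreal (g x) * indicator S x \<partial>P)" if "S \<in> sets P" for S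
  using distributed_emeasure[OF d that] by (simp add: g_def Z_def)
 have "emeasure M (X -` space P \<inter> space M) = 1"
 proof -
  have "X -` space P \<inter> space M = space M" using measurable_space[OF X] by auto
  then show ?thesis by (simp add: emeasure_space_1)
 qed
 moreover have "(\<integral>\<^sup>+x. ennreal (g x) * indicator (space P) x \<partial>P) = (\<integral>\<^sup>+x. ennreal (g x) \<partial>P)"
  by (intro nn_integral_cong) simp
 ultimately have one: "(\<integral>\<^sup>+x. ennreal (g x) \<partial>P) = 1" using em[OF sets.top] by simp
 show Z0: "(\<integral>y. f y \<partial>P) \<noteq> 0"
 proof
  assume "(\<integral>y. f y \<partial>P) = 0"
  then have "g x = 0" for x by (simp add: g_def Z_def)
  then show False using one by simp
 qed
 \<comment> \<open>The integral of a non-integrable function is 0 by convention, so a nonzero value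
   proves integrability.\<close>
 show fi: "integrable P f" using Z0 not_integrable_integral_eq by blast
 then have gi: "integrable P g" unfolding g_def[abs_def] by simp
 have [measurable]: "g \<in> borel_measurable P" using gi by simp
 have "(\<integral>x. g x \<partial>P) = 1" using Z0 by (simp add: g_def[abs_def] Z_def)
 moreover have "(\<integral>x. g x \<partial>P) = enn2real (\<integral>\<^sup>+x. ennreal (g x) \<partial>P) - enn2real (\<integral>\<^sup>+x. ennreal (- g x) \<partial>P)"
  by (rule real_lebesgue_integral_def[OF gi])
 ultimately have "enn2real (\<integral>\<^sup>+x. ennreal (- g x) \<partial>P) = 0" using one by simp
 moreover have "(\<integral>\<^sup>+x. ennreal (- g x) \<partial>P) \<noteq> \<infinity>"
  using integrableD(3)[OF gi] by simp
 ultimately have "(\<integral>\<^sup>+x. ennreal (- g x) \<partial>P) = 0" by (simp add: enn2real_eq_0_iff)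
 then have "AE x in P. ennreal (- g x) = 0" by (subst (asm) nn_integral_0_iff_AE) auto
 then have g0: "AE x in P. 0 \<le> g x" by eventually_elim (simp add: ennreal_eq_0_iff)
 fix S assume S[measurable]: "S \<in> sets P"
 have i: "integrable P (\<lambda>x. g x * indicator S x)" by (rule integrable_real_mult_indicator[OF S gi])
 have "emeasure M (X -` S \<inter> space M) = (\<integral>\<^sup>+x. ennreal (g x * indicator S x) \<partial>P)"
  unfolding em[OF S] by (intro nn_integral_cong) (simp add: indicator_def)
 also have "\<dots> = ennreal (\<integral>x. g x * indicator S x \<partial>P)"
  by (rule nn_integral_eq_integral[OF i]) (use g0 in \<open>eventually_elim, simp\<close>)
 finally have "measure M (X -` S \<inter> space M) = (\<integral>x. g x * indicator S x \<partial>P)"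
  by (simp add: measure_def integral_nonneg_AE[of "\<lambda>x. g x * indicator S x" P] AE_mp[OF g0 AE_I2])
 moreover have "X -` S \<inter> space M = {\<omega> \<in> space M. X \<omega> \<in> S}" by auto
 ultimately show "measure M {\<omega> \<in> space M. X \<omega> \<in> S} = (\<integral>x. f x * indicator S x \<partial>P) / (\<integral>y. f y \<partial>P)"
  by (simp add: g_def Z_def)
qed

lemma detS_scale_rows:
 fixes A :: "nat => nat => 'c::comm_ring_1"
 shows "detS I (\<lambda>i j. c i * A i j) = (\<Prod>i\<in>I. c i) * detS I A"
 unfolding detS_def by (simp add: prod.distrib sum_distrib_left mult_ac)

lemma bnd_mult:
 assumes f: "bnd \<kappa> C f" and g: "bnd \<kappa>' C' g" and "0 \<le> \<kappa>" "0 \<le> \<kappa>'"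
 shows "bnd (\<kappa> + \<kappa>') (C * C') (\<lambda>x. f x * g x)"
 unfolding bnd_def
proof (intro conjI allI)
 have [measurable]: "f \<in> borel_measurable borel" "g \<in> borel_measurable borel" using f g by (auto simp: bnd_def)
 show "(\<lambda>x. f x * g x) \<in> borel_measurable borel" by measurable
 fix x
 have "\<bar>f x * g x\<bar> \<le> (C * cosh (\<kappa> * x)) * (C' * cosh (\<kappa>' * x))"
  unfolding abs_mult using bndD[OF f] bndD[OF g] bnd_const_nonneg[OF f] by (intro mult_mono) auto
 also have "\<dots> = (C * C') * (cosh (\<kappa> * x) * cosh (\<kappa>' * x))" by simp
 also have "\<dots> \<le> (C * C') * cosh (\<bar>\<kappa> * x\<bar> + \<bar>\<kappa>' * x\<bar>)"
  using bnd_const_nonneg[OF f] bnd_const_nonneg[OF g] by (intro mult_left_mono cosh_mult_le) auto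
 also have "\<bar>\<kappa> * x\<bar> + \<bar>\<kappa>' * x\<bar> = \<bar>(\<kappa> + \<kappa>') * x\<bar>" unfolding abs_mult using assms by (simp add: distrib_right)
 finally show "\<bar>f x * g x\<bar> \<le> C * C' * cosh ((\<kappa> + \<kappa>') * x)" by simp
qed

lemma cosh_mult_succ_le:
 assumes "0 \<le> \<kappa>"
 shows "cosh v * cosh (\<kappa> * v) \<le> cosh ((1 + \<kappa>) * v :: real)"
proof -
 have "\<bar>v\<bar> + \<bar>\<kappa> * v\<bar> = \<bar>(1 + \<kappa>) * v\<bar>" unfolding abs_mult using assms by (simp add: distrib_right)
 then show ?thesis using cosh_mult_le[of v "\<kappa> * v"] by simp
qed

lemma bnd_He: obtains C where "bnd 1 C (\<lambda>u. He n (a * u + b) q)"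
proof -
 obtain C where C: "\<And>u. \<bar>He n (a * u + b) q\<bar> \<le> C * cosh u" using He_affine_bound by metis
 have "(\<lambda>u. He n (a * u + b) q) \<in> borel_measurable borel"
  by (intro measurable_compose[OF _ measurable_He]) simp
 then show ?thesis using C that[of C] by (auto simp: bnd_def)
qed

text \<open>The cocycle from time 0 and position 0, whose image is \<open>- s / 2\<close>, converts
  the Gaussian of \<open>Ff\<close> back into \<open>heat 1 t 0 x\<close>. What is left is a
  polynomial with nonzero slope \<open>a\<close> in its argument.\<close>

lemma entrance_weight:
 fixes r t :: real
 assumes t: "0 < t" "t < 1"
 defines "s \<equiv> sqrt 2 * r"
 obtains K a b q :: real where "K \<noteq> 0" "a \<noteq> 0"
  "\<And>x n. Ff s (tau t) n (Uc r t x) / (sqrt 2 * (1 - t) * rhoc r t x) = heat 1 t 0 x * (K * fact n * He n (a * x + b) q)"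
proof
 define \<sigma> where "\<sigma> = tau t"
 have \<sigma>: "0 < \<sigma>" using tau_strict_mono[OF t] by (simp add: \<sigma>_def tau_def)
 define c where "c = sqrt 2 * (1 - t)"
 have c: "0 < c" using t by (simp add: c_def)
 have U0: "Uc r 0 0 = - s / 2"
  by (simp add: Uc_def s_def real_div_sqrt field_simps)
 show "exp (- s\<^sup>2 / 2) / rhoc r 0 0 \<noteq> 0" using rhoc_pos[of 0 r 0] by simp
 show "1 / (4 * \<sigma> * c) \<noteq> 0" using \<sigma> c by simp
 fix x n
 have "heat 1 (t - 0) 0 x * rhoc r t x = rhoc r 0 0 * (heat 2 (tau t - tau 0) (Uc r 0 0) (Uc r t x) / c)"
  unfolding c_def by (rule heat_cocycle[OF t])
 then have h: "heat 2 \<sigma> (- s / 2) (Uc r t x) / (c * rhoc r t x) = heat 1 t 0 x / rhoc r 0 0"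
  using rhoc_pos[of 0 r 0] rhoc_pos[OF t(2), of r x] c unfolding U0 by (simp add: tau_def \<sigma>_def field_simps)
 have u: "(2 * Uc r t x + s + 4 * \<sigma> * s) / (8 * \<sigma>) = 1 / (4 * \<sigma> * c) * x + (s / (8 * \<sigma>) + s / 2 - r / (4 * \<sigma> * c))"
  unfolding Uc_def c_def[symmetric] using \<sigma> c by (simp add: divide_simps) (simp add: algebra_simps)
 have "Ff s \<sigma> n (Uc r t x) / (c * rhoc r t x) = exp (- s\<^sup>2 / 2) * fact n * He n ((2 * Uc r t x + s + 4 * \<sigma> * s) / (8 * \<sigma>)) (1 / (8 * \<sigma>)) * (heat 2 \<sigma> (- s / 2) (Uc r t x) / (c * rhoc r t x))"
  unfolding Ff_def by simp
 then show "Ff s (tau t) n (Uc r t x) / (sqrt 2 * (1 - t) * rhoc r t x) = heat 1 t 0 x * (exp (- s\<^sup>2 / 2) / rhoc r 0 0 * fact n *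
   He n (1 / (4 * \<sigma> * c) * x + (s / (8 * \<sigma>) + s / 2 - r / (4 * \<sigma> * c))) (1 / (8 * \<sigma>)))"
  unfolding h u unfolding \<sigma>_def c_def by simp
qed

text \<open>The exponentials in \<open>rhoc\<close> and \<open>Gf\<close> are inverse to each other,
  leaving the kernel to the endpoint 0 times a polynomial.\<close>

lemma exit_weight:
 fixes r t :: real
 assumes t: "t < 1"
 defines "s \<equiv> sqrt 2 * r"
 obtains a b q :: real where "a \<noteq> 0"
  "\<And>x n. rhoc r t x * Gf s (tau t) n (Uc r t x) = heat 1 (1 - t) x 0 * He n (a * x + b) q"
proof
 define c where "c = sqrt 2 * (1 - t)"
 have c: "0 < c" using t by (simp add: c_def)
 show "2 / c \<noteq> 0" using c by simp
 fix x n
 have "2 * Uc r t x + s + 4 * tau t * s = 2 / c * x + (s + 4 * tau t * s - 2 * r / c)"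
  unfolding Uc_def c_def[symmetric] using c by (simp add: divide_simps) (simp add: algebra_simps)
 then have u: "He n (2 * Uc r t x + s + 4 * tau t * s) (8 * tau t) = He n (2 / c * x + (s + 4 * tau t * s - 2 * r / c)) (8 * tau t)" by (simp only:)
 have e: "exp (s * Uc r t x + s\<^sup>2 * tau t) * exp (- (tau t * s\<^sup>2) - s * Uc r t x) = 1"
  unfolding exp_add[symmetric] by simp
 have "rhoc r t x * Gf s (tau t) n (Uc r t x) = heat 1 (1 - t) x 0 * (exp (s * Uc r t x + s\<^sup>2 * tau t) * exp (- (tau t * s\<^sup>2) - s * Uc r t x)) * He n (2 * Uc r t x + s + 4 * tau t * s) (8 * tau t)"
  unfolding rhoc_def Gf_def s_def[symmetric] by (simp only: mult_ac)
 then show "rhoc r t x * Gf s (tau t) n (Uc r t x) = heat 1 (1 - t) x 0 * He n (2 / c * x + (s + 4 * tau t * s - 2 * r / c)) (8 * tau t)"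
  unfolding e u by simp
qed

text \<open>Row and column operations turn the Vandermonde factors and Gaussians into determinants
  of \<open>\<phi>\<close> and \<open>\<psi>\<close>, at the price of a constant. For ordered
  particles and downward closed sets, a condition on the top particle is the same as that condition
  on all of them. \<open>\<phi>\<close> is divided by \<open>rhoc\<close> and by the Jacobian to
  match \<open>chain_cocycle\<close>.\<close>

lemma nib_unnorm_levels:
 fixes r :: real and t :: "nat => real" and k N :: nat
 assumes t: "k \<ge> 1" "0 < t 1" "t 1 < 1" "t k < 1" and N: "1 \<le> N"
 defines "s \<equiv> sqrt 2 * r"
 defines "\<phi> \<equiv> \<lambda>i x. Ff s (tau (t 1)) (i - 1) (Uc r (t 1) x) / (sqrt 2 * (1 - t 1) * rhoc r (t 1) x)"
  and "\<psi> \<equiv> \<lambda>i x. rhoc r (t k) x * Gf s (tau (t k)) (i - 1) (Uc r (t k) x)"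
 obtains c where "c \<noteq> 0"
  "\<And>A x. (\<And>l y z. y \<le> z ==> z \<in> A l ==> y \<in> A l) ==>
   nib_unnorm N k t x * (if \<forall>l\<in>{1..k}. x (N, l) \<in> A l then 1 else 0) = c * levels N k A \<phi> (\<lambda>l. heat 1 (t (Suc l) - t l)) \<psi> x"
proof -
 obtain K a b q :: real where K: "K \<noteq> 0" "a \<noteq> 0"
  "\<And>x n. Ff s (tau (t 1)) n (Uc r (t 1) x) / (sqrt 2 * (1 - t 1) * rhoc r (t 1) x) = heat 1 (t 1) 0 x * (K * fact n * He n (a * x + b) q)"
  unfolding s_def by (rule entrance_weight[OF t(2,3), of r]) blast
 obtain a' b' q' :: real where K': "a' \<noteq> 0"
  "\<And>x n. rhoc r (t k) x * Gf s (tau (t k)) n (Uc r (t k) x) = heat 1 (1 - t k) x 0 * He n (a' * x + b') q'"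
  unfolding s_def by (rule exit_weight[OF t(4), of r]) blast
 obtain c1 where c1: "c1 \<noteq> 0" "\<And>y. detS {1..N} (\<lambda>i j. He (i - 1) (a * y j + b) q) = c1 * vandermonde N y"
  by (rule detS_He_vandermonde[OF K(2), of N b q]) blast
 obtain c2 where c2: "c2 \<noteq> 0" "\<And>y. detS {1..N} (\<lambda>i j. He (i - 1) (a' * y j + b') q') = c2 * vandermonde N y"
  by (rule detS_He_vandermonde[OF K'(1), of N b' q']) blast
 define d where "d = (\<Prod>i\<in>{1..N}. K * fact (i - 1)) * c1 * c2"
 have d: "d \<noteq> 0" using c1 c2 K by (simp add: d_def)
 have "detS {1..N} (\<lambda>i j. \<phi> i (y j)) = (\<Prod>i\<in>{1..N}. K * fact (i - 1)) * (c1 * vandermonde N y) * (\<Prod>i\<in>{1..N}. heat 1 (t 1) 0 (y i))" for y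
  unfolding \<phi>_def K(3) mult.commute[of "heat _ _ _ _"] c1(2)[symmetric]
  by (subst detS_scale_columns) (simp_all add: detS_scale_rows)
 moreover have "detS {1..N} (\<lambda>i j. \<psi> i (y j)) = (c2 * vandermonde N y) * (\<Prod>i\<in>{1..N}. heat 1 (1 - t k) (y i) 0)" for y
  unfolding \<psi>_def K'(2) mult.commute[of "heat _ _ _ _"] c2(2)[symmetric]
  by (subst detS_scale_columns) simp_all
 ultimately have w: "detS {1..N} (\<lambda>i j. \<phi> i (y j)) * D * detS {1..N} (\<lambda>i j. \<psi> i (z j)) =
   d * (vandermonde N y * (\<Prod>i\<in>{1..N}. heat 1 (t 1) 0 (y i)) * D * vandermonde N z * (\<Prod>i\<in>{1..N}. heat 1 (1 - t k) (z i) 0))" for y z D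
  unfolding d_def by (simp only: mult_ac)
 show ?thesis
 proof
  show "1 / d \<noteq> 0" using d by simp
  fix A :: "nat => real set" and x :: "nat \<times> nat => real" assume A: "\<And>l y z. y \<le> z ==> z \<in> A l ==> y \<in> A l"
  show "nib_unnorm N k t x * (if \<forall>l\<in>{1..k}. x (N, l) \<in> A l then 1 else 0) = 1 / d * levels N k A \<phi> (\<lambda>l. heat 1 (t (Suc l) - t l)) \<psi> x"
  proof (cases "\<forall>l\<in>{1..k}. ordered N (\<lambda>i. x (i, l))")
   case True
   have "(\<forall>l\<in>{1..k}. x (N, l) \<in> A l) \<longleftrightarrow> (\<forall>l\<in>{1..k}. ordered N (\<lambda>i. x (i,l)) \<and> (\<forall>i\<in>{1..N}. x (i,l) \<in> A l))"
   proof -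
    have "x (i, l) \<le> x (N, l)" if "l \<in> {1..k}" "i \<in> {1..N}" for i l
     using ordered_less[of N "\<lambda>i. x (i,l)" i N] True that by (cases "i = N") auto
    then have "x (i, l) \<in> A l" if "l \<in> {1..k}" "i \<in> {1..N}" "x (N, l) \<in> A l" for i l using A that by blast
    then show ?thesis using True N by auto
   qed
   moreover have "\<forall>l\<in>{1..k}. \<forall>i\<in>{1..<N}. x (i,l) < x (Suc i,l)" using True by (simp add: ordered_def)
   ultimately show ?thesis unfolding nib_unnorm_def levels_def w using d by simp
  next
   case False
   then show ?thesis unfolding nib_unnorm_def levels_def by (auto simp: ordered_def)
  qed
 qed
qed

lemma detS_identity: fixes N :: nat shows "detS {1..N} (\<lambda>i j. if i = j then 1 else 0 :: real) = 1"
proof -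
 have bij: "bij_betw Suc {..<N} {1..N}" by (auto simp: bij_betw_def image_Suc_lessThan)
 show ?thesis unfolding detS_reindex[OF bij finite_lessThan] by (subst detS_triangular) auto
qed

text \<open>The constant \<open>c\<close> relating the density to \<open>levels\<close> does not
  depend on the sets. For \<open>A = UNIV\<close> the chain collapses by \<open>Gf_heat\<close> and
  biorthogonality gives the identity matrix, so the normalising integral equals \<open>c\<close> and
  the probability is the determinant itself.\<close>

lemma nib_prob:
 fixes r \<epsilon> :: real and t :: "nat => real" and A A' :: "nat => real set"
 assumes B: "nonint_bridges M N B" and N: "1 \<le> N"
  and t: "k \<ge> 1" "0 < t 1" "t k < 1" "incr t 1 (k - 1)"
  and A: "bsets A" "\<And>l y z. y \<le> z ==> z \<in> A l ==> y \<in> A l"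
  and A': "\<And>l x. 1 \<le> l ==> l \<le> k ==> x \<in> A l \<longleftrightarrow> Uc r (t l) x + \<epsilon> \<in> A' l"
 defines "s \<equiv> sqrt 2 * r"
 shows "measure M {\<omega>\<in>space M. \<forall>l\<in>{1..k}. B N (t l) \<omega> \<in> A l} =
  detS {1..N} (\<lambda>i j. LBINT u. Ff s (tau (t 1)) (i - 1) (u - \<epsilon>) *
   (indicator (A' 1) u * hchain 2 (\<lambda>j. tau (t j)) A' 1 (k - 1) (\<lambda>v. Gf s (tau (t k)) (j - 1) (v - \<epsilon>)) u))"
proof -
 define P where "P = PiM ({1..N}\<times>{1..k}) (\<lambda>_. lborel :: real measure)"
 define X where "X \<omega> = restrict (\<lambda>(i,l). B i (t l) \<omega>) ({1..N}\<times>{1..k})" for \<omega>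
 define \<phi> where "\<phi> i x = Ff s (tau (t 1)) (i - 1) (Uc r (t 1) x) / (sqrt 2 * (1 - t 1) * rhoc r (t 1) x)" for i x
 define \<psi> where "\<psi> i x = rhoc r (t k) x * Gf s (tau (t k)) (i - 1) (Uc r (t k) x)" for i x
 define e where "e A i j = (LBINT x. \<phi> i x * (indicator (A 1) x * hchain 1 t A 1 (k - 1) (\<psi> j) x))" for A i j
 define f where "f = nib_unnorm N k t"
 have tl: "t l < t (Suc l)" if "1 \<le> l" "l < k" for l using t(4) that by (auto simp: incr_def)
 have tle: "t l \<le> t k" if "1 \<le> l" "l \<le> k" for l
 proof (cases "l = k")
  case False
  have "incr t l (k - l)" using tl that by (simp add: incr_def)
  from incr_less[OF this] that False show ?thesis by simp
 qed simp
 have t1: "t l < 1" if "1 \<le> l" "l \<le> k" for l using tle[OF that] t by simp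
 have t11: "t 1 < 1" using t1[of 1] t by simp
 have ps: "prob_space M" and d: "distributed M P X (\<lambda>x. ennreal (f x / (\<integral>y. f y \<partial>P)))"
  using B t(1-3) tl unfolding nonint_bridges_def P_def X_def[abs_def] f_def nib_density_def by auto
 note norm = distributed_normalised[OF ps d]
 obtain c where c: "c \<noteq> 0"
  "\<And>A x. (\<And>l y z. y \<le> z ==> z \<in> A l ==> y \<in> A l) ==>
   f x * (if \<forall>l\<in>{1..k}. x (N, l) \<in> A l then 1 else 0) = c * levels N k A \<phi> (\<lambda>l. heat 1 (t (Suc l) - t l)) \<psi> x"
  unfolding \<phi>_def[abs_def] \<psi>_def[abs_def] f_def s_def by (rule nib_unnorm_levels[OF t(1,2) t11 t(3) N, of r]) blast
 obtain K a b q :: real where K: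
  "\<And>x n. Ff s (tau (t 1)) n (Uc r (t 1) x) / (sqrt 2 * (1 - t 1) * rhoc r (t 1) x) = heat 1 (t 1) 0 x * (K * fact n * He n (a * x + b) q)"
  unfolding s_def by (rule entrance_weight[OF t(2) t11, of r]) blast
 obtain a' b' q' :: real where K':
  "\<And>x n. rhoc r (t k) x * Gf s (tau (t k)) n (Uc r (t k) x) = heat 1 (1 - t k) x 0 * He n (a' * x + b') q'"
  unfolding s_def by (rule exit_weight[OF t(3), of r]) blast
 define G where "G g \<longleftrightarrow> (\<exists>\<kappa> C. 0 \<le> \<kappa> \<and> bnd \<kappa> C g)" for g
 have G\<psi>: "G (\<psi> i)" for i
 proof -
  obtain C where C: "bnd 1 C (\<lambda>x. He (i - 1) (a' * x + b') q')" by (rule bnd_He)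
  have "bnd (0 + 1) (1 / sqrt (2 * pi * (1 * (1 - t k))) * C) (\<psi> i)"
    unfolding \<psi>_def[abs_def] K' by (rule bnd_mult[OF bnd_heat C]) (use t in auto)
  then show ?thesis unfolding G_def by (intro exI[of _ "0 + 1"] exI) simp
 qed
 have \<phi>m: "\<phi> i \<in> borel_measurable borel" for i
 proof -
  obtain C where C: "bnd 1 C (\<lambda>x. He (i - 1) (a * x + b) q)" by (rule bnd_He)
  have [measurable]: "(\<lambda>x. He (i - 1) (a * x + b) q) \<in> borel_measurable borel" using C by (rule bnd_measurable)
  show ?thesis unfolding \<phi>_def[abs_def] K by measurable
 qed
 have G\<phi>: "integrable lborel (\<lambda>y. \<phi> i y * (indicator S y * g y))" if "G g" and S: "S \<in> sets borel" for g i S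
 proof -
  obtain \<kappa> C where g: "0 \<le> \<kappa>" "bnd \<kappa> C g" using \<open>G g\<close> unfolding G_def by auto
  obtain C' where C': "bnd 1 C' (\<lambda>x. He (i - 1) (a * x + b) q)" by (rule bnd_He)
  have "bnd (1 + \<kappa>) (C' * C) (\<lambda>x. He (i - 1) (a * x + b) q * (indicator S x * g x))"
   using bnd_mult[OF C' bnd_indicator_mult[OF g(2) S]] g by simp
  from integrable_mult_right[OF bnd_integrable[OF _ this, of 1 "t 1" 0], of "K * fact (i - 1)"]
  show ?thesis unfolding \<phi>_def K using t by (simp add: mult_ac)
 qed
 have key: "(\<integral>x. f x * indicator {x \<in> space P. \<forall>l\<in>{1..k}. x (N, l) \<in> A l} x \<partial>P) = c * detS {1..N} (e A)"
  if bA: "bsets A" and dA: "\<And>l y z. y \<le> z ==> z \<in> A l ==> y \<in> A l" for A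
 proof -
  let ?S = "{x \<in> space P. \<forall>l\<in>{1..k}. x (N, l) \<in> A l}"
  let ?L = "levels N k A \<phi> (\<lambda>l. heat 1 (t (Suc l) - t l)) \<psi>"
  have [measurable]: "A l \<in> sets borel" for l using bA by (rule bsetsD)
  have comp: "(\<lambda>x. x (N, l)) \<in> measurable P lborel" if "l \<in> {1..k}" for l
   unfolding P_def by (rule measurable_component_singleton) (use that N in auto)
  have S: "?S \<in> sets P" by (intro sets.sets_Collect_finite_All measurable_sets_Collect[OF comp]) auto
  have fc: "f x * (if \<forall>l\<in>{1..k}. x (N, l) \<in> A l then 1 else 0) = c * ?L x" for x
   by (rule c(2)) (rule dA)
  have fS: "f x * indicator ?S x = c * ?L x" if "x \<in> space P" for x
   using fc[of x] that by (auto simp: indicator_def split: if_splits)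
  have "integrable P (\<lambda>x. f x * indicator ?S x)" by (rule integrable_real_mult_indicator[OF S norm(1)])
  then have "integrable P (\<lambda>x. c * ?L x)" by (subst (asm) integrable_cong[OF refl fS])
  then have L: "integrable (PiM ({1..N}\<times>{1..k}) (\<lambda>_. lborel)) ?L" using c(1) by (simp add: P_def)
  have "(\<integral>x. f x * indicator ?S x \<partial>P) = (\<integral>x. c * ?L x \<partial>P)"
   by (intro integral_cong refl fS)
  also have "\<dots> = c * (\<integral>x. ?L x \<partial>P)" by simp
  also have "(\<integral>x. ?L x \<partial>P) = detS {1..N} (e A)"
   unfolding P_def e_def
  proof (rule integral_levels[where G = G, OF t(1) _ \<phi>m _ _ _ _ G\<phi> G\<psi> L])
   show "G g ==> g \<in> borel_measurable borel" for g unfolding G_def by (auto dest: bnd_measurable)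
   show "integrable lborel (\<lambda>y. heat 1 (t (Suc l) - t l) x y * (indicator (A (Suc l)) y * g y))" if "G g" "1 \<le> l" "l < k" for g l x
    using that tl[of l] unfolding G_def by (auto intro!: bnd_integrable bnd_indicator_mult)
   show "G (chain (\<lambda>l. heat 1 (t (Suc l) - t l)) A l 1 g)" if g: "G g" "1 \<le> l" "l < k" for g l
   proof -
    obtain \<kappa> C where g': "0 \<le> \<kappa>" "bnd \<kappa> C g" using g(1) unfolding G_def by auto
    have "incr t l 1" using tl[OF g(2,3)] less_antisym by (auto simp: incr_def One_nat_def less_Suc_eq le_less)
    from bnd_hchain[OF _ this bA g'(2), of 1] g' show ?thesis unfolding G_def by auto
   qed
  qed auto
  finally show ?thesis .
 qed
 have shift: "e A i j = (LBINT u. Ff s (tau (t 1)) (i - 1) (u - \<epsilon>) *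
   (indicator (A' 1) u * hchain 2 (\<lambda>j. tau (t j)) A' 1 (k - 1) (\<lambda>v. Gf s (tau (t k)) (j - 1) (v - \<epsilon>)) u))"
  if A': "\<And>l x. 1 \<le> l ==> l \<le> k ==> x \<in> A l \<longleftrightarrow> Uc r (t l) x + \<epsilon> \<in> A' l" for A A' i j \<epsilon>
 proof -
  let ?h = "hchain 2 (\<lambda>j. tau (t j)) A' 1 (k - 1) (\<lambda>v. Gf s (tau (t k)) (j - 1) (v - \<epsilon>))"
  have ch: "hchain 1 t A 1 (k - 1) (\<psi> j) x = rhoc r (t 1) x * ?h (Uc r (t 1) x + \<epsilon>)" for x
   using chain_cocycle[OF t(4), of A r \<epsilon> A' "\<lambda>v. Gf s (tau (t k)) (j - 1) (v - \<epsilon>)" x] t(1) t1 A'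
   unfolding \<psi>_def[abs_def] by simp
  have "\<phi> i x * (indicator (A 1) x * hchain 1 t A 1 (k - 1) (\<psi> j) x) =
   1 / (sqrt 2 * (1 - t 1)) * (Ff s (tau (t 1)) (i - 1) (Uc r (t 1) x + \<epsilon> - \<epsilon>) * (indicator (A' 1) (Uc r (t 1) x + \<epsilon>) * ?h (Uc r (t 1) x + \<epsilon>)))" for x
  proof -
   have i: "indicator (A 1) x = (indicator (A' 1) (Uc r (t 1) x + \<epsilon>) :: real)"
    using A'[of 1 x] t(1) by (simp add: indicator_def)
   have "F / (c * p) * (I * (p * H)) = 1 / c * (F * (I * H))" if "p \<noteq> 0" for F c p I H :: real
    using that by simp
   then show ?thesis unfolding ch i \<phi>_def using rhoc_pos[OF t11, of r x] by simp
  qed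
  then show ?thesis unfolding e_def
   using integral_Uc[OF t11, where r = r and \<epsilon> = \<epsilon> and f = "\<lambda>u. Ff s (tau (t 1)) (i - 1) (u - \<epsilon>) * (indicator (A' 1) u * ?h u)"] by simp
 qed
 \<comment> \<open>Without barriers and with lift 0, the free flow carries \<open>Gf\<close> from
   the last time back to the first, where it is paired with \<open>Ff\<close>.\<close>
 have UN: "e (\<lambda>_. UNIV) i j = (if i = j then 1 else 0)" if "i \<in> {1..N}" "j \<in> {1..N}" for i j
 proof -
  have pos: "0 < tau (t 1)" using t(2) t11 by (simp add: tau_def)
  have "hchain 2 (\<lambda>j. tau (t j)) (\<lambda>_. UNIV) 1 (k - 1) (Gf s (tau (t k)) (j - 1)) u = Gf s (tau (t 1)) (j - 1) u" for u
  proof (cases "k = 1")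
   case False
   then have "k = 1 + Suc (k - 2)" "k - 1 = Suc (k - 2)" using t(1) by simp_all
   then obtain m where m: "k - 1 = Suc m" "k = 1 + Suc m" by blast
   have inc: "incr (\<lambda>j. tau (t j)) 1 (Suc m)"
    unfolding incr_def using tl t1 m by (auto intro!: tau_strict_mono)
   have lt: "tau (t 1) < tau (t k)" using incr_less[OF inc] m by simp
   obtain C where C: "bnd (\<bar>s\<bar> + 1) C (Gf s (tau (t k)) (j - 1))" by (rule bnd_Gf)
   show ?thesis
    unfolding m(1) using hchain_UNIV[OF _ inc C, of 2 u] Gf_heat[of "tau (t k) - tau (t 1)" s "tau (t 1)" "j - 1" u] lt m(2) by simp
  qed simp
  then have "e (\<lambda>_. UNIV) i j = (LBINT u. Ff s (tau (t 1)) (i - 1) u * Gf s (tau (t 1)) (j - 1) u)"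
   using shift[of "\<lambda>_. UNIV" 0 "\<lambda>_. UNIV" i j] by simp
  also have "\<dots> = (if i - 1 = j - 1 then 1 else 0)" by (rule Ff_Gf_orthonormal[OF pos])
  finally show ?thesis using that by auto
 qed
 have "(\<integral>x. f x \<partial>P) = (\<integral>x. f x * indicator {x \<in> space P. \<forall>l\<in>{1..k}. x (N, l) \<in> UNIV} x \<partial>P)"
  by (intro integral_cong refl) simp
 also have "\<dots> = c * detS {1..N} (e (\<lambda>_. UNIV))" by (rule key) (auto simp: bsets_UNIV)
 also have "detS {1..N} (e (\<lambda>_. UNIV)) = 1" using detS_cong[of "{1..N}", OF UN] detS_identity by simp
 finally have Z: "(\<integral>x. f x \<partial>P) = c" by simp
 have [measurable]: "A l \<in> sets borel" for l using A(1) by (rule bsetsD)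
 have "{x \<in> space P. \<forall>l\<in>{1..k}. x (N, l) \<in> A l} \<in> sets P"
 proof -
  have comp: "(\<lambda>x. x (N, l)) \<in> measurable P lborel" if "l \<in> {1..k}" for l
   unfolding P_def by (rule measurable_component_singleton) (use that N in auto)
  show ?thesis by (intro sets.sets_Collect_finite_All measurable_sets_Collect[OF comp]) auto
 qed
 note S = this
 have kA: "(\<integral>x. f x * indicator {x \<in> space P. \<forall>l\<in>{1..k}. x (N, l) \<in> A l} x \<partial>P) = c * detS {1..N} (e A)"
  by (rule key) (fact A(1), rule A(2))
 from norm(3)[OF S, unfolded Z] have "measure M {\<omega> \<in> space M. X \<omega> \<in> {x \<in> space P. \<forall>l\<in>{1..k}. x (N, l) \<in> A l}} = detS {1..N} (e A)"
  using c(1) kA by simp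
 moreover have "{\<omega> \<in> space M. X \<omega> \<in> {x \<in> space P. \<forall>l\<in>{1..k}. x (N, l) \<in> A l}} = {\<omega>\<in>space M. \<forall>l\<in>{1..k}. B N (t l) \<omega> \<in> A l}"
  unfolding P_def X_def using N by (auto simp: space_PiM)
 ultimately show ?thesis using shift[OF A'] by (simp cong: detS_cong)
qed

text \<open>Three uniform meshes of \<open>Suc n\<close> steps on consecutive intervals, so that the
  limit theorem for each piece applies with one common parameter \<open>n\<close>.\<close>

definition mesh3 :: "nat => real => real => real => real => nat => real" where
 "mesh3 n a T1 T2 T3 l = (if l \<le> Suc n then a + real l * (T1 / real (Suc n))
  else if l \<le> Suc n + Suc n then a + T1 + real (l - Suc n) * (T2 / real (Suc n))
  else a + T1 + T2 + real (l - (Suc n + Suc n)) * (T3 / real (Suc n)))"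

lemma mesh3_first: "j \<le> Suc n ==> mesh3 n a T1 T2 T3 j = a + real j * (T1 / real (Suc n))"
 by (simp add: mesh3_def)

lemma mesh3_second: "j \<le> Suc n ==> mesh3 n a T1 T2 T3 (Suc n + j) = a + T1 + real j * (T2 / real (Suc n))"
 by (cases j) (simp_all add: mesh3_def del: of_nat_Suc)

lemma mesh3_third: "mesh3 n a T1 T2 T3 (Suc n + Suc n + j) = a + T1 + T2 + real j * (T3 / real (Suc n))"
 by (cases j) (simp_all add: mesh3_def del: of_nat_Suc)

lemma mesh3_index:
 assumes "l < 3 * Suc n"
 obtains j where "j < Suc n" "l = j" | j where "j < Suc n" "l = Suc n + j" | j where "j < Suc n" "l = Suc n + Suc n + j"
proof -
 consider "l < Suc n" | "Suc n \<le> l" "l < Suc n + Suc n" | "Suc n + Suc n \<le> l" by linarith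
 then show ?thesis
 proof cases
  case 1 then show ?thesis using that(1)[of l] by simp
 next
  case 2 then show ?thesis using that(2)[of "l - Suc n"] by simp
 next
  case 3 then show ?thesis using that(3)[of "l - (Suc n + Suc n)"] assms by simp
 qed
qed

lemma mesh3_step:
 assumes "0 < T1" "0 < T2" "0 < T3" "l < 3 * Suc n"
 shows "mesh3 n a T1 T2 T3 l < mesh3 n a T1 T2 T3 (Suc l)"
proof -
 have pos: "0 < T1 / real (Suc n)" "0 < T2 / real (Suc n)" "0 < T3 / real (Suc n)" using assms by simp_all
 have lt: "real j * x < real (Suc j) * x" if "0 < x" for x j using that by simp
 show ?thesis using assms(4)
 proof (cases rule: mesh3_index)
  case (1 j)
  then show ?thesis using mesh3_first[of j n a T1 T2 T3] mesh3_first[of "Suc j" n a T1 T2 T3] lt[OF pos(1), of j] by simp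
 next
  case (2 j)
  then have e: "Suc l = Suc n + Suc j" by simp
  show ?thesis unfolding e unfolding 2 using mesh3_second[of j n a T1 T2 T3] mesh3_second[of "Suc j" n a T1 T2 T3] 2 lt[OF pos(2), of j] by linarith
 next
  case (3 j)
  then have e: "Suc l = Suc n + Suc n + Suc j" by simp
  show ?thesis unfolding e unfolding 3 using mesh3_third[of n a T1 T2 T3 j] mesh3_third[of n a T1 T2 T3 "Suc j"] lt[OF pos(3), of j] by linarith
 qed
qed

lemma mesh3_mono:
 assumes "0 < T1" "0 < T2" "0 < T3" "i \<le> j" "j \<le> 3 * Suc n"
 shows "mesh3 n a T1 T2 T3 i \<le> mesh3 n a T1 T2 T3 j"
 using assms(4,5)
proof (induction j rule: dec_induct)
 case (step j)
 then show ?case using mesh3_step[OF assms(1-3), of j n a] by simp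
qed simp

lemma mesh3_range:
 assumes "0 < T1" "0 < T2" "0 < T3" "j \<le> 3 * Suc n"
 shows "mesh3 n a T1 T2 T3 j \<in> {a..a + T1 + T2 + T3}"
proof -
 have "mesh3 n a T1 T2 T3 0 = a" using mesh3_first[of 0] by simp
 moreover have "mesh3 n a T1 T2 T3 (3 * Suc n) = a + T1 + T2 + T3"
 proof -
  have e: "3 * Suc n = Suc n + Suc n + Suc n" by simp
  show ?thesis unfolding e mesh3_third by (simp del: of_nat_Suc)
 qed
 ultimately show ?thesis
  using mesh3_mono[OF assms(1-3), of 0 j n a] mesh3_mono[OF assms(1-3), of j "3 * Suc n" n a] assms(4) by simp
qed

text \<open>The last set is imposed by the chain already, so it may be imposed again. This inserts a
  cut between consecutive pieces.\<close>

lemma hchain_indicator_last: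
 "hchain D s A l (Suc m) g = hchain D s A l (Suc m) (\<lambda>x. indicator (A (l + Suc m)) x * g x)"
proof (induction m arbitrary: l)
 case 0
 have "(\<lambda>y. indicator S y * g y) = (\<lambda>y. indicator S y * (indicator S y * g y))" for S by (auto simp: indicator_def)
 note e = this[of "A (Suc l)", symmetric]
 show ?case by (subst (1 2) hchain_Suc) (simp only: chain.simps add_Suc_right add_0_right e)
next
 case (Suc m)
 show ?case using Suc.IH[of "Suc l"] by (simp only: hchain_Suc[of _ _ _ _ "Suc m"] add_Suc_right add_Suc)
qed

text \<open>\<open>chain_add\<close> splits the chain. The barrier is 0 on the outer pieces, which
  become reflected kernels, and \<open>b\<close> on the middle piece, which becomes the killed
  operator; the growth bounds let the limits be taken from the inside out. Levels count from 1 and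
  mesh points from 0.\<close>

lemma chain_three_pieces:
 fixes \<beta> b :: "real => real" and a T1 T2 T3 :: real
 assumes bm: "brownian_motion M D W" and D: "0 < D" and T: "0 < T1" "0 < T2" "0 < T3"
  and b: "continuous_on {0..T2} b" "\<And>x. x \<in> {0..T2} ==> b x = \<beta> (a + T1 + x)" "b T2 = 0"
  and \<beta>: "\<And>x. a \<le> x ==> x \<le> a + T1 ==> \<beta> x = 0" "\<And>x. a + T1 + T2 \<le> x ==> x \<le> a + T1 + T2 + T3 ==> \<beta> x = 0"
  and g: "bnd \<kappa> C g"
 defines "s \<equiv> \<lambda>n l. mesh3 n a T1 T2 T3 (l - 1)"
 defines "A \<equiv> \<lambda>n l. {..\<beta> (s n l)}"
 shows "u \<le> 0 ==> (\<lambda>n. hchain D (s n) (A n) 1 (3 * Suc n) g u) \<longlonglongrightarrow>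
   refl_op 0 D T1 (killed_op M W b T2 (\<lambda>x. indicator {..0} x * refl_op 0 D T3 g x)) u"
  and "bnd \<kappa> (C * exp (D * (T1 + T2 + T3) * \<kappa>\<^sup>2 / 2)) (hchain D (s n) (A n) 1 (3 * Suc n) g)"
  and "incr (s n) 1 (3 * Suc n)"
proof -
 define d where "d T n = T / real (Suc n)" for T n
 have dT: "real (Suc n) * d T n = T" for T n by (simp add: d_def del: of_nat_Suc)
 have dpos: "0 < d T n" if "0 < T" for T n using that by (simp add: d_def)
 have dle: "real j * d T n \<le> T" if "j \<le> Suc n" "0 < T" for j T n
 proof -
  have "real j * d T n \<le> real (Suc n) * d T n" using that dpos[OF that(2), of n] by (intro mult_right_mono) auto
  then show ?thesis by (simp only: dT)
 qed
 have dge: "0 \<le> real j * d T n" if "0 < T" for j T n using dpos[OF that, of n] by simp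
 have s1: "s n (1 + j) = a + real j * d T1 n" if "j \<le> Suc n" for n j
  using mesh3_first[OF that] by (simp add: s_def d_def)
 have s2: "s n (1 + Suc n + j) = a + T1 + real j * d T2 n" if "j \<le> Suc n" for n j
 proof -
  have "1 + Suc n + j - 1 = Suc n + j" by simp
  then show ?thesis using mesh3_second[OF that] by (simp only: s_def d_def)
 qed
 have s3: "s n (1 + Suc n + Suc n + j) = a + T1 + T2 + real j * d T3 n" for n j
 proof -
  have "1 + Suc n + Suc n + j - 1 = Suc n + Suc n + j" by simp
  then show ?thesis using mesh3_third[of n a T1 T2 T3 j] by (simp only: s_def d_def)
 qed
 define H3 where "H3 n = hchain D (\<lambda>l. real l * d T3 n) (\<lambda>_. {..0}) 0 (Suc n) g" for n
 define H2 where "H2 n = hchain D (\<lambda>l. real l * d T2 n) (\<lambda>l. {..b (real l * d T2 n)}) 0 (Suc n) (\<lambda>x. indicator {..0} x * H3 n x)" for n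
 define H1 where "H1 n = hchain D (\<lambda>l. real l * d T1 n) (\<lambda>_. {..0}) 0 (Suc n) (H2 n)" for n
 have p3: "hchain D (s n) (A n) (1 + Suc n + Suc n) (Suc n) g = H3 n" for n
  unfolding H3_def
 proof (rule hchain_cong)
  fix j assume j: "j < Suc n"
  have e: "Suc (1 + Suc n + Suc n + j) = 1 + Suc n + Suc n + Suc j" by simp
  show "s n (Suc (1 + Suc n + Suc n + j)) - s n (1 + Suc n + Suc n + j) = real (Suc (0 + j)) * d T3 n - real (0 + j) * d T3 n"
   unfolding e s3 by (simp add: algebra_simps)
  have "\<beta> (a + T1 + T2 + real (Suc j) * d T3 n) = 0"
   by (rule \<beta>(2)) (use dle[of "Suc j" n T3] dge[of T3 "Suc j" n] j T in auto)
  then show "A n (Suc (1 + Suc n + Suc n + j)) = {..0}" unfolding e A_def s3 by simp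
 qed
 have p2: "hchain D (s n) (A n) (1 + Suc n) (Suc n) (H3 n) = H2 n" for n
 proof -
  have bA: "A n (1 + Suc n + Suc j) = {..b (real (Suc j) * d T2 n)}" if "j < Suc n" for j
  proof -
   have "Suc j \<le> Suc n" using that by simp
   then have "real (Suc j) * d T2 n \<in> {0..T2}" using dle[of "Suc j" n T2] dge[of T2 "Suc j" n] T by simp
   from b(2)[OF this] show ?thesis unfolding A_def s2[OF \<open>Suc j \<le> Suc n\<close>] by simp
  qed
  \<comment> \<open>Since \<open>b T2 = 0\<close> the cut at the end of the middle piece is the
    half-line. It has to be made explicit: the reflected limit holds for arguments
    \<open>\<le> 0\<close> only, while \<open>killed_op_tendsto\<close> asks for convergence
    everywhere.\<close>
  have last: "A n (1 + Suc n + Suc n) = {..0}" using bA[of n] by (simp only: dT b(3) lessI)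
  show ?thesis
   unfolding H2_def hchain_indicator_last[of D "s n" "A n" "1 + Suc n" n "H3 n"] last
  proof (rule hchain_cong)
   fix j assume j: "j < Suc n"
   have e: "Suc (1 + Suc n + j) = 1 + Suc n + Suc j" by simp
   show "s n (Suc (1 + Suc n + j)) - s n (1 + Suc n + j) = real (Suc (0 + j)) * d T2 n - real (0 + j) * d T2 n"
    unfolding e using s2[of j n] s2[of "Suc j" n] j by (simp add: algebra_simps)
   show "A n (Suc (1 + Suc n + j)) = {..b (real (Suc (0 + j)) * d T2 n)}" unfolding e bA[OF j] by simp
  qed
 qed
 have p1: "hchain D (s n) (A n) 1 (Suc n) (H2 n) = H1 n" for n
  unfolding H1_def
 proof (rule hchain_cong)
  fix j assume j: "j < Suc n"
  then have j': "j \<le> Suc n" "Suc j \<le> Suc n" by auto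
  have e: "Suc (1 + j) = 1 + Suc j" by simp
  show "s n (Suc (1 + j)) - s n (1 + j) = real (Suc (0 + j)) * d T1 n - real (0 + j) * d T1 n"
   unfolding e s1[OF j'(1)] s1[OF j'(2)] by (simp add: algebra_simps)
  have "\<beta> (a + real (Suc j) * d T1 n) = 0"
   by (rule \<beta>(1)) (use dle[of "Suc j" n T1] dge[of T1 "Suc j" n] j T in auto)
  then show "A n (Suc (1 + j)) = {..0}" unfolding e A_def s1[OF j'(2)] by simp
 qed
 have all: "hchain D (s n) (A n) 1 (3 * Suc n) g = H1 n" for n
 proof -
  have "3 * Suc n = Suc n + (Suc n + Suc n)" by simp
  then show ?thesis using p1[of n] p2[of n] p3[of n] by (simp only: chain_add)
 qed
 have inc: "incr (\<lambda>l. real l * d T n) l m" if "0 < T" for T n l m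
  using dpos[OF that, of n] by (auto simp: incr_def intro!: mult_strict_right_mono)
 have bs: "bsets (\<lambda>l. {..f l})" for f :: "nat => real" by (simp add: bsets_def)
 have bnd_step: "bnd \<kappa> (C' * exp (D * T * \<kappa>\<^sup>2 / 2)) (hchain D (\<lambda>l. real l * d T n) (\<lambda>l. {..f l}) 0 (Suc n) g')"
  if "0 < T" "bnd \<kappa> C' g'" for T n f g' C'
 proof -
  have "real (0 + Suc n) * d T n - real 0 * d T n = T" using dT[of n T] by simp
  then show ?thesis using bnd_hchain[OF D inc[OF that(1), of n 0 "Suc n"] bs[of f] that(2)] by simp
 qed
 define C3 where "C3 = C * exp (D * T3 * \<kappa>\<^sup>2 / 2)"
 define C2 where "C2 = C3 * exp (D * T2 * \<kappa>\<^sup>2 / 2)"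
 have b3: "bnd \<kappa> C3 (H3 n)" for n unfolding H3_def C3_def by (rule bnd_step[OF T(3) g])
 have b3': "bnd \<kappa> C3 (\<lambda>x. indicator {..0} x * H3 n x)" for n by (rule bnd_indicator_mult[OF b3]) simp
 have b2: "bnd \<kappa> C2 (H2 n)" for n unfolding H2_def C2_def by (rule bnd_step[OF T(2) b3'])
 have "bnd \<kappa> (C2 * exp (D * T1 * \<kappa>\<^sup>2 / 2)) (H1 n)" unfolding H1_def by (rule bnd_step[OF T(1) b2])
 moreover have "C2 * exp (D * T1 * \<kappa>\<^sup>2 / 2) = C * exp (D * (T1 + T2 + T3) * \<kappa>\<^sup>2 / 2)"
  unfolding C2_def C3_def mult.assoc exp_add[symmetric] by (simp add: algebra_simps add_divide_distrib)
 ultimately show "bnd \<kappa> (C * exp (D * (T1 + T2 + T3) * \<kappa>\<^sup>2 / 2)) (hchain D (s n) (A n) 1 (3 * Suc n) g)"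
  unfolding all by simp
 have l3: "(\<lambda>n. indicator {..0} x * H3 n x) \<longlonglongrightarrow> indicator {..0} x * refl_op 0 D T3 g x" for x
 proof (cases "x \<le> 0")
  case True
  have "(\<lambda>n. H3 n x) \<longlonglongrightarrow> refl_op 0 D T3 g x"
   unfolding H3_def d_def by (rule hchain_halfline_tendsto[OF D T(3) g _ True]) simp
  then show ?thesis by (intro tendsto_intros)
 qed simp
 have l2: "(\<lambda>n. H2 n x) \<longlonglongrightarrow> killed_op M W b T2 (\<lambda>x. indicator {..0} x * refl_op 0 D T3 g x) x" for x
  unfolding H2_def d_def by (rule killed_op_tendsto[OF bm D T(2) b(1) b3' l3])
 show "(\<lambda>n. hchain D (s n) (A n) 1 (3 * Suc n) g u) \<longlonglongrightarrow>
   refl_op 0 D T1 (killed_op M W b T2 (\<lambda>x. indicator {..0} x * refl_op 0 D T3 g x)) u" if "u \<le> 0"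
  unfolding all H1_def d_def by (rule hchain_halfline_tendsto[OF D T(1) b2 l2 that])
 show "incr (s n) 1 (3 * Suc n)"
  unfolding incr_def s_def
 proof (intro allI impI)
  fix j assume "1 \<le> j \<and> j < 1 + 3 * Suc n"
  then have "j - 1 < 3 * Suc n" "Suc j - 1 = Suc (j - 1)" by auto
  then show "mesh3 n a T1 T2 T3 (j - 1) < mesh3 n a T1 T2 T3 (Suc j - 1)"
   using mesh3_step[OF T, of "j - 1" n a] by (simp only:)
 qed
qed

text \<open>On each piece the uniform mesh tests the right end but not the left one; the pieces
  overlap in such ends, and \<open>f a\<close> remains as a separate factor.\<close>

lemma mesh3_indicator_tendsto:
 fixes f :: "real => real" and a T1 T2 T3 :: real
 assumes T: "0 < T1" "0 < T2" "0 < T3" and f: "continuous_on {a..a + T1 + T2 + T3} f"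
 shows "(\<lambda>n. indicator {y. \<forall>l\<in>{1..Suc (3 * Suc n)}. y (mesh3 n a T1 T2 T3 (l - 1)) \<le> 0} f :: real) \<longlonglongrightarrow>
  (if \<forall>t\<in>{a..a + T1 + T2 + T3}. f t \<le> 0 then 1 else 0)"
proof -
 let ?m = "\<lambda>n. mesh3 n a T1 T2 T3"
 let ?P = "\<lambda>g T n. (\<Prod>l\<in>{1..Suc n}. indicator {..0} (g (real l * (T / real (Suc n)))) :: real)"
 let ?f1 = "\<lambda>x. f (a + x)" and ?f2 = "\<lambda>x. f (a + T1 + x)" and ?f3 = "\<lambda>x. f (a + T1 + T2 + x)"
 have c: "continuous_on {0..T1} ?f1" "continuous_on {0..T2} ?f2" "continuous_on {0..T3} ?f3"
 proof -
  have sh: "continuous_on {0..T} (\<lambda>x. f (p + x))" if "a \<le> p" "p + T \<le> a + T1 + T2 + T3" for p T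
   by (rule continuous_on_compose2[OF f continuous_on_add[OF continuous_on_const continuous_on_id]]) (use that in auto)
  show "continuous_on {0..T1} ?f1" by (rule sh) (use T in simp_all)
  show "continuous_on {0..T2} ?f2" by (rule sh) (use T in simp_all)
  show "continuous_on {0..T3} ?f3" by (rule sh) (use T in simp_all)
 qed
 have P1: "?P g T n = (if \<forall>l\<in>{1..Suc n}. g (real l * (T / real (Suc n))) \<le> 0 then 1 else 0)" for g T n
  by (subst prod_indicator_eq) auto
 have all: "(\<forall>l\<in>{1..Suc (3 * Suc n)}. f (?m n (l - 1)) \<le> 0) \<longleftrightarrow> f a \<le> 0 \<and>
  (\<forall>l\<in>{1..Suc n}. ?f1 (real l * (T1 / real (Suc n))) \<le> 0) \<and> (\<forall>l\<in>{1..Suc n}. ?f2 (real l * (T2 / real (Suc n))) \<le> 0) \<and>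
  (\<forall>l\<in>{1..Suc n}. ?f3 (real l * (T3 / real (Suc n))) \<le> 0)" (is "?L \<longleftrightarrow> ?R") for n
 proof
  assume L: ?L
  have L': "f (?m n l) \<le> 0" if "l \<le> 3 * Suc n" for l using bspec[OF L, of "Suc l"] that by simp
  show ?R
  proof (intro conjI ballI)
   show "f a \<le> 0" using L'[of 0] mesh3_first[of 0] by simp
   fix l assume l: "l \<in> {1..Suc n}"
   show "?f1 (real l * (T1 / real (Suc n))) \<le> 0" using L'[of l] mesh3_first[of l n a T1 T2 T3] l by simp
   show "?f2 (real l * (T2 / real (Suc n))) \<le> 0" using L'[of "Suc n + l"] mesh3_second[of l n a T1 T2 T3] l by simp
   show "?f3 (real l * (T3 / real (Suc n))) \<le> 0" using L'[of "Suc n + Suc n + l"] mesh3_third[of n a T1 T2 T3 l] l by simp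
  qed
 next
  assume R: ?R
  have main: "f (?m n (Suc l)) \<le> 0" if "l < 3 * Suc n" for l
   using that
  proof (cases rule: mesh3_index)
   case (1 j)
   then have "Suc j \<in> {1..Suc n}" "Suc l = Suc j" by auto
   then show ?thesis using bspec[OF conjunct1[OF conjunct2[OF R]], of "Suc j"] mesh3_first[of "Suc j" n a T1 T2 T3] by simp
  next
   case (2 j)
   then have "Suc j \<in> {1..Suc n}" "Suc l = Suc n + Suc j" by auto
   then show ?thesis using bspec[OF conjunct1[OF conjunct2[OF conjunct2[OF R]]], of "Suc j"] mesh3_second[of "Suc j" n a T1 T2 T3] by simp
  next
   case (3 j)
   then have "Suc j \<in> {1..Suc n}" "Suc l = Suc n + Suc n + Suc j" by auto
   then show ?thesis using bspec[OF conjunct2[OF conjunct2[OF conjunct2[OF R]]], of "Suc j"] mesh3_third[of n a T1 T2 T3 "Suc j"] by simp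
  qed
  show ?L
  proof
   fix l assume l: "l \<in> {1..Suc (3 * Suc n)}"
   show "f (?m n (l - 1)) \<le> 0"
   proof (cases "l = 1")
    case True then show ?thesis using R mesh3_first[of 0] by simp
   next
    case False
    then have "l - 1 = Suc (l - 2)" "l - 2 < 3 * Suc n" using l by auto
    then show ?thesis using main[of "l - 2"] by (simp only:)
   qed
  qed
 qed
 have if_conj: "(if p \<and> q then 1 else 0 :: real) = (if p then 1 else 0) * (if q then 1 else 0)" for p q by simp
 have ind: "(indicator {y. Q y} f :: real) = (if Q f then 1 else 0)" for Q by (simp add: indicator_def)
 have eq: "indicator {y. \<forall>l\<in>{1..Suc (3 * Suc n)}. y (?m n (l - 1)) \<le> 0} f = (if f a \<le> 0 then 1 else 0) * (?P ?f1 T1 n * (?P ?f2 T2 n * ?P ?f3 T3 n))" for n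
  unfolding P1[of ?f1 T1 n] P1[of ?f2 T2 n] P1[of ?f3 T3 n] ind all if_conj ..
 have iff: "(\<forall>t\<in>{a..a + T1 + T2 + T3}. f t \<le> 0) \<longleftrightarrow> f a \<le> 0 \<and> (\<forall>t\<in>{0..T1}. ?f1 t \<le> 0) \<and> (\<forall>t\<in>{0..T2}. ?f2 t \<le> 0) \<and> (\<forall>t\<in>{0..T3}. ?f3 t \<le> 0)"
  (is "?L2 \<longleftrightarrow> ?R2")
 proof
  assume L: ?L2
  show ?R2 by (intro conjI ballI; rule bspec[OF L]) (use T in auto)
 next
  assume R: ?R2
  show ?L2
  proof
   fix t assume t: "t \<in> {a..a + T1 + T2 + T3}"
   consider "t \<le> a + T1" | "a + T1 \<le> t" "t \<le> a + T1 + T2" | "a + T1 + T2 \<le> t" by linarith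
   then show "f t \<le> 0"
   proof cases
    case 1
    then have "t - a \<in> {0..T1}" using t by simp
    from bspec[OF conjunct1[OF conjunct2[OF R]] this] show ?thesis by simp
   next
    case 2
    then have "t - (a + T1) \<in> {0..T2}" using t by simp
    from bspec[OF conjunct1[OF conjunct2[OF conjunct2[OF R]]] this] show ?thesis by simp
   next
    case 3
    then have "t - (a + T1 + T2) \<in> {0..T3}" using t by simp
    from bspec[OF conjunct2[OF conjunct2[OF conjunct2[OF R]]] this] show ?thesis by simp
   qed
  qed
 qed
 have lim: "(\<lambda>n. (if f a \<le> 0 then 1 else 0) * (?P ?f1 T1 n * (?P ?f2 T2 n * ?P ?f3 T3 n))) \<longlonglongrightarrow>
  (if f a \<le> 0 then 1 else 0) * ((if \<forall>t\<in>{0..T1}. ?f1 t \<le> 0 then 1 else 0) * ((if \<forall>t\<in>{0..T2}. ?f2 t \<le> 0 then 1 else 0) * (if \<forall>t\<in>{0..T3}. ?f3 t \<le> 0 then 1 else 0)))"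
  by (intro tendsto_mult tendsto_const mesh_indicator_tendsto T c)
 show ?thesis unfolding eq using lim unfolding iff if_conj .
qed

section \<open>Refining the time mesh and exhausting the time interval\<close>

lemma measure_indicator_tendsto:
 assumes "prob_space M" and E: "\<And>n. E n \<in> sets M" and F: "F \<subseteq> space M"
  and lim: "\<And>\<omega>. \<omega> \<in> space M ==> (\<lambda>n. indicator (E n) \<omega> :: real) \<longlonglongrightarrow> indicator F \<omega>"
 shows "F \<in> sets M" and "(\<lambda>n. measure M (E n)) \<longlonglongrightarrow> measure M F"
proof -
 interpret prob_space M by fact
 note [measurable] = E
 have m: "(indicator F :: _ => real) \<in> borel_measurable M"
  by (rule borel_measurable_LIMSEQ_real[OF lim]) measurable
 then have "indicator F -` {1::real} \<inter> space M \<in> sets M" by (rule measurable_sets) simp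
 moreover have "indicator F -` {1::real} \<inter> space M = F" using F by (auto simp: indicator_def split: if_splits)
 ultimately show FM[measurable]: "F \<in> sets M" by simp
 have "(\<lambda>n. \<integral>\<omega>. indicator (E n) \<omega> \<partial>M) \<longlonglongrightarrow> (\<integral>\<omega>. indicator F \<omega> \<partial>M :: real)"
 proof (rule integral_dominated_convergence[where w = "\<lambda>_. 1"])
  show "AE \<omega> in M. (\<lambda>n. indicator (E n) \<omega> :: real) \<longlonglongrightarrow> indicator F \<omega>" by (intro AE_I2 lim)
  show "AE \<omega> in M. norm (indicator (E n) \<omega> :: real) \<le> 1" for n by (intro AE_I2) (simp split: split_indicator)
 qed (use FM E in auto)
 then show "(\<lambda>n. measure M (E n)) \<longlonglongrightarrow> measure M F"
  using E FM sets.sets_into_space by (simp add: Int_absorb2)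
qed

lemma detS_tendsto:
 fixes A :: "nat => 'i => 'i => real"
 assumes "\<And>i j. i \<in> I ==> j \<in> I ==> (\<lambda>n. A n i j) \<longlonglongrightarrow> L i j"
 shows "(\<lambda>n. detS I (A n)) \<longlonglongrightarrow> detS I L"
 unfolding detS_def
 by (intro tendsto_intros assms) (auto simp: permutes_in_image)

definition tinv :: "real => real" where
 "tinv \<tau> = 4 * \<tau> / (1 + 4 * \<tau>)"

lemma tau_tinv: "0 \<le> \<tau> ==> tau (tinv \<tau>) = \<tau>"
proof -
 assume "0 \<le> \<tau>"
 then have "1 - tinv \<tau> = 1 / (1 + 4 * \<tau>)" by (simp add: tinv_def field_simps)
 then show ?thesis using \<open>0 \<le> \<tau>\<close> by (simp add: tau_def tinv_def)
qed

lemma tinv_less_one: "0 \<le> \<tau> ==> tinv \<tau> < 1"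
 and tinv_nonneg: "0 \<le> \<tau> ==> 0 \<le> tinv \<tau>"
 and tinv_pos: "0 < \<tau> ==> 0 < tinv \<tau>"
 by (auto simp: tinv_def field_simps)

lemma tinv_less: "0 \<le> \<tau> ==> \<tau> < \<tau>' ==> tinv \<tau> < tinv \<tau>'"
 by (simp add: tinv_def field_simps)

lemma tinv_tau: "t < 1 ==> tinv (tau t) = t"
proof -
 assume t: "t < 1"
 have "1 + 4 * tau t = 1 / (1 - t)" using t by (simp add: tau_def field_simps)
 then have "tinv (tau t) = 4 * tau t * (1 - t)" by (simp add: tinv_def)
 also have "\<dots> = t"
 proof -
  have "4 * (1 / 4 * (t / c)) * c = t" if "c \<noteq> 0" for c :: real using that by simp
  from this[of "1 - t"] show ?thesis using t by (simp only: tau_def)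
 qed
 finally show ?thesis .
qed

lemma continuous_on_tinv: "(\<And>x. x \<in> S ==> 0 \<le> x) ==> continuous_on S tinv"
 unfolding tinv_def[abs_def] by (intro continuous_intros) force

lemma continuous_on_htilde:
 assumes "continuous_on {0..1} h" "\<And>x. x \<in> S ==> 0 \<le> x"
 shows "continuous_on S (htilde h r)"
 unfolding htilde_def[abs_def] tinv_def[symmetric]
 by (intro continuous_intros continuous_on_compose2[OF assms(1) continuous_on_tinv])
  (use assms(2) tinv_nonneg less_imp_le[OF tinv_less_one] in auto)

lemma Ff_shift_integrable:
 assumes "0 < \<tau>"
 shows "integrable lborel (\<lambda>u. \<bar>Ff s \<tau> n (u - \<epsilon>)\<bar> * cosh (\<kappa> * u))"
proof -
 have "integrable lborel (\<lambda>u. \<bar>Ff s \<tau> n u\<bar> * cosh (\<kappa> * (\<epsilon> + u)))"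
 proof (rule integrable_bound)
  show "integrable lborel (\<lambda>u. exp \<bar>\<kappa> * \<epsilon>\<bar> * (\<bar>Ff s \<tau> n u\<bar> * cosh (\<kappa> * u)))"
   by (intro integrable_mult_right Ff_integrable_cosh assms)
  show "AE u in lborel. norm (\<bar>Ff s \<tau> n u\<bar> * cosh (\<kappa> * (\<epsilon> + u))) \<le> norm (exp \<bar>\<kappa> * \<epsilon>\<bar> * (\<bar>Ff s \<tau> n u\<bar> * cosh (\<kappa> * u)))"
  proof (rule AE_I2)
   fix u
   have "\<bar>Ff s \<tau> n u\<bar> * cosh (\<kappa> * (\<epsilon> + u)) \<le> \<bar>Ff s \<tau> n u\<bar> * (exp \<bar>\<kappa> * \<epsilon>\<bar> * cosh (\<kappa> * u))"
    using cosh_shift_le[of "\<kappa> * \<epsilon>" "\<kappa> * u"] by (intro mult_left_mono) (auto simp: distrib_left)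
   then show "norm (\<bar>Ff s \<tau> n u\<bar> * cosh (\<kappa> * (\<epsilon> + u))) \<le> norm (exp \<bar>\<kappa> * \<epsilon>\<bar> * (\<bar>Ff s \<tau> n u\<bar> * cosh (\<kappa> * u)))"
    by (simp add: abs_mult mult_ac)
  qed
  have "(\<lambda>u. cosh (\<kappa> * (\<epsilon> + u))) \<in> borel_measurable borel"
   by (intro borel_measurable_continuous_onI continuous_intros)
  then show "(\<lambda>u. \<bar>Ff s \<tau> n u\<bar> * cosh (\<kappa> * (\<epsilon> + u))) \<in> borel_measurable lborel" by measurable
 qed
 from lborel_integrable_real_affine[OF this, of 1 "- \<epsilon>"] show ?thesis by simp
qed

lemma bnd_Gf_shift: obtains C where "bnd (\<bar>s\<bar> + 1) C (\<lambda>v. Gf s \<tau> m (v - \<epsilon>))"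
proof -
 obtain C where "bnd (\<bar>s\<bar> + 1) C (Gf s \<tau> m)" by (rule bnd_Gf)
 from bnd_shift[OF this, of "- \<epsilon>"] show ?thesis using that by simp
qed

text \<open>Both sides of \<open>nib_prob\<close> are passed to the limit along
  \<open>mesh3\<close>: events converge by path continuity, matrix entries by dominated convergence.
  The lift \<open>\<epsilon>\<close> of the paths is moved onto the weights by translation.\<close>

lemma bridge_path_prob:
 fixes r \<epsilon> a T1 T2 T3 :: real and h b :: "real => real"
 assumes B: "nonint_bridges M N B" and N: "1 \<le> N" and bm: "brownian_motion M' 2 W"
  and T: "0 < a" "0 < T1" "0 < T2" "0 < T3" and h: "continuous_on {0..1} h"
  and b: "continuous_on {0..T2} b" "\<And>x. x \<in> {0..T2} ==> b x = htilde h r (a + T1 + x)" "b T2 = 0"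
  and \<beta>: "\<And>x. a \<le> x ==> x \<le> a + T1 ==> htilde h r x = 0"
   "\<And>x. a + T1 + T2 \<le> x ==> x \<le> a + T1 + T2 + T3 ==> htilde h r x = 0"
 defines "s \<equiv> sqrt 2 * r"
 defines "F \<equiv> {\<omega> \<in> space M. \<forall>\<tau>\<in>{a..a + T1 + T2 + T3}. Uc r (tinv \<tau>) (B N (tinv \<tau>) \<omega>) + \<epsilon> \<le> htilde h r \<tau>}"
 shows "F \<in> sets M"
  and "measure M F = detS {1..N} (\<lambda>i j. LBINT u. Ff s a (i - 1) (u - \<epsilon>) * (indicator {..0} u *
   refl_op 0 2 T1 (killed_op M' W b T2 (\<lambda>x. indicator {..0} x * refl_op 0 2 T3 (\<lambda>v. Gf s (a + T1 + T2 + T3) (j - 1) (v - \<epsilon>)) x)) u))"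
proof -
 define m where "m n l = mesh3 n a T1 T2 T3 (l - 1)" for n l
 define t where "t n l = tinv (m n l)" for n l
 define k where "k n = Suc (3 * Suc n)" for n
 define A where "A n l = {x. Uc r (t n l) x + \<epsilon> \<le> htilde h r (m n l)}" for n l
 define A' where "A' n l = {..htilde h r (m n l)}" for n l
 define b' where "b' = a + T1 + T2 + T3"
 define E where "E n = {\<omega> \<in> space M. \<forall>l\<in>{1..k n}. B N (t n l) \<omega> \<in> A n l}" for n
 define G where "G j v = Gf s b' (j - 1) (v - \<epsilon>)" for j v
 have ps: "prob_space M" and Bm: "\<And>t. t \<in> {0..1} ==> B N t \<in> borel_measurable M"
  and Bc: "\<And>\<omega>. \<omega> \<in> space M ==> continuous_on {0..1} (\<lambda>t. B N t \<omega>)"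
  using B N unfolding nonint_bridges_def by auto
 have mr: "m n l \<in> {a..b'}" if "l \<le> k n" for n l
  unfolding m_def b'_def by (rule mesh3_range) (use T that in \<open>auto simp: k_def\<close>)
 have m0: "0 \<le> m n l" if "l \<le> k n" for n l using mr[OF that] T by simp
 have t01: "t n l \<in> {0..1}" if "l \<le> k n" for n l
  using tinv_nonneg[OF m0[OF that]] tinv_less_one[OF m0[OF that]] by (simp add: t_def)
 have t1: "t n l < 1" if "l \<le> k n" for n l using tinv_less_one[OF m0[OF that]] by (simp add: t_def)
 have tt: "tau (t n l) = m n l" if "l \<le> k n" for n l using tau_tinv[OF m0[OF that]] by (simp add: t_def)
 have m1: "m n 1 = a" for n using mesh3_first[of 0] by (simp add: m_def)
 have mk: "m n (k n) = b'" for n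
 proof -
  have "k n - 1 = Suc n + Suc n + Suc n" by (simp add: k_def)
  then show ?thesis unfolding m_def b'_def by (simp only: mesh3_third) (simp del: of_nat_Suc)
 qed
 have minc: "incr (m n) 1 (3 * Suc n)" for n
  unfolding m_def[abs_def] by (rule chain_three_pieces(3)[OF bm _ T(2-4) b \<beta>, where g = "\<lambda>_. 0" and C = 0]) (auto simp: bnd_def)
 have tinc: "incr (t n) 1 (3 * Suc n)" for n
  unfolding incr_def t_def
 proof (intro allI impI)
  fix j assume j: "1 \<le> j \<and> j < 1 + 3 * Suc n"
  then have "m n j < m n (Suc j)" using minc[of n] by (simp add: incr_def)
  then show "tinv (m n j) < tinv (m n (Suc j))" using j by (intro tinv_less m0) (auto simp: k_def)
 qed
 have Acl: "y \<in> A n l" if "y \<le> z" "z \<in> A n l" "l \<le> k n" for n l y z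
 proof -
  have "(y - r) / (sqrt 2 * (1 - t n l)) \<le> (z - r) / (sqrt 2 * (1 - t n l))"
   using that t1[OF that(3)] by (intro divide_right_mono) auto
  then show ?thesis using that by (simp add: A_def Uc_def)
 qed
 \<comment> \<open>Levels beyond \<open>k n\<close> carry no condition; with \<open>UNIV\<close>
   there, measurability and downward closedness hold for every index.\<close>
 define A2 where "A2 n l = (if l \<le> k n then A n l else UNIV)" for n l
 have Ab: "bsets (A2 n)" for n
 proof -
  have "A n l \<in> sets borel" for l unfolding A_def Uc_def by measurable
  then show ?thesis by (simp add: bsets_def A2_def)
 qed
 have E2: "E n = {\<omega> \<in> space M. \<forall>l\<in>{1..k n}. B N (t n l) \<omega> \<in> A2 n l}" for n by (auto simp: E_def A2_def)
 have ch: "hchain 2 (\<lambda>j. tau (t n j)) (A' n) 1 (k n - 1) g = hchain 2 (m n) (A' n) 1 (3 * Suc n) g" for n g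
 proof -
  have e: "k n - 1 = 3 * Suc n" by (simp add: k_def)
  show ?thesis unfolding e by (rule hchain_cong) (auto simp: tt k_def)
 qed
 have prob: "measure M (E n) = detS {1..N} (\<lambda>i j. LBINT u. Ff s a (i - 1) (u - \<epsilon>) *
   (indicator {..0} u * hchain 2 (m n) (A' n) 1 (3 * Suc n) (G j) u))" for n
 proof -
  have "tau (t n 1) = a" "tau (t n (k n)) = b'" "A' n 1 = {..0}"
   using tt[of 1 n] tt[of "k n" n] m1 mk \<beta>(1)[of a] T by (auto simp: k_def A'_def)
  moreover have "measure M (E n) = detS {1..N} (\<lambda>i j. LBINT u. Ff s (tau (t n 1)) (i - 1) (u - \<epsilon>) *
   (indicator (A' n 1) u * hchain 2 (\<lambda>j. tau (t n j)) (A' n) 1 (k n - 1) (\<lambda>v. Gf s (tau (t n (k n))) (j - 1) (v - \<epsilon>)) u))"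
   unfolding E2 s_def
  proof (rule nib_prob[OF B N _ _ _ _ Ab])
   show "1 \<le> k n" by (simp add: k_def)
   show "0 < t n 1" using tinv_pos[OF T(1)] m1 by (simp add: t_def)
   show "t n (k n) < 1" by (rule t1) simp
   show "incr (t n) 1 (k n - 1)" using tinc[of n] by (simp add: k_def)
   show "y \<in> A2 n l" if "y \<le> z" "z \<in> A2 n l" for l y z using Acl that by (auto simp: A2_def split: if_splits)
   show "x \<in> A2 n l \<longleftrightarrow> Uc r (t n l) x + \<epsilon> \<in> A' n l" if "1 \<le> l" "l \<le> k n" for l x
    using that by (simp add: A2_def A_def A'_def)
  qed
  ultimately show ?thesis unfolding ch G_def by simp
 qed
 have EM: "E n \<in> sets M" for n
 proof -
  have "{\<omega> \<in> space M. B N (t n l) \<omega> \<in> A2 n l} \<in> sets M" if "l \<in> {1..k n}" for l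
   using measurable_sets[OF Bm[OF t01] bsetsD[OF Ab, of n l], of l n] that by (simp add: vimage_def Int_def conj_commute)
  then show ?thesis unfolding E2 by (intro sets.sets_Collect_finite_All) auto
 qed
 have lim: "(\<lambda>n. indicator (E n) \<omega> :: real) \<longlonglongrightarrow> indicator F \<omega>" if \<omega>: "\<omega> \<in> space M" for \<omega>
 proof -
  define f where "f \<tau> = Uc r (tinv \<tau>) (B N (tinv \<tau>) \<omega>) + \<epsilon> - htilde h r \<tau>" for \<tau>
  have S: "0 \<le> x" "tinv x \<in> {0..1}" "tinv x < 1" if "x \<in> {a..b'}" for x
   using that T tinv_nonneg[of x] tinv_less_one[of x] by auto
  have "continuous_on {a..b'} (\<lambda>\<tau>. B N (tinv \<tau>) \<omega>)"
   by (rule continuous_on_compose2[OF Bc[OF \<omega>] continuous_on_tinv]) (use S in auto)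
  then have "continuous_on {a..b'} f"
   unfolding f_def[abs_def] Uc_def by (intro continuous_intros continuous_on_htilde[OF h] continuous_on_tinv) (use S in force)+
  from mesh3_indicator_tendsto[OF T(2-4) this[unfolded b'_def]]
  have "(\<lambda>n. indicator {y. \<forall>l\<in>{1..k n}. y (m n l) \<le> 0} f :: real) \<longlonglongrightarrow> (if \<forall>t\<in>{a..b'}. f t \<le> 0 then 1 else 0)"
   unfolding m_def k_def b'_def .
  moreover have "indicator {y. \<forall>l\<in>{1..k n}. y (m n l) \<le> 0} f = (indicator (E n) \<omega> :: real)" for n
   using \<omega> by (auto simp: E_def A_def f_def t_def indicator_def)
  moreover have "(if \<forall>t\<in>{a..b'}. f t \<le> 0 then 1 else 0) = (indicator F \<omega> :: real)"
   using \<omega> by (auto simp: F_def f_def b'_def indicator_def)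
  ultimately show ?thesis by simp
 qed
 have FS: "F \<subseteq> space M" by (auto simp: F_def)
 show "F \<in> sets M" by (rule measure_indicator_tendsto(1)[OF ps EM FS lim])
 have "(\<lambda>n. measure M (E n)) \<longlonglongrightarrow> measure M F" by (rule measure_indicator_tendsto(2)[OF ps EM FS lim])
 moreover have "(\<lambda>n. measure M (E n)) \<longlonglongrightarrow> detS {1..N} (\<lambda>i j. LBINT u. Ff s a (i - 1) (u - \<epsilon>) * (indicator {..0} u *
   refl_op 0 2 T1 (killed_op M' W b T2 (\<lambda>x. indicator {..0} x * refl_op 0 2 T3 (G j) x)) u))"
  unfolding prob
 proof (rule detS_tendsto)
  fix i j
  let ?H = "\<lambda>n. hchain 2 (m n) (A' n) 1 (3 * Suc n) (G j)"
  let ?L = "refl_op 0 2 T1 (killed_op M' W b T2 (\<lambda>x. indicator {..0} x * refl_op 0 2 T3 (G j) x))"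
  obtain C where C: "bnd (\<bar>s\<bar> + 1) C (G j)" unfolding G_def[abs_def] by (rule bnd_Gf_shift)
  define C' where "C' = C * exp (2 * (T1 + T2 + T3) * (\<bar>s\<bar> + 1)\<^sup>2 / 2)"
  have two: "(0::real) < 2" by simp
  note tp = chain_three_pieces[OF bm two T(2-4) b \<beta> C, folded m_def, folded A'_def, folded C'_def]
  have [measurable]: "?H n \<in> borel_measurable borel" for n by (rule bnd_measurable[OF tp(2)])
  have pl: "(\<lambda>n. indicator {..0} u * ?H n u) \<longlonglongrightarrow> indicator {..0} u * ?L u" for u
   using tp(1)[of u] by (cases "u \<le> 0") (auto intro!: tendsto_intros)
  have "(\<lambda>u. indicator {..0} u * ?L u) \<in> borel_measurable borel"
   by (rule borel_measurable_LIMSEQ_real[OF pl]) measurable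
  then have [measurable]: "(\<lambda>u. indicator {..0} u * ?L u) \<in> borel_measurable lborel" by simp
  show "(\<lambda>n. LBINT u. Ff s a (i - 1) (u - \<epsilon>) * (indicator {..0} u * ?H n u))
   \<longlonglongrightarrow> (LBINT u. Ff s a (i - 1) (u - \<epsilon>) * (indicator {..0} u * ?L u))"
  proof (rule integral_dominated_convergence)
   show "integrable lborel (\<lambda>u. C' * (\<bar>Ff s a (i - 1) (u - \<epsilon>)\<bar> * cosh ((\<bar>s\<bar> + 1) * u)))"
    by (intro integrable_mult_right Ff_shift_integrable T)
   show "AE u in lborel. (\<lambda>n. Ff s a (i - 1) (u - \<epsilon>) * (indicator {..0} u * ?H n u)) \<longlonglongrightarrow> Ff s a (i - 1) (u - \<epsilon>) * (indicator {..0} u * ?L u)"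
    by (intro AE_I2 tendsto_mult tendsto_const pl)
   fix n
   show "AE u in lborel. norm (Ff s a (i - 1) (u - \<epsilon>) * (indicator {..0} u * ?H n u)) \<le> C' * (\<bar>Ff s a (i - 1) (u - \<epsilon>)\<bar> * cosh ((\<bar>s\<bar> + 1) * u))"
   proof (rule AE_I2)
    fix u
    have "{..0::real} \<in> sets borel" by simp
    from bndD[OF bnd_indicator_mult[OF tp(2)[of n] this], of u]
    have "\<bar>indicator {..0} u * ?H n u\<bar> \<le> C' * cosh ((\<bar>s\<bar> + 1) * u)"
     by simp
    then have "\<bar>Ff s a (i - 1) (u - \<epsilon>)\<bar> * \<bar>indicator {..0} u * ?H n u\<bar> \<le> \<bar>Ff s a (i - 1) (u - \<epsilon>)\<bar> * (C' * cosh ((\<bar>s\<bar> + 1) * u))"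
     by (rule mult_left_mono) simp
    then show "norm (Ff s a (i - 1) (u - \<epsilon>) * (indicator {..0} u * ?H n u)) \<le> C' * (\<bar>Ff s a (i - 1) (u - \<epsilon>)\<bar> * cosh ((\<bar>s\<bar> + 1) * u))"
     by (simp only: real_norm_def abs_mult mult.left_commute)
   qed
  qed measurable
 qed
 ultimately show "measure M F = detS {1..N} (\<lambda>i j. LBINT u. Ff s a (i - 1) (u - \<epsilon>) * (indicator {..0} u *
   refl_op 0 2 T1 (killed_op M' W b T2 (\<lambda>x. indicator {..0} x * refl_op 0 2 T3 (\<lambda>v. Gf s (a + T1 + T2 + T3) (j - 1) (v - \<epsilon>)) x)) u))"
  unfolding G_def[abs_def] b'_def by (rule LIMSEQ_unique)
qed

section \<open>Odd extensions, and the limits of early entrance and late exit\<close>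

definition oddx :: "(real => real) => real => real" where
 "oddx h v = indicator {..0} v * h v - indicator {..0} (- v) * h (- v)"

lemma bnd_oddx: "bnd \<kappa> C h ==> bnd \<kappa> (C + C) (oddx h)"
 unfolding oddx_def[abs_def]
 by (rule bnd_diff[OF bnd_indicator_mult bnd_reflect[OF bnd_indicator_mult]]) auto

text \<open>The image term is the free flow of the mirrored function. \<open>oddx f\<close> reads
  \<open>f\<close> on the closed half-line only and vanishes at 0.\<close>

lemma refl_op_oddx:
 assumes "0 < D * T" "bnd \<kappa> C f"
 shows "refl_op 0 D T f = heat_op D T (oddx f)"
proof
 fix u
 have i: "bnd \<kappa> C (\<lambda>v. indicator {..0} v * f v)" by (rule bnd_indicator_mult[OF assms(2)]) simp
 show "refl_op 0 D T f u = heat_op D T (oddx f) u"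
  unfolding refl_op_def oddx_def[abs_def] heat_op_diff[OF assms(1) i bnd_reflect[OF i]]
  using heat_op_reflect[of D T "\<lambda>v. indicator {..0} v * f v" u] by simp
qed

lemma heat_op_abs_le_const:
 assumes "0 < D * t" and [measurable]: "g \<in> borel_measurable borel" and le: "\<And>x. \<bar>g x\<bar> \<le> C"
 shows "\<bar>heat_op D t g x\<bar> \<le> C"
proof -
 have i: "integrable lborel (\<lambda>y. heat D t x y * C)" using integrable_heat[OF assms(1)] by simp
 have i2: "integrable lborel (\<lambda>y. heat D t x y * g y)"
  by (rule integrable_bound[OF i]) (auto intro!: AE_I2 mult_left_mono order_trans[OF le] simp: abs_mult)
 have "\<bar>heat_op D t g x\<bar> \<le> (LBINT y. \<bar>heat D t x y * g y\<bar>)" unfolding heat_op_def by (rule integral_abs_bound)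
 also have "\<dots> \<le> (LBINT y. heat D t x y * C)"
  by (rule integral_mono[OF integrable_abs[OF i2] i]) (auto simp: abs_mult intro!: mult_left_mono le)
 also have "\<dots> = C" using integral_heat[OF assms(1), of x] by simp
 finally show ?thesis .
qed

text \<open>\<open>oddx G\<close> differs from \<open>G w - G (- w)\<close> only through values of
  \<open>G\<close> on the positive half-line, which are uniformly small at late times, and the free
  flow does not increase a uniform bound. So late exit weights, pulled back to time
  \<open>\<tau>\<close>, approach the odd combination that defines \<open>Psi\<close>.\<close>

lemma refl_op_Gf:
 assumes s: "0 < s"
 obtains C where "0 \<le> C" "\<And>\<tau> T \<epsilon> v. 0 < \<tau> ==> 0 < T ==> 0 \<le> \<epsilon> ==> \<epsilon> \<le> 1 ==>
  \<bar>refl_op 0 2 T (\<lambda>v. Gf s (\<tau> + T) m (v - \<epsilon>)) v - (Gf s \<tau> m (v - \<epsilon>) - Gf s \<tau> m (- v - \<epsilon>))\<bar> \<le> C * ((1 + (\<tau> + T)) ^ m * exp (- ((\<tau> + T) * s\<^sup>2)))"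
proof -
 obtain C where C: "0 \<le> C" "\<And>\<beta> w. 0 < \<beta> ==> - 1 \<le> w ==> \<bar>Gf s \<beta> m w\<bar> \<le> C * ((1 + \<beta>) ^ m * exp (- (\<beta> * s\<^sup>2)))"
  using Gf_small[OF s] by metis
 have "\<bar>refl_op 0 2 T (\<lambda>v. Gf s (\<tau> + T) m (v - \<epsilon>)) v - (Gf s \<tau> m (v - \<epsilon>) - Gf s \<tau> m (- v - \<epsilon>))\<bar> \<le> C * ((1 + (\<tau> + T)) ^ m * exp (- ((\<tau> + T) * s\<^sup>2)))"
  if t: "0 < \<tau>" "0 < T" "0 \<le> \<epsilon>" "\<epsilon> \<le> 1" for \<tau> T \<epsilon> v
 proof -
  define G where "G v = Gf s (\<tau> + T) m (v - \<epsilon>)" for v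
  define \<rho> where "\<rho> w = (G w - G (- w)) - oddx G w" for w
  have T2: "0 < 2 * T" using t by simp
  obtain C' where G: "bnd (\<bar>s\<bar> + 1) C' G" unfolding G_def[abs_def] by (rule bnd_Gf_shift)
  have d: "bnd (\<bar>s\<bar> + 1) (C' + C') (\<lambda>w. G w - G (- w))" by (rule bnd_diff[OF G bnd_reflect[OF G]])
  have [measurable]: "\<rho> \<in> borel_measurable borel"
   unfolding \<rho>_def[abs_def] using bnd_measurable[OF d] bnd_measurable[OF bnd_oddx[OF G]] by measurable
  have Gle: "\<bar>G w\<bar> \<le> C * ((1 + (\<tau> + T)) ^ m * exp (- ((\<tau> + T) * s\<^sup>2)))" if "0 < w" for w
   unfolding G_def by (rule C(2)) (use that t in auto)
  have "0 \<le> C * ((1 + (\<tau> + T)) ^ m * exp (- ((\<tau> + T) * s\<^sup>2)))" using C(1) t by simp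
  then have \<rho>: "\<bar>\<rho> w\<bar> \<le> C * ((1 + (\<tau> + T)) ^ m * exp (- ((\<tau> + T) * s\<^sup>2)))" for w
   using Gle[of w] Gle[of "- w"] by (cases w "0::real" rule: linorder_cases) (auto simp: \<rho>_def oddx_def)
  have hs: "heat_op 2 T G v = Gf s \<tau> m (v - \<epsilon>)" for v
   using heat_op_shift[of 2 T "Gf s (\<tau> + T) m" "- \<epsilon>" v] Gf_heat[OF t(2), of s \<tau> m "v - \<epsilon>"] unfolding G_def[abs_def] by simp
  have "heat_op 2 T \<rho> v = heat_op 2 T (\<lambda>w. G w - G (- w)) v - heat_op 2 T (oddx G) v"
   unfolding \<rho>_def[abs_def] by (rule heat_op_diff[OF T2 d bnd_oddx[OF G]])
  also have "heat_op 2 T (\<lambda>w. G w - G (- w)) v = heat_op 2 T G v - heat_op 2 T G (- v)"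
   using heat_op_diff[OF T2 G bnd_reflect[OF G]] heat_op_reflect[of 2 T G v] by simp
  finally have "refl_op 0 2 T G v - (Gf s \<tau> m (v - \<epsilon>) - Gf s \<tau> m (- v - \<epsilon>)) = - heat_op 2 T \<rho> v"
   unfolding refl_op_oddx[OF T2 G] hs by simp
  then show ?thesis unfolding G_def[abs_def] using heat_op_abs_le_const[OF T2 _ \<rho>, where x = v] by simp
 qed
 then show ?thesis using that C(1) by blast
qed

text \<open>Dominated convergence against the density of the killed operator, which is bounded by
  the heat kernel.\<close>

lemma killed_op_continuous:
 assumes bm: "brownian_motion M D W" and D: "0 < D" and T: "0 < T" and b: "continuous_on {0..T} b"
  and g: "\<And>n. bnd \<kappa> C (g n)" and lim: "\<And>x. (\<lambda>n. g n x) \<longlonglongrightarrow> g' x"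
 shows "(\<lambda>n. killed_op M W b T (g n) u) \<longlonglongrightarrow> killed_op M W b T g' u"
proof -
 obtain q :: "real => real => real" where q: "\<And>u v. 0 \<le> q u v" "\<And>u v. q u v \<le> heat D T u v" "\<And>u. q u \<in> borel_measurable borel"
  "\<And>\<kappa> C g u. bnd \<kappa> C g ==> killed_op M W b T g u = (LBINT v. q u v * (indicator {..b T} v * g v))"
  by (rule killed_op_kernel[OF bm D T b]) blast
 have DT: "0 < D * T" using D T by simp
 have g': "bnd \<kappa> C g'" by (rule bnd_lim[OF g lim])
 note [measurable] = q(3) bnd_measurable[OF g] bnd_measurable[OF g']
 show ?thesis
  unfolding q(4)[OF g] q(4)[OF g']
 proof (rule integral_dominated_convergence)
  show "integrable lborel (\<lambda>v. C * (heat D T u v * cosh (\<kappa> * v)))" using integrable_heat_cosh[OF DT] by simp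
  show "AE v in lborel. (\<lambda>n. q u v * (indicator {..b T} v * g n v)) \<longlonglongrightarrow> q u v * (indicator {..b T} v * g' v)"
   by (intro AE_I2 tendsto_intros lim)
  fix n
  show "AE v in lborel. norm (q u v * (indicator {..b T} v * g n v)) \<le> C * (heat D T u v * cosh (\<kappa> * v))"
  proof (rule AE_I2)
   fix v
   have "\<bar>q u v\<bar> * \<bar>indicator {..b T} v * g n v\<bar> \<le> heat D T u v * (C * cosh (\<kappa> * v))"
    using q(1,2)[of u v] bndD[OF bnd_indicator_mult[OF g[of n], of "{..b T}"], of v] by (intro mult_mono) auto
   then show "norm (q u v * (indicator {..b T} v * g n v)) \<le> C * (heat D T u v * cosh (\<kappa> * v))"
    by (simp only: real_norm_def abs_mult mult.left_commute)
  qed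
 qed measurable
qed

text \<open>The condition \<open>\<epsilon> \<le> s / 4\<close> keeps the argument
  \<open>u - \<epsilon>\<close> in the range of \<open>Ff_small\<close>; doubling the variance makes
  the bound independent of \<open>\<epsilon>\<close>.\<close>

lemma Ff_small_shift:
 assumes s: "0 < s"
 obtains C where "0 \<le> C" "\<And>\<alpha> \<epsilon> u. 0 < \<alpha> ==> \<alpha> \<le> 1 ==> 0 \<le> \<epsilon> ==> \<epsilon> \<le> 1 ==> \<epsilon> \<le> s / 4 ==> 0 \<le> u ==>
  \<bar>Ff s \<alpha> n (u - \<epsilon>)\<bar> \<le> C * ((1 / \<alpha>) ^ Suc n * exp (- (s\<^sup>2 / (64 * \<alpha>)))) * (heat 2 2 (- s / 4) u * cosh u)"
proof -
 obtain C where C: "0 \<le> C" "\<And>\<alpha> y. 0 < \<alpha> ==> \<alpha> \<le> 1 ==> - (s / 4) \<le> y ==>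
  \<bar>Ff s \<alpha> n y\<bar> \<le> C * ((1 / \<alpha>) ^ Suc n * exp (- (s\<^sup>2 / (64 * \<alpha>)))) * (heat 2 1 (- s / 4) y * cosh y)"
  using Ff_small[OF s] by metis
 define K where "K = sqrt 2 * exp (1 / (2 * (2 * (1::real))))"
 have K: "0 \<le> K" by (simp add: K_def)
 have "\<bar>Ff s \<alpha> n (u - \<epsilon>)\<bar> \<le> (C * (K * exp 1)) * ((1 / \<alpha>) ^ Suc n * exp (- (s\<^sup>2 / (64 * \<alpha>)))) * (heat 2 2 (- s / 4) u * cosh u)"
  if a: "0 < \<alpha>" "\<alpha> \<le> 1" "0 \<le> \<epsilon>" "\<epsilon> \<le> 1" "\<epsilon> \<le> s / 4" "0 \<le> u" for \<alpha> \<epsilon> u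
 proof -
  have h: "heat 2 1 (- s / 4) (u - \<epsilon>) \<le> K * heat 2 2 (- s / 4) u"
   using heat_perturb_le[of 2 1 \<epsilon> "- s / 4" u] heat_shift[of 2 1 "- s / 4" \<epsilon> "u - \<epsilon>"] a by (simp add: K_def)
  have "cosh (u - \<epsilon>) \<le> exp \<bar>- \<epsilon>\<bar> * cosh u" using cosh_shift_le[of "- \<epsilon>" u] by simp
  also have "\<dots> \<le> exp 1 * cosh u" using a by (intro mult_right_mono) auto
  finally have "heat 2 1 (- s / 4) (u - \<epsilon>) * cosh (u - \<epsilon>) \<le> (K * heat 2 2 (- s / 4) u) * (exp 1 * cosh u)"
   using h K by (intro mult_mono) auto
  then have "C * ((1 / \<alpha>) ^ Suc n * exp (- (s\<^sup>2 / (64 * \<alpha>)))) * (heat 2 1 (- s / 4) (u - \<epsilon>) * cosh (u - \<epsilon>))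
   \<le> C * ((1 / \<alpha>) ^ Suc n * exp (- (s\<^sup>2 / (64 * \<alpha>)))) * ((K * heat 2 2 (- s / 4) u) * (exp 1 * cosh u))"
   using C(1) a by (intro mult_left_mono) auto
  moreover have "\<bar>Ff s \<alpha> n (u - \<epsilon>)\<bar> \<le> C * ((1 / \<alpha>) ^ Suc n * exp (- (s\<^sup>2 / (64 * \<alpha>)))) * (heat 2 1 (- s / 4) (u - \<epsilon>) * cosh (u - \<epsilon>))"
   by (rule C(2)) (use a in auto)
  ultimately show ?thesis by (simp only: mult_ac)
 qed
 then show ?thesis using that[of "C * (K * exp 1)"] C(1) K by auto
qed

lemma power_exp_tendsto_zero:
 assumes "0 < c"
 shows "((\<lambda>x::real. x ^ k * exp (- (c * x))) \<longlongrightarrow> 0) at_top"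
proof -
 have "filterlim (\<lambda>x. c * x) at_top at_top"
  using assms by (intro filterlim_tendsto_pos_mult_at_top[OF tendsto_const] filterlim_ident)
 from tendsto_mult_left_zero[OF filterlim_compose[OF tendsto_power_div_exp_0[of k] this], of "1 / c ^ k"]
 show ?thesis using assms by (simp add: exp_minus field_simps)
qed

lemma small_at_zero: "0 < s ==> ((\<lambda>\<alpha>::real. (1 / \<alpha>) ^ Suc n * exp (- (s\<^sup>2 / (64 * \<alpha>)))) \<longlongrightarrow> 0) (at_right 0)"
proof -
 assume s: "0 < s"
 define c where "c = s\<^sup>2 / 64"
 have c: "0 < c" using s by (simp add: c_def)
 from filterlim_compose[OF power_exp_tendsto_zero[OF c, of "Suc n"] filterlim_inverse_at_top_right]
 show ?thesis by (simp add: c_def inverse_eq_divide)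
qed

lemma small_at_infinity: "0 < s ==> ((\<lambda>\<beta>::real. (1 + \<beta>) ^ m * exp (- (\<beta> * s\<^sup>2))) \<longlongrightarrow> 0) at_top"
proof -
 assume s: "0 < s"
 define c where "c = s\<^sup>2"
 have c: "0 < c" using s by (simp add: c_def)
 have "filterlim (\<lambda>\<beta>. 1 + \<beta> :: real) at_top at_top" by (intro filterlim_tendsto_add_at_top[OF tendsto_const] filterlim_ident)
 from tendsto_mult_left_zero[OF filterlim_compose[OF power_exp_tendsto_zero[OF c, of m] this], of "exp c"]
 have "((\<lambda>\<beta>. (1 + \<beta>) ^ m * exp (- (c * (1 + \<beta>))) * exp c) \<longlongrightarrow> 0) at_top" .
 then show ?thesis by (simp add: c_def mult.assoc algebra_simps flip: exp_add)
qed

text \<open>As \<open>\<alpha> \<rightarrow> 0\<close> the entrance weight carries no mass on the positive half-line, so the half-line integral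
 may be replaced by the one over the line, where the reflected kernel acts on odd extensions and can be moved
 onto \<open>Ff\<close>.\<close>

lemma entrance_limit:
 fixes s \<tau> :: real and \<alpha> T \<epsilon> :: "nat => real"
 assumes s: "0 < s" and a: "filterlim \<alpha> (at_right 0) sequentially" and T: "\<And>n. 0 < T n" "\<And>n. \<alpha> n + T n = \<tau>" "\<And>n. 0 < \<alpha> n" "\<And>n. \<alpha> n \<le> 1"
  and e: "\<epsilon> \<longlonglongrightarrow> 0" "\<And>n. 0 \<le> \<epsilon> n" "\<And>n. \<epsilon> n \<le> 1" "\<And>n. \<epsilon> n \<le> s / 4"
  and h: "\<And>n. bnd \<kappa> C (h n)" "\<And>x. (\<lambda>n. h n x) \<longlonglongrightarrow> h' x" and \<kappa>: "0 \<le> \<kappa>"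
 shows "(\<lambda>n. LBINT u. Ff s (\<alpha> n) i (u - \<epsilon> n) * (indicator {..0} u * refl_op 0 2 (T n) (h n) u))
  \<longlonglongrightarrow> (LBINT v. Ff s \<tau> i v * oddx h' v)"
proof -
 let ?J = "indicator {0<..} :: real => real"
 define F where "F n u = Ff s (\<alpha> n) i (u - \<epsilon> n)" for n u
 define H where "H n = heat_op 2 (T n) (oddx (h n))" for n
 have \<tau>: "0 < \<tau>" using T(1-3)[of 0] by simp
 have T2: "0 < 2 * T n" for n using T(1)[of n] by simp
 have C0: "0 \<le> C" using bnd_const_nonneg[OF h(1)[of 0]] .
 have o: "bnd \<kappa> (C + C) (oddx (h n))" for n by (rule bnd_oddx[OF h(1)])
 have RH: "refl_op 0 2 (T n) (h n) = H n" for n unfolding H_def by (rule refl_op_oddx[OF T2 h(1)])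
 have [measurable]: "F n \<in> borel_measurable borel" for n
  unfolding F_def[abs_def] by (intro measurable_compose[OF _ measurable_Ff]) simp
 have [measurable]: "oddx (h n) \<in> borel_measurable borel" for n by (rule bnd_measurable[OF o])
 have Fint: "integrable lborel (\<lambda>u. \<bar>F n u\<bar> * cosh (\<kappa> * u))" for n
  unfolding F_def by (rule Ff_shift_integrable[OF T(3)])
 define C' where "C' = (C + C) * exp (2 * \<tau> * \<kappa>\<^sup>2 / 2)"
 have Hb: "bnd \<kappa> C' (H n)" for n
 proof (rule bnd_mono)
  show "bnd \<kappa> ((C + C) * exp (2 * T n * \<kappa>\<^sup>2 / 2)) (H n)" unfolding H_def by (rule bnd_heat_op[OF T2 o])
  have "T n \<le> \<tau>" using T(2,3)[of n] by simp
  then show "(C + C) * exp (2 * T n * \<kappa>\<^sup>2 / 2) \<le> C'"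
   unfolding C'_def using C0 by (intro mult_left_mono) (auto intro!: mult_right_mono)
 qed
 have [measurable]: "H n \<in> borel_measurable borel" for n by (rule bnd_measurable[OF Hb])
 have dual: "(LBINT u. F n u * H n u) = (LBINT v. heat_op 2 (T n) (F n) v * oddx (h n) v)" "integrable lborel (\<lambda>u. F n u * H n u)" for n
  unfolding H_def by (rule heat_op_dual[OF T2 o _ Fint]; measurable)+
 have FT: "heat_op 2 (T n) (F n) v = Ff s \<tau> i (v - \<epsilon> n)" for n v
  using heat_op_shift[of 2 "T n" "Ff s (\<alpha> n) i" "- \<epsilon> n" v] Ff_heat[where s = s and n = i and v = "v - \<epsilon> n", OF T(3)[of n] T(1)[of n]] T(2)[of n]
  unfolding F_def[abs_def] by simp
 have split: "(LBINT u. F n u * (indicator {..0} u * H n u)) = (LBINT v. Ff s \<tau> i (v - \<epsilon> n) * oddx (h n) v) - (LBINT u. F n u * (?J u * H n u))" for n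
 proof -
  have i: "integrable lborel (\<lambda>u. F n u * H n u)" by (rule dual(2))
  have i': "integrable lborel (\<lambda>u. F n u * (indicator S u * H n u))" if "S \<in> sets borel" for S
   using integrable_real_mult_indicator[OF _ i, of S] that by (simp add: mult_ac)
  have "(LBINT u. F n u * H n u) = (LBINT u. F n u * (indicator {..0} u * H n u) + F n u * (?J u * H n u))"
   by (intro integral_cong refl) (auto simp: indicator_def)
  also have "\<dots> = (LBINT u. F n u * (indicator {..0} u * H n u)) + (LBINT u. F n u * (?J u * H n u))"
   by (intro integral_add i') auto
  also have "(LBINT u. F n u * H n u) = (LBINT v. Ff s \<tau> i (v - \<epsilon> n) * oddx (h n) v)"
   using dual(1)[of n] by (simp add: FT)
  finally show ?thesis by simp
 qed
 have main: "(\<lambda>n. LBINT v. Ff s \<tau> i (v - \<epsilon> n) * oddx (h n) v) \<longlonglongrightarrow> (LBINT v. Ff s \<tau> i v * oddx h' v)"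
 proof -
  obtain C1 where C1: "0 \<le> C1" "\<And>\<epsilon> v. \<bar>\<epsilon>\<bar> \<le> 1 ==> \<bar>Ff s \<tau> i (v - \<epsilon>)\<bar> \<le> C1 * (heat 2 (2 * \<tau>) (- s / 2) v * cosh v)"
   using Ff_shift_le[OF \<tau>] by metis
  have lim: "(\<lambda>n. Ff s \<tau> i (v - \<epsilon> n) * oddx (h n) v) \<longlonglongrightarrow> Ff s \<tau> i v * oddx h' v" for v
  proof (rule tendsto_mult)
   have "isCont (Ff s \<tau> i) v"
    unfolding Ff_def[abs_def] heat_eq[OF mult_pos_pos[OF zero_less_numeral \<tau>]] using \<tau>
    by (intro continuous_on_interior[of UNIV] continuous_intros) auto
   moreover have "(\<lambda>n. v - \<epsilon> n) \<longlonglongrightarrow> v" using tendsto_diff[OF tendsto_const e(1), of v] by simp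
   ultimately show "(\<lambda>n. Ff s \<tau> i (v - \<epsilon> n)) \<longlonglongrightarrow> Ff s \<tau> i v" by (rule isCont_tendsto_compose)
   show "(\<lambda>n. oddx (h n) v) \<longlonglongrightarrow> oddx h' v" unfolding oddx_def by (intro tendsto_intros h(2))
  qed
  show ?thesis
  proof (rule integral_dominated_convergence[where w = "\<lambda>v. (C1 * (C + C)) * (heat 2 (2 * \<tau>) (- s / 2) v * cosh ((1 + \<kappa>) * v))"])
   show "integrable lborel (\<lambda>v. (C1 * (C + C)) * (heat 2 (2 * \<tau>) (- s / 2) v * cosh ((1 + \<kappa>) * v)))"
    using \<tau> by (intro integrable_mult_right integrable_heat_cosh) simp
   show "AE v in lborel. (\<lambda>n. Ff s \<tau> i (v - \<epsilon> n) * oddx (h n) v) \<longlonglongrightarrow> Ff s \<tau> i v * oddx h' v" by (intro AE_I2 lim)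
   have "(\<lambda>v. Ff s \<tau> i v * oddx h' v) \<in> borel_measurable borel"
    by (rule borel_measurable_LIMSEQ_real[OF lim]) (intro borel_measurable_times measurable_compose[OF _ measurable_Ff]; measurable)
   then show "(\<lambda>v. Ff s \<tau> i v * oddx h' v) \<in> borel_measurable lborel" by simp
   fix n
   show "(\<lambda>v. Ff s \<tau> i (v - \<epsilon> n) * oddx (h n) v) \<in> borel_measurable lborel"
    by (intro borel_measurable_times measurable_compose[OF _ measurable_Ff]) auto
   show "AE v in lborel. norm (Ff s \<tau> i (v - \<epsilon> n) * oddx (h n) v) \<le> (C1 * (C + C)) * (heat 2 (2 * \<tau>) (- s / 2) v * cosh ((1 + \<kappa>) * v))"
   proof (rule AE_I2)
    fix v
    have "\<bar>Ff s \<tau> i (v - \<epsilon> n)\<bar> * \<bar>oddx (h n) v\<bar> \<le> (C1 * (heat 2 (2 * \<tau>) (- s / 2) v * cosh v)) * ((C + C) * cosh (\<kappa> * v))"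
     using C1 e(2,3)[of n] bndD[OF o[of n], of v] by (intro mult_mono) auto
    also have "\<dots> = (C1 * (C + C) * heat 2 (2 * \<tau>) (- s / 2) v) * (cosh v * cosh (\<kappa> * v))" by simp
    also have "\<dots> \<le> (C1 * (C + C) * heat 2 (2 * \<tau>) (- s / 2) v) * cosh ((1 + \<kappa>) * v)"
     by (rule mult_left_mono[OF cosh_mult_succ_le[OF \<kappa>]]) (use C1 C0 in simp)
    finally show "norm (Ff s \<tau> i (v - \<epsilon> n) * oddx (h n) v) \<le> (C1 * (C + C)) * (heat 2 (2 * \<tau>) (- s / 2) v * cosh ((1 + \<kappa>) * v))"
     by (simp add: abs_mult mult_ac)
   qed
  qed
 qed
 \<comment> \<open>The part on the positive half-line that was added to integrate over the whole
   line: it is small because the entrance Gaussian has not reached it.\<close>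
 have rest: "(\<lambda>n. LBINT u. F n u * (?J u * H n u)) \<longlonglongrightarrow> 0"
 proof -
  obtain C2 where C2: "0 \<le> C2" "\<And>\<alpha> \<epsilon> u. 0 < \<alpha> ==> \<alpha> \<le> 1 ==> 0 \<le> \<epsilon> ==> \<epsilon> \<le> 1 ==> \<epsilon> \<le> s / 4 ==> 0 \<le> u ==>
   \<bar>Ff s \<alpha> i (u - \<epsilon>)\<bar> \<le> C2 * ((1 / \<alpha>) ^ Suc i * exp (- (s\<^sup>2 / (64 * \<alpha>)))) * (heat 2 2 (- s / 4) u * cosh u)"
   using Ff_small_shift[OF s] by metis
  define \<delta> where "\<delta> n = (1 / \<alpha> n) ^ Suc i * exp (- (s\<^sup>2 / (64 * \<alpha> n)))" for n
  have \<delta>0: "0 \<le> \<delta> n" for n using T(3)[of n] by (simp add: \<delta>_def)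
  define w where "w u = heat 2 2 (- s / 4) u * cosh ((1 + \<kappa>) * u)" for u
  have wi: "integrable lborel w" unfolding w_def[abs_def] by (rule integrable_heat_cosh) simp
  have bd: "\<bar>(LBINT u. F n u * (?J u * H n u))\<bar> \<le> \<delta> n * (C2 * C' * (LBINT u. w u))" for n
  proof -
   have pt: "\<bar>F n u * (?J u * H n u)\<bar> \<le> (\<delta> n * (C2 * C')) * w u" for u
   proof (cases "0 < u")
    case True
    have "\<bar>F n u\<bar> * \<bar>H n u\<bar> \<le> (C2 * \<delta> n * (heat 2 2 (- s / 4) u * cosh u)) * (C' * cosh (\<kappa> * u))"
     unfolding F_def \<delta>_def using C2(2)[OF T(3)[of n] T(4)[of n] e(2)[of n] e(3)[of n] e(4)[of n], of u] True bndD[OF Hb[of n], of u] C2(1) T(3)[of n]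
     by (intro mult_mono) auto
    also have "\<dots> = (\<delta> n * (C2 * C') * heat 2 2 (- s / 4) u) * (cosh u * cosh (\<kappa> * u))" by simp
    also have "\<dots> \<le> (\<delta> n * (C2 * C') * heat 2 2 (- s / 4) u) * cosh ((1 + \<kappa>) * u)"
     by (rule mult_left_mono[OF cosh_mult_succ_le[OF \<kappa>]]) (use C2(1) \<delta>0 bnd_const_nonneg[OF Hb[of n]] in simp)
    finally show ?thesis using True by (simp add: abs_mult w_def mult_ac)
   next
    case False
    then show ?thesis using C2(1) \<delta>0 bnd_const_nonneg[OF Hb[of n]] by (simp add: w_def)
   qed
   have "\<bar>(LBINT u. F n u * (?J u * H n u))\<bar> \<le> (LBINT u. \<bar>F n u * (?J u * H n u)\<bar>)"
    by (rule integral_abs_bound)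
   also have "\<dots> \<le> (LBINT u. (\<delta> n * (C2 * C')) * w u)"
   proof (rule integral_mono)
    show i: "integrable lborel (\<lambda>u. (\<delta> n * (C2 * C')) * w u)" by (intro integrable_mult_right wi)
    show "integrable lborel (\<lambda>u. \<bar>F n u * (?J u * H n u)\<bar>)"
     by (rule integrable_bound[OF i]) (auto intro!: AE_I2 order_trans[OF pt])
   qed (rule pt)
   finally show ?thesis by (simp add: mult_ac)
  qed
  have "\<delta> \<longlonglongrightarrow> 0" unfolding \<delta>_def[abs_def] by (rule filterlim_compose[OF small_at_zero[OF s] a])
  from tendsto_mult_left_zero[OF this, of "C2 * C' * (LBINT u. w u)"]
  show ?thesis by (rule Lim_null_comparison[rotated]) (use bd in simp)
 qed
 show ?thesis unfolding RH F_def[symmetric] split using tendsto_diff[OF main rest] by simp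
qed

lemma H1_on_continuous:
 assumes "H1_on 0 1 h"
 shows "continuous_on {0..1} h"
proof -
 from assms obtain g where g1: "set_integrable lborel {0..1} g" and g2: "\<forall>x\<in>{0..1}. h x = h 0 + (LBINT s=ereal 0..ereal x. g s)"
  unfolding H1_on_def by (elim exE conjE)
 note g = g1 bspec[OF g2]
 have eq: "h x = h 0 + integral {0..x} g" if "x \<in> {0..1}" for x
 proof -
  have "set_integrable lborel {0..x} g" by (rule set_integrable_subset[OF g(1)]) (use that in auto)
  then have "(LBINT s=ereal 0..ereal x. g s) = integral {0..x} g"
   by (intro interval_integral_eq_integral) (use that in auto)
  then show ?thesis unfolding g(2)[OF that] by simp
 qed
 have "continuous_on {0..1} (\<lambda>x. h 0 + integral {0..x} g)"
  by (rule continuous_on_add[OF continuous_on_const indefinite_integral_continuous_1[OF set_borel_integral_eq_integral(1)[OF g(1)]]])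
 then show ?thesis by (rule continuous_on_eq) (rule eq[symmetric])
qed

text \<open>In the original coordinate the lift is a gap of size
  \<open>\<epsilon> * sqrt 2 * (1 - t)\<close>: positive at every time before 1, and at most
  \<open>\<epsilon> * sqrt 2\<close>.\<close>

lemma Uc_le_htilde_iff:
 assumes "0 \<le> \<tau>"
 shows "Uc r (tinv \<tau>) x + \<epsilon> \<le> htilde h r \<tau> \<longleftrightarrow> x + \<epsilon> * (sqrt 2 * (1 - tinv \<tau>)) \<le> h (tinv \<tau>)"
proof -
 define c where "c = sqrt 2 * (1 - tinv \<tau>)"
 have c: "0 < c" using tinv_less_one[OF assms] by (simp add: c_def)
 have "1 - tinv \<tau> = 1 / (1 + 4 * \<tau>)" using assms by (simp add: tinv_def field_simps)
 then have "htilde h r \<tau> = (h (tinv \<tau>) - r) / c" using assms by (simp add: htilde_def tinv_def c_def)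
 then have "Uc r (tinv \<tau>) x + \<epsilon> \<le> htilde h r \<tau> \<longleftrightarrow> (x - r) / c + \<epsilon> \<le> (h (tinv \<tau>) - r) / c"
  by (simp add: Uc_def c_def)
 also have "\<dots> \<longleftrightarrow> x + \<epsilon> * c \<le> h (tinv \<tau>)" proof -
  have "(x - r) / c + \<epsilon> = (x - r + \<epsilon> * c) / c" using c by (simp add: add_divide_distrib)
  then show ?thesis using c by (simp add: divide_le_cancel)
 qed
 finally show ?thesis by (simp add: c_def)
qed

lemma tau_order:
 assumes "0 < t1" "t1 < t2" "t2 < 1"
 shows "0 < tau t1" "tau t1 < tau t2" "0 < tau t2"
 using tau_strict_mono[of 0 t1] tau_strict_mono[of t1 t2] assms by (auto simp: tau_def[of 0])

lemma htilde_outside: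
 assumes t: "0 < t1" "t1 < t2" "t2 < 1" and hr: "\<forall>t\<in>{0..1} - {t1<..<t2}. h t = r"
  and "0 \<le> \<tau>" "\<tau> \<le> tau t1 \<or> tau t2 \<le> \<tau>"
 shows "htilde h r \<tau> = 0"
proof -
 have "tinv \<tau> \<in> {0..1}" using tinv_nonneg[OF assms(5)] tinv_less_one[OF assms(5)] by simp
 moreover have "tinv \<tau> \<notin> {t1<..<t2}"
  using assms tinv_less[of \<tau> "tau t1"] tinv_less[of "tau t2" \<tau>] tinv_tau[of t1] tinv_tau[of t2] t tau_order[OF t]
  by (cases "\<tau> = tau t1"; cases "\<tau> = tau t2") auto
 ultimately have "h (tinv \<tau>) = r" using hr by blast
 then show ?thesis by (simp add: htilde_def tinv_def)
qed

lemma barrier_properties: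
 assumes t: "0 < t1" "t1 < t2" "t2 < 1" and h: "continuous_on {0..1} h" and hr: "\<forall>t\<in>{0..1} - {t1<..<t2}. h t = r"
 shows "continuous_on {0..tau t2 - tau t1} (\<lambda>x. htilde h r (tau t1 + x))" "htilde h r (tau t1 + (tau t2 - tau t1)) = 0"
proof -
 show "continuous_on {0..tau t2 - tau t1} (\<lambda>x. htilde h r (tau t1 + x))"
  by (rule continuous_on_compose2[OF continuous_on_htilde[OF h, of "{0..}"] continuous_on_add[OF continuous_on_const continuous_on_id]])
   (use tau_order[OF t] in auto)
 show "htilde h r (tau t1 + (tau t2 - tau t1)) = 0" by (rule htilde_outside[OF t hr]) (use tau_order[OF t] in auto)
qed

text \<open>The operator \<open>T\<close> applied to the real form of \<open>Psi\<close> at time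
  \<open>tau t2\<close>, expressed by a path expectation so that the derivative in \<open>Th\<close>
  is avoided until the end.\<close>

definition transit :: "'b measure => (real => 'b => real) => (real => real) => real => real => real => nat => real => real" where
 "transit M W h r t1 t2 m = killed_op M W (\<lambda>x. htilde h r (tau t1 + x)) (tau t2 - tau t1)
  (\<lambda>x. indicator {..0} x * (Gf (sqrt 2 * r) (tau t2) m x - Gf (sqrt 2 * r) (tau t2) m (- x)))"

text \<open>The entrance time tends to 0, the exit time to infinity and the lift to 0 along one
  sequence. A continuous path strictly below \<open>h\<close> has a positive gap, which eventually
  exceeds the lift; a contact at an interior time is eventually inside the window, where the
  positive lift forbids it.\<close>

lemma bridge_prob_detS:
 fixes N :: nat and r t1 t2 :: real and h :: "real => real"
  and M :: "'a measure" and B :: "nat => real => 'a => real"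
  and M' :: "'b measure" and W :: "real => 'b => real"
 assumes N: "N \<ge> 1" and r: "r > 0" and t: "0 < t1" "t1 < t2" "t2 < 1"
  and h: "continuous_on {0..1} h" and hr: "\<forall>t\<in>{0..1} - {t1<..<t2}. h t = r"
  and B: "nonint_bridges M N B" and W: "brownian_motion M' 2 W"
 shows "measure M {\<omega> \<in> space M. \<forall>t\<in>{0..1}. B N t \<omega> < h t} =
  detS {1..N} (\<lambda>i j. LBINT v. Ff (sqrt 2 * r) (tau t1) (i - 1) v * oddx (transit M' W h r t1 t2 (j - 1)) v)"
proof -
 define s where "s = sqrt 2 * r"
 have s: "0 < s" using r by (simp add: s_def)
 \<comment> \<open>The summand 2 keeps \<open>a n\<close> strictly below \<open>tau t1\<close>, so
   the first piece of the mesh has positive length.\<close>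
 define a where "a n = min 1 (tau t1) / (real n + 2)" for n
 define T1 where "T1 n = tau t1 - a n" for n
 define T2 where "T2 = tau t2 - tau t1"
 define T3 where "T3 n = real n + 1" for n
 \<comment> \<open>The bounds 1 and \<open>s / 4\<close> are those of the shift estimates for
   \<open>Gf\<close> and \<open>Ff\<close>.\<close>
 define \<epsilon> where "\<epsilon> n = min 1 (s / 4) / (real n + 1)" for n
 define b where "b x = htilde h r (tau t1 + x)" for x
 have a0: "0 < a n" "a n \<le> 1" "a n < tau t1" for n
 proof -
  show "0 < a n" using tau_order[OF t] by (simp add: a_def)
  have "a n \<le> min 1 (tau t1) / 2" unfolding a_def using tau_order[OF t] by (intro divide_left_mono) auto
  then show "a n \<le> 1" "a n < tau t1" using tau_order[OF t] by (auto simp: min_def split: if_splits)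
 qed
 have T: "0 < T1 n" "0 < T2" "0 < T3 n" for n using a0[of n] tau_order[OF t] by (auto simp: T1_def T2_def T3_def)
 have e0: "0 < \<epsilon> n" "\<epsilon> n \<le> 1" "\<epsilon> n \<le> s / 4" for n
 proof -
  show "0 < \<epsilon> n" using s by (simp add: \<epsilon>_def)
  have "\<epsilon> n \<le> min 1 (s / 4) / 1" unfolding \<epsilon>_def using s by (intro divide_left_mono) auto
  then show "\<epsilon> n \<le> 1" "\<epsilon> n \<le> s / 4" by auto
 qed
 have elim: "\<epsilon> \<longlonglongrightarrow> 0" unfolding \<epsilon>_def[abs_def] by real_asymp
 have alim: "a \<longlonglongrightarrow> 0" unfolding a_def[abs_def] by real_asymp
 have aR: "filterlim a (at_right 0) sequentially"
 proof -
  have "a n \<in> {0<..} \<and> a n \<noteq> 0" for n using a0(1)[of n] by simp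
  then show ?thesis unfolding filterlim_at by (intro conjI alim always_eventually) blast
 qed
 have sum: "a n + T1 n = tau t1" "a n + T1 n + T2 = tau t2" "a n + T1 n + T2 + T3 n = tau t2 + T3 n" "tau t1 + T2 = tau t2" for n
  by (simp_all add: T1_def T2_def)
 define E where "E n = {\<omega> \<in> space M. \<forall>\<tau>\<in>{a n..tau t2 + T3 n}. Uc r (tinv \<tau>) (B N (tinv \<tau>) \<omega>) + \<epsilon> n \<le> htilde h r \<tau>}" for n
 define F where "F = {\<omega> \<in> space M. \<forall>t\<in>{0..1}. B N t \<omega> < h t}"
 define G where "G n j v = Gf s (tau t2 + T3 n) (j - 1) (v - \<epsilon> n)" for n j v
 define g where "g n j x = indicator {..0} x * refl_op 0 2 (T3 n) (G n j) x" for n j x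
 define e where "e n i j = (LBINT u. Ff s (a n) (i - 1) (u - \<epsilon> n) * (indicator {..0} u * refl_op 0 2 (T1 n) (killed_op M' W b T2 (g n j)) u))" for n i j
 have bp: "continuous_on {0..T2} b" "b T2 = 0" using barrier_properties[OF t h hr] by (simp_all add: b_def[abs_def] T2_def)
 have path: "E n \<in> sets M" "measure M (E n) = detS {1..N} (e n)" for n
 proof -
  have bb: "\<And>x. x \<in> {0..T2} ==> b x = htilde h r (a n + T1 n + x)" by (simp add: b_def sum)
  have \<beta>: "\<And>x. a n \<le> x ==> x \<le> a n + T1 n ==> htilde h r x = 0"
   "\<And>x. a n + T1 n + T2 \<le> x ==> x \<le> a n + T1 n + T2 + T3 n ==> htilde h r x = 0"
   unfolding sum using a0(1)[of n] tau_order[OF t] by (auto intro!: htilde_outside[OF t hr])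
  note p = bridge_path_prob[OF B N W a0(1) T h bp(1) bb bp(2) \<beta>, where \<epsilon> = "\<epsilon> n", unfolded sum]
  show "E n \<in> sets M" unfolding E_def by (rule p(1))
  show "measure M (E n) = detS {1..N} (e n)" unfolding E_def e_def[abs_def] g_def[abs_def] G_def[abs_def] s_def by (rule p(2))
 qed
 have ps: "prob_space M" and Bc: "\<And>\<omega>. \<omega> \<in> space M ==> continuous_on {0..1} (\<lambda>t. B N t \<omega>)"
  and B01: "\<And>\<omega>. \<omega> \<in> space M ==> B N 0 \<omega> = 0" "\<And>\<omega>. \<omega> \<in> space M ==> B N 1 \<omega> = 0"
  using B N unfolding nonint_bridges_def by auto
 have lim: "(\<lambda>n. indicator (E n) \<omega> :: real) \<longlonglongrightarrow> indicator F \<omega>" if \<omega>: "\<omega> \<in> space M" for \<omega>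
 proof (cases "\<omega> \<in> F")
  case True
  have "continuous_on {0..1} (\<lambda>t. h t - B N t \<omega>)" by (intro continuous_intros h Bc[OF \<omega>])
  from continuous_attains_inf[OF _ _ this] obtain t0 where t0: "t0 \<in> {0..1}" "\<And>t. t \<in> {0..1} ==> h t0 - B N t0 \<omega> \<le> h t - B N t \<omega>"
   by auto
  define m where "m = h t0 - B N t0 \<omega>"
  have m: "0 < m" using True t0(1) by (auto simp: F_def m_def)
  have "\<forall>\<^sub>F n in sequentially. \<epsilon> n * sqrt 2 < m" by (rule order_tendstoD(2)[OF tendsto_mult_left_zero[OF elim] m])
  then have "\<forall>\<^sub>F n in sequentially. indicator (E n) \<omega> = (1::real)"
  proof eventually_elim
   case (elim n)
   have "Uc r (tinv \<tau>) (B N (tinv \<tau>) \<omega>) + \<epsilon> n \<le> htilde h r \<tau>" if "\<tau> \<in> {a n..tau t2 + T3 n}" for \<tau>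
   proof -
    have \<tau>: "0 \<le> \<tau>" using that a0(1)[of n] by simp
    have "m \<le> h (tinv \<tau>) - B N (tinv \<tau>) \<omega>"
     unfolding m_def by (rule t0(2)) (use tinv_nonneg[OF \<tau>] tinv_less_one[OF \<tau>] in simp)
    moreover have "\<epsilon> n * (sqrt 2 * (1 - tinv \<tau>)) \<le> \<epsilon> n * (sqrt 2 * 1)"
     using e0(1)[of n] tinv_nonneg[OF \<tau>] by (intro mult_left_mono) auto
    ultimately show ?thesis unfolding Uc_le_htilde_iff[OF \<tau>] using elim by simp
   qed
   then show ?case using \<omega> by (simp add: E_def)
  qed
  then show ?thesis using True by (simp add: tendsto_eventually)
 next
  case False
  then obtain t0 where t0: "t0 \<in> {0..1}" "h t0 \<le> B N t0 \<omega>" using \<omega> by (auto simp: F_def not_less)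
  \<comment> \<open>The bridges vanish at both ends, where the barrier is \<open>r > 0\<close>; so a
    contact happens at an interior time.\<close>
  have "h 0 = r" "h 1 = r" using hr t by auto
  then have t0': "0 < t0" "t0 < 1" using t0 B01[OF \<omega>] r by (auto simp: less_le)
  have \<tau>0: "0 < tau t0" using tau_strict_mono[of 0 t0] t0' by (simp add: tau_def[of 0])
  have "\<forall>\<^sub>F n in sequentially. a n < tau t0" using order_tendstoD(2)[OF alim \<tau>0] .
  moreover have "\<forall>\<^sub>F n in sequentially. tau t0 < real n" using eventually_gt_at_top[of "nat \<lceil>tau t0\<rceil>"]
   by eventually_elim linarith
  ultimately have "\<forall>\<^sub>F n in sequentially. indicator (E n) \<omega> = (0::real)"
  proof eventually_elim
   case (elim n)
   have "tau t0 \<in> {a n..tau t2 + T3 n}" using elim tau_order[OF t] by (simp add: T3_def)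
   moreover have "\<not> Uc r (tinv (tau t0)) (B N (tinv (tau t0)) \<omega>) + \<epsilon> n \<le> htilde h r (tau t0)"
   proof -
    have "0 < \<epsilon> n * (sqrt 2 * (1 - t0))" using e0(1)[of n] t0' by simp
    then show ?thesis unfolding Uc_le_htilde_iff[OF less_imp_le[OF \<tau>0]] unfolding tinv_tau[OF t0'(2)] using t0(2) by linarith
   qed
   ultimately have "\<omega> \<notin> E n" unfolding E_def by blast
   then show ?case by simp
  qed
  then show ?thesis using False by (simp add: tendsto_eventually)
 qed
 have FS: "F \<subseteq> space M" by (auto simp: F_def)
 have "(\<lambda>n. measure M (E n)) \<longlonglongrightarrow> measure M F" by (rule measure_indicator_tendsto(2)[OF ps path(1) FS lim])
 moreover have "(\<lambda>n. measure M (E n)) \<longlonglongrightarrow> detS {1..N} (\<lambda>i j. LBINT v. Ff s (tau t1) (i - 1) v * oddx (transit M' W h r t1 t2 (j - 1)) v)"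
  unfolding path(2)
 proof (rule detS_tendsto)
  fix i j
  define \<kappa> where "\<kappa> = \<bar>s\<bar> + 1"
  define gl where "gl x = indicator {..0} x * (Gf s (tau t2) (j - 1) x - Gf s (tau t2) (j - 1) (- x))" for x
  obtain C where C: "0 \<le> C" "\<And>\<tau> T \<epsilon> v. 0 < \<tau> ==> 0 < T ==> 0 \<le> \<epsilon> ==> \<epsilon> \<le> 1 ==>
   \<bar>refl_op 0 2 T (\<lambda>v. Gf s (\<tau> + T) (j - 1) (v - \<epsilon>)) v - (Gf s \<tau> (j - 1) (v - \<epsilon>) - Gf s \<tau> (j - 1) (- v - \<epsilon>))\<bar> \<le> C * ((1 + (\<tau> + T)) ^ (j - 1) * exp (- ((\<tau> + T) * s\<^sup>2)))"
   using refl_op_Gf[OF s] by metis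
  define \<delta> where "\<delta> n = C * ((1 + (tau t2 + T3 n)) ^ (j - 1) * exp (- ((tau t2 + T3 n) * s\<^sup>2)))" for n
  define p where "p n v = Gf s (tau t2) (j - 1) (v - \<epsilon> n) - Gf s (tau t2) (j - 1) (- v - \<epsilon> n)" for n v
  have rp: "\<bar>refl_op 0 2 (T3 n) (G n j) v - p n v\<bar> \<le> \<delta> n" for n v
   unfolding G_def[abs_def] p_def \<delta>_def by (rule C(2)) (use tau_order[OF t] T e0[of n] in auto)
  have Tinf: "filterlim (\<lambda>n. tau t2 + T3 n) at_top sequentially"
   unfolding T3_def by real_asymp
  have \<delta>lim: "\<delta> \<longlonglongrightarrow> 0"
   unfolding \<delta>_def[abs_def] by (rule tendsto_mult_right_zero, rule filterlim_compose[OF small_at_infinity[OF s] Tinf])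
  then obtain D where D: "\<And>n. \<bar>\<delta> n\<bar> \<le> D" using convergent_imp_Bseq[of \<delta>] unfolding Bseq_def convergent_def real_norm_def by metis
  obtain C0 where C0: "bnd \<kappa> C0 (Gf s (tau t2) (j - 1))" unfolding \<kappa>_def by (rule bnd_Gf)
  have c00: "0 \<le> C0" by (rule bnd_const_nonneg[OF C0])
  \<comment> \<open>One growth constant for all \<open>n\<close>: two shifted copies of
    \<open>Gf\<close>, plus the bounded error left by the finite exit time.\<close>
  define C1 where "C1 = 2 * (C0 * exp \<kappa>) + D"
  have gb: "bnd \<kappa> C1 (g n j)" for n
   unfolding bnd_def
  proof (intro conjI allI)
   obtain C2 where C2: "bnd \<kappa> C2 (G n j)" unfolding G_def[abs_def] \<kappa>_def by (rule bnd_Gf_shift)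
   have [measurable]: "refl_op 0 2 (T3 n) (G n j) \<in> borel_measurable borel"
    by (rule bnd_measurable[OF bnd_refl_op[OF _ C2]]) (use T in simp)
   show "g n j \<in> borel_measurable borel" unfolding g_def[abs_def] by measurable
   fix x
   have sh: "\<bar>Gf s (tau t2) (j - 1) (y - \<epsilon> n)\<bar> \<le> C0 * exp \<kappa> * cosh (\<kappa> * y)" for y
   proof -
    have "\<bar>Gf s (tau t2) (j - 1) (y - \<epsilon> n)\<bar> \<le> C0 * cosh (- (\<kappa> * \<epsilon> n) + \<kappa> * y)"
     using bndD[OF C0, of "y - \<epsilon> n"] by (simp add: right_diff_distrib)
    also have "\<dots> \<le> C0 * (exp \<bar>- (\<kappa> * \<epsilon> n)\<bar> * cosh (\<kappa> * y))" by (intro mult_left_mono cosh_shift_le c00)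
    also have "\<dots> \<le> C0 * (exp \<kappa> * cosh (\<kappa> * y))"
    proof (intro mult_left_mono mult_right_mono c00)
     have "\<kappa> * \<epsilon> n \<le> \<kappa> * 1" using e0[of n] by (intro mult_left_mono) (auto simp: \<kappa>_def)
     moreover have "0 \<le> \<kappa> * \<epsilon> n" using e0(1)[of n] by (simp add: \<kappa>_def)
     ultimately show "exp \<bar>- (\<kappa> * \<epsilon> n)\<bar> \<le> exp \<kappa>" by simp
    qed simp
    finally show ?thesis by simp
   qed
   have c1: "1 \<le> cosh (\<kappa> * x)" by (rule cosh_real_ge_1)
   have "\<bar>g n j x\<bar> \<le> \<bar>refl_op 0 2 (T3 n) (G n j) x\<bar>" by (simp add: g_def indicator_def)
   also have "\<dots> \<le> \<bar>p n x\<bar> + D" using rp[of n x] D[of n] by linarith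
   also have "\<bar>p n x\<bar> \<le> 2 * (C0 * exp \<kappa>) * cosh (\<kappa> * x)" using sh[of x] sh[of "- x"] unfolding p_def by simp
   also have "D \<le> D * cosh (\<kappa> * x)" using mult_left_mono[OF c1, of D] order_trans[OF abs_ge_zero D[of n]] by simp
   finally show "\<bar>g n j x\<bar> \<le> C1 * cosh (\<kappa> * x)" by (simp add: C1_def distrib_right)
  qed
  have gl: "(\<lambda>n. g n j x) \<longlonglongrightarrow> gl x" for x
  proof -
   have cont: "(\<lambda>n. Gf s (tau t2) (j - 1) (y - \<epsilon> n)) \<longlonglongrightarrow> Gf s (tau t2) (j - 1) y" for y
   proof (rule isCont_tendsto_compose[where g = "Gf s (tau t2) (j - 1)"])
    show "isCont (Gf s (tau t2) (j - 1)) y"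
     unfolding Gf_def[abs_def] by (intro continuous_on_interior[of UNIV] continuous_intros) auto
    show "(\<lambda>n. y - \<epsilon> n) \<longlonglongrightarrow> y" using tendsto_diff[OF tendsto_const elim, of y] by simp
   qed
   have "(\<lambda>n. refl_op 0 2 (T3 n) (G n j) x - p n x) \<longlonglongrightarrow> 0"
    by (rule Lim_null_comparison[OF _ \<delta>lim]) (use rp in simp)
   moreover have "(\<lambda>n. p n x) \<longlonglongrightarrow> Gf s (tau t2) (j - 1) x - Gf s (tau t2) (j - 1) (- x)"
    unfolding p_def by (intro tendsto_diff cont)
   ultimately have "(\<lambda>n. (refl_op 0 2 (T3 n) (G n j) x - p n x) + p n x) \<longlonglongrightarrow> 0 + (Gf s (tau t2) (j - 1) x - Gf s (tau t2) (j - 1) (- x))"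
    by (rule tendsto_add)
   then show ?thesis unfolding g_def gl_def by (intro tendsto_mult tendsto_const) simp
  qed
  have two: "(0::real) < 2" by simp
  have kb: "bnd \<kappa> (C1 * exp (2 * T2 * \<kappa>\<^sup>2 / 2)) (killed_op M' W b T2 (g n j))" for n
   by (rule bnd_killed_op[OF W two T(2) bp(1) gb])
  have kl: "(\<lambda>n. killed_op M' W b T2 (g n j) u) \<longlonglongrightarrow> killed_op M' W b T2 gl u" for u
   by (rule killed_op_continuous[OF W two T(2) bp(1) gb gl])
  have tr: "transit M' W h r t1 t2 (j - 1) = killed_op M' W b T2 gl"
   unfolding transit_def b_def[abs_def] T2_def gl_def[abs_def] s_def ..
  show "(\<lambda>n. e n i j) \<longlonglongrightarrow> (LBINT v. Ff s (tau t1) (i - 1) v * oddx (transit M' W h r t1 t2 (j - 1)) v)"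
   unfolding e_def tr
   by (rule entrance_limit[OF s aR T(1) sum(1) a0(1,2) elim less_imp_le[OF e0(1)] e0(2,3) kb kl]) (simp add: \<kappa>_def)
 qed
 ultimately show ?thesis unfolding F_def s_def by (rule LIMSEQ_unique)
qed

section \<open>Invertibility of \<open>1 - K0\<close>\<close>

text \<open>Induction by removing the largest zero: Rolle between the two largest zeros gives a zero
  of \<open>f'\<close> to the right of all those found before.\<close>

lemma rolle_card:
 fixes f f' :: "real => real"
 assumes der: "\<And>x. (f has_real_derivative f' x) (at x)"
 shows "finite S ==> card S = Suc m ==> (\<And>x. x \<in> S ==> f x = 0) ==>
  \<exists>Z. finite Z \<and> card Z = m \<and> Z \<subseteq> {Min S<..<Max S} \<and> (\<forall>z\<in>Z. f' z = 0)"
proof (induction m arbitrary: S)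
 case 0
 show ?case by (rule exI[of _ "{}"]) simp
next
 case (Suc m)
 define b where "b = Max S"
 define S' where "S' = S - {b}"
 have ne: "S \<noteq> {}" using Suc.prems(2) by auto
 have b: "b \<in> S" unfolding b_def by (rule Max_in[OF Suc.prems(1) ne])
 have S': "finite S'" "card S' = Suc m" using Suc.prems(1,2) b by (simp_all add: S'_def)
 then have ne': "S' \<noteq> {}" by auto
 obtain Z where Z: "finite Z" "card Z = m" "Z \<subseteq> {Min S'<..<Max S'}" "\<And>z. z \<in> Z ==> f' z = 0"
  using Suc.IH[OF S'] Suc.prems(3) by (auto simp: S'_def)
 define a where "a = Max S'"
 have a: "a \<in> S'" unfolding a_def by (rule Max_in[OF S'(1) ne'])
 have ab: "a < b"
 proof -
  have "a \<le> b" "a \<noteq> b" using a Max_ge[OF Suc.prems(1), of a] by (auto simp: S'_def b_def)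
  then show ?thesis by simp
 qed
 have "f a = f b" using a b Suc.prems(3) by (simp add: S'_def)
 then obtain z where z: "a < z" "z < b" "f' z = 0"
  using Rolle_deriv[OF ab, of f "\<lambda>x. (*) (f' x)"] der DERIV_isCont[OF der]
  by (auto simp: has_field_derivative_def fun_eq_iff continuous_at_imp_continuous_on dest: spec[of _ 1])
 have mm: "Min S \<le> Min S'" by (rule Min_antimono) (use ne' Suc.prems(1) in \<open>auto simp: S'_def\<close>)
 have mi: "Min S' \<le> a" using a S'(1) by simp
 have zZ: "z \<notin> Z" using Z(3) z(1) by (auto simp: a_def)
 show ?case
 proof (intro exI conjI ballI)
  show "finite (insert z Z)" "card (insert z Z) = Suc m" using Z zZ by auto
  show "insert z Z \<subseteq> {Min S<..<Max S}"
   using Z(3) z mm mi ab unfolding a_def[symmetric] b_def[symmetric] by force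
  show "f' x = 0" if "x \<in> insert z Z" for x using that Z(4) z(3) by auto
 qed
qed

lemma poly_eq_sum:
 fixes p :: "'c::comm_semiring_1 poly"
 shows "degree p \<le> d ==> poly p x = (\<Sum>i\<le>d. Polynomial.coeff p i * x ^ i)"
 unfolding poly_altdef by (intro sum.mono_neutral_left) (auto simp: coeff_eq_0)

text \<open>As long as \<open>k < N\<close>, both endpoints are zeros of \<open>D k\<close> in
  addition to the \<open>k\<close> interior ones, so Rolle gains one interior zero at each
  differentiation.\<close>

lemma rolle_iterated:
 fixes D :: "nat => real => real"
 assumes der: "\<And>k x. (D k has_real_derivative D (Suc k) x) (at x)" and ab: "a < b"
  and zero: "\<And>k. k < N ==> D k a = 0" "\<And>k. k < N ==> D k b = 0"
 shows "k \<le> N ==> \<exists>Z. finite Z \<and> card Z = k \<and> Z \<subseteq> {a<..<b} \<and> (\<forall>z\<in>Z. D k z = 0)"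
proof (induction k)
 case 0
 show ?case by (rule exI[of _ "{}"]) simp
next
 case (Suc k)
 then obtain Z where Z: "finite Z" "card Z = k" "Z \<subseteq> {a<..<b}" "\<And>z. z \<in> Z ==> D k z = 0" by auto
 define S where "S = insert a (insert b Z)"
 have "a \<notin> insert b Z" "b \<notin> Z" using Z(3) ab by auto
 then have S: "finite S" "card S = Suc (Suc k)" using Z(1,2) by (simp_all add: S_def)
 have "D k x = 0" if "x \<in> S" for x using that Z(4) zero Suc.prems by (auto simp: S_def)
 from rolle_card[OF der S this] obtain Z' where Z': "finite Z'" "card Z' = Suc k" "Z' \<subseteq> {Min S<..<Max S}" "\<forall>z\<in>Z'. D (Suc k) z = 0"
  by blast
 have "a \<le> Min S" "Max S \<le> b" using S(1) Z(3) ab by (auto simp: S_def subset_iff less_imp_le)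
 then have "Z' \<subseteq> {a<..<b}" using Z'(3) by force
 then show ?case using Z' by blast
qed

text \<open>If a combination \<open>p\<close> of the rows of \<open>1 - K0\<close> vanishes, then \<open>p(z) - p(s - z) exp(2 s z - s^2)\<close> vanishes
 to order \<open>N\<close> at \<open>0\<close> and, by the symmetry \<open>z \<mapsto> s - z\<close>, at \<open>s\<close>; by Rolle its \<open>N\<close>-th derivative, a polynomial of
 degree less than \<open>N\<close> times an exponential, then has \<open>N\<close> zeros in between.\<close>

lemma reflected_polynomial_nonvanishing:
 fixes p :: "complex poly" and s :: real
 assumes s: "0 < s" and deg: "degree p < N" and mon: "lead_coeff p = 1"
 defines "f \<equiv> \<lambda>z. poly p z - poly p (of_real s - z) * exp (- of_real (s\<^sup>2) + 2 * of_real s * z)"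
 shows "\<exists>m<N. (deriv ^^ m) f 0 \<noteq> 0"
proof (rule ccontr)
 let ?e = "\<lambda>z. exp (of_real (s\<^sup>2) - 2 * of_real s * z) :: complex"
 assume "\<not> ?thesis"
 then have z0: "(deriv ^^ m) f 0 = 0" if "m < N" for m using that by auto
 \<comment> \<open>Differentiating \<open>q z * exp (2 * s * z)\<close> gives
   \<open>T q z * exp (2 * s * z)\<close>; \<open>T\<close> keeps the degree and multiplies the
   leading coefficient by \<open>2 * s\<close>.\<close>
 define T where "T q = pderiv q + Polynomial.smult (of_real (2 * s)) q" for q :: "complex poly"
 define Q where "Q k = (T ^^ k) (Polynomial.smult (exp (- of_real (s\<^sup>2))) (pcompose p [:of_real s, - 1:]))" for k
 define F where "F k z = poly ((pderiv ^^ k) p) z - poly (Q k) z * exp (2 * of_real s * z)" for k z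
 have Q_Suc: "Q (Suc k) = T (Q k)" for k by (simp add: Q_def)
 have F0: "F 0 = f"
 proof
  fix z :: complex
  have "exp (- of_real (s\<^sup>2) + 2 * of_real s * z) = exp (- of_real (s\<^sup>2)) * exp (2 * of_real s * z)" by (rule exp_add)
  then show "F 0 z = f z" unfolding F_def f_def Q_def by (simp add: poly_pcompose)
 qed
 have derF: "(F k has_field_derivative F (Suc k) z) (at z)" for k z
  unfolding F_def[abs_def] Q_Suc T_def
  by (auto intro!: derivative_eq_intros simp: algebra_simps)
 have dF: "(deriv ^^ k) f = F k" for k
 proof (induction k)
  case (Suc k)
  show ?case unfolding funpow.simps comp_def Suc.IH by (rule ext, rule DERIV_imp_deriv, rule derF)
 qed (simp add: F0)
 have sym: "\<exists>\<alpha>. \<forall>z. F k (of_real s - z) = ?e z * (\<Sum>j\<le>k. \<alpha> j * F j z)" for k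
 proof (induction k)
  case 0
  have "F 0 (of_real s - z) = ?e z * (- F 0 z)" for z
  proof -
   have e: "?e z * exp (- of_real (s\<^sup>2) + 2 * of_real s * z) = 1"
    by (simp flip: exp_add)
   have e2: "- of_real (s\<^sup>2) + 2 * of_real s * (of_real s - z) = of_real (s\<^sup>2) - 2 * of_real s * z"
    by (simp add: algebra_simps power2_eq_square)
   have "F 0 (of_real s - z) = poly p (of_real s - z) - poly p z * ?e z"
    unfolding F0 f_def e2 by simp
   also have "\<dots> = poly p (of_real s - z) * (?e z * exp (- of_real (s\<^sup>2) + 2 * of_real s * z)) - poly p z * ?e z"
    unfolding e by simp
   also have "\<dots> = ?e z * (- F 0 z)"
   proof -
    have "a * (b * c) - d * b = b * - (d - a * c)" for a b c d :: complex by (simp add: algebra_simps)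
    then show ?thesis unfolding F0 f_def .
   qed
   finally show ?thesis .
  qed
  then show ?case by (intro exI[of _ "\<lambda>_. - 1"]) simp
 next
  case (Suc k)
  then obtain \<alpha> where \<alpha>: "\<And>z. F k (of_real s - z) = ?e z * (\<Sum>j\<le>k. \<alpha> j * F j z)" by blast
  have *: "F (Suc k) (of_real s - z) = ?e z * (\<Sum>j\<le>k. 2 * of_real s * \<alpha> j * F j z - \<alpha> j * F (Suc j) z)" for z
  proof -
   have "((\<lambda>z. F k (of_real s - z)) has_field_derivative F (Suc k) (of_real s - z) * (- 1)) (at z)"
    by (rule DERIV_chain2[OF derF]) (auto intro!: derivative_eq_intros)
   moreover have "((\<lambda>z. ?e z * (\<Sum>j\<le>k. \<alpha> j * F j z)) has_field_derivative
    ?e z * (- (2 * of_real s)) * (\<Sum>j\<le>k. \<alpha> j * F j z) + ?e z * (\<Sum>j\<le>k. \<alpha> j * F (Suc j) z)) (at z)"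
    by (auto intro!: derivative_eq_intros derF simp: algebra_simps)
   ultimately have "F (Suc k) (of_real s - z) * (- 1) = ?e z * (- (2 * of_real s)) * (\<Sum>j\<le>k. \<alpha> j * F j z) + ?e z * (\<Sum>j\<le>k. \<alpha> j * F (Suc j) z)"
    unfolding \<alpha> by (rule DERIV_unique)
   then have "F (Suc k) (of_real s - z) = ?e z * (2 * of_real s * (\<Sum>j\<le>k. \<alpha> j * F j z) - (\<Sum>j\<le>k. \<alpha> j * F (Suc j) z))"
    by (simp add: algebra_simps)
   then show ?thesis by (simp add: sum_subtractf sum_distrib_left mult.assoc)
  qed
  define \<beta> where "\<beta> j = (if j \<le> k then 2 * of_real s * \<alpha> j else 0) - (if j = 0 then 0 else \<alpha> (j - 1))" for j
  have "(\<Sum>j\<le>k. 2 * of_real s * \<alpha> j * F j z - \<alpha> j * F (Suc j) z) = (\<Sum>j\<le>Suc k. \<beta> j * F j z)" for z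
  proof -
   have "(\<Sum>j\<le>Suc k. (if j \<le> k then 2 * of_real s * \<alpha> j else 0) * F j z) = (\<Sum>j\<le>k. 2 * of_real s * \<alpha> j * F j z)"
    by simp
   moreover have "(\<Sum>j\<le>Suc k. (if j = 0 then 0 else \<alpha> (j - 1)) * F j z) = (\<Sum>j\<le>k. \<alpha> j * F (Suc j) z)"
    unfolding sum.atMost_Suc_shift by simp
   ultimately show ?thesis unfolding \<beta>_def left_diff_distrib sum_subtractf by (simp only:)
  qed
  then show ?case using * by (intro exI[of _ \<beta>]) simp
 qed
 have zs: "F k (of_real s) = 0" if "k < N" for k
 proof -
  obtain \<alpha> where "\<And>z. F k (of_real s - z) = ?e z * (\<Sum>j\<le>k. \<alpha> j * F j z)" using sym[of k] by blast
  from this[of 0] have "F k (of_real s) = exp (of_real (s\<^sup>2)) * (\<Sum>j\<le>k. \<alpha> j * F j 0)" by simp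
  also have "(\<Sum>j\<le>k. \<alpha> j * F j 0) = 0" by (intro sum.neutral) (use z0 that in \<open>simp add: dF\<close>)
  finally show ?thesis by simp
 qed
 \<comment> \<open>The coefficients of \<open>p\<close> may be complex, so Rolle is applied to the
   real part along the real axis.\<close>
 define D where "D k x = Re (F k (of_real x))" for k and x :: real
 have derD: "(D k has_real_derivative D (Suc k) x) (at x)" for k x
 proof -
  have "((\<lambda>x. F k (of_real x)) has_vector_derivative F (Suc k) (of_real x)) (at x)"
   using has_vector_derivative_real_field[OF derF[of k "of_real x"]] by simp
  from bounded_linear.has_vector_derivative[OF bounded_linear_Re this] show ?thesis
   by (simp add: D_def[abs_def] has_real_derivative_iff_has_vector_derivative)
 qed
 have Dz: "D k 0 = 0" "D k s = 0" if "k < N" for k using z0[OF that] zs[OF that] by (simp_all add: D_def dF)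
 from rolle_iterated[of D 0 s N, OF derD s Dz(1) Dz(2), of N] obtain Z where Z: "finite Z" "card Z = N" "\<And>x. x \<in> Z ==> D N x = 0"
  by auto
 define d where "d = degree p"
 \<comment> \<open>The polynomial \<open>p\<close> is monic, so the top coefficient of
   \<open>Q k\<close> is real and nonzero, and taking real parts cannot annihilate the polynomial
   \<open>Q N\<close>.\<close>
 have Qd: "degree (Q k) \<le> d \<and> coeff (Q k) d = of_real ((2 * s) ^ k * exp (- s\<^sup>2) * (- 1) ^ d)" for k
 proof (induction k)
  case 0
  have "degree (pcompose p [:of_real s, - 1:]) = d" by (simp add: degree_pcompose d_def)
  moreover have "lead_coeff (pcompose p [:of_real s, - 1:]) = (- 1) ^ d"
   by (subst lead_coeff_comp) (auto simp: mon d_def)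
  ultimately show ?case by (auto simp: Q_def exp_of_real[symmetric])
 next
  case (Suc k)
  have "coeff (pderiv (Q k)) d = 0" using Suc by (simp add: coeff_pderiv coeff_eq_0)
  moreover have "degree (T (Q k)) \<le> d"
   unfolding T_def using Suc degree_pderiv[of "Q k"] by (intro degree_add_le order_trans[OF degree_smult_le]) auto
  ultimately show ?case using Suc unfolding Q_Suc by (simp add: T_def)
 qed
 define q where "q = map_poly Re (Q N)"
 have cq: "coeff q i = Re (coeff (Q N) i)" for i by (simp add: q_def coeff_map_poly)
 have "coeff q d \<noteq> 0" using Qd[of N] s by (simp add: cq del: of_real_mult of_real_power)
 then have q0: "q \<noteq> 0" by auto
 have dq: "degree q \<le> d"
  by (rule degree_le) (use Qd[of N] in \<open>auto simp: cq coeff_eq_0\<close>)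
 have pq: "Re (poly (Q N) (of_real x)) = poly q x" for x
 proof -
  have "poly (Q N) (of_real x) = (\<Sum>i\<le>d. coeff (Q N) i * of_real (x ^ i))"
   using poly_eq_sum[of "Q N" d "of_real x"] Qd[of N] by simp
  moreover have "poly q x = (\<Sum>i\<le>d. coeff q i * x ^ i)" by (rule poly_eq_sum) (rule dq)
  ultimately show ?thesis by (simp add: cq del: of_real_power)
 qed
 have "(pderiv ^^ N) p = 0"
  by (rule poly_eqI) (use deg in \<open>simp add: coeff_higher_pderiv coeff_eq_0\<close>)
 then have DN: "D N x = - (exp (2 * s * x) * poly q x)" for x
 proof -
  have "exp (2 * of_real s * of_real x) = (of_real (exp (2 * s * x)) :: complex)" by (simp flip: exp_of_real)
  then show ?thesis using \<open>(pderiv ^^ N) p = 0\<close> pq[of x] by (simp add: D_def F_def)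
 qed
 have "Z \<subseteq> {x. poly q x = 0}" using Z(3) DN by auto
 then have "N \<le> card {x. poly q x = 0}" using card_mono[OF poly_roots_finite[OF q0]] Z(2) by metis
 also have "\<dots> \<le> degree q" by (rule card_poly_roots_bound[OF q0])
 also have "\<dots> < N" using dq deg by (simp add: d_def)
 finally show False by simp
qed

lemma circle0_int_sum:
 assumes "\<And>i. i \<in> I ==> continuous_on (sphere 0 1) (F i)"
 shows "circle0_int (\<lambda>Z. \<Sum>i\<in>I. c i * F i Z) = (\<Sum>i\<in>I. c i * circle0_int (F i))"
proof -
 have i: "integrable lborel (\<lambda>\<theta>. c i * (indicator {0..2*pi} \<theta> *\<^sub>R (F i (cis \<theta>) * (\<i> * cis \<theta>))))" if "i \<in> I" for i
  by (intro integrable_mult_right circle0_integrable assms that)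
 have "circle0_int (\<lambda>Z. \<Sum>i\<in>I. c i * F i Z) = (LBINT \<theta>. (\<Sum>i\<in>I. c i * (indicator {0..2*pi} \<theta> *\<^sub>R (F i (cis \<theta>) * (\<i> * cis \<theta>)))))"
  unfolding circle0_int_eq
  by (intro integral_cong refl) (simp add: sum_distrib_right scaleR_sum_right mult.assoc)
 also have "\<dots> = (\<Sum>i\<in>I. (LBINT \<theta>. c i * (indicator {0..2*pi} \<theta> *\<^sub>R (F i (cis \<theta>) * (\<i> * cis \<theta>)))))"
  by (rule integral_sum) (rule i)
 finally show ?thesis unfolding circle0_int_eq by (simp only: integral_mult_right_zero)
qed

text \<open>Row \<open>n\<close> of \<open>1 - K0\<close> consists of Taylor coefficients at 0 of
  \<open>f n\<close>, the monomial minus its reflection. A relation between rows thus says that the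
  corresponding combination vanishes to high order.\<close>

lemma K0_coeff:
 fixes r :: real
 defines "s \<equiv> sqrt 2 * r"
 defines "f \<equiv> \<lambda>n Z. Z ^ n - (of_real s - Z) ^ n * exp (- of_real (s\<^sup>2) + 2 * of_real s * Z)"
 shows "1 / (2 * of_real pi * \<i>) * circle0_int (\<lambda>Z. inverse (Z ^ (m + 1)) * f n Z) = (if n = m then 1 else 0) - K0 r n m"
proof -
 have ss: "- complex_of_real (s\<^sup>2) = - 2 * of_real (r\<^sup>2)" by (simp add: s_def power_mult_distrib)
 have c1: "continuous_on (sphere 0 1) (\<lambda>Z::complex. inverse (Z ^ (m + 1)) * Z ^ n)"
  by (intro continuous_intros) auto
 have c2: "continuous_on (sphere 0 1) (\<lambda>Z::complex. inverse (Z ^ (m + 1)) * ((of_real s - Z) ^ n * exp (- of_real (s\<^sup>2) + 2 * of_real s * Z)))"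
  by (intro continuous_intros) auto
 have "1 / (2 * of_real pi * \<i>) * circle0_int (\<lambda>Z. inverse (Z ^ (m + 1)) * Z ^ n) = (if n = m then 1 else 0)"
  by (rule circle0_monomial)
 moreover have "K0 r n m = 1 / (2 * of_real pi * \<i>) * circle0_int (\<lambda>Z. inverse (Z ^ (m + 1)) * ((of_real s - Z) ^ n * exp (- of_real (s\<^sup>2) + 2 * of_real s * Z)))"
  unfolding K0_def ss s_def[symmetric] divide_inverse[of "_ ^ n"] by (simp only: mult_ac)
 ultimately show ?thesis
  unfolding f_def right_diff_distrib[of "inverse _"] circle0_int_diff[OF c1 c2] by (simp only: right_diff_distrib)
qed

text \<open>A vector annihilating the rows is read as the coefficients of a polynomial of degree
  below \<open>N\<close>, made monic by scaling; the Taylor coefficients of its reflected difference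
  up to order \<open>N - 1\<close> would all vanish.\<close>

lemma det_K0_nonzero:
 assumes r: "0 < r"
 shows "detS {..<N} (\<lambda>n m. (if n = m then 1 else 0) - K0 r n m) \<noteq> 0"
proof
 define A where "A n m = (if n = m then 1 else 0) - K0 r n m" for n m
 assume "detS {..<N} (\<lambda>n m. (if n = m then 1 else 0) - K0 r n m) = 0"
 then have "detS {..<N} A = 0" unfolding A_def[abs_def] .
 \<comment> \<open>The transpose is taken because the relation is wanted between rows.\<close>
 then have "detS {..<N} (\<lambda>m n. A n m) = 0" using detS_transpose[of "{..<N}" A] by simp
 then have "Determinant.det (Matrix.mat N N (\<lambda>(m,n). A n m)) = 0" by (simp add: det_mat_detS)
 then obtain w where w: "w \<in> carrier_vec N" "w \<noteq> 0\<^sub>v N" "Matrix.mat N N (\<lambda>(m,n). A n m) *\<^sub>v w = 0\<^sub>v N"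
  using det_0_iff_vec_prod_zero_field[of "Matrix.mat N N (\<lambda>(m,n). A n m)" N] by auto
 have ker: "(\<Sum>n<N. w $ n * A n m) = 0" if "m < N" for m
 proof -
  have "(Matrix.mat N N (\<lambda>(m,n). A n m) *\<^sub>v w) $ m = 0" using w(3) that by simp
  then show ?thesis using that w(1) by (simp add: scalar_prod_def lessThan_atLeast0 mult.commute)
 qed
 define p0 where "p0 = (\<Sum>n<N. Polynomial.monom (w $ n) n)"
 have cp0: "coeff p0 i = (if i < N then w $ i else 0)" for i
  by (simp add: p0_def coeff_sum coeff_monom)
 have "\<exists>i<N. w $ i \<noteq> 0" using w(1,2) by (metis carrier_vecD eq_vecI index_zero_vec)
 then have p00: "p0 \<noteq> 0" using cp0 by (metis coeff_0)
 have dp0: "degree p0 < N"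
 proof -
  have "coeff p0 (degree p0) \<noteq> 0" using p00 by simp
  then show ?thesis using cp0[of "degree p0"] by (auto split: if_splits)
 qed
 define c where "c = inverse (lead_coeff p0)"
 define p where "p = Polynomial.smult c p0"
 have c0: "c \<noteq> 0" using p00 by (simp add: c_def)
 have p: "degree p < N" "lead_coeff p = 1" using dp0 p00 c0 by (simp_all add: p_def) (simp add: c_def)
 define s where "s = sqrt 2 * r"
 have s: "0 < s" using r by (simp add: s_def)
 define f where "f n Z = Z ^ n - (of_real s - Z) ^ n * exp (- of_real (s\<^sup>2) + 2 * of_real s * Z)" for n and Z :: complex
 have px: "poly p Z = (\<Sum>n<N. c * (w $ n) * Z ^ n)" for Z
  unfolding p_def p0_def by (simp add: poly_sum poly_monom sum_distrib_left mult.assoc)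
 define F where "F z = poly p z - poly p (of_real s - z) * exp (- of_real (s\<^sup>2) + 2 * of_real s * z)" for z
 have F: "F Z = (\<Sum>n<N. (c * (w $ n)) * f n Z)" for Z
  unfolding F_def px f_def by (simp add: sum_distrib_right sum_subtractf right_diff_distrib mult.assoc)
 obtain m where m: "m < N" "(deriv ^^ m) F 0 \<noteq> 0"
  using reflected_polynomial_nonvanishing[OF s p] unfolding F_def[abs_def] by blast
 have hol: "F holomorphic_on UNIV" unfolding F_def[abs_def] by (intro holomorphic_intros)
 have "(deriv ^^ m) F 0 / fact m = 1 / (2 * of_real pi * \<i>) * circle0_int (\<lambda>Z. inverse (Z ^ (m + 1)) * F Z)"
  by (rule circle0_coeff[OF hol, symmetric])
 also have "circle0_int (\<lambda>Z. inverse (Z ^ (m + 1)) * F Z) = circle0_int (\<lambda>Z. \<Sum>n<N. (c * (w $ n)) * (inverse (Z ^ (m + 1)) * f n Z))"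
  unfolding F by (intro circle0_int_cong) (simp add: sum_distrib_left mult_ac)
 also have "\<dots> = (\<Sum>n<N. (c * (w $ n)) * circle0_int (\<lambda>Z. inverse (Z ^ (m + 1)) * f n Z))"
  by (rule circle0_int_sum) (auto simp: f_def intro!: continuous_intros)
 also have "1 / (2 * of_real pi * \<i>) * \<dots> = (\<Sum>n<N. (c * (w $ n)) * (1 / (2 * of_real pi * \<i>) * circle0_int (\<lambda>Z. inverse (Z ^ (m + 1)) * f n Z)))"
  unfolding sum_distrib_left by (intro sum.cong refl) (simp only: mult_ac)
 also have "\<dots> = (\<Sum>n<N. (c * (w $ n)) * A n m)"
  unfolding f_def s_def K0_coeff A_def ..
 also have "\<dots> = c * (\<Sum>n<N. w $ n * A n m)" by (simp add: sum_distrib_left mult.assoc)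
 also have "\<dots> = 0" using ker[OF m(1)] by simp
 finally show False using m(2) by simp
qed

text \<open>The determinant is nonzero, so some matrix satisfies the defining property of the choice
  term, and the chosen one therefore does.\<close>

lemma Minv_inverse:
 assumes r: "0 < r" and nm: "n < N" "m < N"
 shows "(\<Sum>k<N. ((if n = k then 1 else 0) - K0 r n k) * Minv N r k m) = (if n = m then 1 else 0)"
proof -
 let ?M = "Matrix.mat N N (\<lambda>(i,j). (if i = j then 1 else 0) - K0 r i j)"
 have "Determinant.det ?M \<noteq> 0" unfolding det_mat_detS by (rule det_K0_nonzero[OF r])
 then have "?M \<in> Units (ring_mat TYPE(complex) N b)" by (intro det_non_zero_imp_unit) simp_all
 then obtain X where X: "X \<in> carrier_mat N N" "X * ?M = 1\<^sub>m N" "?M * X = 1\<^sub>m N"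
  unfolding Units_def ring_mat_def by auto
 let ?P = "\<lambda>X. \<forall>n<N. \<forall>m<N.
   (\<Sum>k<N. ((if n = k then 1 else 0) - K0 r n k) * X k m) = (if n = m then 1 else 0) \<and>
   (\<Sum>k<N. X n k * ((if k = m then 1 else 0) - K0 r k m)) = (if n = m then 1 else 0)"
 have "?P (\<lambda>i j. X $$ (i,j))"
 proof (intro allI impI conjI)
  fix n m assume nm: "n < N" "m < N"
  have "(?M * X) $$ (n,m) = (\<Sum>k<N. ((if n = k then 1 else 0) - K0 r n k) * X $$ (k,m))"
   "(X * ?M) $$ (n,m) = (\<Sum>k<N. X $$ (n,k) * ((if k = m then 1 else 0) - K0 r k m))"
   using nm X(1) by (simp_all add: scalar_prod_def lessThan_atLeast0)
  then show "(\<Sum>k<N. ((if n = k then 1 else 0) - K0 r n k) * X $$ (k,m)) = (if n = m then 1 else 0)"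
   "(\<Sum>k<N. X $$ (n,k) * ((if k = m then 1 else 0) - K0 r k m)) = (if n = m then 1 else 0)"
   unfolding X using nm by auto
 qed
 then have "?P (Minv N r)" unfolding Minv_def by (rule someI[of ?P])
 then show ?thesis using nm by blast
qed

section \<open>The kernel of \<open>T\<close>, the flat barrier, and the Fredholm
  determinant\<close>

lemma oddx_odd:
 assumes "\<And>v. v \<le> 0 ==> h v = G v - G (- v)"
 shows "oddx h = (\<lambda>v. G v - G (- v))"
proof
 fix v show "oddx h v = G v - G (- v)"
  using assms[of v] assms[of "- v"] by (cases v "0::real" rule: linorder_cases) (auto simp: oddx_def)
qed

lemma heat_op_odd_Gf:
 assumes "0 < T"
 shows "heat_op 2 T (\<lambda>v. Gf s (\<tau> + T) m v - Gf s (\<tau> + T) m (- v)) u = Gf s \<tau> m u - Gf s \<tau> m (- u)"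
proof -
 obtain C where G: "bnd (\<bar>s\<bar> + 1) C (Gf s (\<tau> + T) m)" by (rule bnd_Gf)
 have T2: "0 < 2 * T" using assms by simp
 show ?thesis
  unfolding heat_op_diff[OF T2 G bnd_reflect[OF G]] heat_op_reflect Gf_heat[OF assms] ..
qed

text \<open>For the barrier 0 the killed operator and the reflected heat operator are limits of the
  same mesh chains, hence equal. On the odd combination of \<open>Gf\<close> the latter is the free
  flow, which moves it back to \<open>tau t1\<close>.\<close>

lemma transit_flat:
 fixes r t1 t2 v :: real
 assumes W: "brownian_motion M' 2 W" and t: "tau t1 < tau t2" and v: "v \<le> 0"
 shows "transit M' W (\<lambda>_. r) r t1 t2 m v = Gf (sqrt 2 * r) (tau t1) m v - Gf (sqrt 2 * r) (tau t1) m (- v)"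
proof -
 define s where "s = sqrt 2 * r"
 define T where "T = tau t2 - tau t1"
 have T: "0 < T" "0 < 2 * T" "tau t2 = tau t1 + T" using t by (simp_all add: T_def)
 define g where "g x = indicator {..0} x * (Gf s (tau t2) m x - Gf s (tau t2) m (- x))" for x
 obtain C where G: "bnd (\<bar>s\<bar> + 1) C (Gf s (tau t2) m)" by (rule bnd_Gf)
 have g: "bnd (\<bar>s\<bar> + 1) (C + C) g"
  unfolding g_def[abs_def] by (rule bnd_indicator_mult[OF bnd_diff[OF G bnd_reflect[OF G]]]) simp
 have b: "htilde (\<lambda>_. r) r x = 0" for x by (simp add: htilde_def)
 have two: "(0::real) < 2" by simp
 have cb: "continuous_on {0..T} (\<lambda>_. 0 :: real)" by (rule continuous_on_const)
 have "transit M' W (\<lambda>_. r) r t1 t2 m v = killed_op M' W (\<lambda>_. 0) T g v"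
  unfolding transit_def b T_def g_def[abs_def] s_def ..
 also have "\<dots> = refl_op 0 2 T g v"
  using killed_op_tendsto[OF W two T(1) cb g tendsto_const, where u = v]
   hchain_halfline_tendsto[OF two T(1) g tendsto_const v, where l = 0]
  by (rule LIMSEQ_unique)
 also have "\<dots> = heat_op 2 T (\<lambda>v. Gf s (tau t2) m v - Gf s (tau t2) m (- v)) v"
  unfolding refl_op_oddx[OF T(2) g] by (subst oddx_odd[of g]) (simp_all add: g_def)
 also have "\<dots> = Gf s (tau t1) m v - Gf s (tau t1) m (- v)"
  unfolding T(3) by (rule heat_op_odd_Gf[OF T(1)])
 finally show ?thesis by (simp add: s_def)
qed

text \<open>\<open>Th\<close> differentiates the distribution function of the endpoint of the killed
  path, so it equals the density \<open>q u\<close> where that is continuous and the argument is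
  negative. The exceptional set adds only the point 0, at which the density is cut off.\<close>

lemma Th_kernel:
 fixes h :: "real => real" and r t1 t2 :: real
 assumes W: "brownian_motion M' 2 W" and t: "0 < t1" "t1 < t2" "t2 < 1" and h: "continuous_on {0..1} h"
  and hle: "\<forall>t\<in>{0..1}. h t \<le> r" and hr: "\<forall>t\<in>{0..1} - {t1<..<t2}. h t = r"
 obtains q where "\<And>u v. 0 \<le> q u v" "\<And>u v. q u v \<le> heat 2 (tau t2 - tau t1) u v" "\<And>u. q u \<in> borel_measurable borel"
  "\<And>u. countable {v. v \<le> 0 \<and> Th M' W h r (tau t1) (tau t2) u v \<noteq> q u v}"
  "\<And>\<kappa> C g u. bnd \<kappa> C g ==> killed_op M' W (\<lambda>x. htilde h r (tau t1 + x)) (tau t2 - tau t1) g u = (LBINT v. q u v * (indicator {..0} v * g v))"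
proof -
 define T where "T = tau t2 - tau t1"
 define b where "b x = htilde h r (tau t1 + x)" for x
 have to: "0 < tau t1" "tau t1 < tau t2" by (rule tau_order[OF t])+
 have T: "0 < T" "0 < 2 * T" using to by (simp_all add: T_def)
 have bp: "continuous_on {0..T} b" "b T = 0"
  using barrier_properties[OF t h hr] unfolding b_def[abs_def] T_def by auto
 have b0: "b 0 = 0" unfolding b_def by (rule htilde_outside[OF t hr]) (use to in auto)
 have ble: "b x \<le> 0" if "0 \<le> x" for x
 proof -
  have "0 \<le> tau t1 + x" using that to by simp
  then have "h (tinv (tau t1 + x)) \<le> r" using hle tinv_nonneg[of "tau t1 + x"] tinv_less_one[of "tau t1 + x"] by simp
  then show ?thesis using \<open>0 \<le> tau t1 + x\<close> unfolding b_def htilde_def tinv_def[symmetric]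
   by (intro mult_nonneg_nonpos divide_nonneg_pos) auto
 qed
 have two: "(0::real) < 2" by simp
 obtain q where q: "\<And>u v. 0 \<le> q u v" "\<And>u v. q u v \<le> heat 2 T u v" "\<And>u. q u \<in> borel_measurable borel"
  "\<And>u. countable {v. \<not> isCont (q u) v}"
  "\<And>\<kappa> C g u. bnd \<kappa> C g ==> killed_op M' W b T g u = (LBINT v. q u v * (indicator {..b T} v * g v))"
  by (rule killed_op_kernel[OF W two T(1) bp(1)]) blast
 have event: "measure M' {\<omega>\<in>space M'. (\<forall>\<tau>\<in>{tau t1..tau t2}. u + W (\<tau> - tau t1) \<omega> \<le> 0) \<and>
   (\<forall>\<tau>\<in>{tau t1<..<tau t2}. u + W (\<tau> - tau t1) \<omega> \<le> htilde h r \<tau>) \<and> u + W (tau t2 - tau t1) \<omega> \<le> v'}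
  = (LBINT v. indicator {..v'} v * (indicator {..0} v * q u v))" (is "measure M' ?E = _") for u v'
 proof -
  \<comment> \<open>The two conditions in \<open>Th\<close> amount to the single barrier
    \<open>b\<close>, because \<open>b \<le> 0\<close> throughout and \<open>b\<close> is 0 at both
    ends, where only the condition \<open>\<le> 0\<close> is imposed.\<close>
  have iff: "(\<forall>\<tau>\<in>{tau t1..tau t2}. X (\<tau> - tau t1) \<le> 0) \<and> (\<forall>\<tau>\<in>{tau t1<..<tau t2}. X (\<tau> - tau t1) \<le> htilde h r \<tau>)
   \<longleftrightarrow> (\<forall>x\<in>{0..T}. X x \<le> b x)" (is "?L \<longleftrightarrow> ?R") for X :: "real => real"
  proof
   assume L: ?L
   show ?R
   proof
    fix x assume x: "x \<in> {0..T}"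
    have 1: "X x \<le> 0" using bspec[OF conjunct1[OF L], of "tau t1 + x"] x by (simp add: T_def)
    show "X x \<le> b x"
    proof (cases "x = 0 \<or> x = T")
     case True then show ?thesis using 1 b0 bp(2) by auto
    next
     case False
     then show ?thesis using bspec[OF conjunct2[OF L], of "tau t1 + x"] x by (simp add: T_def b_def)
    qed
   qed
  next
   assume R: ?R
   have 1: "X (\<tau> - tau t1) \<le> b (\<tau> - tau t1)" if "\<tau> \<in> {tau t1..tau t2}" for \<tau>
    using bspec[OF R, of "\<tau> - tau t1"] that by (simp add: T_def)
   show ?L
   proof (intro conjI ballI)
    show "X (\<tau> - tau t1) \<le> 0" if "\<tau> \<in> {tau t1..tau t2}" for \<tau>
     using 1[OF that] ble[of "\<tau> - tau t1"] that by simp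
    show "X (\<tau> - tau t1) \<le> htilde h r \<tau>" if "\<tau> \<in> {tau t1<..<tau t2}" for \<tau>
     using 1[of \<tau>] that by (simp add: b_def)
   qed
  qed
  have i: "bnd 0 1 (indicator {..v'} :: real => real)" by (auto simp: bnd_def)
  have "measure M' ?E = (\<integral>\<omega>. indicator ?E \<omega> \<partial>M')" by (simp add: Int_def conj_commute)
  also have "\<dots> = killed_op M' W b T (indicator {..v'}) u"
   unfolding killed_op_def
  proof (intro integral_cong refl)
   fix \<omega> assume "\<omega> \<in> space M'"
   then show "indicator ?E \<omega> = (if \<forall>t\<in>{0..T}. u + W t \<omega> \<le> b t then indicator {..v'} (u + W T \<omega>) else 0 :: real)"
    using iff[of "\<lambda>x. u + W x \<omega>"] unfolding indicator_def T_def[symmetric] by auto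
  qed
  also have "\<dots> = (LBINT v. indicator {..v'} v * (indicator {..0} v * q u v))"
   unfolding q(5)[OF i] bp(2) by (simp only: mult_ac)
  finally show ?thesis .
 qed
 have eq: "Th M' W h r (tau t1) (tau t2) u v = q u v" if v: "v < 0" "isCont (q u) v" for u v
 proof -
  have [measurable]: "q u \<in> borel_measurable borel" by (rule q(3))
  have int: "integrable lborel (\<lambda>v. indicator {..0} v * q u v)"
   by (rule integrable_bound[OF integrable_heat[OF T(2), of u]])
    (auto intro!: AE_I2 simp: indicator_def q(1,2))
  have "\<forall>\<^sub>F x in nhds v. x \<in> {..<0}" using v(1) by (intro eventually_nhds_in_open) auto
  then have "\<forall>\<^sub>F x in nhds v. indicator {..0} x * q u x = q u x" by eventually_elim simp
  then have "isCont (\<lambda>v. indicator {..0} v * q u v) v" using v(2) by (subst isCont_cong)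
  from has_real_derivative_integral_atMost[OF int this] v(1)
  have "((\<lambda>v'. LBINT v. indicator {..v'} v * (indicator {..0} v * q u v)) has_real_derivative q u v) (at v)" by simp
  then show ?thesis unfolding Th_def event by (rule DERIV_imp_deriv)
 qed
 have cnt: "countable {v. v \<le> 0 \<and> Th M' W h r (tau t1) (tau t2) u v \<noteq> q u v}" for u
 proof (rule countable_subset)
  show "{v. v \<le> 0 \<and> Th M' W h r (tau t1) (tau t2) u v \<noteq> q u v} \<subseteq> insert 0 {v. \<not> isCont (q u) v}"
   using eq[of _ u] by force
 qed (intro countable_insert q(4))
 show ?thesis
  by (rule that[of q]) (use q cnt bp(2) in \<open>simp_all add: T_def b_def[abs_def]\<close>)
qed

text \<open>Measurability and integrability of \<open>Th\<close> on the half-line are read off from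
  \<open>q\<close>, from which it differs at countably many points only.\<close>

lemma Th_integral:
 fixes h :: "real => real" and r t1 t2 :: real
 assumes W: "brownian_motion M' 2 W" and t: "0 < t1" "t1 < t2" "t2 < 1" and h: "continuous_on {0..1} h"
  and hle: "\<forall>t\<in>{0..1}. h t \<le> r" and hr: "\<forall>t\<in>{0..1} - {t1<..<t2}. h t = r"
  and g: "bnd \<kappa> C g"
 shows "set_integrable lborel {..0} (\<lambda>w. complex_of_real (Th M' W h r (tau t1) (tau t2) u w) * of_real (g w))"
  and "(LINT w:{..0}|lborel. complex_of_real (Th M' W h r (tau t1) (tau t2) u w) * of_real (g w)) =
   of_real (killed_op M' W (\<lambda>x. htilde h r (tau t1 + x)) (tau t2 - tau t1) (\<lambda>x. indicator {..0} x * g x) u)"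
proof -
 obtain q where q: "\<And>u v. 0 \<le> q u v" "\<And>u v. q u v \<le> heat 2 (tau t2 - tau t1) u v" "\<And>u. q u \<in> borel_measurable borel"
  "\<And>u. countable {v. v \<le> 0 \<and> Th M' W h r (tau t1) (tau t2) u v \<noteq> q u v}"
  "\<And>\<kappa> C g u. bnd \<kappa> C g ==> killed_op M' W (\<lambda>x. htilde h r (tau t1 + x)) (tau t2 - tau t1) g u = (LBINT v. q u v * (indicator {..0} v * g v))"
  by (rule Th_kernel[OF W t h hle hr]) blast
 let ?Th = "Th M' W h r (tau t1) (tau t2) u"
 have T2: "0 < 2 * (tau t2 - tau t1)" using tau_order[OF t] by simp
 have gi: "bnd \<kappa> C (\<lambda>x. indicator {..0} x * g x)" by (rule bnd_indicator_mult[OF g]) simp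
 note [measurable] = q(3) bnd_measurable[OF g]
 have qi: "integrable lborel (\<lambda>w. q u w * (indicator {..0} w * g w))"
 proof (rule integrable_bound[OF integrable_abs[OF bnd_integrable[OF T2 gi, of u]]])
  show "AE w in lborel. norm (q u w * (indicator {..0} w * g w)) \<le> norm \<bar>heat 2 (tau t2 - tau t1) u w * (indicator {..0} w * g w)\<bar>"
   using q(1,2) by (intro AE_I2) (auto simp: abs_mult intro!: mult_right_mono)
 qed measurable
 define X where "X = {v. v \<le> 0 \<and> ?Th v \<noteq> q u v}"
 have X: "countable X" unfolding X_def by (rule q(4))
 have off: "indicator {..0} w *\<^sub>R (complex_of_real (?Th w) * of_real (g w)) = of_real (q u w * (indicator {..0} w * g w))" if "w \<notin> X" for w
  using that by (auto simp: X_def indicator_def)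
 have null: "emeasure lborel {x} = 0" "{x} \<in> sets lborel" for x :: real by simp_all
 show "set_integrable lborel {..0} (\<lambda>w. complex_of_real (?Th w) * of_real (g w))"
  unfolding set_integrable_def
 proof (rule iffD2[OF integrable_discrete_difference[OF X null]])
  show "integrable lborel (\<lambda>w. complex_of_real (q u w * (indicator {..0} w * g w)))" using qi by (simp only: integrable_of_real)
 qed (rule off)
 have "(LINT w:{..0}|lborel. complex_of_real (?Th w) * of_real (g w)) = (LBINT w. of_real (q u w * (indicator {..0} w * g w)))"
  unfolding set_lebesgue_integral_def by (rule integral_discrete_difference[OF X null off])
 also have "\<dots> = of_real (LBINT w. q u w * (indicator {..0} w * g w))" by (rule integral_complex_of_real)
 also have "(LBINT w. q u w * (indicator {..0} w * g w)) = killed_op M' W (\<lambda>x. htilde h r (tau t1 + x)) (tau t2 - tau t1) (\<lambda>x. indicator {..0} x * g x) u"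
  unfolding q(5)[OF gi] by (intro integral_cong refl) (simp add: indicator_def)
 finally show "(LINT w:{..0}|lborel. complex_of_real (?Th w) * of_real (g w)) =
   of_real (killed_op M' W (\<lambda>x. htilde h r (tau t1 + x)) (tau t2 - tau t1) (\<lambda>x. indicator {..0} x * g x) u)" .
qed

lemma Ff_integrable_bnd:
 assumes \<tau>: "0 < \<tau>" and g: "bnd \<kappa> C g"
 shows "integrable lborel (\<lambda>v. Ff s \<tau> i v * g v)"
proof (rule integrable_bound)
 show "integrable lborel (\<lambda>v. C * (\<bar>Ff s \<tau> i v\<bar> * cosh (\<kappa> * v)))"
  by (intro integrable_mult_right Ff_integrable_cosh \<tau>)
 show "(\<lambda>v. Ff s \<tau> i v * g v) \<in> borel_measurable lborel"
  using bnd_measurable[OF g] by measurable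
 show "AE v in lborel. norm (Ff s \<tau> i v * g v) \<le> norm (C * (\<bar>Ff s \<tau> i v\<bar> * cosh (\<kappa> * v)))"
 proof (rule AE_I2)
  fix v
  have "\<bar>Ff s \<tau> i v\<bar> * \<bar>g v\<bar> \<le> \<bar>Ff s \<tau> i v\<bar> * (C * cosh (\<kappa> * v))" by (rule mult_left_mono[OF bndD[OF g]]) simp
  then show "norm (Ff s \<tau> i v * g v) \<le> norm (C * (\<bar>Ff s \<tau> i v\<bar> * cosh (\<kappa> * v)))"
   using bnd_const_nonneg[OF g] by (simp add: abs_mult mult_ac)
 qed
qed

text \<open>Substituting \<open>- v\<close> in the reflected half unfolds the half-line pairing with
  \<open>Phi\<close> into a pairing of \<open>Ff\<close> with the odd extension over the whole
  line.\<close>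

lemma Ff_halfline:
 assumes \<tau>: "0 < \<tau>" and g: "bnd \<kappa> C g"
 shows "integrable lborel (\<lambda>v. indicator {..0} v * ((Ff s \<tau> i v - Ff s \<tau> i (- v)) * g v))"
  and "(LBINT v. indicator {..0} v * ((Ff s \<tau> i v - Ff s \<tau> i (- v)) * g v)) = (LBINT v. Ff s \<tau> i v * oddx g v)"
proof -
 have gi: "bnd \<kappa> C (\<lambda>v. indicator {..0} v * g v)" by (rule bnd_indicator_mult[OF g]) simp
 have i1: "integrable lborel (\<lambda>v. Ff s \<tau> i v * (indicator {..0} v * g v))" by (rule Ff_integrable_bnd[OF \<tau> gi])
 have i2: "integrable lborel (\<lambda>v. Ff s \<tau> i v * (indicator {..0} (- v) * g (- v)))"
  by (rule Ff_integrable_bnd[OF \<tau> bnd_reflect[OF gi]])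
 have i3: "integrable lborel (\<lambda>v. Ff s \<tau> i (- v) * (indicator {..0} v * g v))"
  using lborel_integrable_real_affine[OF i2, of "- 1" 0] by simp
 have e3: "(LBINT v. Ff s \<tau> i (- v) * (indicator {..0} v * g v)) = (LBINT v. Ff s \<tau> i v * (indicator {..0} (- v) * g (- v)))"
  using lborel_integral_real_affine[of "- 1" "\<lambda>v. Ff s \<tau> i v * (indicator {..0} (- v) * g (- v))" 0] by simp
 have eq: "indicator {..0} v * ((Ff s \<tau> i v - Ff s \<tau> i (- v)) * g v) = Ff s \<tau> i v * (indicator {..0} v * g v) - Ff s \<tau> i (- v) * (indicator {..0} v * g v)" for v
  by (simp add: algebra_simps)
 show "integrable lborel (\<lambda>v. indicator {..0} v * ((Ff s \<tau> i v - Ff s \<tau> i (- v)) * g v))"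
  unfolding eq by (rule integrable_diff[OF i1 i3])
 show "(LBINT v. indicator {..0} v * ((Ff s \<tau> i v - Ff s \<tau> i (- v)) * g v)) = (LBINT v. Ff s \<tau> i v * oddx g v)"
  unfolding eq integral_diff[OF i1 i3] e3 oddx_def right_diff_distrib integral_diff[OF i1 i2] ..
qed

lemma bnd_odd_Gf: "\<exists>C. bnd (\<bar>s\<bar> + 1) C (\<lambda>u. Gf s \<tau> n u - Gf s \<tau> n (- u))"
proof -
 obtain C where "bnd (\<bar>s\<bar> + 1) C (Gf s \<tau> n)" by (rule bnd_Gf)
 from bnd_diff[OF this bnd_reflect[OF this]] show ?thesis by blast
qed

lemma Ff_odd_Gf:
 assumes \<tau>: "0 < \<tau>"
 shows "complex_of_real (LBINT v. Ff (sqrt 2 * r) \<tau> i v * (Gf (sqrt 2 * r) \<tau> m v - Gf (sqrt 2 * r) \<tau> m (- v))) = (if i = m then 1 else 0) - K0 r i m"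
proof -
 have i1: "integrable lborel (\<lambda>v. Ff (sqrt 2 * r) \<tau> i v * Gf (sqrt 2 * r) \<tau> m v)"
  and i2: "integrable lborel (\<lambda>v. Ff (sqrt 2 * r) \<tau> i v * Gf (sqrt 2 * r) \<tau> m (- v))"
  using Ff_Gf_integrable[OF \<tau>, of "sqrt 2 * r" i \<tau> m 1] Ff_Gf_integrable[OF \<tau>, of "sqrt 2 * r" i \<tau> m "- 1"] by simp_all
 have "(LBINT v. Ff (sqrt 2 * r) \<tau> i v * (Gf (sqrt 2 * r) \<tau> m v - Gf (sqrt 2 * r) \<tau> m (- v))) =
  (if i = m then 1 else 0) - (LBINT v. Ff (sqrt 2 * r) \<tau> i v * Gf (sqrt 2 * r) \<tau> m (- v))"
  unfolding right_diff_distrib integral_diff[OF i1 i2] Ff_Gf_orthonormal[OF \<tau>] ..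
 then show ?thesis using Ff_Gf_reflected[OF \<tau> refl, of r i m] by simp
qed

lemma detS_of_real: "complex_of_real (detS I A) = detS I (\<lambda>i j. complex_of_real (A i j))"
 unfolding detS_def by simp

lemma detS_shift: "detS {1..N} (\<lambda>i j. A (i - 1) (j - 1)) = detS {..<N::nat} A"
proof -
 have bij: "bij_betw Suc {..<N} {1..N}" by (auto simp: bij_betw_def image_Suc_lessThan)
 show ?thesis unfolding detS_reindex[OF bij finite_lessThan] by simp
qed

text \<open>For \<open>h = r\<close> the odd extension of \<open>transit\<close> is the odd
  combination of \<open>Gf\<close> at \<open>tau t1\<close>; its pairing with \<open>Ff\<close>
  consists of the biorthogonal term and the reflected term \<open>K0\<close>.\<close>

lemma flat_prob:
 fixes N :: nat and r t1 t2 :: real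
 assumes N: "N \<ge> 1" and r: "r > 0" and t: "0 < t1" "t1 < t2" "t2 < 1"
  and B: "nonint_bridges M N B" and W: "brownian_motion M' 2 W"
 shows "complex_of_real (measure M {\<omega> \<in> space M. \<forall>t\<in>{0..1}. B N t \<omega> < r}) = detS {..<N} (\<lambda>n m. (if n = m then 1 else 0) - K0 r n m)"
proof -
 have o: "oddx (transit M' W (\<lambda>_. r) r t1 t2 m) = (\<lambda>v. Gf (sqrt 2 * r) (tau t1) m v - Gf (sqrt 2 * r) (tau t1) m (- v))" for m
  by (rule oddx_odd) (rule transit_flat[OF W tau_order(2)[OF t]])
 have "measure M {\<omega> \<in> space M. \<forall>t\<in>{0..1}. B N t \<omega> < r} =
  detS {1..N} (\<lambda>i j. LBINT v. Ff (sqrt 2 * r) (tau t1) (i - 1) v * oddx (transit M' W (\<lambda>_. r) r t1 t2 (j - 1)) v)"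
  by (rule bridge_prob_detS[OF N r t _ _ B W]) auto
 then show ?thesis
  unfolding o by (simp only: detS_of_real Ff_odd_Gf[OF tau_order(1)[OF t]] detS_shift[of N "\<lambda>n m. (if n = m then 1 else 0) - K0 r n m"])
qed

theorem theorem2p4:
  fixes N :: nat and r t1 t2 :: real and h :: "real \<Rightarrow> real"
    and M :: "'a measure" and B :: "nat \<Rightarrow> real \<Rightarrow> 'a \<Rightarrow> real"
    and M' :: "'b measure" and W :: "real \<Rightarrow> 'b \<Rightarrow> real"
  assumes "N \<ge> 1" and "r > 0" and "0 < t1" and "t1 < t2" and "t2 < 1"
    and "H1_on 0 1 h"
    and "\<forall>t\<in>{0..1}. h t \<le> r"
    and "\<forall>t\<in>{0..1} - {t1<..<t2}. h t = r"
    and "nonint_bridges M N B"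
    and "brownian_motion M' 2 W"
  shows "fredholm_term (Aker N r M' W h t1 t2) sums
           complex_of_real
             (measure M ({\<omega>\<in>space M. \<forall>t\<in>{0..1}. B N t \<omega> < h t} \<inter> {\<omega>\<in>space M. \<forall>t\<in>{0..1}. B N t \<omega> < r})
              / measure M {\<omega>\<in>space M. \<forall>t\<in>{0..1}. B N t \<omega> < r})"
proof -
 note N = assms(1) and r = assms(2) and t = assms(3-5) and hle = assms(7) and hr = assms(8) and B = assms(9) and W = assms(10)
 have h: "continuous_on {0..1} h" by (rule H1_on_continuous[OF assms(6)])
 define s where "s = sqrt 2 * r"
 note tp = tau_order[OF t]
 define o1 where "o1 n u = Gf s (tau t1) n u - Gf s (tau t1) n (- u)" for n u
 define o2 where "o2 n u = Gf s (tau t2) n u - Gf s (tau t2) n (- u)" for n u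
 define f where "f m v = Ff s (tau t1) m v - Ff s (tau t1) m (- v)" for m v
 define R where "R n = transit M' W h r t1 t2 n" for n
 define X where "X = Minv N r"
 \<comment> \<open>Left factor of the finite-rank kernel: \<open>Psi\<close> at
   \<open>tau t1\<close> minus \<open>T\<close> applied to \<open>Psi\<close> at
   \<open>tau t2\<close>, multiplied by \<open>Minv\<close>. The right factor is \<open>Phi\<close>
   at \<open>tau t1\<close>.\<close>
 define a where "a m u = (\<Sum>n<N. complex_of_real (o1 n u - R n u) * X n m)" for m u
 define K where "K n m = (if n = m then 1 else 0) - K0 r n m" for n m
 define E where "E i n = complex_of_real (LBINT v. Ff s (tau t1) i v * oddx (R n) v)" for i n
 have Psi1: "Psi r (tau t1) n u = of_real (o1 n u)" and Psi2: "Psi r (tau t2) n u = of_real (o2 n u)" for n u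
  by (simp_all only: Psi_eq o1_def o2_def s_def)
 have Phi1: "Phi r (tau t1) m v = of_real (f m v)" for m v
  by (simp only: Phi_eq[OF tp(1)] f_def s_def)
 obtain C1 where C1: "\<And>n. bnd (\<bar>s\<bar> + 1) (C1 n) (o1 n)" unfolding o1_def[abs_def] using bnd_odd_Gf[of s "tau t1"] by metis
 obtain C2 where C2: "\<And>n. bnd (\<bar>s\<bar> + 1) (C2 n) (o2 n)" unfolding o2_def[abs_def] using bnd_odd_Gf[of s "tau t2"] by metis
 have Req: "R n = killed_op M' W (\<lambda>x. htilde h r (tau t1 + x)) (tau t2 - tau t1) (\<lambda>x. indicator {..0} x * o2 n x)" for n
  unfolding R_def transit_def o2_def s_def ..
 obtain CR where CR: "\<And>n. bnd (\<bar>s\<bar> + 1) (CR n) (R n)"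
 proof -
  have "\<exists>C. bnd (\<bar>s\<bar> + 1) C (R n)" for n
   unfolding Req
   by (rule exI, rule bnd_killed_op[OF W _ _ barrier_properties(1)[OF t h hr] bnd_indicator_mult[OF C2]]) (use tp in auto)
  then show ?thesis using that by metis
 qed
 have Ker: "Kker N r \<sigma> (tau t1) u v = (\<Sum>n<N. Psi r \<sigma> n u * (\<Sum>m<N. X n m * of_real (f m v)))" for \<sigma> u v
  unfolding Kker_def X_def Phi1 by (simp add: sum_distrib_left mult.assoc)
 have A: "Aker N r M' W h t1 t2 u v = (\<Sum>m<N. a m u * of_real (f m v))" for u v
 proof -
  let ?Y = "\<lambda>n. \<Sum>m<N. X n m * of_real (f m v)"
  note Thi = Th_integral[OF W t h hle hr C2, where u = u]
  have "(LINT w:{..0}|lborel. of_real (Th M' W h r (tau t1) (tau t2) u w) * Kker N r (tau t2) (tau t1) w v) =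
   (LINT w:{..0}|lborel. (\<Sum>n<N. (of_real (Th M' W h r (tau t1) (tau t2) u w) * of_real (o2 n w)) * ?Y n))"
   unfolding Ker Psi2 by (simp add: sum_distrib_left mult.assoc)
  also have "\<dots> = (\<Sum>n<N. (LINT w:{..0}|lborel. (of_real (Th M' W h r (tau t1) (tau t2) u w) * of_real (o2 n w)) * ?Y n))"
   unfolding set_lebesgue_integral_def scaleR_sum_right
   by (rule integral_sum) (use Thi(1) in \<open>simp add: set_integrable_def flip: mult_scaleR_left\<close>)
  also have "\<dots> = (\<Sum>n<N. of_real (R n u) * ?Y n)"
   by (intro sum.cong refl) (simp add: Thi(2) Req)
  finally have "Aker N r M' W h t1 t2 u v = (\<Sum>n<N. of_real (o1 n u) * ?Y n) - (\<Sum>n<N. of_real (R n u) * ?Y n)"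
   unfolding Aker_def Ker[of "tau t1"] Psi1 by simp
  also have "\<dots> = (\<Sum>n<N. \<Sum>m<N. of_real (o1 n u - R n u) * X n m * of_real (f m v))"
   by (simp add: sum_subtractf[symmetric] left_diff_distrib sum_distrib_left mult.assoc)
  also have "\<dots> = (\<Sum>m<N. a m u * of_real (f m v))"
   unfolding a_def sum_distrib_right by (rule sum.swap)
  finally show ?thesis .
 qed
 have b: "bnd (\<bar>s\<bar> + 1) (C1 n + CR n) (\<lambda>u. o1 n u - R n u)" for n by (rule bnd_diff[OF C1 CR])
 have int: "integrable (restrict_space lborel {..0}) (\<lambda>x. complex_of_real (f i x) * a j x)"
  and val: "(\<integral>x. complex_of_real (f i x) * a j x \<partial>restrict_space lborel {..0}) = (\<Sum>n<N. (K i n - E i n) * X n j)" for i j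
 proof -
  have eq: "indicator {..0} x *\<^sub>R (complex_of_real (f i x) * a j x) = (\<Sum>n<N. complex_of_real (indicator {..0} x * (f i x * (o1 n x - R n x))) * X n j)" for x
   unfolding a_def by (simp add: sum_distrib_left scaleR_sum_right scaleR_conv_of_real mult.assoc)
  have sp: "{..0::real} \<inter> space lborel \<in> sets lborel" by simp
  have ii: "integrable lborel (\<lambda>x. indicator {..0} x * (f i x * (o1 n x - R n x)))" for n
   unfolding f_def by (rule Ff_halfline(1)[OF tp(1) b])
  have ic: "integrable lborel (\<lambda>x. complex_of_real (indicator {..0} x * (f i x * (o1 n x - R n x))) * X n j)" for n
   using ii[of n] by (simp only: integrable_of_real integrable_mult_left)
  show "integrable (restrict_space lborel {..0}) (\<lambda>x. complex_of_real (f i x) * a j x)"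
   unfolding integrable_restrict_space[OF sp] eq by (rule integrable_sum) (rule ic)
  \<comment> \<open>The half-line pairings split: the first part is an entry of
    \<open>1 - K0\<close>, the second an entry of the matrix \<open>E\<close> whose determinant is
    the probability for \<open>h\<close>.\<close>
  have v: "complex_of_real (LBINT x. indicator {..0} x * (f i x * (o1 n x - R n x))) = K i n - E i n" for n
  proof -
   have "oddx (\<lambda>u. o1 n u - R n u) v = o1 n v - oddx (R n) v" for v
    using fun_cong[OF oddx_odd[of "o1 n" "Gf s (tau t1) n"], of v] by (simp add: oddx_def o1_def algebra_simps)
   then have "(LBINT x. indicator {..0} x * (f i x * (o1 n x - R n x))) = (LBINT v. Ff s (tau t1) i v * (o1 n v - oddx (R n) v))"
    unfolding f_def Ff_halfline(2)[OF tp(1) b] by simp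
   also have "\<dots> = (LBINT v. Ff s (tau t1) i v * o1 n v) - (LBINT v. Ff s (tau t1) i v * oddx (R n) v)"
    unfolding right_diff_distrib
    by (rule integral_diff[OF Ff_integrable_bnd[OF tp(1) C1] Ff_integrable_bnd[OF tp(1) bnd_oddx[OF CR]]])
   finally show ?thesis
    using Ff_odd_Gf[OF tp(1), of r i n] unfolding K_def E_def o1_def s_def by simp
  qed
  have "(\<integral>x. complex_of_real (f i x) * a j x \<partial>restrict_space lborel {..0}) = (LBINT x. (\<Sum>n<N. complex_of_real (indicator {..0} x * (f i x * (o1 n x - R n x))) * X n j))"
   unfolding integral_restrict_space[OF sp] eq ..
  also have "\<dots> = (\<Sum>n<N. (LBINT x. complex_of_real (indicator {..0} x * (f i x * (o1 n x - R n x))) * X n j))"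
   by (rule integral_sum) (rule ic)
  also have "\<dots> = (\<Sum>n<N. (K i n - E i n) * X n j)"
   by (intro sum.cong refl) (simp only: integral_mult_left_zero integral_complex_of_real v)
  finally show "(\<integral>x. complex_of_real (f i x) * a j x \<partial>restrict_space lborel {..0}) = (\<Sum>n<N. (K i n - E i n) * X n j)" .
 qed
 have KX: "(\<Sum>n<N. K i n * X n j) = (if i = j then 1 else 0)" if "i < N" "j < N" for i j
  using Minv_inverse[OF r that] by (simp add: K_def X_def)
 have "fredholm_term (Aker N r M' W h t1 t2) sums detS {..<N} (\<lambda>i j. (if i = j then 1 else 0) - (\<Sum>n<N. (K i n - E i n) * X n j))"
  unfolding val[symmetric] by (rule fredholm_finite_rank[OF int A])
 \<comment> \<open>As \<open>K\<close> times \<open>X\<close> is the identity, it cancels against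
   the 1 of the Fredholm determinant and \<open>E\<close> times \<open>X\<close> remains.\<close>
 also have "detS {..<N} (\<lambda>i j. (if i = j then 1 else 0) - (\<Sum>n<N. (K i n - E i n) * X n j)) = detS {..<N} (\<lambda>i j. \<Sum>n<N. E i n * X n j)"
  by (rule detS_cong) (use KX in \<open>simp add: left_diff_distrib sum_subtractf\<close>)
 also have "\<dots> = detS {..<N} E * detS {..<N} X" by (rule detS_mult)
 also have "detS {..<N} X = 1 / detS {..<N} K"
 proof -
  have "detS {..<N} K * detS {..<N} X = detS {..<N} (\<lambda>i j. \<Sum>n<N. K i n * X n j)" by (rule detS_mult[symmetric])
  also have "\<dots> = detS {..<N} (\<lambda>i j. if i = j then 1 else 0)" by (rule detS_cong) (simp add: KX)
  also have "\<dots> = complex_of_real (detS {..<N} (\<lambda>i j. if i = j then 1 else 0))"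
   unfolding detS_of_real by (rule detS_cong) simp
  also have "\<dots> = 1" using detS_identity[of N] detS_shift[of N "\<lambda>i j. if i = j then 1 else 0 :: real"] detS_triangular[of N "\<lambda>i j. if i = j then 1 else 0"] by simp
  finally show ?thesis by (metis mult_zero_left nonzero_eq_divide_eq mult.commute zero_neq_one)
 qed
 also have "detS {..<N} K = complex_of_real (measure M {\<omega> \<in> space M. \<forall>t\<in>{0..1}. B N t \<omega> < r})"
  unfolding K_def[abs_def] by (rule flat_prob[OF N r t B W, symmetric])
 also have "detS {..<N} E = complex_of_real (measure M {\<omega> \<in> space M. \<forall>t\<in>{0..1}. B N t \<omega> < h t})"
  unfolding bridge_prob_detS[OF N r t h hr B W] detS_of_real detS_shift[of N E, symmetric] E_def R_def s_def ..
 \<comment> \<open>Since \<open>h \<le> r\<close>, the conditioning event contains the event for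
   \<open>h\<close>.\<close>
 also have "{\<omega> \<in> space M. \<forall>t\<in>{0..1}. B N t \<omega> < h t} = {\<omega>\<in>space M. \<forall>t\<in>{0..1}. B N t \<omega> < h t} \<inter> {\<omega>\<in>space M. \<forall>t\<in>{0..1}. B N t \<omega> < r}"
  using hle by (auto intro: less_le_trans)
 finally show ?thesis by simp
qed

end
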